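(* Let $\mathcal A$ be a unital $C^*$-algebra, $(\mathcal I,\|\cdot\|_{\mathcal I})$ a symmetrically normed ideal of $\mathcal A$, $k\in\mathbb N$, and $\alpha$ a family of possibly infinite norms. Write $\mathcal I_{\mathrm{sa}}:=\mathcal I\cap\mathcal A_{\mathrm{sa}}$, a real normed vector space under $\|\cdot\|_{\mathcal I}$. Let $a\in\mathcal A_{\mathrm{sa}}$. If $\alpha$ controls polynomial LFC in $\mathcal I$ and $f\in C_\alpha^k(\mathbb R)$, then $f(a+b)-f(a)\in\mathcal I$ for all $b\in\mathcal I_{\mathrm{sa}}$, and the function $$\mathcal I_{\mathrm{sa}}\ni b\mapsto f_{a,\mathcal I}(b):=f(a+b)-f(a)\in\mathcal I$$ is $C^k$ (in the Fréchet sense) with respect to $\|\cdot\|_{\mathcal I}$. Furthermore, $$\partial_{b_k}\cdots\partial_{b_1}f_{a,\mathcal I}(b)=\sum_{\pi\in S_k}f^{[k]}_{\mathcal I,\alpha}(\underbrace{a+b,\ldots,a+b}_{k+1\text{ times}})\#[b_{\pi(1)},\ldots,b_{\pi(k)}]$$ for all $b,b_1,\ldots,b_k\in\mathcal I_{\mathrm{sa}}$.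
   Context: $\mathcal A_{\mathrm{sa}}:=\{a\in\mathcal A:a^*=a\}$, $\mathcal A_{\mathrm{sa},r}:=\{a\in\mathcal A_{\mathrm{sa}}:\|a\|\le r\}$; $f(a)$ is defined by continuous functional calculus; $S_k$ is the symmetric group; $\partial_b$ is the directional derivative. A symmetrically normed ideal of $\mathcal A$ is a (two-sided, complex-linear) ideal $\mathcal I$ with a norm $\|\cdot\|_{\mathcal I}$ such that $(\mathcal I,\|\cdot\|_{\mathcal I})$ is a Banach space, the inclusion $\iota:(\mathcal I,\|\cdot\|_{\mathcal I})\to(\mathcal A,\|\cdot\|)$ is bounded, and $\|xry\|_{\mathcal I}\le\|x\|\|r\|_{\mathcal I}\|y\|$ for $x,y\in\mathcal A$, $r\in\mathcal I$. $C_{\mathcal I}$ denotes the operator norm of $\iota$. A possibly infinite norm on a complex vector space $V$ is a function $\eta:V\to[0,\infty]$ with $\eta(cv)=|c|\eta(v)$ ($0\cdot\infty=0$), $\eta(v+w)\le\eta(v)+\eta(w)$, $\eta(v)=0$ iff $v=0$. A family of possibly infinite norms is $\alpha=(\alpha_{r,m}:C([-r,r]^m)\to[0,\infty])_{r>0,m\in\mathbb N}$, with $C(X)$ the complex-valued continuous functions. Write $\alpha_{r,m}(\varphi):=\alpha_{r,m}(\varphi|_{[-r,r]^m})$ when the domain of $\varphi$ contains $[-r,r]^m$. $\mathcal P_m:=\mathbb C[\lambda_1,\ldots,\lambda_m]$ viewed as functions on $\mathbb R^m$. $\mathcal C_\alpha(\mathbb R^m):=\{\varphi\in C(\mathbb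 R^m):\alpha_{r,m}(\varphi)<\infty\ \forall r>0\}$ with the topology generated by the seminorms $\alpha_{r,m}$, $r>0$. $\alpha$ is finite on polynomials if $\mathcal P_m\subseteq\mathcal C_\alpha(\mathbb R^m)$ for all $m$; then $C_\alpha(\mathbb R^m)$ is the closure of $\mathcal P_m$ in $\mathcal C_\alpha(\mathbb R^m)$. For $m\ge2$, $P=\sum_{|\delta|\le d}c_\delta\boldsymbol\lambda^\delta\in\mathcal P_m$, $\mathbf a\in\mathcal A^m$, $b\in\mathcal A^{m-1}$: $P_\otimes(\mathbf a)\# b=\sum_{|\delta|\le d}c_\delta a_1^{\delta_1}b_1\cdots a_{m-1}^{\delta_{m-1}}b_{m-1}a_m^{\delta_m}$. $\alpha$ controls polynomial LFC in $\mathcal I$ if it is finite on polynomials, $\alpha_{r,1}(\varphi)=\sup_{[-r,r]}|\varphi|$ for all $r>0$ and $\varphi\in C([-r,r])$, and for all $m\ge2$, $P\in\mathcal P_m$, $b\in\mathcal I^{m-1}$, $r>0$: $\sup_{\mathbf a\in\mathcal A_{\mathrm{sa},r}^m}\|P_\otimes(\mathbf a)\# b\|_{\mathcal I}\le C_{\mathcal I}^{m-2}\alpha_{r,m}(P)\prod_{i=1}^{m-1}\|b_i\|_{\mathcal I}$. In that case, for $m\ge2$ the map sending $P\in\mathcal P_m$ to the function $\mathbf a\mapsto(b\mapsto P_\otimes(\mathbf a)\# b)$ extends uniquely to a continuous linear map from $C_\alpha(\mathbb R^m)$ to the space of continuous, bounded-on-bounded-sets maps $\mathcal A_{\mathrm{sa}}^m\to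 B_{m-1}(\mathcal I^{m-1};\mathcal I)$ (bounded $(m-1)$-linear maps) with the topology of uniform convergence on bounded sets; the image of $\varphi$ is denoted $\varphi_{\mathcal I,\alpha}$ and $\varphi_{\mathcal I,\alpha}(\mathbf a)\# b:=\varphi_{\mathcal I,\alpha}(\mathbf a)[b]\in\mathcal I$ (lexicographic functional calculus, LFC). Divided differences: $f^{[0]}:=f$ and, for distinct reals, $f^{[i]}(s_1,\ldots,s_{i+1}):=\frac{f^{[i-1]}(s_1,\ldots,s_i)-f^{[i-1]}(s_1,\ldots,s_{i-1},s_{i+1})}{s_i-s_{i+1}}$, extended continuously to $\mathbb R^{i+1}$ when $f\in C^i(\mathbb R)$. $\mathcal C_\alpha^k(\mathbb R):=\{f\in C^k(\mathbb R):\alpha_{r,i+1}(f^{[i]})<\infty\ \forall r>0,\ 0\le i\le k\}$ with the topology generated by the seminorms $f\mapsto\alpha_{r,i+1}(f^{[i]})$; $C_\alpha^k(\mathbb R)$ is the closure of $\mathbb C[\lambda]$ in $\mathcal C_\alpha^k(\mathbb R)$. If $f\in C_\alpha^k(\mathbb R)$, then $f^{[i]}\in C_\alpha(\mathbb R^{i+1})$ for $0\le i\le k$. *)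

theory Defs
  imports "HOL-Analysis.Analysis" "HOL-Computational_Algebra.Polynomial"
    "HOL-Combinatorics.Permutations"
begin

section \<open>Unital C*-algebras\<close>

text \<open>The zero algebra is not excluded, hence \<^class>\<open>monoid_mult\<close> rather than
  \<^class>\<open>real_normed_algebra_1\<close>; \<open>norm 1 = 1\<close> follows from the C*-identity when \<open>1 \<noteq> 0\<close>.\<close>

class cstar_algebra = real_normed_algebra + banach + monoid_mult +
  fixes scaleC :: "complex \<Rightarrow> 'a \<Rightarrow> 'a" (infixr \<open>*\<^sub>C\<close> 75)
    and star :: "'a \<Rightarrow> 'a"
  assumes scaleC_add_right: "c *\<^sub>C (x + y) = c *\<^sub>C x + c *\<^sub>C y"
    and scaleC_add_left: "(c + d) *\<^sub>C x = c *\<^sub>C x + d *\<^sub>C x"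
    and scaleC_scaleC: "c *\<^sub>C d *\<^sub>C x = (c * d) *\<^sub>C x"
    and scaleC_of_real: "complex_of_real r *\<^sub>C x = r *\<^sub>R x"
    and norm_scaleC: "norm (c *\<^sub>C x) = cmod c * norm x"
    and mult_scaleC_left: "(c *\<^sub>C x) * y = c *\<^sub>C (x * y)"
    and mult_scaleC_right: "x * (c *\<^sub>C y) = c *\<^sub>C (x * y)"
    and star_add: "star (x + y) = star x + star y"
    and star_scaleC: "star (c *\<^sub>C x) = cnj c *\<^sub>C star x"
    and star_mult: "star (x * y) = star y * star x"
    and star_star: "star (star x) = x"
    and cstar_identity: "norm (star x * x) = (norm x)\<^sup>2"

definition selfadjoint :: "'a::cstar_algebra set" where
  "selfadjoint = {a. star a = a}"

definition selfadjoint_ball :: "real \<Rightarrow> 'a::cstar_algebra set" where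
  "selfadjoint_ball r = {a \<in> selfadjoint. norm a \<le> r}"

definition spectrum :: "'a::cstar_algebra \<Rightarrow> complex set" where
  "spectrum a = {z. \<not> (\<exists>y. y * (a - z *\<^sub>C 1) = 1 \<and> (a - z *\<^sub>C 1) * y = 1)}"

text \<open>Functions with domain \<open>X\<close> are \<^const>\<open>extensional\<close>; operations
  on them are therefore restricted to \<open>X\<close> again.\<close>

definition cfun :: "'x::topological_space set \<Rightarrow> ('x \<Rightarrow> complex) set" where
  "cfun X = {\<phi> \<in> extensional X. continuous_on X \<phi>}"

definition unital_star_hom_of :: "'a::cstar_algebra \<Rightarrow> ((complex \<Rightarrow> complex) \<Rightarrow> 'a) \<Rightarrow> bool" where
  "unital_star_hom_of a \<Phi> \<longleftrightarrow>
    (let X = spectrum a in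
      (\<forall>\<phi>\<in>cfun X. \<forall>\<psi>\<in>cfun X.
         \<Phi> (\<lambda>z\<in>X. \<phi> z + \<psi> z) = \<Phi> \<phi> + \<Phi> \<psi> \<and> \<Phi> (\<lambda>z\<in>X. \<phi> z * \<psi> z) = \<Phi> \<phi> * \<Phi> \<psi>) \<and>
      (\<forall>\<phi>\<in>cfun X. (\<forall>c. \<Phi> (\<lambda>z\<in>X. c * \<phi> z) = c *\<^sub>C \<Phi> \<phi>) \<and> \<Phi> (\<lambda>z\<in>X. cnj (\<phi> z)) = star (\<Phi> \<phi>)) \<and>
      \<Phi> (\<lambda>z\<in>X. 1) = 1 \<and> \<Phi> (\<lambda>z\<in>X. z) = a)"

text \<open>Continuous functional calculus \<open>f(a)\<close> for self-adjoint \<open>a\<close>: the value at \<open>f\<close> of the unique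
  unital *-homomorphism \<open>C(\<sigma>(a)) \<rightarrow> A\<close> mapping the identity function to \<open>a\<close>. Since
  \<open>\<sigma>(a) \<subseteq> \<real>\<close>, \<open>f\<close> on \<open>\<sigma>(a)\<close> is \<open>f \<circ> Re\<close>.\<close>

definition cfc :: "(real \<Rightarrow> complex) \<Rightarrow> 'a::cstar_algebra \<Rightarrow> 'a" where
  "cfc f a = (THE x. \<exists>\<Phi>. unital_star_hom_of a \<Phi> \<and> x = \<Phi> (\<lambda>z\<in>spectrum a. f (Re z)))"


section \<open>Symmetrically normed ideals\<close>

locale symmetrically_normed_ideal =
  fixes I :: "'a::cstar_algebra set" and nI :: "'a \<Rightarrow> real"
  assumes zero_mem: "0 \<in> I"
    and add_mem: "\<lbrakk>r \<in> I; s \<in> I\<rbrakk> \<Longrightarrow> r + s \<in> I"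
    and scaleC_mem: "r \<in> I \<Longrightarrow> c *\<^sub>C r \<in> I"
    and mult_left_mem: "r \<in> I \<Longrightarrow> x * r \<in> I"
    and mult_right_mem: "r \<in> I \<Longrightarrow> r * x \<in> I"
    and nI_nonneg: "r \<in> I \<Longrightarrow> 0 \<le> nI r"
    and nI_eq_0_iff: "r \<in> I \<Longrightarrow> nI r = 0 \<longleftrightarrow> r = 0"
    and nI_scaleC: "r \<in> I \<Longrightarrow> nI (c *\<^sub>C r) = cmod c * nI r"
    and nI_triangle: "\<lbrakk>r \<in> I; s \<in> I\<rbrakk> \<Longrightarrow> nI (r + s) \<le> nI r + nI s"
    and nI_complete: "\<lbrakk>\<And>n::nat. u n \<in> I; \<And>e. 0 < e \<Longrightarrow> \<exists>N. \<forall>m\<ge>N. \<forall>n\<ge>N. nI (u m - u n) < e\<rbrakk>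
        \<Longrightarrow> \<exists>l\<in>I. (\<lambda>n. nI (u n - l)) \<longlonglongrightarrow> 0"
    and inclusion_bounded: "\<exists>C. \<forall>r\<in>I. norm r \<le> C * nI r"
    and nI_symmetric: "r \<in> I \<Longrightarrow> nI (x * r * y) \<le> norm x * nI r * norm y"

text \<open>Operator norm of the inclusion, as in \<^const>\<open>onorm\<close> (with \<open>0 / 0 = 0\<close>).\<close>

definition incl_norm :: "'a::cstar_algebra set \<Rightarrow> ('a \<Rightarrow> real) \<Rightarrow> real" where
  "incl_norm I nI = (SUP r\<in>I. norm r / nI r)"


section \<open>Topologies given by seminorms, bounded multilinear maps\<close>

definition seminorm_topology :: "'v::minus set \<Rightarrow> ('v \<Rightarrow> ennreal) set \<Rightarrow> 'v topology" where
  "seminorm_topology V S =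
     topology_generated_by {{w \<in> V. p (w - v) < ennreal e} |p v e. p \<in> S \<and> v \<in> V \<and> 0 < e}"

text \<open>Tuples of length \<open>n\<close> are extensional functions on \<open>{..<n}\<close>, so all indices start at \<open>0\<close>.\<close>

definition tuples :: "nat \<Rightarrow> 'v set \<Rightarrow> (nat \<Rightarrow> 'v) set" where
  "tuples n V = PiE {..<n} (\<lambda>_. V)"

text \<open>Bounded \<open>n\<close>-linear maps \<open>V\<^sup>n \<rightarrow> W\<close> over the scalars \<open>K \<subseteq> \<complex>\<close>, where \<open>V\<close> and \<open>W\<close> carry the norms
  \<open>nV\<close> and \<open>nW\<close>; \<open>K = UNIV\<close> and \<open>K = \<real>\<close> give complex and real multilinearity.\<close>

definition bounded_multilinear ::
    "complex set \<Rightarrow> 'a::cstar_algebra set \<Rightarrow> ('a \<Rightarrow> real) \<Rightarrow> 'a set \<Rightarrow> ('a \<Rightarrow> real) \<Rightarrow> nat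
      \<Rightarrow> ((nat \<Rightarrow> 'a) \<Rightarrow> 'a) set" where
  "bounded_multilinear K V nV W nW n =
     {S \<in> tuples n V \<rightarrow>\<^sub>E W.
       (\<forall>b\<in>tuples n V. \<forall>i<n. \<forall>x\<in>V. \<forall>y\<in>V. S (b(i := x + y)) = S (b(i := x)) + S (b(i := y))) \<and>
       (\<forall>b\<in>tuples n V. \<forall>i<n. \<forall>x\<in>V. \<forall>c\<in>K. S (b(i := c *\<^sub>C x)) = c *\<^sub>C S (b(i := x))) \<and>
       (\<exists>C. \<forall>b\<in>tuples n V. nW (S b) \<le> C * (\<Prod>i<n. nV (b i)))}"

definition multilinear_norm ::
    "'a::cstar_algebra set \<Rightarrow> ('a \<Rightarrow> real) \<Rightarrow> ('a \<Rightarrow> real) \<Rightarrow> nat \<Rightarrow> ((nat \<Rightarrow> 'a) \<Rightarrow> 'a) \<Rightarrow> real" where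
  "multilinear_norm V nV nW n S =
     Inf {C. 0 \<le> C \<and> (\<forall>b\<in>tuples n V. nW (S b) \<le> C * (\<Prod>i<n. nV (b i)))}"


section \<open>Families of possibly infinite norms\<close>

definition cube :: "real \<Rightarrow> nat \<Rightarrow> (nat \<Rightarrow> real) set" where
  "cube r m = tuples m {-r..r}"

abbreviation Rn :: "nat \<Rightarrow> (nat \<Rightarrow> real) set" where
  "Rn m \<equiv> tuples m UNIV"

definition possibly_infinite_norm ::
    "'x::topological_space set \<Rightarrow> (('x \<Rightarrow> complex) \<Rightarrow> ennreal) \<Rightarrow> bool" where
  "possibly_infinite_norm X \<eta> \<longleftrightarrow>
     (\<forall>\<phi>\<in>cfun X. \<forall>c. \<eta> (\<lambda>x\<in>X. c * \<phi> x) = ennreal (cmod c) * \<eta> \<phi>) \<and>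
     (\<forall>\<phi>\<in>cfun X. \<forall>\<psi>\<in>cfun X. \<eta> (\<lambda>x\<in>X. \<phi> x + \<psi> x) \<le> \<eta> \<phi> + \<eta> \<psi>) \<and>
     (\<forall>\<phi>\<in>cfun X. \<eta> \<phi> = 0 \<longleftrightarrow> \<phi> = (\<lambda>x\<in>X. 0))"

type_synonym norm_fam = "real \<Rightarrow> nat \<Rightarrow> ((nat \<Rightarrow> real) \<Rightarrow> complex) \<Rightarrow> ennreal"

definition norm_family :: "norm_fam \<Rightarrow> bool" where
  "norm_family \<alpha> \<longleftrightarrow> (\<forall>r>0. \<forall>m\<ge>1. possibly_infinite_norm (cube r m) (\<alpha> r m))"

definition fam_norm :: "norm_fam \<Rightarrow> real \<Rightarrow> nat \<Rightarrow> ((nat \<Rightarrow> real) \<Rightarrow> complex) \<Rightarrow> ennreal" where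
  "fam_norm \<alpha> r m \<phi> = \<alpha> r m (restrict \<phi> (cube r m))"

definition multi_indices :: "nat \<Rightarrow> nat \<Rightarrow> (nat \<Rightarrow> nat) set" where
  "multi_indices m d = {\<delta> \<in> tuples m UNIV. (\<Sum>i<m. \<delta> i) \<le> d}"

definition poly_fun :: "nat \<Rightarrow> nat \<Rightarrow> ((nat \<Rightarrow> nat) \<Rightarrow> complex) \<Rightarrow> (nat \<Rightarrow> real) \<Rightarrow> complex" where
  "poly_fun m d c =
     (\<lambda>x\<in>Rn m. \<Sum>\<delta>\<in>multi_indices m d. c \<delta> * complex_of_real (\<Prod>i<m. x i ^ \<delta> i))"

definition poly_funs :: "nat \<Rightarrow> ((nat \<Rightarrow> real) \<Rightarrow> complex) set" where
  "poly_funs m = {poly_fun m d c |d c. True}"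

definition finite_norm_funs :: "norm_fam \<Rightarrow> nat \<Rightarrow> ((nat \<Rightarrow> real) \<Rightarrow> complex) set" where
  "finite_norm_funs \<alpha> m = {\<phi> \<in> cfun (Rn m). \<forall>r>0. fam_norm \<alpha> r m \<phi> < \<infinity>}"

definition finite_norm_topology :: "norm_fam \<Rightarrow> nat \<Rightarrow> ((nat \<Rightarrow> real) \<Rightarrow> complex) topology" where
  "finite_norm_topology \<alpha> m =
     seminorm_topology (finite_norm_funs \<alpha> m) {fam_norm \<alpha> r m |r. 0 < r}"

definition finite_on_polynomials :: "norm_fam \<Rightarrow> bool" where
  "finite_on_polynomials \<alpha> \<longleftrightarrow> (\<forall>m\<ge>1. poly_funs m \<subseteq> finite_norm_funs \<alpha> m)"

text \<open>\<open>C\<^sub>\<alpha>(\<real>\<^sup>m)\<close>\<close>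

definition C_alpha :: "norm_fam \<Rightarrow> nat \<Rightarrow> ((nat \<Rightarrow> real) \<Rightarrow> complex) set" where
  "C_alpha \<alpha> m = finite_norm_topology \<alpha> m closure_of poly_funs m"


section \<open>Lexicographic functional calculus\<close>

text \<open>\<open>P\<^sub>\<otimes>(a) # b\<close> for \<open>m \<ge> 2\<close> and the polynomial \<open>P\<close> with coefficients \<open>c\<close>\<close>

definition poly_lfc ::
    "nat \<Rightarrow> nat \<Rightarrow> ((nat \<Rightarrow> nat) \<Rightarrow> complex) \<Rightarrow> (nat \<Rightarrow> 'a) \<Rightarrow> (nat \<Rightarrow> 'a) \<Rightarrow> 'a::cstar_algebra" where
  "poly_lfc m d c a b =
     (\<Sum>\<delta>\<in>multi_indices m d.
        c \<delta> *\<^sub>C (prod_list (map (\<lambda>i. a i ^ \<delta> i * b i) [0..<m-1]) * a (m-1) ^ \<delta> (m-1)))"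

definition controls_polynomial_lfc ::
    "norm_fam \<Rightarrow> 'a::cstar_algebra set \<Rightarrow> ('a \<Rightarrow> real) \<Rightarrow> bool" where
  "controls_polynomial_lfc \<alpha> I nI \<longleftrightarrow>
     finite_on_polynomials \<alpha> \<and>
     (\<forall>r>0. \<forall>\<phi>\<in>cfun (cube r 1). \<alpha> r 1 \<phi> = (SUP x\<in>cube r 1. ennreal (cmod (\<phi> x)))) \<and>
     (\<forall>m\<ge>2. \<forall>d c. \<forall>b\<in>tuples (m-1) I. \<forall>r>0.
        (SUP a\<in>tuples m (selfadjoint_ball r). ennreal (nI (poly_lfc m d c a b)))
          \<le> ennreal (incl_norm I nI ^ (m-2)) * fam_norm \<alpha> r m (poly_fun m d c)
              * ennreal (\<Prod>i<m-1. nI (b i)))"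

text \<open>Continuous maps \<open>A\<^sub>s\<^sub>a\<^sup>m \<rightarrow> B\<^sub>m\<^sub>-\<^sub>1(I\<^sup>m\<^sup>-\<^sup>1; I)\<close> that are bounded on bounded sets. On \<open>A\<^sub>s\<^sub>a\<^sup>m\<close> the
  product topology of the function type induces the usual topology.\<close>

definition lfc_maps ::
    "'a::cstar_algebra set \<Rightarrow> ('a \<Rightarrow> real) \<Rightarrow> nat \<Rightarrow> ((nat \<Rightarrow> 'a) \<Rightarrow> (nat \<Rightarrow> 'a) \<Rightarrow> 'a) set" where
  "lfc_maps I nI m =
     (let B = bounded_multilinear UNIV I nI I nI (m-1); nB = multilinear_norm I nI nI (m-1) in
      {F \<in> tuples m selfadjoint \<rightarrow>\<^sub>E B.
        continuous_map (top_of_set (tuples m selfadjoint))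
          (seminorm_topology B {\<lambda>S. ennreal (nB S)}) F \<and>
        (\<forall>r>0. \<exists>C. \<forall>a\<in>tuples m (selfadjoint_ball r). nB (F a) \<le> C)})"

text \<open>The topology of uniform convergence on bounded sets; every bounded set of tuples is contained
  in a power of some \<^const>\<open>selfadjoint_ball\<close>.\<close>

definition lfc_maps_topology ::
    "'a::cstar_algebra set \<Rightarrow> ('a \<Rightarrow> real) \<Rightarrow> nat \<Rightarrow> ((nat \<Rightarrow> 'a) \<Rightarrow> (nat \<Rightarrow> 'a) \<Rightarrow> 'a) topology" where
  "lfc_maps_topology I nI m =
     seminorm_topology (lfc_maps I nI m)
       {\<lambda>F. SUP a\<in>tuples m (selfadjoint_ball r). ennreal (multilinear_norm I nI nI (m-1) (F a))
         |r. 0 < r}"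

definition lfc_extension ::
    "norm_fam \<Rightarrow> 'a::cstar_algebra set \<Rightarrow> ('a \<Rightarrow> real) \<Rightarrow> nat
      \<Rightarrow> (((nat \<Rightarrow> real) \<Rightarrow> complex) \<Rightarrow> (nat \<Rightarrow> 'a) \<Rightarrow> (nat \<Rightarrow> 'a) \<Rightarrow> 'a) \<Rightarrow> bool" where
  "lfc_extension \<alpha> I nI m T \<longleftrightarrow>
     continuous_map (subtopology (finite_norm_topology \<alpha> m) (C_alpha \<alpha> m))
       (lfc_maps_topology I nI m) T \<and>
     (\<forall>\<phi>\<in>C_alpha \<alpha> m. \<forall>\<psi>\<in>C_alpha \<alpha> m. \<forall>z.
        \<forall>a\<in>tuples m selfadjoint. \<forall>b\<in>tuples (m-1) I.
          T (\<lambda>x\<in>Rn m. z * \<phi> x + \<psi> x) a b = z *\<^sub>C T \<phi> a b + T \<psi> a b) \<and>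
     (\<forall>d c. \<forall>a\<in>tuples m selfadjoint. \<forall>b\<in>tuples (m-1) I.
        T (poly_fun m d c) a b = poly_lfc m d c a b)"

text \<open>\<open>lfc \<alpha> I nI m \<phi> a b\<close> is \<open>\<phi>\<^sub>I\<^sub>,\<^sub>\<alpha>(a) # b\<close>, for \<open>m \<ge> 2\<close>.\<close>

definition lfc ::
    "norm_fam \<Rightarrow> 'a::cstar_algebra set \<Rightarrow> ('a \<Rightarrow> real) \<Rightarrow> nat \<Rightarrow> ((nat \<Rightarrow> real) \<Rightarrow> complex)
      \<Rightarrow> (nat \<Rightarrow> 'a) \<Rightarrow> (nat \<Rightarrow> 'a) \<Rightarrow> 'a" where
  "lfc \<alpha> I nI m \<phi> = (THE F. \<exists>T. lfc_extension \<alpha> I nI m T \<and> F = T \<phi>)"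


section \<open>Divided differences and the spaces of functions on the line\<close>

text \<open>Meaningful when \<open>s 0, \<dots>, s i\<close> are distinct\<close>

primrec divdiff_distinct :: "(real \<Rightarrow> complex) \<Rightarrow> nat \<Rightarrow> (nat \<Rightarrow> real) \<Rightarrow> complex" where
  "divdiff_distinct f 0 s = f (s 0)"
| "divdiff_distinct f (Suc i) s =
     (divdiff_distinct f i s - divdiff_distinct f i (s(i := s (Suc i))))
       / complex_of_real (s i - s (Suc i))"

text \<open>\<open>f\<^sup>[\<^sup>i\<^sup>]\<close>: the continuous extension to \<open>\<real>\<^sup>i\<^sup>+\<^sup>1\<close>, for \<open>f\<close> of class \<open>C\<^sup>i\<close>\<close>

definition divdiff :: "(real \<Rightarrow> complex) \<Rightarrow> nat \<Rightarrow> (nat \<Rightarrow> real) \<Rightarrow> complex" where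
  "divdiff f i =
     (THE \<phi>. \<phi> \<in> cfun (Rn (Suc i)) \<and>
        (\<forall>s\<in>Rn (Suc i). inj_on s {..i} \<longrightarrow> \<phi> s = divdiff_distinct f i s))"

definition Ck_on_line :: "nat \<Rightarrow> (real \<Rightarrow> complex) set" where
  "Ck_on_line k =
     {f. \<exists>g. g 0 = f \<and>
        (\<forall>j<k. \<forall>x. (g j has_vector_derivative g (Suc j) x) (at x)) \<and>
        (\<forall>j\<le>k. continuous_on UNIV (g j))}"

definition finite_norm_Ck :: "norm_fam \<Rightarrow> nat \<Rightarrow> (real \<Rightarrow> complex) set" where
  "finite_norm_Ck \<alpha> k =
     {f \<in> Ck_on_line k. \<forall>r>0. \<forall>i\<le>k. fam_norm \<alpha> r (i+1) (divdiff f i) < \<infinity>}"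

definition finite_norm_Ck_topology :: "norm_fam \<Rightarrow> nat \<Rightarrow> (real \<Rightarrow> complex) topology" where
  "finite_norm_Ck_topology \<alpha> k =
     seminorm_topology (finite_norm_Ck \<alpha> k)
       {\<lambda>f. fam_norm \<alpha> r (i+1) (divdiff f i) |r i. 0 < r \<and> i \<le> k}"

text \<open>\<open>C\<^sub>\<alpha>\<^sup>k(\<real>)\<close>\<close>

definition Ck_alpha :: "norm_fam \<Rightarrow> nat \<Rightarrow> (real \<Rightarrow> complex) set" where
  "Ck_alpha \<alpha> k =
     finite_norm_Ck_topology \<alpha> k closure_of range (\<lambda>p x. poly p (complex_of_real x))"


section \<open>Frechet and directional derivatives with respect to a norm on a subspace\<close>

text \<open>Class \<open>C\<^sup>k\<close> on the real normed space \<open>(V, nV)\<close> with values in \<open>(W, nW)\<close>. The \<open>j\<close>-th derivative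
  at a point is a bounded \<open>j\<close>-linear map over \<open>\<real>\<close>, under the isometry of \<open>B(V; B\<^sub>j(V\<^sup>j; W))\<close> with
  \<open>B\<^sub>j\<^sub>+\<^sub>1(V\<^sup>j\<^sup>+\<^sup>1; W)\<close> that puts the newest direction first (\<open>case_nat h b\<close> is \<open>h\<close> followed by \<open>b\<close>).\<close>

definition frechet_Ck ::
    "nat \<Rightarrow> 'a::cstar_algebra set \<Rightarrow> ('a \<Rightarrow> real) \<Rightarrow> 'a set \<Rightarrow> ('a \<Rightarrow> real) \<Rightarrow> ('a \<Rightarrow> 'a) \<Rightarrow> bool" where
  "frechet_Ck k V nV W nW f \<longleftrightarrow>
     (\<exists>D :: nat \<Rightarrow> 'a \<Rightarrow> (nat \<Rightarrow> 'a) \<Rightarrow> 'a.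
        (\<forall>x\<in>V. \<forall>b\<in>tuples 0 V. D 0 x b = f x) \<and>
        (\<forall>j\<le>k. continuous_map (seminorm_topology V {\<lambda>v. ennreal (nV v)})
           (seminorm_topology (bounded_multilinear \<real> V nV W nW j)
              {\<lambda>S. ennreal (multilinear_norm V nV nW j S)}) (D j)) \<and>
        (\<forall>j<k. \<forall>x\<in>V. \<forall>e>0. \<exists>\<delta>>0. \<forall>h\<in>V. nV h < \<delta> \<longrightarrow>
           multilinear_norm V nV nW j
             (\<lambda>b. D j (x + h) b - D j x b - D (Suc j) x (case_nat h b)) \<le> e * nV h))"

definition dir_deriv ::
    "'a::cstar_algebra set \<Rightarrow> ('a \<Rightarrow> real) \<Rightarrow> 'a \<Rightarrow> ('a \<Rightarrow> 'a) \<Rightarrow> 'a \<Rightarrow> 'a" where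
  "dir_deriv W nW v g x =
     (THE y. y \<in> W \<and>
        ((\<lambda>t::real. nW ((1 / t) *\<^sub>R (g (x + t *\<^sub>R v) - g x) - y)) \<longlongrightarrow> 0) (at 0))"

text \<open>\<open>iter_dir_deriv W nW j v g\<close> is \<open>\<partial>\<^bsub>v (j-1)\<^esub> \<cdots> \<partial>\<^bsub>v 0\<^esub> g\<close>.\<close>

primrec iter_dir_deriv ::
    "'a::cstar_algebra set \<Rightarrow> ('a \<Rightarrow> real) \<Rightarrow> nat \<Rightarrow> (nat \<Rightarrow> 'a) \<Rightarrow> ('a \<Rightarrow> 'a) \<Rightarrow> 'a \<Rightarrow> 'a" where
  "iter_dir_deriv W nW 0 v g = g"
| "iter_dir_deriv W nW (Suc j) v g = dir_deriv W nW (v j) (iter_dir_deriv W nW j v g)"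

end

theory Submission
  imports Defs "HOL-Computational_Algebra.Fundamental_Theorem_Algebra"
    "HOL-Computational_Algebra.Formal_Power_Series"
begin

text \<open>Polynomials are dense in \<open>C\<^sub>\<alpha>\<^sup>k(\<real>)\<close> for the seminorms \<open>f \<mapsto> \<alpha>\<^sub>r\<^sub>,\<^sub>i\<^sub>+\<^sub>1(f\<^sup>[\<^sup>i\<^sup>])\<close> with \<open>i \<le> k\<close>, and by the control inequality
  everything below depends continuously on these seminorms. So identities need to be verified for polynomials only.
  The decisive one is the perturbation formula (\<open>lfc_dd_telescope\<close>): if \<open>u, v\<close> are self-adjoint and \<open>u - v\<close> lies in the
  ideal, then \<open>f\<^sup>[\<^sup>j\<^sup>](u, \<dots>, u) # b - f\<^sup>[\<^sup>j\<^sup>](v, \<dots>, v) # b\<close> is the sum over all positions \<open>l = 0, \<dots>, j\<close> of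
  \<open>f\<^sup>[\<^sup>j\<^sup>+\<^sup>1\<^sup>](u, \<dots>, u, v, \<dots>, v) # (b\<^sub>1, \<dots>, b\<^sub>l, u - v, b\<^sub>l\<^sub>+\<^sub>1, \<dots>, b\<^sub>j)\<close>, where \<open>u\<close> occurs \<open>l + 1\<close> times. For polynomials it is the
  resolvent identity \<open>(1 - u z)\<^sup>-\<^sup>1 - (1 - v z)\<^sup>-\<^sup>1 = (1 - u z)\<^sup>-\<^sup>1 (u - v) z (1 - v z)\<^sup>-\<^sup>1\<close>, read in formal power series in \<open>z\<close>
  (\<open>lex_geo_telescope\<close>).

  For \<open>j = 0\<close> the formula reads \<open>f(u) - f(v) = f\<^sup>[\<^sup>1\<^sup>](u, v) # (u - v)\<close>, so \<open>f(a + b) - f(a)\<close> lies in the ideal. In general,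
  take \<open>u = a + x + h\<close> and \<open>v = a + x\<close>. Replacing \<open>u\<close> by \<open>v\<close> on the right side costs \<open>o(\<parallel>h\<parallel>)\<close>, because the calculus of
  \<open>f\<^sup>[\<^sup>j\<^sup>+\<^sup>1\<^sup>]\<close> is continuous in its arguments. Symmetrising over the directions, and since every permutation of \<open>j + 1\<close>
  objects arises exactly once by inserting a new first object into a permutation of the others
  (\<open>sum_permutations_insert_at\<close>), one sees that \<open>\<Sum>\<pi>. f\<^sup>[\<^sup>j\<^sup>+\<^sup>1\<^sup>](a + x, \<dots>, a + x) # b\<^sub>\<pi>\<close> is the Frechet derivative of
  \<open>\<Sum>\<pi>. f\<^sup>[\<^sup>j\<^sup>](a + x, \<dots>, a + x) # b\<^sub>\<pi>\<close> (\<open>deriv_map_frechet\<close>).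

  Three objects in the statement are defined by description, and their existence and uniqueness has to be established.
  For the continuous functional calculus (\<open>cfc_eq_fc\<close>) one needs that a self-adjoint element attains its norm in the
  spectrum, which has an elementary proof. The continuous extension of divided differences (\<open>divdiff_Ck\<close>) is given by
  the Hermite--Genocchi formula. The lexicographic functional calculus (\<open>lfc_eq_lfc_map\<close>) extends from polynomials by
  completeness of the ideal.\<close>

section \<open>Elementary facts about C*-algebras\<close>

lemma scaleC_zero_right [simp]: "c *\<^sub>C (0::'a::cstar_algebra) = 0"
  using scaleC_add_right[of c 0 "0::'a"] by simp

lemma scaleC_zero_left [simp]: "0 *\<^sub>C (x::'a::cstar_algebra) = 0"
  using scaleC_of_real[of 0 x] by simp

lemma scaleC_one [simp]: "1 *\<^sub>C (x::'a::cstar_algebra) = x"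
  using scaleC_of_real[of 1 x] by simp

lemma scaleC_minus_right: "c *\<^sub>C (- x) = - (c *\<^sub>C (x::'a::cstar_algebra))"
  using scaleC_add_right[of c x "-x"] by (simp add: eq_neg_iff_add_eq_0 add.commute)

lemma scaleC_minus_left: "(- c) *\<^sub>C x = - (c *\<^sub>C (x::'a::cstar_algebra))"
  using scaleC_add_left[of c "-c" x] by (simp add: eq_neg_iff_add_eq_0 add.commute)

lemma scaleC_diff_right: "c *\<^sub>C (x - y) = c *\<^sub>C x - c *\<^sub>C (y::'a::cstar_algebra)"
  using scaleC_add_right[of c x "-y"] by (simp add: scaleC_minus_right)

lemma scaleC_diff_left: "(c - d) *\<^sub>C x = c *\<^sub>C x - d *\<^sub>C (x::'a::cstar_algebra)"
  using scaleC_add_left[of c "-d" x] by (simp add: scaleC_minus_left)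

lemma scaleC_minus_one: "(-1) *\<^sub>C x = - (x::'a::cstar_algebra)"
  by (simp add: scaleC_minus_left)

lemma scaleC_sum_right: "c *\<^sub>C (\<Sum>i\<in>A. g i) = (\<Sum>i\<in>A. c *\<^sub>C (g i::'a::cstar_algebra))"
  by (induction A rule: infinite_finite_induct) (auto simp: scaleC_add_right)

lemma star_zero [simp]: "star (0::'a::cstar_algebra) = 0"
  using star_add[of 0 "0::'a"] by simp

lemma star_minus: "star (- x) = - star (x::'a::cstar_algebra)"
  using star_add[of x "-x"] by (simp add: eq_neg_iff_add_eq_0 add.commute)

lemma star_diff: "star (x - y) = star x - star (y::'a::cstar_algebra)"
  using star_add[of x "-y"] by (simp add: star_minus)

lemma star_one [simp]: "star (1::'a::cstar_algebra) = 1"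
  using star_mult[of "star (1::'a)" 1] by (simp add: star_star)

lemma star_power: "star (x ^ n) = star (x::'a::cstar_algebra) ^ n"
  by (induction n) (auto simp: star_mult power_commutes)

lemma norm_star: "norm (star x) = norm (x::'a::cstar_algebra)"
proof -
  have le: "norm y \<le> norm (star y)" for y :: 'a
  proof (cases "norm y = 0")
    case False
    have "norm y * norm y \<le> norm (star y) * norm y"
      using cstar_identity[of y] norm_mult_ineq[of "star y" y] by (simp add: power2_eq_square)
    with False show ?thesis by (simp add: mult_le_cancel_right)
  qed simp
  show ?thesis using le[of x] le[of "star x"] by (simp add: star_star)
qed

text \<open>By the C*-identity \<open>norm 1\<close> equals its own square.\<close>

lemma norm_one_le: "norm (1::'a::cstar_algebra) \<le> 1"
proof (rule ccontr)
  assume "\<not> ?thesis"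
  moreover have "norm (1::'a) = norm (1::'a) * norm (1::'a)"
    using cstar_identity[of "1::'a"] by (simp add: power2_eq_square)
  ultimately show False by simp
qed

lemma norm_power_le: "norm (x ^ n) \<le> norm (x::'a::cstar_algebra) ^ n"
proof (induction n)
  case (Suc n)
  have "norm (x ^ Suc n) \<le> norm x * norm (x ^ n)"
    using norm_mult_ineq[of x "x ^ n"] by simp
  also have "\<dots> \<le> norm x * norm x ^ n"
    using Suc by (intro mult_left_mono) auto
  finally show ?case by simp
qed (simp add: norm_one_le)

lemma selfadjoint_simps:
  "x \<in> selfadjoint \<Longrightarrow> y \<in> selfadjoint \<Longrightarrow> x + y \<in> selfadjoint"
  "x \<in> selfadjoint \<Longrightarrow> y \<in> selfadjoint \<Longrightarrow> x - y \<in> selfadjoint"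
  "x \<in> selfadjoint \<Longrightarrow> x ^ n \<in> selfadjoint"
  "x \<in> selfadjoint \<Longrightarrow> complex_of_real t *\<^sub>C x \<in> selfadjoint"
  for x y :: "'a::cstar_algebra"
  by (auto simp: selfadjoint_def star_add star_diff star_power star_scaleC)

lemma norm_selfadjoint_square: "x \<in> selfadjoint \<Longrightarrow> norm (x * x) = (norm (x::'a::cstar_algebra))\<^sup>2"
  using cstar_identity[of x] by (simp add: selfadjoint_def)

lemma norm_selfadjoint_power2_power:
  assumes "x \<in> selfadjoint" "norm (x::'a::cstar_algebra) = 1"
  shows "norm (x ^ (2 ^ m)) = 1"
proof (induction m)
  case (Suc m)
  have "x ^ (2 ^ Suc m) = x ^ (2 ^ m) * x ^ (2 ^ m)"
    by (simp add: power_add[symmetric] mult_2)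
  then show ?case
    using Suc norm_selfadjoint_square[OF selfadjoint_simps(3)[OF assms(1)], of "2 ^ m"] by simp
qed (use assms in simp)


section \<open>Invertible elements and the spectrum\<close>

definition two_sided_inverse :: "'a::cstar_algebra \<Rightarrow> 'a \<Rightarrow> bool" where
  "two_sided_inverse y x \<longleftrightarrow> y * x = 1 \<and> x * y = 1"

definition invertible_elem :: "'a::cstar_algebra \<Rightarrow> bool" where
  "invertible_elem x \<longleftrightarrow> (\<exists>y. two_sided_inverse y x)"

lemma spectrum_iff: "z \<in> spectrum a \<longleftrightarrow> \<not> invertible_elem (a - z *\<^sub>C 1)"
  by (simp add: spectrum_def invertible_elem_def two_sided_inverse_def)

lemma invertible_elem_mult:
  assumes "invertible_elem (x::'a::cstar_algebra)" "invertible_elem y"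
  shows "invertible_elem (x * y)"
proof -
  obtain x' y' where "x' * x = 1" "x * x' = 1" "y' * y = 1" "y * y' = 1"
    using assms by (auto simp: invertible_elem_def two_sided_inverse_def)
  then have "(y' * x') * (x * y) = 1" "(x * y) * (y' * x') = 1"
    by (metis mult.assoc mult_1_right)+
  then show ?thesis
    by (auto simp: invertible_elem_def two_sided_inverse_def)
qed

lemma invertible_elem_scaleC:
  assumes "c \<noteq> 0" "invertible_elem (x::'a::cstar_algebra)"
  shows "invertible_elem (c *\<^sub>C x)"
proof -
  obtain x' where "x' * x = 1" "x * x' = 1"
    using assms by (auto simp: invertible_elem_def two_sided_inverse_def)
  with \<open>c \<noteq> 0\<close> have "two_sided_inverse (inverse c *\<^sub>C x') (c *\<^sub>C x)"
    by (simp add: two_sided_inverse_def mult_scaleC_left mult_scaleC_right scaleC_scaleC)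
  then show ?thesis by (auto simp: invertible_elem_def)
qed

lemma invertible_elem_one: "invertible_elem (1::'a::cstar_algebra)"
  by (auto simp: invertible_elem_def two_sided_inverse_def)

text \<open>Neumann series. In the zero algebra \<open>norm 1 = 0\<close>, so only \<open>norm 1 \<le> 1\<close> may enter the estimate.\<close>

lemma invertible_elem_one_minus:
  assumes "norm (x::'a::cstar_algebra) < 1"
  shows "invertible_elem (1 - x)"
proof -
  have sm: "summable (\<lambda>n. x ^ n)"
    by (rule summable_comparison_test'[OF summable_geometric[of "norm x"], of 0])
       (use assms norm_power_le in auto)
  define S where "S = (\<Sum>n. x ^ n)"
  have S: "S = 1 + (\<Sum>n. x ^ Suc n)"
    using suminf_split_head[OF sm] by (simp add: S_def)
  have "x * S = (\<Sum>n. x ^ Suc n)"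
    using suminf_mult[OF sm, of x] by (simp add: S_def)
  moreover have "S * x = (\<Sum>n. x ^ Suc n)"
    using suminf_mult2[OF sm, of x] by (simp add: S_def power_commutes)
  ultimately have "two_sided_inverse S (1 - x)"
    using S by (simp add: two_sided_inverse_def algebra_simps)
  then show ?thesis by (auto simp: invertible_elem_def)
qed

text \<open>For \<open>\<bar>z\<bar> > \<parallel>a\<parallel>\<close> the element \<open>a - z = - z (1 - z\<^sup>-\<^sup>1 a)\<close> is invertible by the Neumann series.\<close>

lemma spectrum_norm_bound:
  assumes "z \<in> spectrum (a::'a::cstar_algebra)"
  shows "cmod z \<le> norm a"
proof (rule ccontr)
  assume "\<not> cmod z \<le> norm a"
  then have z: "norm a < cmod z" "z \<noteq> 0" by auto
  have "norm (inverse z *\<^sub>C a) < 1"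
    using z by (simp add: norm_scaleC norm_inverse inverse_eq_divide norm_divide divide_less_eq)
  then have "invertible_elem ((- z) *\<^sub>C (1 - inverse z *\<^sub>C a))"
    using z by (intro invertible_elem_scaleC invertible_elem_one_minus) auto
  moreover have "(- z) *\<^sub>C (1 - inverse z *\<^sub>C a) = a - z *\<^sub>C 1"
    using z by (simp add: scaleC_diff_right scaleC_scaleC scaleC_minus_left)
  ultimately show False using assms by (simp add: spectrum_iff)
qed

text \<open>A small change of \<open>z\<close> multiplies an invertible \<open>a - z\<close> by a factor close to \<open>1\<close>.\<close>

lemma closed_spectrum: "closed (spectrum (a::'a::cstar_algebra))"
proof -
  have "open (- spectrum a)"
    unfolding open_dist
  proof
    fix z assume "z \<in> - spectrum a"
    then obtain y where y: "y * (a - z *\<^sub>C 1) = 1" "(a - z *\<^sub>C 1) * y = 1"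
      by (auto simp: spectrum_iff invertible_elem_def two_sided_inverse_def)
    define e where "e = 1 / (norm y + 1)"
    have e: "e > 0" by (simp add: e_def add_nonneg_pos)
    have "w \<in> - spectrum a" if "dist w z < e" for w
    proof -
      have "norm ((w - z) *\<^sub>C y) \<le> e * norm y"
        using that by (simp add: norm_scaleC dist_norm mult_right_mono)
      also have "\<dots> < 1"
        using norm_ge_zero[of y] by (simp add: e_def divide_less_eq del: norm_ge_zero)
      finally have "invertible_elem (1 - (w - z) *\<^sub>C y)"
        by (rule invertible_elem_one_minus)
      moreover have "invertible_elem (a - z *\<^sub>C 1)"
        using y by (auto simp: invertible_elem_def two_sided_inverse_def)
      ultimately have "invertible_elem ((a - z *\<^sub>C 1) * (1 - (w - z) *\<^sub>C y))"
        by (rule invertible_elem_mult[rotated])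
      also have "(a - z *\<^sub>C 1) * (1 - (w - z) *\<^sub>C y) = a - z *\<^sub>C 1 - (w - z) *\<^sub>C ((a - z *\<^sub>C 1) * y)"
        by (simp add: right_diff_distrib mult_scaleC_right)
      also have "\<dots> = a - w *\<^sub>C 1"
        using y by (simp add: scaleC_diff_left)
      finally show ?thesis by (simp add: spectrum_iff)
    qed
    with e show "\<exists>e>0. \<forall>w. dist w z < e \<longrightarrow> w \<in> - spectrum a" by blast
  qed
  then show ?thesis by (simp add: closed_def)
qed

lemma compact_spectrum: "compact (spectrum (a::'a::cstar_algebra))"
  using closed_spectrum spectrum_norm_bound
  by (auto simp: compact_eq_bounded_closed bounded_iff)

lemma spectrum_shift: "z \<in> spectrum a \<Longrightarrow> z + w \<in> spectrum ((a::'a::cstar_algebra) + w *\<^sub>C 1)"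
  by (simp add: spectrum_iff scaleC_add_left)

text \<open>If \<open>x + \<i>y\<close> lies in the spectrum of \<open>a\<close>, then \<open>x + \<i>(y + t)\<close> lies in that of \<open>a + \<i>t\<close>, whose
  norm squared is at most \<open>\<parallel>a\<parallel>\<^sup>2 + t\<^sup>2\<close> by the C*-identity; for large \<open>t\<close> this forces \<open>y = 0\<close>.\<close>

lemma spectrum_selfadjoint_real:
  assumes a: "a \<in> selfadjoint" and z: "z \<in> spectrum (a::'a::cstar_algebra)"
  shows "Im z = 0"
proof (rule ccontr)
  assume y: "Im z \<noteq> 0"
  have *: "(Im z)\<^sup>2 + 2 * Im z * t \<le> (norm a)\<^sup>2" for t
  proof -
    define c where "c = a + (\<i> * complex_of_real t) *\<^sub>C 1"
    have st: "star c = a - (\<i> * complex_of_real t) *\<^sub>C 1"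
      using a by (simp add: c_def star_add star_scaleC selfadjoint_def scaleC_minus_left)
    have "star c * c = a * a - ((\<i> * complex_of_real t) * (\<i> * complex_of_real t)) *\<^sub>C 1"
      unfolding st unfolding c_def
      by (simp add: ring_distribs mult_scaleC_left mult_scaleC_right scaleC_scaleC scaleC_diff_right)
    also have "(\<i> * complex_of_real t) * (\<i> * complex_of_real t) = complex_of_real (- (t\<^sup>2))"
      by (simp add: power2_eq_square algebra_simps)
    finally have "star c * c = a * a + (t\<^sup>2) *\<^sub>R 1"
      unfolding scaleC_of_real by simp
    then have "(norm c)\<^sup>2 \<le> norm (a * a) + t\<^sup>2 * norm (1::'a)"
      using cstar_identity[of c] norm_triangle_ineq[of "a * a" "(t\<^sup>2) *\<^sub>R 1"] by simp
    also have "\<dots> \<le> (norm a)\<^sup>2 + t\<^sup>2"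
      using norm_one_le[where 'a='a] a
      by (intro add_mono) (simp_all add: norm_selfadjoint_square mult_left_le)
    finally have 1: "(norm c)\<^sup>2 \<le> (norm a)\<^sup>2 + t\<^sup>2" .
    have "z + \<i> * complex_of_real t \<in> spectrum c"
      unfolding c_def by (rule spectrum_shift[OF z])
    then have "(cmod (z + \<i> * complex_of_real t))\<^sup>2 \<le> (norm c)\<^sup>2"
      by (intro power_mono spectrum_norm_bound) auto
    moreover have "(Im z + t)\<^sup>2 \<le> (cmod (z + \<i> * complex_of_real t))\<^sup>2"
      by (simp add: cmod_power2)
    ultimately show ?thesis using 1 by (simp add: power2_eq_square algebra_simps)
  qed
  \<comment> \<open>The left side of \<open>*\<close> is unbounded in \<open>t\<close>; this
    \<open>t\<close> makes it \<open>(Im z)\<^sup>2 + \<parallel>a\<parallel>\<^sup>2 + 1\<close>.\<close>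
  show False
    using *[of "((norm a)\<^sup>2 + 1) / (2 * Im z)"] y zero_le_power2[of "Im z"]
    by (simp del: zero_le_power2)
qed


section \<open>The norm of a self-adjoint element is at most its spectral radius\<close>

text \<open>An elementary replacement of Gelfand's spectral radius formula. Suppose that \<open>1 - w g\<close> is
  invertible for all \<open>w\<close> in the closed unit disc, with inverse \<open>S w\<close>. Then \<open>S\<close> is bounded
  and Lipschitz, and passing from \<open>g\<close> to \<open>g\<^sup>2\<close> amounts to averaging,
  \<open>(1 - w\<^sup>2 g\<^sup>2)\<^sup>-\<^sup>1 = (S w + S (- w)) / 2\<close>. Hence the bounds survive for \<open>g ^ 2 ^ m\<close>, uniformly in \<open>m\<close>.\<close>

lemma resolvent_bounds:
  assumes inv: "\<And>w. cmod w \<le> 1 \<Longrightarrow> invertible_elem (1 - w *\<^sub>C g)" and g: "norm (g::'a::cstar_algebra) \<le> 1"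
  obtains S B where
    "\<And>w. cmod w \<le> 1 \<Longrightarrow> two_sided_inverse (S w) (1 - w *\<^sub>C g)"
    "\<And>w. cmod w \<le> 1 \<Longrightarrow> norm (S w) \<le> B"
    "\<And>w v. cmod w \<le> 1 \<Longrightarrow> cmod v \<le> 1 \<Longrightarrow> norm (S w - S v) \<le> B\<^sup>2 * cmod (w - v)"
    "0 \<le> B"
proof -
  define S where "S w = (SOME y. two_sided_inverse y (1 - w *\<^sub>C g))" for w
  have S: "two_sided_inverse (S w) (1 - w *\<^sub>C g)" if "cmod w \<le> 1" for w
    using inv[OF that] unfolding invertible_elem_def S_def by (rule someI_ex)
  have diff: "S w - S v = (w - v) *\<^sub>C (S w * g * S v)" if "cmod w \<le> 1" "cmod v \<le> 1" for w v
  proof -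
    have "S w - S v = S w * ((1 - v *\<^sub>C g) * S v) - (S w * (1 - w *\<^sub>C g)) * S v"
      using S[OF that(1)] S[OF that(2)] by (simp add: two_sided_inverse_def)
    also have "\<dots> = S w * ((1 - v *\<^sub>C g) - (1 - w *\<^sub>C g)) * S v"
      by (simp add: right_diff_distrib left_diff_distrib mult.assoc)
    also have "(1 - v *\<^sub>C g) - (1 - w *\<^sub>C g) = (w - v) *\<^sub>C g"
      by (simp add: scaleC_diff_left)
    finally show ?thesis by (simp add: mult_scaleC_left mult_scaleC_right)
  qed
  have ndiff: "norm (S w - S v) \<le> cmod (w - v) * norm (S w) * norm (S v)"
    if "cmod w \<le> 1" "cmod v \<le> 1" for w v
  proof -
    have "norm (S w * g * S v) \<le> norm (S w) * 1 * norm (S v)"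
      by (intro order_trans[OF norm_mult_ineq] mult_mono g) auto
    then have "cmod (w - v) * norm (S w * g * S v) \<le> cmod (w - v) * (norm (S w) * 1 * norm (S v))"
      by (intro mult_left_mono) auto
    then show ?thesis by (simp add: diff[OF that] norm_scaleC mult_ac)
  qed
  \<comment> \<open>The bound on \<open>norm (S w)\<close> comes from compactness of the disc, so continuity
    has to be shown before any uniform estimate: near \<open>v\<close> the resolvent identity first gives
    \<open>norm (S w) \<le> 2 N\<close>, then smallness of \<open>S w - S v\<close>.\<close>
  have "continuous_on (cball 0 1) S"
    unfolding continuous_on_iff
  proof (intro ballI allI impI)
    fix v and e :: real assume v: "v \<in> cball (0::complex) 1" and e: "e > 0"
    define N where "N = norm (S v) + 1"
    have N: "N > 0" "norm (S v) \<le> N" by (auto simp: N_def add_nonneg_pos)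
    define d where "d = min (1 / (2 * N)) (e / (2 * N * N))"
    have d: "d > 0" using N e by (simp add: d_def)
    have "dist (S w) (S v) < e" if w: "w \<in> cball 0 1" "dist w v < d" for w
    proof -
      have a1: "norm (S w - S v) \<le> cmod (w - v) * norm (S w) * norm (S v)"
        using ndiff[of w v] v w by simp
      have a2: "cmod (w - v) * norm (S v) \<le> 1 / (2 * N) * N"
        using w N by (intro mult_mono) (auto simp: d_def dist_norm)
      have "cmod (w - v) * norm (S v) * norm (S w) \<le> 1 / 2 * norm (S w)"
        using a2 N by (intro mult_right_mono) auto
      with a1 have "norm (S w - S v) \<le> norm (S w) / 2" by (simp add: mult_ac)
      then have a3: "norm (S w) \<le> 2 * N"
        using norm_triangle_ineq2[of "S w" "S v"] N by simp
      have "norm (S w - S v) \<le> cmod (w - v) * (2 * N) * N"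
        using a3 N by (intro order_trans[OF a1] mult_mono) auto
      also have "\<dots> < e / (2 * N * N) * (2 * N) * N"
        using w N by (intro mult_strict_right_mono) (auto simp: d_def dist_norm)
      also have "\<dots> = e" using N by simp
      finally show ?thesis by (simp add: dist_norm)
    qed
    with d show "\<exists>d>0. \<forall>w\<in>cball 0 1. dist w v < d \<longrightarrow> dist (S w) (S v) < e" by blast
  qed
  then have "bounded (S ` cball 0 1)"
    by (intro compact_imp_bounded compact_continuous_image compact_cball)
  then obtain B where "\<forall>x\<in>S ` cball 0 1. norm x \<le> B"
    unfolding bounded_iff by blast
  then have B: "norm (S w) \<le> B" if "cmod w \<le> 1" for w
    using that by auto
  have B0: "0 \<le> B" using B[of 0] norm_ge_zero[of "S 0"] by (simp del: norm_ge_zero)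
  have "norm (S w - S v) \<le> B\<^sup>2 * cmod (w - v)" if "cmod w \<le> 1" "cmod v \<le> 1" for w v
  proof -
    have "cmod (w - v) * norm (S w) * norm (S v) \<le> cmod (w - v) * B * B"
      using B B0 that by (intro mult_mono) auto
    then show ?thesis using ndiff[OF that] by (simp add: power2_eq_square mult_ac)
  qed
  then show thesis using that[of S B] S B B0 by blast
qed

text \<open>Induction on \<open>m\<close> by the averaging identity. Every \<open>w\<close> in the disc is a square \<open>z\<^sup>2\<close>, and the factor
  \<open>s ^ 2 ^ m\<close> in front of \<open>w\<close> is the square of the one in front of \<open>z\<close>, so that the two differences are
  averaged as well and the bound \<open>B\<^sup>2 (1 - s)\<close> does not deteriorate.\<close>

lemma resolvent_bounds_power:
  assumes S: "\<And>w. cmod w \<le> 1 \<Longrightarrow> two_sided_inverse (S w) (1 - w *\<^sub>C (g::'a::cstar_algebra))"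
    and B: "\<And>w. cmod w \<le> 1 \<Longrightarrow> norm (S w) \<le> B"
    and L: "\<And>w v. cmod w \<le> 1 \<Longrightarrow> cmod v \<le> 1 \<Longrightarrow> norm (S w - S v) \<le> B\<^sup>2 * cmod (w - v)"
    and s: "0 \<le> s" "s \<le> 1"
  shows "\<exists>T. (\<forall>w. cmod w \<le> 1 \<longrightarrow> two_sided_inverse (T w) (1 - w *\<^sub>C g ^ (2 ^ m)) \<and> norm (T w) \<le> B \<and>
           norm (T (of_real (s ^ (2 ^ m)) * w) - T w) \<le> B\<^sup>2 * (1 - s))"
proof (induction m)
  case 0
  have "norm (S (of_real s * w) - S w) \<le> B\<^sup>2 * (1 - s)" if "cmod w \<le> 1" for w
  proof -
    have 1: "cmod (of_real s * w) \<le> 1"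
      using that s by (simp add: norm_mult mult_le_one)
    have "cmod (of_real s * w - w) = cmod (of_real (s - 1) * w)" by (simp add: algebra_simps)
    also have "\<dots> \<le> 1 - s"
      using that s by (simp only: norm_mult norm_of_real) (simp add: mult_left_le)
    finally have "B\<^sup>2 * cmod (of_real s * w - w) \<le> B\<^sup>2 * (1 - s)" by (intro mult_left_mono) auto
    then show ?thesis using L[OF 1 that] by linarith
  qed
  with S B show ?case by (intro exI[of _ S]) simp
next
  case (Suc m)
  then obtain T where T: "\<And>w. cmod w \<le> 1 \<Longrightarrow> two_sided_inverse (T w) (1 - w *\<^sub>C g ^ (2 ^ m))"
    "\<And>w. cmod w \<le> 1 \<Longrightarrow> norm (T w) \<le> B"
    "\<And>w. cmod w \<le> 1 \<Longrightarrow> norm (T (of_real (s ^ (2 ^ m)) * w) - T w) \<le> B\<^sup>2 * (1 - s)"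
    by blast
  define G where "G = g ^ (2 ^ m)"
  have G2: "g ^ (2 ^ Suc m) = G * G"
    by (simp add: G_def power_add[symmetric] mult_2)
  \<comment> \<open>The average over both square roots of \<open>w\<close>, so that the choice of the root
    does not matter (\<open>U2\<close>).\<close>
  define U where "U w = (1 / 2) *\<^sub>C (T (csqrt w) + T (- csqrt w))" for w
  have avg: "norm ((1 / 2) *\<^sub>C (x + y)) \<le> M" if "norm x \<le> M" "norm y \<le> M" for x y :: 'a and M
    using norm_triangle_ineq[of x y] that by (simp add: norm_scaleC norm_divide)
  have U2: "U (z * z) = (1 / 2) *\<^sub>C (T z + T (- z))" for z
  proof -
    have "csqrt (z * z) = z \<or> csqrt (z * z) = - z"
      by (metis power2_csqrt power2_eq_iff power2_eq_square)
    then show ?thesis by (auto simp: U_def add.commute)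
  qed
  have "two_sided_inverse (U w) (1 - w *\<^sub>C (G * G)) \<and> norm (U w) \<le> B \<and>
      norm (U (of_real (s ^ (2 ^ Suc m)) * w) - U w) \<le> B\<^sup>2 * (1 - s)" if "cmod w \<le> 1" for w
  proof -
    define z where "z = csqrt w"
    have w: "w = z * z" by (simp add: z_def flip: power2_eq_square)
    have z: "cmod z \<le> 1" "cmod (- z) \<le> 1"
      using that abs_square_le_1[of "cmod z"] by (auto simp: w norm_mult power2_eq_square)
    define x where "x = z *\<^sub>C G"
    have xx: "w *\<^sub>C (G * G) = x * x"
      by (simp add: x_def w mult_scaleC_left mult_scaleC_right scaleC_scaleC)
    have T1: "T z * (1 - x) = 1" "(1 - x) * T z = 1" "T (-z) * (1 + x) = 1" "(1 + x) * T (-z) = 1"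
      using T(1)[OF z(1)] T(1)[OF z(2)]
      by (auto simp: two_sided_inverse_def G_def[symmetric] x_def scaleC_minus_left)
    have f1: "1 - x * x = (1 - x) * (1 + x)" "1 - x * x = (1 + x) * (1 - x)"
      by (simp_all add: ring_distribs)
    have l: "T z * (1 - x * x) = 1 + x" "T (-z) * (1 - x * x) = 1 - x"
      by (subst f1(1), simp add: mult.assoc[symmetric] T1) (subst f1(2), simp add: mult.assoc[symmetric] T1)
    have r: "(1 - x * x) * T z = 1 + x" "(1 - x * x) * T (-z) = 1 - x"
      by (subst f1(2), simp add: mult.assoc T1) (subst f1(1), simp add: mult.assoc T1)
    have two: "(1 / 2) *\<^sub>C ((1 + x) + (1 - x)) = 1"
    proof -
      have "(1 + x) + (1 - x) = 1 *\<^sub>C 1 + 1 *\<^sub>C (1::'a)" by simp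
      also have "\<dots> = 2 *\<^sub>C 1" by (simp only: scaleC_add_left[symmetric]) simp
      finally show ?thesis by (simp only: scaleC_scaleC) simp
    qed
    have "two_sided_inverse (U w) (1 - x * x)"
      unfolding two_sided_inverse_def w U2
      by (simp only: mult_scaleC_left mult_scaleC_right distrib_left distrib_right l r two simp_thms)
    moreover have "norm (U w) \<le> B"
      unfolding w U2 using T(2) z by (intro avg) auto
    moreover have "norm (U (of_real (s ^ (2 ^ Suc m)) * w) - U w) \<le> B\<^sup>2 * (1 - s)"
    proof -
      define t where "t = complex_of_real (s ^ (2 ^ m))"
      have t: "complex_of_real (s ^ (2 ^ Suc m)) * w = (t * z) * (t * z)"
        by (simp add: t_def w power_add[symmetric] mult_2 mult_ac)
      have "U (of_real (s ^ (2 ^ Suc m)) * w) - U w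
          = (1 / 2) *\<^sub>C ((T (t * z) - T z) + (T (t * (- z)) - T (- z)))"
        unfolding t unfolding w U2 by (simp add: scaleC_add_right scaleC_diff_right)
      then show ?thesis
        using T(3)[OF z(1)] T(3)[OF z(2)] by (simp only: t_def[symmetric]) (intro avg)
    qed
    ultimately show ?thesis by (simp add: xx)
  qed
  then show ?case unfolding G2 by blast
qed

text \<open>Let \<open>G = g ^ 2 ^ m\<close>, which has norm \<open>1\<close> by the C*-identity. If the claim fails, then for \<open>s\<close> close to
  \<open>1\<close> the inverse of \<open>1 - G\<close> is close to that of \<open>1 - s ^ 2 ^ m G\<close>, uniformly in \<open>m\<close>; the latter tends to
  \<open>1\<close> as \<open>m\<close> grows. So \<open>G = 1 - (1 - G)\<close> would be small.\<close>

lemma norm_le_spectral_radius_normalized: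
  assumes g: "g \<in> selfadjoint" and n: "norm (g::'a::cstar_algebra) = 1"
  shows "\<exists>w. cmod w \<le> 1 \<and> \<not> invertible_elem (1 - w *\<^sub>C g)"
proof (rule ccontr)
  assume "\<not> ?thesis"
  then have "\<And>w. cmod w \<le> 1 \<Longrightarrow> invertible_elem (1 - w *\<^sub>C g)" by blast
  from resolvent_bounds[OF this] n obtain S B where S:
    "\<And>w. cmod w \<le> 1 \<Longrightarrow> two_sided_inverse (S w) (1 - w *\<^sub>C g)"
    "\<And>w. cmod w \<le> 1 \<Longrightarrow> norm (S w) \<le> B"
    "\<And>w v. cmod w \<le> 1 \<Longrightarrow> cmod v \<le> 1 \<Longrightarrow> norm (S w - S v) \<le> B\<^sup>2 * cmod (w - v)"
    "0 \<le> B" by auto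
  \<comment> \<open>Chosen such that the error \<open>B\<^sup>2 (1 - s)\<close> is at most \<open>1 /
    8\<close>. Then \<open>m\<close> is taken so large that \<open>1 - s ^ 2 ^ m G\<close> has its inverse
    within \<open>1 / 8\<close> of \<open>1\<close>; altogether \<open>norm G \<le> 2 * (1 / 8 + 1 / 8) = 1
    / 2\<close>.\<close>
  define s where "s = 1 - 1 / (8 * (B\<^sup>2 + 1))"
  have den: "8 * (B\<^sup>2 + 1) \<ge> 1" "0 < 8 * (B\<^sup>2 + 1)" by (simp_all add: add_nonneg_pos)
  have s: "0 \<le> s" "s < 1" using den by (auto simp: s_def divide_le_eq)
  have "B\<^sup>2 * (1 - s) = B\<^sup>2 / (8 * (B\<^sup>2 + 1))" by (simp add: s_def)
  also have "\<dots> \<le> 1 / 8" using den by (simp add: divide_le_eq)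
  finally have Bs: "B\<^sup>2 * (1 - s) \<le> 1 / 8" .
  have "(\<lambda>m. s ^ m) \<longlonglongrightarrow> 0" using s by (intro LIMSEQ_power_zero) auto
  moreover have "strict_mono (\<lambda>m::nat. 2 ^ m :: nat)" by (simp add: strict_mono_def)
  ultimately have "(\<lambda>m. s ^ (2 ^ m)) \<longlonglongrightarrow> 0"
    using LIMSEQ_subseq_LIMSEQ[of "\<lambda>m. s ^ m" 0 "\<lambda>m. 2 ^ m"] by (simp add: o_def)
  then have "(\<lambda>m. s ^ (2 ^ m) * B) \<longlonglongrightarrow> 0" using tendsto_mult_left_zero by blast
  then have "eventually (\<lambda>m. s ^ (2 ^ m) * B < 1 / 8) sequentially"
    by (rule order_tendstoD) simp
  then obtain m where m: "s ^ (2 ^ m) * B < 1 / 8" by (auto simp: eventually_sequentially)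
  obtain T where T: "\<And>w. cmod w \<le> 1 \<Longrightarrow> two_sided_inverse (T w) (1 - w *\<^sub>C g ^ (2 ^ m))"
    "\<And>w. cmod w \<le> 1 \<Longrightarrow> norm (T w) \<le> B"
    "\<And>w. cmod w \<le> 1 \<Longrightarrow> norm (T (of_real (s ^ (2 ^ m)) * w) - T w) \<le> B\<^sup>2 * (1 - s)"
    using resolvent_bounds_power[OF S(1-3), of s m] s by (auto simp: less_imp_le)
  define G where "G = g ^ (2 ^ m)"
  have G: "norm G = 1" unfolding G_def by (rule norm_selfadjoint_power2_power[OF g n])
  define t where "t = s ^ (2 ^ m)"
  have t: "0 \<le> t" "t \<le> 1" using s by (auto simp: t_def power_le_one)
  have "T t - 1 = t *\<^sub>C (T t * G)"
  proof -
    have "T t * (1 - t *\<^sub>C G) = 1" using T(1)[of t] t by (simp add: two_sided_inverse_def G_def)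
    then show ?thesis by (simp add: right_diff_distrib mult_scaleC_right diff_eq_eq add.commute)
  qed
  moreover have "norm (t *\<^sub>C (T t * G)) \<le> t * (B * 1)"
    using T(2)[of t] t G S(4) unfolding norm_scaleC
    by (intro mult_mono order_trans[OF norm_mult_ineq]) auto
  ultimately have "norm (T t - 1) \<le> t * (B * 1)" by simp
  with m have 1: "norm (T t - 1) \<le> 1 / 8" by (simp add: t_def)
  have 2: "norm (T t - T 1) \<le> 1 / 8"
    using T(3)[of 1] Bs by (simp add: t_def)
  have T1: "T 1 * (1 - G) = 1" "(1 - G) * T 1 = 1"
    using T(1)[of 1] by (auto simp: two_sided_inverse_def G_def)
  have "norm (T 1 - 1) \<le> 1 / 4"
    using norm_triangle_ineq[of "T t - 1" "T 1 - T t"] 1 2 by (simp add: norm_minus_commute)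
  moreover have "T 1 - 1 = T 1 * G" using T1 by (simp add: right_diff_distrib algebra_simps)
  ultimately have 3: "norm (T 1 * G) \<le> 1 / 4" by simp
  have "G = (1 - G) * (T 1 * G)" using T1 by (simp add: mult.assoc[symmetric])
  then have "norm G \<le> norm (1 - G) * norm (T 1 * G)" by (metis norm_mult_ineq)
  also have "\<dots> \<le> (1 + 1) * (1 / 4)"
    using 3 G norm_one_le[where 'a='a] by (intro mult_mono order_trans[OF norm_triangle_ineq4] add_mono) auto
  finally show False using G by simp
qed

text \<open>In the zero algebra all spectra are empty, so that case has to be excluded.\<close>

lemma norm_le_spectral_radius:
  assumes h: "h \<in> selfadjoint" and nt: "(1::'a::cstar_algebra) \<noteq> 0"
  shows "\<exists>z\<in>spectrum (h::'a). norm h \<le> cmod z"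
proof (cases "h = 0")
  case True
  have "\<not> invertible_elem (0::'a)"
    using nt by (auto simp: invertible_elem_def two_sided_inverse_def)
  with True show ?thesis by (intro bexI[of _ 0]) (auto simp: spectrum_iff)
next
  case False
  define g where "g = complex_of_real (inverse (norm h)) *\<^sub>C h"
  have "g \<in> selfadjoint" unfolding g_def by (rule selfadjoint_simps(4)[OF h])
  moreover have "norm g = 1"
    using False unfolding g_def scaleC_of_real by simp
  ultimately obtain w where w: "cmod w \<le> 1" "\<not> invertible_elem (1 - w *\<^sub>C g)"
    using norm_le_spectral_radius_normalized by blast
  define c where "c = w * complex_of_real (inverse (norm h))"
  have wg: "w *\<^sub>C g = c *\<^sub>C h" by (simp add: g_def c_def scaleC_scaleC)
  have c0: "c \<noteq> 0" using w(2) invertible_elem_one unfolding wg by auto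
  have "inverse c \<in> spectrum h"
  proof (rule ccontr)
    assume "inverse c \<notin> spectrum h"
    then have "invertible_elem ((- c) *\<^sub>C (h - inverse c *\<^sub>C 1))"
      using c0 by (intro invertible_elem_scaleC) (auto simp: spectrum_iff)
    also have "(- c) *\<^sub>C (h - inverse c *\<^sub>C 1) = 1 - w *\<^sub>C g"
      using c0 by (simp add: wg scaleC_diff_right scaleC_scaleC scaleC_minus_left)
    finally show False using w by simp
  qed
  moreover have "norm h \<le> cmod (inverse c)"
    using False w c0 by (simp add: c_def norm_mult norm_inverse norm_divide field_simps mult_left_le)
  ultimately show ?thesis by blast
qed

section \<open>The continuous functional calculus of a self-adjoint element\<close>

definition alg_poly :: "complex poly \<Rightarrow> 'a::cstar_algebra \<Rightarrow> 'a" where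
  "alg_poly p a = (\<Sum>i\<le>degree p. coeff p i *\<^sub>C a ^ i)"

lemma alg_poly_altdef:
  assumes "degree p \<le> n"
  shows "alg_poly p (a::'a::cstar_algebra) = (\<Sum>i\<le>n. coeff p i *\<^sub>C a ^ i)"
  unfolding alg_poly_def using assms
  by (intro sum.mono_neutral_left) (auto simp: coeff_eq_0)

lemma alg_poly_0 [simp]: "alg_poly 0 (a::'a::cstar_algebra) = 0"
  by (simp add: alg_poly_def)

lemma alg_poly_pCons: "alg_poly (pCons c p) (a::'a::cstar_algebra) = c *\<^sub>C 1 + a * alg_poly p a"
proof -
  have "alg_poly (pCons c p) a = (\<Sum>i\<le>Suc (degree p). coeff (pCons c p) i *\<^sub>C a ^ i)"
    by (rule alg_poly_altdef) (simp add: degree_pCons_le)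
  also have "\<dots> = c *\<^sub>C 1 + a * alg_poly p a"
    by (subst sum.atMost_Suc_shift) (simp add: alg_poly_def sum_distrib_left mult_scaleC_right)
  finally show ?thesis .
qed

lemma alg_poly_add: "alg_poly (p + q) (a::'a::cstar_algebra) = alg_poly p a + alg_poly q a"
  by (simp add: alg_poly_altdef[of _ "max (degree p) (degree q)"] degree_add_le sum.distrib scaleC_add_left)

lemma alg_poly_smult: "alg_poly (smult c p) (a::'a::cstar_algebra) = c *\<^sub>C alg_poly p a"
  by (simp add: alg_poly_altdef[of _ "degree p"] degree_smult_le scaleC_sum_right scaleC_scaleC)

lemma alg_poly_diff: "alg_poly (p - q) (a::'a::cstar_algebra) = alg_poly p a - alg_poly q a"
  using alg_poly_add[of "p - q" q a] by (simp add: algebra_simps)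

lemma alg_poly_mult: "alg_poly (p * q) (a::'a::cstar_algebra) = alg_poly p a * alg_poly q a"
  by (induction p) (simp_all add: alg_poly_pCons alg_poly_add alg_poly_smult distrib_right
      mult_scaleC_left mult.assoc)

lemma star_alg_poly:
  "a \<in> selfadjoint \<Longrightarrow> star (alg_poly p (a::'a::cstar_algebra)) = alg_poly (map_poly cnj p) a"
proof (induction p)
  case (pCons c p)
  then have "star (alg_poly (pCons c p) a) = cnj c *\<^sub>C 1 + alg_poly (map_poly cnj p) a * a"
    by (simp add: alg_poly_pCons star_add star_scaleC star_mult selfadjoint_def)
  also have "alg_poly (map_poly cnj p) a * a = a * alg_poly (map_poly cnj p) a"
    using alg_poly_mult[of "[:0,1:]" "map_poly cnj p" a] alg_poly_mult[of "map_poly cnj p" "[:0,1:]" a]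
    by (simp add: alg_poly_pCons mult.commute)
  finally show ?case
    by (simp add: alg_poly_pCons map_poly_pCons)
qed simp

text \<open>Split off the linear factors of \<open>p\<close> one by one.\<close>

lemma invertible_alg_poly:
  assumes "p \<noteq> 0" "\<And>z. z \<in> spectrum (a::'a::cstar_algebra) \<Longrightarrow> poly p z \<noteq> 0"
  shows "invertible_elem (alg_poly p a)"
  using assms
proof (induction "degree p" arbitrary: p)
  case 0
  then obtain c where "p = [:c:]" by (metis degree_eq_zeroE)
  with 0 show ?case
    using invertible_elem_scaleC[OF _ invertible_elem_one, of c] by (auto simp: alg_poly_pCons)
next
  case (Suc n)
  have "\<not> constant (poly p)" using Suc(2) by (simp add: constant_degree)
  then obtain z where z: "poly p z = 0" using fundamental_theorem_of_algebra by blast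
  then obtain q where q: "p = [:- z, 1:] * q" by (auto simp: poly_eq_0_iff_dvd elim: dvdE)
  have "q \<noteq> 0" using Suc(3) q by auto
  moreover have "n = degree q"
    using Suc(2) \<open>q \<noteq> 0\<close> unfolding q by (subst (asm) degree_mult_eq) auto
  moreover have "poly q x \<noteq> 0" if "x \<in> spectrum a" for x
    using Suc(4)[OF that] q by auto
  ultimately have "invertible_elem (alg_poly q a)" using Suc(1) by blast
  moreover have "z \<notin> spectrum a" using Suc(4) z by blast
  then have "invertible_elem (alg_poly [:- z, 1:] a)"
    by (simp add: spectrum_iff alg_poly_pCons scaleC_minus_left)
  ultimately show ?case
    unfolding q alg_poly_mult by (rule invertible_elem_mult[rotated])
qed

lemma spectral_mapping_alg_poly:
  assumes "l \<in> spectrum (alg_poly p (a::'a::cstar_algebra))" "spectrum a \<noteq> {}"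
  shows "\<exists>z\<in>spectrum a. poly p z = l"
proof (cases "p = [:l:]")
  case True
  with assms show ?thesis by auto
next
  case False
  show ?thesis
  proof (rule ccontr)
    assume "\<not> ?thesis"
    with False have "invertible_elem (alg_poly (p - [:l:]) a)"
      by (intro invertible_alg_poly) auto
    also have "alg_poly (p - [:l:]) a = alg_poly p a - l *\<^sub>C 1"
      by (simp add: alg_poly_diff alg_poly_pCons)
    finally show False using assms by (simp add: spectrum_iff)
  qed
qed

lemma norm_eq_0_trivial_algebra: "(1::'a::cstar_algebra) = 0 \<Longrightarrow> norm (x::'a) = 0"
  by (metis mult_1_right mult_zero_right norm_zero)

text \<open>The C*-identity reduces the bound to the self-adjoint element \<open>(\<bar>p\<bar> p)(a)\<close>, whose norm is attained
  in its spectrum, and that is the image of the spectrum of \<open>a\<close>.\<close>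

lemma norm_alg_poly_le:
  assumes a: "a \<in> selfadjoint" and M: "\<And>z. z \<in> spectrum (a::'a::cstar_algebra) \<Longrightarrow> cmod (poly p z) \<le> M" "0 \<le> M"
  shows "norm (alg_poly p a) \<le> M"
proof (cases "(1::'a) = 0")
  case True
  then show ?thesis using norm_eq_0_trivial_algebra M by metis
next
  case False
  define h where "h = alg_poly (map_poly cnj p * p) a"
  have h: "h = star (alg_poly p a) * alg_poly p a"
    by (simp add: h_def alg_poly_mult star_alg_poly[OF a])
  have "h \<in> selfadjoint" by (simp add: h selfadjoint_def star_mult star_star)
  then obtain l where l: "l \<in> spectrum h" "norm h \<le> cmod l"
    using norm_le_spectral_radius False by blast
  have "spectrum a \<noteq> {}" using norm_le_spectral_radius[OF a False] by auto
  then obtain z where z: "z \<in> spectrum a" "poly (map_poly cnj p * p) z = l"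
    using spectral_mapping_alg_poly l(1) unfolding h_def by blast
  have "cnj z = z" using spectrum_selfadjoint_real[OF a z(1)] by (simp add: complex_eq_iff)
  then have "cmod l = (cmod (poly p z))\<^sup>2"
    using z(2) by (auto simp: poly_map_poly_cnj norm_mult power2_eq_square)
  also have "\<dots> \<le> M\<^sup>2" using M z by (intro power_mono) auto
  finally have "(norm (alg_poly p a))\<^sup>2 \<le> M\<^sup>2"
    using l(2) cstar_identity[of "alg_poly p a"] by (simp add: h)
  then show ?thesis using M(2) by (rule power2_le_imp_le)
qed

text \<open>The Weierstrass theorem, applied to real and imaginary part.\<close>

lemma polynomial_approximation_on_real_compact:
  assumes S: "compact S" "\<And>z. z \<in> S \<Longrightarrow> Im z = 0" and \<phi>: "continuous_on S \<phi>" and e: "0 < e"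
  shows "\<exists>p. \<forall>z\<in>S. cmod (poly p z - \<phi> z) < e"
proof -
  have S': "compact (Re ` S)" using S by (intro compact_continuous_image continuous_intros)
  have c: "continuous_on (Re ` S) (\<lambda>x. \<phi> (of_real x))"
  proof (rule continuous_on_compose2[OF \<phi>])
    show "complex_of_real ` Re ` S \<subseteq> S"
      using S(2) by (auto simp: complex_eq_iff) (metis S(2) complex_of_real_def complex.collapse)
  qed (intro continuous_intros)
  have approx: "\<exists>q::complex poly. \<forall>x\<in>Re ` S. cmod (poly q (of_real x) - of_real (g x)) < e / 2"
    if g: "continuous_on (Re ` S) g" for g :: "real \<Rightarrow> real"
  proof -
    obtain h where h: "real_polynomial_function h" "\<And>x. x \<in> Re ` S \<Longrightarrow> \<bar>g x - h x\<bar> < e / 2"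
      using Stone_Weierstrass_real_polynomial_function[OF S' g, of "e / 2"] e by auto
    from h(1) obtain b n where b: "h = (\<lambda>x. \<Sum>i\<le>n. b i * x ^ i)"
      by (auto simp: real_polynomial_function_iff_sum)
    define q where "q = (\<Sum>i\<le>n. monom (complex_of_real (b i)) i)"
    have "poly q (of_real x) = complex_of_real (h x)" for x
      by (simp add: q_def b poly_sum poly_monom)
    then have "\<forall>x\<in>Re ` S. cmod (poly q (of_real x) - of_real (g x)) < e / 2"
      using h(2) by (metis norm_minus_commute norm_of_real of_real_diff)
    then show ?thesis by blast
  qed
  have c': "continuous_on (Re ` S) (\<lambda>x. Re (\<phi> (of_real x)))" "continuous_on (Re ` S) (\<lambda>x. Im (\<phi> (of_real x)))"
    by (intro continuous_intros c)+
  obtain q1 where q1: "\<And>x. x \<in> Re ` S \<Longrightarrow> cmod (poly q1 (of_real x) - of_real (Re (\<phi> (of_real x)))) < e / 2"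
    using approx[OF c'(1)] by blast
  obtain q2 where q2: "\<And>x. x \<in> Re ` S \<Longrightarrow> cmod (poly q2 (of_real x) - of_real (Im (\<phi> (of_real x)))) < e / 2"
    using approx[OF c'(2)] by blast
  have "cmod (poly (q1 + smult \<i> q2) z - \<phi> z) < e" if z: "z \<in> S" for z
  proof -
    have zr: "complex_of_real (Re z) = z" using S(2)[OF z] by (simp add: complex_eq_iff)
    have 1: "cmod (poly q1 z - of_real (Re (\<phi> z))) < e / 2" "cmod (poly q2 z - of_real (Im (\<phi> z))) < e / 2"
      using q1[of "Re z"] q2[of "Re z"] z zr by auto
    have "complex_of_real (Re (\<phi> z)) + \<i> * complex_of_real (Im (\<phi> z)) = \<phi> z"
      by (rule complex_eq[symmetric])
    then have eq: "poly (q1 + smult \<i> q2) z - \<phi> z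
        = (poly q1 z - of_real (Re (\<phi> z))) + \<i> * (poly q2 z - of_real (Im (\<phi> z)))"
      by (simp add: algebra_simps)
    show ?thesis
      unfolding eq
      using norm_triangle_ineq[of "poly q1 z - of_real (Re (\<phi> z))" "\<i> * (poly q2 z - of_real (Im (\<phi> z)))"] 1
      by (simp add: norm_mult)
  qed
  then show ?thesis by blast
qed

lemma uniform_polynomial_approximation:
  assumes a: "a \<in> selfadjoint" and \<phi>: "continuous_on (spectrum (a::'a::cstar_algebra)) \<phi>"
  shows "\<exists>q. uniform_limit (spectrum a) (\<lambda>n. poly (q n)) \<phi> sequentially"
proof -
  have "\<exists>p. \<forall>z\<in>spectrum a. cmod (poly p z - \<phi> z) < inverse (real (Suc n))" for n
    by (rule polynomial_approximation_on_real_compact[OF compact_spectrum _ \<phi>])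
       (auto simp: spectrum_selfadjoint_real[OF a])
  then obtain q where q: "\<And>n z. z \<in> spectrum a \<Longrightarrow> cmod (poly (q n) z - \<phi> z) < inverse (real (Suc n))"
    by metis
  have "uniform_limit (spectrum a) (\<lambda>n. poly (q n)) \<phi> sequentially"
    unfolding uniform_limit_sequentially_iff
  proof (intro allI impI)
    fix e :: real assume "e > 0"
    then obtain N where N: "inverse (real (Suc N)) < e" using reals_Archimedean by blast
    have "dist (poly (q n) z) (\<phi> z) < e" if "N \<le> n" "z \<in> spectrum a" for n z
    proof -
      have "dist (poly (q n) z) (\<phi> z) < inverse (real (Suc n))"
        using q[OF that(2), of n] by (simp only: dist_norm)
      also have "\<dots> \<le> inverse (real (Suc N))" using that by (simp add: field_simps)
      finally show ?thesis using N by linarith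
    qed
    then show "\<exists>N. \<forall>n\<ge>N. \<forall>z\<in>spectrum a. dist (poly (q n) z) (\<phi> z) < e" by blast
  qed
  then show ?thesis by blast
qed

text \<open>The functional calculus as a limit over polynomials; it does not depend on the choice of the
  polynomials.\<close>

definition fc :: "'a::cstar_algebra \<Rightarrow> (complex \<Rightarrow> complex) \<Rightarrow> 'a" where
  "fc a \<phi> = lim (\<lambda>n. alg_poly ((SOME q. uniform_limit (spectrum a) (\<lambda>n. poly (q n)) \<phi> sequentially) n) a)"

text \<open>By \<open>norm_alg_poly_le\<close>, polynomials that are uniformly close on the spectrum have close values at \<open>a\<close>.
  So the values along any approximating sequence are Cauchy, and any two such sequences have the same limit.\<close>

lemma tendsto_fc:
  assumes a: "a \<in> selfadjoint" and q: "uniform_limit (spectrum (a::'a::cstar_algebra)) (\<lambda>n. poly (q n)) \<phi> sequentially"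
  shows "(\<lambda>n. alg_poly (q n) a) \<longlonglongrightarrow> fc a \<phi>"
proof -
  have close: "\<exists>N. \<forall>m\<ge>N. \<forall>n\<ge>N. norm (alg_poly (q1 m) a - alg_poly (q2 n) a) < e"
    if q1: "uniform_limit (spectrum a) (\<lambda>n. poly (q1 n)) \<phi> sequentially"
      and q2: "uniform_limit (spectrum a) (\<lambda>n. poly (q2 n)) \<phi> sequentially" and e: "e > 0" for q1 q2 e
  proof -
    have "e / 4 > 0" using e by simp
    then obtain N1 N2 where N: "\<And>n z. n \<ge> N1 \<Longrightarrow> z \<in> spectrum a \<Longrightarrow> cmod (poly (q1 n) z - \<phi> z) < e / 4"
      "\<And>n z. n \<ge> N2 \<Longrightarrow> z \<in> spectrum a \<Longrightarrow> cmod (poly (q2 n) z - \<phi> z) < e / 4"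
      using q1 q2 unfolding uniform_limit_sequentially_iff dist_norm by meson
    have "norm (alg_poly (q1 m - q2 n) a) \<le> e / 2" if "m \<ge> max N1 N2" "n \<ge> max N1 N2" for m n
    proof (rule norm_alg_poly_le[OF a])
      fix z assume "z \<in> spectrum a"
      then show "cmod (poly (q1 m - q2 n) z) \<le> e / 2"
        using N(1)[of m z] N(2)[of n z] that
          norm_triangle_ineq4[of "poly (q1 m) z - \<phi> z" "poly (q2 n) z - \<phi> z"] by simp
    qed (use e in simp)
    then show ?thesis
      using e by (intro exI[of _ "max N1 N2"]) (fastforce simp: alg_poly_diff)
  qed
  define p where "p = (SOME q. uniform_limit (spectrum a) (\<lambda>n. poly (q n)) \<phi> sequentially)"
  have p: "uniform_limit (spectrum a) (\<lambda>n. poly (p n)) \<phi> sequentially"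
    unfolding p_def
    by (rule someI[where P = "\<lambda>q. uniform_limit (spectrum a) (\<lambda>n. poly (q n)) \<phi> sequentially", OF q])
  have "Cauchy (\<lambda>n. alg_poly (p n) a)"
    using close[OF p p] unfolding Cauchy_def dist_norm by blast
  then have lim: "(\<lambda>n. alg_poly (p n) a) \<longlonglongrightarrow> fc a \<phi>"
    unfolding fc_def p_def[symmetric] by (simp add: Cauchy_convergent_iff convergent_LIMSEQ_iff)
  have "(\<lambda>n. alg_poly (q n) a - alg_poly (p n) a) \<longlonglongrightarrow> 0"
  proof (rule LIMSEQ_I)
    fix e :: real assume "e > 0"
    then show "\<exists>N. \<forall>n\<ge>N. norm (alg_poly (q n) a - alg_poly (p n) a - 0) < e"
      using close[OF q p] by fastforce
  qed
  from tendsto_add[OF this lim] show ?thesis by simp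
qed

lemma fc_unique:
  assumes "a \<in> selfadjoint" "uniform_limit (spectrum (a::'a::cstar_algebra)) (\<lambda>n. poly (q n)) \<phi> sequentially"
    "(\<lambda>n. alg_poly (q n) a) \<longlonglongrightarrow> x"
  shows "fc a \<phi> = x"
  using LIMSEQ_unique[OF tendsto_fc[OF assms(1,2)] assms(3)] .

lemma fc_poly:
  assumes "a \<in> selfadjoint" "\<And>z. z \<in> spectrum (a::'a::cstar_algebra) \<Longrightarrow> \<phi> z = poly p z"
  shows "fc a \<phi> = alg_poly p a"
  by (rule fc_unique[OF assms(1), of "\<lambda>_. p"]) (use assms in \<open>auto simp: uniform_limit_sequentially_iff\<close>)

lemma tendsto_star: "(f \<longlongrightarrow> (x::'a::cstar_algebra)) F \<Longrightarrow> ((\<lambda>n. star (f n)) \<longlongrightarrow> star x) F"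
  by (simp add: tendsto_iff dist_norm star_diff[symmetric] norm_star)

lemma tendsto_scaleC: "(f \<longlongrightarrow> (x::'a::cstar_algebra)) F \<Longrightarrow> ((\<lambda>n. c *\<^sub>C f n) \<longlongrightarrow> c *\<^sub>C x) F"
proof -
  assume "(f \<longlongrightarrow> x) F"
  then have "((\<lambda>n. norm (f n - x)) \<longlongrightarrow> 0) F" by (simp add: tendsto_norm_zero_iff LIM_zero)
  then have "((\<lambda>n. cmod c * norm (f n - x)) \<longlongrightarrow> 0) F" by (rule tendsto_mult_right_zero)
  then have "((\<lambda>n. c *\<^sub>C f n - c *\<^sub>C x) \<longlongrightarrow> 0) F"
    by (simp add: norm_scaleC[symmetric] scaleC_diff_right tendsto_norm_zero_iff)
  then show ?thesis by (rule LIM_zero_cancel)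
qed

lemma unital_star_hom_of_fc:
  assumes a: "a \<in> selfadjoint"
  shows "unital_star_hom_of (a::'a::cstar_algebra) (fc a)"
proof -
  let ?X = "spectrum a"
  have ap: "\<exists>q. uniform_limit ?X (\<lambda>n. poly (q n)) \<phi> sequentially" if "\<phi> \<in> cfun ?X" for \<phi>
    using uniform_polynomial_approximation[OF a] that by (simp add: cfun_def)
  have cong: "uniform_limit ?X (\<lambda>n. poly (q n)) (restrict \<phi> ?X) sequentially"
    if "uniform_limit ?X (\<lambda>n z. poly (q n) z) \<phi> sequentially" for q \<phi>
    using that by (subst uniform_limit_cong'[where g = "\<lambda>n. poly (q n)" and i = \<phi>]) auto
  have bd: "bounded (\<phi> ` ?X)" if "\<phi> \<in> cfun ?X" for \<phi>
    using that by (intro compact_imp_bounded compact_continuous_image compact_spectrum) (auto simp: cfun_def)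
  have alg: "fc a (\<lambda>z\<in>?X. \<phi> z + \<psi> z) = fc a \<phi> + fc a \<psi> \<and> fc a (\<lambda>z\<in>?X. \<phi> z * \<psi> z) = fc a \<phi> * fc a \<psi>"
    if \<phi>: "\<phi> \<in> cfun ?X" and \<psi>: "\<psi> \<in> cfun ?X" for \<phi> \<psi>
  proof -
    obtain q1 where q1: "uniform_limit ?X (\<lambda>n. poly (q1 n)) \<phi> sequentially" using ap[OF \<phi>] by blast
    obtain q2 where q2: "uniform_limit ?X (\<lambda>n. poly (q2 n)) \<psi> sequentially" using ap[OF \<psi>] by blast
    have "uniform_limit ?X (\<lambda>n. poly (q1 n + q2 n)) (\<lambda>z\<in>?X. \<phi> z + \<psi> z) sequentially"
      by (rule cong) (use uniform_limit_add[OF q1 q2] in simp)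
    then have 1: "fc a (\<lambda>z\<in>?X. \<phi> z + \<psi> z) = fc a \<phi> + fc a \<psi>"
      by (rule fc_unique[OF a])
         (simp add: alg_poly_add tendsto_add tendsto_fc[OF a q1] tendsto_fc[OF a q2])
    have "uniform_limit ?X (\<lambda>n. poly (q1 n * q2 n)) (\<lambda>z\<in>?X. \<phi> z * \<psi> z) sequentially"
      by (rule cong) (use uniform_lim_mult[OF q1 q2 bd[OF \<phi>] bd[OF \<psi>]] in simp)
    then have 2: "fc a (\<lambda>z\<in>?X. \<phi> z * \<psi> z) = fc a \<phi> * fc a \<psi>"
      by (rule fc_unique[OF a])
         (simp add: alg_poly_mult tendsto_mult tendsto_fc[OF a q1] tendsto_fc[OF a q2])
    from 1 2 show ?thesis by blast
  qed
  have sc: "(\<forall>c. fc a (\<lambda>z\<in>?X. c * \<phi> z) = c *\<^sub>C fc a \<phi>) \<and> fc a (\<lambda>z\<in>?X. cnj (\<phi> z)) = star (fc a \<phi>)"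
    if \<phi>: "\<phi> \<in> cfun ?X" for \<phi>
  proof -
    obtain q where q: "uniform_limit ?X (\<lambda>n. poly (q n)) \<phi> sequentially" using ap[OF \<phi>] by blast
    have 1: "fc a (\<lambda>z\<in>?X. c * \<phi> z) = c *\<^sub>C fc a \<phi>" for c
    proof -
      have "uniform_limit ?X (\<lambda>n. poly (smult c (q n))) (\<lambda>z\<in>?X. c * \<phi> z) sequentially"
        by (rule cong)
           (use bounded_linear.uniform_limit[OF bounded_linear_mult_right q, of c] in simp)
      then show ?thesis
        by (rule fc_unique[OF a]) (simp add: alg_poly_smult tendsto_scaleC tendsto_fc[OF a q])
    qed
    have "uniform_limit ?X (\<lambda>n. poly (map_poly cnj (q n))) (\<lambda>z\<in>?X. cnj (\<phi> z)) sequentially"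
    proof (rule cong)
      have "cnj z = z" if "z \<in> ?X" for z
        using spectrum_selfadjoint_real[OF a that] by (simp add: complex_eq_iff)
      then show "uniform_limit ?X (\<lambda>n. poly (map_poly cnj (q n))) (\<lambda>z. cnj (\<phi> z)) sequentially"
        using q by (simp add: uniform_limit_sequentially_iff poly_map_poly_cnj dist_norm
            complex_cnj_diff[symmetric] del: complex_cnj_diff)
    qed
    then have 2: "fc a (\<lambda>z\<in>?X. cnj (\<phi> z)) = star (fc a \<phi>)"
      by (rule fc_unique[OF a]) (simp add: star_alg_poly[OF a, symmetric] tendsto_star tendsto_fc[OF a q])
    from 1 2 show ?thesis by blast
  qed
  have one: "fc a (\<lambda>z\<in>?X. 1) = 1"
    by (subst fc_poly[OF a, of _ "[:1:]"]) (auto simp: alg_poly_pCons)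
  have id: "fc a (\<lambda>z\<in>?X. z) = a"
    by (subst fc_poly[OF a, of _ "[:0,1:]"]) (auto simp: alg_poly_pCons)
  show ?thesis
    unfolding unital_star_hom_of_def Let_def using alg sc one id by blast
qed

text \<open>Every unital *-homomorphism is contractive: for \<open>h = \<Phi>(|\<phi>|\<^sup>2)\<close>, the spectrum of \<open>h\<close> lies in the
  range of \<open>|\<phi>|\<^sup>2\<close>, because \<open>|\<phi>|\<^sup>2 - l\<close> has a continuous reciprocal for any other \<open>l\<close>.\<close>

lemma unital_star_hom_of_contractive:
  assumes \<Phi>: "unital_star_hom_of (a::'a::cstar_algebra) \<Phi>" and \<phi>: "\<phi> \<in> cfun (spectrum a)"
    and M: "\<And>z. z \<in> spectrum a \<Longrightarrow> cmod (\<phi> z) \<le> M" "0 \<le> M"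
  shows "norm (\<Phi> \<phi>) \<le> M"
proof (cases "(1::'a) = 0")
  case True
  then show ?thesis using norm_eq_0_trivial_algebra M by metis
next
  case False
  let ?X = "spectrum a"
  have add: "\<Phi> (\<lambda>z\<in>?X. u z + v z) = \<Phi> u + \<Phi> v" "\<Phi> (\<lambda>z\<in>?X. u z * v z) = \<Phi> u * \<Phi> v"
    if "u \<in> cfun ?X" "v \<in> cfun ?X" for u v
    using \<Phi> that unfolding unital_star_hom_of_def Let_def by blast+
  have sc: "\<Phi> (\<lambda>z\<in>?X. c * u z) = c *\<^sub>C \<Phi> u" "\<Phi> (\<lambda>z\<in>?X. cnj (u z)) = star (\<Phi> u)"
    if "u \<in> cfun ?X" for u c
    using \<Phi> that unfolding unital_star_hom_of_def Let_def by blast+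
  have one: "\<Phi> (\<lambda>z\<in>?X. 1) = 1" using \<Phi> unfolding unital_star_hom_of_def Let_def by blast
  have cf: "(\<lambda>z\<in>?X. u z) \<in> cfun ?X" if "continuous_on ?X u" for u
    using that by (simp add: cfun_def)
  have \<phi>c: "continuous_on ?X \<phi>" using \<phi> by (simp add: cfun_def)
  define \<psi> where "\<psi> = (\<lambda>z\<in>?X. cnj (\<phi> z) * \<phi> z)"
  have \<psi>c: "continuous_on ?X (\<lambda>z. cnj (\<phi> z) * \<phi> z)" using \<phi>c by (intro continuous_intros)
  then have \<psi>: "\<psi> \<in> cfun ?X" unfolding \<psi>_def by (rule cf)
  define h where "h = \<Phi> \<psi>"
  have h: "h = star (\<Phi> \<phi>) * \<Phi> \<phi>"
  proof -
    have "\<psi> = (\<lambda>z\<in>?X. (\<lambda>z\<in>?X. cnj (\<phi> z)) z * \<phi> z)" by (auto simp: \<psi>_def)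
    then show ?thesis
      unfolding h_def using add(2)[OF cf[of "\<lambda>z. cnj (\<phi> z)"] \<phi>] sc(2)[OF \<phi>] \<phi>c
      by (simp add: continuous_intros)
  qed
  have "h \<in> selfadjoint" by (simp add: h selfadjoint_def star_mult star_star)
  then obtain l where l: "l \<in> spectrum h" "norm h \<le> cmod l"
    using norm_le_spectral_radius False by blast
  have "\<exists>z\<in>?X. \<psi> z = l"
  proof (rule ccontr)
    assume no: "\<not> ?thesis"
    define u where "u = (\<lambda>z\<in>?X. \<psi> z - l)"
    define v where "v = (\<lambda>z\<in>?X. 1 / (\<psi> z - l))"
    have uc: "continuous_on ?X (\<lambda>z. \<psi> z - l)" using \<psi> by (auto simp: cfun_def intro!: continuous_intros)
    have u: "u \<in> cfun ?X" unfolding u_def by (rule cf[OF uc])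
    have v: "v \<in> cfun ?X" unfolding v_def using no by (intro cf continuous_on_divide uc) auto
    have uv: "(\<lambda>z\<in>?X. u z * v z) = (\<lambda>z\<in>?X. 1)" "(\<lambda>z\<in>?X. v z * u z) = (\<lambda>z\<in>?X. 1)"
      using no by (auto simp: u_def v_def fun_eq_iff)
    have "\<Phi> u * \<Phi> v = 1" "\<Phi> v * \<Phi> u = 1"
      using add(2)[OF u v] add(2)[OF v u] one by (simp_all add: uv)
    moreover have "\<Phi> u = h - l *\<^sub>C 1"
    proof -
      have 1: "(\<lambda>z\<in>?X. 1) \<in> cfun ?X" by (rule cf) (intro continuous_intros)
      have 2: "(\<lambda>z\<in>?X. (- l) * (\<lambda>z\<in>?X. 1) z) \<in> cfun ?X"
        by (rule cf) (simp cong: continuous_on_cong)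
      have "u = (\<lambda>z\<in>?X. \<psi> z + (\<lambda>z\<in>?X. (- l) * (\<lambda>z\<in>?X. 1) z) z)" by (auto simp: u_def)
      then have "\<Phi> u = \<Phi> \<psi> + (- l) *\<^sub>C 1"
        using add(1)[OF \<psi> 2] sc(1)[OF 1, of "- l"] one by simp
      then show ?thesis by (simp add: h_def scaleC_minus_left)
    qed
    ultimately have "invertible_elem (h - l *\<^sub>C 1)"
      by (auto simp: invertible_elem_def two_sided_inverse_def)
    with l(1) show False by (simp add: spectrum_iff)
  qed
  then obtain z where z: "z \<in> ?X" "\<psi> z = l" by blast
  have "cmod l = (cmod (\<phi> z))\<^sup>2"
    using z by (auto simp: \<psi>_def norm_mult power2_eq_square)
  also have "\<dots> \<le> M\<^sup>2" using M z by (intro power_mono) auto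
  finally have "(norm (\<Phi> \<phi>))\<^sup>2 \<le> M\<^sup>2"
    using l(2) cstar_identity[of "\<Phi> \<phi>"] by (simp add: h)
  then show ?thesis using M(2) by (rule power2_le_imp_le)
qed

lemma unital_star_hom_of_poly:
  assumes \<Phi>: "unital_star_hom_of (a::'a::cstar_algebra) \<Phi>"
  shows "\<Phi> (\<lambda>z\<in>spectrum a. poly p z) = alg_poly p a"
proof -
  let ?X = "spectrum a"
  have add: "\<Phi> (\<lambda>z\<in>?X. u z + v z) = \<Phi> u + \<Phi> v" "\<Phi> (\<lambda>z\<in>?X. u z * v z) = \<Phi> u * \<Phi> v"
    if "u \<in> cfun ?X" "v \<in> cfun ?X" for u v
    using \<Phi> that unfolding unital_star_hom_of_def Let_def by blast+
  have sc: "\<Phi> (\<lambda>z\<in>?X. c * u z) = c *\<^sub>C \<Phi> u" if "u \<in> cfun ?X" for u c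
    using \<Phi> that unfolding unital_star_hom_of_def Let_def by blast+
  have one: "\<Phi> (\<lambda>z\<in>?X. 1) = 1" "\<Phi> (\<lambda>z\<in>?X. z) = a"
    using \<Phi> unfolding unital_star_hom_of_def Let_def by blast+
  have cf: "(\<lambda>z\<in>?X. u z) \<in> cfun ?X" if "continuous_on ?X u" for u
    using that by (simp add: cfun_def)
  have c1: "(\<lambda>z\<in>?X. 1) \<in> cfun ?X" "(\<lambda>z\<in>?X. z) \<in> cfun ?X"
    by (rule cf, intro continuous_intros)+
  have const: "\<Phi> (\<lambda>z\<in>?X. c) = c *\<^sub>C 1" for c
  proof -
    have "(\<lambda>z\<in>?X. c) = (\<lambda>z\<in>?X. c * (\<lambda>z\<in>?X. 1) z)" by auto
    then show ?thesis using sc[OF c1(1), of c] one by simp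
  qed
  show ?thesis
  proof (induction p)
    case 0
    then show ?case using const[of 0] by (simp add: restrict_def)
  next
    case (pCons c p)
    have p: "(\<lambda>z\<in>?X. poly p z) \<in> cfun ?X" by (intro cf continuous_intros)
    have zp: "(\<lambda>z\<in>?X. (\<lambda>z\<in>?X. z) z * (\<lambda>z\<in>?X. poly p z) z) \<in> cfun ?X"
      by (intro cf) (auto intro!: continuous_intros cong: continuous_on_cong)
    have cc: "(\<lambda>z\<in>?X. c) \<in> cfun ?X" by (intro cf continuous_intros)
    have e: "(\<lambda>z\<in>?X. poly (pCons c p) z)
      = (\<lambda>z\<in>?X. (\<lambda>z\<in>?X. c) z + (\<lambda>z\<in>?X. (\<lambda>z\<in>?X. z) z * (\<lambda>z\<in>?X. poly p z) z) z)" by auto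
    show ?case
      unfolding e add(1)[OF cc zp] add(2)[OF c1(2) p] const pCons.IH one by (simp add: alg_poly_pCons)
  qed
qed

text \<open>A contractive homomorphism is determined by its values at polynomials, which are forced.\<close>

lemma unital_star_hom_of_eq_fc:
  assumes a: "a \<in> selfadjoint" and \<Phi>: "unital_star_hom_of (a::'a::cstar_algebra) \<Phi>"
    and \<phi>: "continuous_on (spectrum a) \<phi>"
  shows "\<Phi> (restrict \<phi> (spectrum a)) = fc a \<phi>"
proof -
  let ?X = "spectrum a"
  obtain q where q: "uniform_limit ?X (\<lambda>n. poly (q n)) \<phi> sequentially"
    using uniform_polynomial_approximation[OF a \<phi>] by blast
  have sub: "\<Phi> (\<lambda>z\<in>?X. u z - v z) = \<Phi> (\<lambda>z\<in>?X. u z) - \<Phi> (\<lambda>z\<in>?X. v z)"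
    if "continuous_on ?X u" "continuous_on ?X v" for u v
  proof -
    have 1: "(\<lambda>z\<in>?X. u z) \<in> cfun ?X" "(\<lambda>z\<in>?X. v z) \<in> cfun ?X" using that by (simp_all add: cfun_def)
    have 2: "(\<lambda>z\<in>?X. u z - v z) \<in> cfun ?X" using that by (simp add: cfun_def continuous_on_diff)
    have "\<Phi> (\<lambda>z\<in>?X. (\<lambda>z\<in>?X. u z - v z) z + (\<lambda>z\<in>?X. v z) z)
      = \<Phi> (\<lambda>z\<in>?X. u z - v z) + \<Phi> (\<lambda>z\<in>?X. v z)"
      using \<Phi> 1 2 unfolding unital_star_hom_of_def Let_def by blast
    moreover have "(\<lambda>z\<in>?X. (\<lambda>z\<in>?X. u z - v z) z + (\<lambda>z\<in>?X. v z) z) = (\<lambda>z\<in>?X. u z)" by auto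
    ultimately show ?thesis by simp
  qed
  have "(\<lambda>n. alg_poly (q n) a) \<longlonglongrightarrow> \<Phi> (restrict \<phi> ?X)"
  proof (rule LIMSEQ_I)
    fix e :: real assume "e > 0"
    then have "e / 2 > 0" by simp
    then obtain N where N: "\<And>n z. n \<ge> N \<Longrightarrow> z \<in> ?X \<Longrightarrow> cmod (poly (q n) z - \<phi> z) < e / 2"
      using q unfolding uniform_limit_sequentially_iff dist_norm by meson
    have "norm (alg_poly (q n) a - \<Phi> (restrict \<phi> ?X)) < e" if "n \<ge> N" for n
    proof -
      have c: "continuous_on ?X (poly (q n))" by (intro continuous_intros)
      have "alg_poly (q n) a - \<Phi> (restrict \<phi> ?X) = \<Phi> (\<lambda>z\<in>?X. poly (q n) z - \<phi> z)"
        using sub[OF c \<phi>] unital_star_hom_of_poly[OF \<Phi>, of "q n"] by simp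
      also have "norm \<dots> \<le> e / 2"
        using N[OF that] \<open>e > 0\<close> c \<phi>
        by (intro unital_star_hom_of_contractive[OF \<Phi>])
           (auto simp: cfun_def less_imp_le intro!: continuous_on_diff)
      finally show ?thesis using \<open>e > 0\<close> by simp
    qed
    then show "\<exists>N. \<forall>n\<ge>N. norm (alg_poly (q n) a - \<Phi> (restrict \<phi> ?X)) < e" by blast
  qed
  then show ?thesis using fc_unique[OF a q] by simp
qed

lemma cfc_eq_fc:
  assumes a: "a \<in> selfadjoint" and f: "continuous_on UNIV f"
  shows "cfc f (a::'a::cstar_algebra) = fc a (\<lambda>z. f (Re z))"
proof -
  have c: "continuous_on (spectrum a) (\<lambda>z. f (Re z))"
    by (intro continuous_on_compose2[OF f] continuous_intros) auto
  show ?thesis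
    unfolding cfc_def
    using unital_star_hom_of_eq_fc[OF a _ c] unital_star_hom_of_fc[OF a]
    by (intro the_equality) metis+
qed

text \<open>This estimate is all that is needed about \<^const>\<open>cfc\<close> in the sequel: approximation of \<open>f\<close> on \<open>[-r, r]\<close> by
  polynomials gives approximation of \<open>f(a)\<close>.\<close>

lemma norm_cfc_minus_poly_le:
  assumes a: "a \<in> selfadjoint" "norm (a::'a::cstar_algebra) \<le> r" and f: "continuous_on UNIV f"
    and M: "\<And>x. x \<in> {-r..r} \<Longrightarrow> cmod (f x - poly p (complex_of_real x)) \<le> M"
  shows "norm (cfc f a - alg_poly p a) \<le> M"
proof -
  let ?X = "spectrum a"
  have "0 \<le> r" using a(2) norm_ge_zero order_trans by blast
  then have M0: "0 \<le> M" using M[of 0] norm_ge_zero[of "f 0 - poly p 0"] by (simp del: norm_ge_zero)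
  have c: "continuous_on ?X (\<lambda>z. f (Re z))"
    by (intro continuous_on_compose2[OF f] continuous_intros) auto
  obtain q where q: "uniform_limit ?X (\<lambda>n. poly (q n)) (\<lambda>z. f (Re z)) sequentially"
    using uniform_polynomial_approximation[OF a(1) c] by blast
  have "(\<lambda>n. alg_poly (q n) a - alg_poly p a) \<longlonglongrightarrow> cfc f a - alg_poly p a"
    unfolding cfc_eq_fc[OF a(1) f] by (intro tendsto_diff tendsto_fc[OF a(1) q] tendsto_const)
  then have lim: "(\<lambda>n. norm (alg_poly (q n) a - alg_poly p a)) \<longlonglongrightarrow> norm (cfc f a - alg_poly p a)"
    by (rule tendsto_norm)
  have "norm (cfc f a - alg_poly p a) \<le> M + e" if e: "e > 0" for e
  proof (rule LIMSEQ_le_const2[OF lim])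
    obtain N where N: "\<And>n z. n \<ge> N \<Longrightarrow> z \<in> ?X \<Longrightarrow> cmod (poly (q n) z - f (Re z)) < e"
      using q e unfolding uniform_limit_sequentially_iff dist_norm by meson
    have "norm (alg_poly (q n - p) a) \<le> M + e" if n: "n \<ge> N" for n
    proof (rule norm_alg_poly_le[OF a(1)])
      fix z assume z: "z \<in> ?X"
      have zr: "complex_of_real (Re z) = z"
        using spectrum_selfadjoint_real[OF a(1) z] by (simp add: complex_eq_iff)
      have "\<bar>Re z\<bar> \<le> r"
        using spectrum_norm_bound[OF z] abs_Re_le_cmod[of z] a(2) by linarith
      then have "Re z \<in> {-r..r}" by (auto simp: abs_le_iff)
      then have "cmod (f (Re z) - poly p z) \<le> M" using M[of "Re z"] zr by simp
      then show "cmod (poly (q n - p) z) \<le> M + e"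
        using N[OF n z] norm_triangle_ineq[of "poly (q n) z - f (Re z)" "f (Re z) - poly p z"] by simp
    qed (use M0 e in simp)
    then show "\<exists>N. \<forall>n\<ge>N. norm (alg_poly (q n) a - alg_poly p a) \<le> M + e"
      by (auto simp: alg_poly_diff)
  qed
  then show ?thesis by (rule field_le_epsilon)
qed

section \<open>Divided differences\<close>

lemma divdiff_distinct_cong:
  assumes "\<And>j. j \<le> i \<Longrightarrow> s j = t j" "\<And>j. j \<le> i \<Longrightarrow> f (s j) = g (s j)"
  shows "divdiff_distinct f i s = divdiff_distinct g i t"
  using assms
proof (induction i arbitrary: s t)
  case (Suc i)
  have "divdiff_distinct f i s = divdiff_distinct g i t"
    using Suc.prems by (intro Suc.IH) auto
  moreover have "divdiff_distinct f i (s(i := s (Suc i))) = divdiff_distinct g i (t(i := t (Suc i)))"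
    using Suc.prems by (intro Suc.IH) auto
  ultimately show ?case using Suc.prems(1)[of i] Suc.prems(1)[of "Suc i"] by simp
qed auto

lemma divdiff_distinct_diff_divide:
  "divdiff_distinct (\<lambda>x. (f x - g x) / c) i s = (divdiff_distinct f i s - divdiff_distinct g i s) / c"
  by (induction i arbitrary: s) (simp_all add: diff_divide_distrib mult.commute)

lemma has_integral_divdiff_distinct:
  assumes "\<And>j. j \<le> i \<Longrightarrow> ((\<lambda>t. h t (s j)) has_integral F (s j)) A"
  shows "((\<lambda>t. divdiff_distinct (h t) i s) has_integral divdiff_distinct F i s) A"
  using assms
proof (induction i arbitrary: s)
  case (Suc i)
  have "((\<lambda>t. divdiff_distinct (h t) i s) has_integral divdiff_distinct F i s) A"
    using Suc.prems by (intro Suc.IH) auto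
  moreover have "((\<lambda>t. divdiff_distinct (h t) i (s(i := s (Suc i)))) has_integral
      divdiff_distinct F i (s(i := s (Suc i)))) A"
    using Suc.prems by (intro Suc.IH) auto
  ultimately show ?case
    by (simp only: divdiff_distinct.simps has_integral_divide has_integral_diff)
qed auto

lemma divdiff_distinct_affine:
  assumes "t \<noteq> 0"
  shows "divdiff_distinct (\<lambda>x. f (y + t * (x - y))) i s =
    complex_of_real (t ^ i) * divdiff_distinct f i (\<lambda>l. y + t * (s l - y))"
proof (induction i arbitrary: s)
  case (Suc i)
  let ?S = "\<lambda>l. y + t * (s l - y)"
  have upd: "(\<lambda>l. y + t * ((s(i := s (Suc i))) l - y)) = ?S(i := ?S (Suc i))" by auto
  have dif: "complex_of_real (?S i - ?S (Suc i)) = complex_of_real t * complex_of_real (s i - s (Suc i))"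
    by (simp add: algebra_simps)
  have field: "(T * A - T * B) / X = (u * T) * ((A - B) / (u * X))" if "u \<noteq> 0" for T A B X u :: complex
    using that by (cases "X = 0") (simp_all add: field_simps)
  show ?case
    unfolding divdiff_distinct.simps Suc upd dif power_Suc of_real_mult[of t "t ^ i"]
    by (rule field) (use assms in simp)
qed simp

lemma inj_on_replace_last:
  assumes "inj_on s {..Suc i}"
  shows "inj_on (s(i := s (Suc i))) {..i}"
proof (rule inj_on_fun_updI)
  show "inj_on s {..i}" using assms by (rule inj_on_subset) auto
  show "s (Suc i) \<notin> s ` {..i}"
  proof
    assume "s (Suc i) \<in> s ` {..i}"
    then obtain x where "x \<le> i" "s (Suc i) = s x" by auto
    then show False using inj_on_eq_iff[OF assms, of "Suc i" x] by simp
  qed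
qed

text \<open>The defining recursion varies the last but one node. Removing the last node \<open>y\<close> once and for all instead
  gives a divided difference of the quotient \<open>(f x - f y) / (x - y)\<close>. By induction both divided differences in the
  recursion are of this form, and their quotient is that of the quotient function.\<close>

lemma divdiff_distinct_reduce:
  assumes "inj_on s {..Suc i}"
  shows "divdiff_distinct f (Suc i) s =
    divdiff_distinct (\<lambda>x. (f x - f (s (Suc i))) / complex_of_real (x - s (Suc i))) i s"
  using assms
proof (induction i arbitrary: f s)
  case (Suc i)
  let ?q = "\<lambda>u x. (f x - f u) / complex_of_real (x - u)"
  define u y where "u = s (Suc i)" and "y = s (Suc (Suc i))"
  have neq: "s j \<noteq> u" "s j \<noteq> y" "u \<noteq> y" if "j \<le> i" for j
    using that inj_on_eq_iff[OF Suc.prems] by (simp_all add: u_def y_def)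
  have inj1: "inj_on s {..Suc i}" using Suc.prems by (rule inj_on_subset) auto
  have inj2: "inj_on (s(Suc i := y)) {..Suc i}"
    unfolding y_def by (rule inj_on_replace_last[OF Suc.prems])
  have "divdiff_distinct f (Suc i) s = divdiff_distinct (?q u) i s"
    using Suc.IH[OF inj1, of f] by (simp only: u_def)
  moreover have "divdiff_distinct f (Suc i) (s(Suc i := y)) = divdiff_distinct (?q y) i s"
    unfolding Suc.IH[OF inj2, of f] by (intro divdiff_distinct_cong) auto
  ultimately have "divdiff_distinct f (Suc (Suc i)) s
      = (divdiff_distinct (?q u) i s - divdiff_distinct (?q y) i s) / complex_of_real (u - y)"
    unfolding divdiff_distinct.simps(2)[of f "Suc i"] u_def y_def by simp
  also have "\<dots> = divdiff_distinct (\<lambda>x. (?q u x - ?q y x) / complex_of_real (u - y)) i s"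
    by (simp only: divdiff_distinct_diff_divide)
  also have "\<dots> = divdiff_distinct (\<lambda>x. (?q y x - ?q y u) / complex_of_real (x - u)) i s"
  proof (rule divdiff_distinct_cong)
    fix j assume "j \<le> i"
    have field: "((a - b) / (X - U) - (a - c) / (X - Y)) / (U - Y)
        = ((a - c) / (X - Y) - (b - c) / (U - Y)) / (X - U)"
      if "X \<noteq> U" "X \<noteq> Y" "U \<noteq> Y" for a b c X Y U :: complex
      using that by (simp add: divide_simps) (simp add: algebra_simps)
    show "(?q u (s j) - ?q y (s j)) / complex_of_real (u - y)
        = (?q y (s j) - ?q y u) / complex_of_real (s j - u)"
      unfolding of_real_diff by (rule field) (use neq[OF \<open>j \<le> i\<close>] in auto)
  qed simp
  also have "\<dots> = divdiff_distinct (?q y) (Suc i) s"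
    using Suc.IH[OF inj1, of "?q y"] by (simp only: u_def)
  finally show ?case by (simp only: y_def)
qed simp

text \<open>The Hermite--Genocchi formula as an iterated integral: \<open>g j\<close> stands for the \<open>j\<close>-th derivative of
  \<open>g 0\<close>. It exhibits the divided difference as a function that is continuous on the whole space.\<close>

primrec hermite_genocchi :: "nat \<Rightarrow> (nat \<Rightarrow> real \<Rightarrow> complex) \<Rightarrow> (nat \<Rightarrow> real) \<Rightarrow> complex" where
  "hermite_genocchi 0 g s = g 0 (s 0)"
| "hermite_genocchi (Suc i) g s = integral {0..1} (\<lambda>t. complex_of_real (t ^ i) *
     hermite_genocchi i (\<lambda>j. g (Suc j)) (\<lambda>l. s (Suc i) + t * (s l - s (Suc i))))"

lemma continuous_on_hermite_genocchi:
  assumes "\<And>j. j \<le> i \<Longrightarrow> continuous_on UNIV (g j)"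
  shows "continuous_on UNIV (hermite_genocchi i g)"
  using assms
proof (induction i arbitrary: g)
  case 0
  have "continuous_on UNIV (\<lambda>s::nat \<Rightarrow> real. g 0 (s 0))"
    by (rule continuous_on_compose2[OF 0[of 0] continuous_on_product_coordinates]) auto
  then show ?case by (simp cong: continuous_on_cong)
next
  case (Suc i)
  have IH: "continuous_on UNIV (hermite_genocchi i (\<lambda>j. g (Suc j)))"
    using Suc.prems by (intro Suc.IH) auto
  have co: "continuous_on X (\<lambda>p. fst p l)" for l and X :: "((nat \<Rightarrow> real) \<times> real) set"
    by (rule continuous_on_compose2[OF continuous_on_product_coordinates]) (auto intro: continuous_intros)
  have "continuous_on (UNIV \<times> cbox 0 1) (\<lambda>(s, t). complex_of_real (t ^ i) *
     hermite_genocchi i (\<lambda>j. g (Suc j)) (\<lambda>l. s (Suc i) + t * (s l - s (Suc i))))"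
    unfolding split_beta
    by (intro continuous_intros continuous_on_compose2[OF IH] continuous_on_coordinatewise_then_product co) auto
  then have "continuous_on UNIV (\<lambda>s. integral (cbox 0 1) (\<lambda>t. complex_of_real (t ^ i) *
     hermite_genocchi i (\<lambda>j. g (Suc j)) (\<lambda>l. s (Suc i) + t * (s l - s (Suc i)))))"
    by (rule integral_continuous_on_param)
  then show ?case by (simp cong: continuous_on_cong)
qed

text \<open>The quotient in \<open>divdiff_distinct_reduce\<close> is the integral of \<open>f'(y + t (x - y))\<close> over \<open>t \<in> [0, 1]\<close>.
  Divided differences are finite linear combinations of function values, so they commute with the integral, and the
  affine substitution contributes the factor \<open>t ^ i\<close>.\<close>

lemma divdiff_distinct_eq_hermite_genocchi:
  assumes "\<And>j x. j < i \<Longrightarrow> (g j has_vector_derivative g (Suc j) x) (at x)" and "inj_on s {..i}"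
  shows "divdiff_distinct (g 0) i s = hermite_genocchi i g s"
  using assms
proof (induction i arbitrary: g s)
  case (Suc i)
  define y where "y = s (Suc i)"
  have neq: "s j \<noteq> y" if "j \<le> i" for j
    using that inj_on_eq_iff[OF Suc.prems(2), of j "Suc i"] by (simp add: y_def)
  have ftc: "((\<lambda>t. g 1 (y + t * (x - y))) has_integral (g 0 x - g 0 y) / complex_of_real (x - y)) {0..1}"
    if "x \<noteq> y" for x
  proof -
    have "((\<lambda>t. g 0 (y + t * (x - y))) has_vector_derivative (x - y) *\<^sub>R g 1 (y + t * (x - y))) (at t within {0..1})" for t
    proof -
      have "((\<lambda>t. y + t * (x - y)) has_vector_derivative (x - y)) (at t)"
        by (auto intro!: derivative_eq_intros simp: has_real_derivative_iff_has_vector_derivative[symmetric])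
      from vector_diff_chain_at[OF this, of "g 0" "g 1 (y + t * (x - y))"] Suc.prems(1)[of 0]
      show ?thesis by (auto simp: o_def intro: has_vector_derivative_at_within)
    qed
    then have "((\<lambda>t. (x - y) *\<^sub>R g 1 (y + t * (x - y))) has_integral
        g 0 (y + 1 * (x - y)) - g 0 (y + 0 * (x - y))) {0..1}"
      by (intro fundamental_theorem_of_calculus) auto
    from has_integral_divide[OF this, of "complex_of_real (x - y)"] that
    show ?thesis by (simp add: scaleR_conv_of_real del: of_real_diff)
  qed
  have "((\<lambda>t. divdiff_distinct (\<lambda>x. g 1 (y + t * (x - y))) i s) has_integral
      divdiff_distinct (\<lambda>x. (g 0 x - g 0 y) / complex_of_real (x - y)) i s) {0..1}"
    by (rule has_integral_divdiff_distinct) (use ftc neq in blast)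
  then have "((\<lambda>t. complex_of_real (t ^ i) * hermite_genocchi i (\<lambda>j. g (Suc j)) (\<lambda>l. y + t * (s l - y)))
      has_integral divdiff_distinct (\<lambda>x. (g 0 x - g 0 y) / complex_of_real (x - y)) i s) {0..1}"
  \<comment> \<open>At \<open>t = 0\<close> all nodes coincide and the induction hypothesis is not
    applicable.\<close>
  proof (rule has_integral_spike_finite[of "{0}", rotated 2])
    fix t :: real assume "t \<in> {0..1} - {0}"
    then have t: "t \<noteq> 0" by simp
    have "inj_on s {..i}" using Suc.prems(2) by (rule inj_on_subset) auto
    then have "inj_on (\<lambda>l. y + t * (s l - y)) {..i}" using t by (auto simp: inj_on_def)
    then have "divdiff_distinct (g (Suc 0)) i (\<lambda>l. y + t * (s l - y))
        = hermite_genocchi i (\<lambda>j. g (Suc j)) (\<lambda>l. y + t * (s l - y))"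
      using Suc.prems(1) by (intro Suc.IH[of "\<lambda>j. g (Suc j)"]) auto
    then show "complex_of_real (t ^ i) * hermite_genocchi i (\<lambda>j. g (Suc j)) (\<lambda>l. y + t * (s l - y))
        = divdiff_distinct (\<lambda>x. g 1 (y + t * (x - y))) i s"
      by (simp add: divdiff_distinct_affine[OF t])
  qed simp
  then show ?case
    unfolding divdiff_distinct_reduce[OF Suc.prems(2)] by (simp add: y_def[symmetric] integral_unique)
qed simp

text \<open>Tuples with distinct entries are dense: \<open>s + t (0, 1, 2, \<dots>)\<close> has distinct entries for all but
  finitely many \<open>t\<close>.\<close>

lemma cfun_eq_if_eq_on_distinct:
  assumes \<phi>: "\<phi> \<in> cfun (Rn (Suc i))" and \<psi>: "\<psi> \<in> cfun (Rn (Suc i))"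
    and eq: "\<And>s. s \<in> Rn (Suc i) \<Longrightarrow> inj_on s {..i} \<Longrightarrow> \<phi> s = \<psi> s"
  shows "\<phi> = \<psi>"
proof (rule extensionalityI[of _ "Rn (Suc i)"])
  fix s assume s: "s \<in> Rn (Suc i)"
  define p where "p t = (\<lambda>j\<in>{..<Suc i}. s j + t * real j)" for t
  have pR: "p t \<in> Rn (Suc i)" for t by (auto simp: p_def tuples_def)
  have p0: "p 0 = s" using s by (auto simp: p_def tuples_def PiE_def extensional_def fun_eq_iff)
  have "continuous_on UNIV p"
    unfolding p_def restrict_def
  proof (rule continuous_on_coordinatewise_then_product)
    show "continuous_on UNIV (\<lambda>t. if j \<in> {..<Suc i} then s j + t * real j else undefined)" for j
      by (cases "j \<in> {..<Suc i}") (auto intro!: continuous_intros)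
  qed


  have comp: "((\<lambda>t. \<eta> (p t)) \<longlongrightarrow> \<eta> s) (at 0)" if "\<eta> \<in> cfun (Rn (Suc i))" for \<eta> :: "_ \<Rightarrow> complex"
  proof -
    have "continuous_on UNIV (\<lambda>t. \<eta> (p t))"
      by (rule continuous_on_compose2[of "Rn (Suc i)" \<eta>]) (use that \<open>continuous_on UNIV p\<close> pR in \<open>auto simp: cfun_def\<close>)
    then have "((\<lambda>t. \<eta> (p t)) \<longlongrightarrow> \<eta> (p 0)) (at 0)" by (auto simp: continuous_on_def)
    then show ?thesis by (simp only: p0)
  qed
  have "eventually (\<lambda>t. \<forall>q\<in>{..i} \<times> {..i}. fst q \<noteq> snd q \<longrightarrow> p t (fst q) \<noteq> p t (snd q)) (at 0)"
  proof (rule eventually_ball_finite)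
    show "\<forall>q\<in>{..i} \<times> {..i}. \<forall>\<^sub>F t in at 0. fst q \<noteq> snd q \<longrightarrow> p t (fst q) \<noteq> p t (snd q)"
    proof safe
      fix a b assume ab: "a \<le> i" "b \<le> i"
      show "\<forall>\<^sub>F t in at 0. fst (a, b) \<noteq> snd (a, b) \<longrightarrow> p t (fst (a, b)) \<noteq> p t (snd (a, b))"
      proof (cases "a = b")
        case False
        \<comment> \<open>The only \<open>t\<close> for which the entries \<open>a\<close> and
          \<open>b\<close> of \<open>p t\<close> coincide.\<close>
        define r where "r = (s a - s b) / (real b - real a)"
        have "eventually (\<lambda>t::real. t \<noteq> r) (at 0)"
        proof (cases "r = 0")
          case True then show ?thesis by (simp add: eventually_at_filter)
        next
          case False
          have "((\<lambda>t::real. t) \<longlongrightarrow> 0) (at 0)" by (rule tendsto_ident_at)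
          then show ?thesis using False by (intro tendsto_imp_eventually_ne) auto
        qed
        then show ?thesis
        proof eventually_elim
          case (elim t)
          have "p t a \<noteq> p t b"
          proof
            assume "p t a = p t b"
            then have "t * (real b - real a) = s a - s b" using ab by (simp add: p_def algebra_simps)
            then have "t = r" using False by (simp add: r_def field_simps)
            with elim show False by simp
          qed
          then show ?case by simp
        qed
      qed simp
    qed
  qed simp
  then have "eventually (\<lambda>t. \<phi> (p t) = \<psi> (p t)) (at 0)"
  proof eventually_elim
    case (elim t)
    then have "inj_on (p t) {..i}" by (force simp: inj_on_def)
    then show ?case by (rule eq[OF pR])
  qed
  then have "((\<lambda>t. \<psi> (p t)) \<longlongrightarrow> \<phi> s) (at 0)"
    using comp[OF \<phi>] by (rule Lim_transform_eventually[rotated])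
  then show "\<phi> s = \<psi> s"
    using comp[OF \<psi>] by (metis tendsto_unique trivial_limit_at)
qed (use \<phi> \<psi> in \<open>auto simp: cfun_def\<close>)

lemma divdiff_eqI:
  assumes "\<phi> \<in> cfun (Rn (Suc i))"
    and "\<And>s. s \<in> Rn (Suc i) \<Longrightarrow> inj_on s {..i} \<Longrightarrow> \<phi> s = divdiff_distinct f i s"
  shows "divdiff f i = \<phi>"
  unfolding divdiff_def
proof (rule the_equality)
  fix \<psi> assume "\<psi> \<in> cfun (Rn (Suc i)) \<and>
    (\<forall>s\<in>Rn (Suc i). inj_on s {..i} \<longrightarrow> \<psi> s = divdiff_distinct f i s)"
  then show "\<psi> = \<phi>" using assms by (intro cfun_eq_if_eq_on_distinct) auto
qed (use assms in auto)

text \<open>Existence comes from the Hermite--Genocchi formula, uniqueness from density.\<close>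

lemma divdiff_Ck:
  assumes f: "f \<in> Ck_on_line k" and i: "i \<le> k"
  shows divdiff_in_cfun: "divdiff f i \<in> cfun (Rn (Suc i))"
    and divdiff_eq_distinct: "s \<in> Rn (Suc i) \<Longrightarrow> inj_on s {..i} \<Longrightarrow> divdiff f i s = divdiff_distinct f i s"
proof -
  obtain g where g: "g 0 = f" "\<And>j x. j < k \<Longrightarrow> (g j has_vector_derivative g (Suc j) x) (at x)"
    "\<And>j. j \<le> k \<Longrightarrow> continuous_on UNIV (g j)"
    using f by (auto simp: Ck_on_line_def)
  define \<phi> where "\<phi> = restrict (hermite_genocchi i g) (Rn (Suc i))"
  have "continuous_on UNIV (hermite_genocchi i g)"
    using g i by (intro continuous_on_hermite_genocchi) auto
  then have "continuous_on (Rn (Suc i)) (hermite_genocchi i g)"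
    by (rule continuous_on_subset) auto
  then have c: "\<phi> \<in> cfun (Rn (Suc i))" by (simp add: \<phi>_def cfun_def)
  have d: "\<phi> s = divdiff_distinct f i s" if "s \<in> Rn (Suc i)" "inj_on s {..i}" for s
    using divdiff_distinct_eq_hermite_genocchi[of i g s] that g i by (simp add: \<phi>_def)
  have "divdiff f i = \<phi>" by (rule divdiff_eqI[OF c d])
  with c d show "divdiff f i \<in> cfun (Rn (Suc i))"
    "s \<in> Rn (Suc i) \<Longrightarrow> inj_on s {..i} \<Longrightarrow> divdiff f i s = divdiff_distinct f i s" by auto
qed

lemma divdiff_diff:
  assumes "f \<in> Ck_on_line k" "g \<in> Ck_on_line k" "i \<le> k"
  shows "divdiff (f - g) i = (\<lambda>s\<in>Rn (Suc i). divdiff f i s - divdiff g i s)"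
proof (rule divdiff_eqI)
  show "(\<lambda>s\<in>Rn (Suc i). divdiff f i s - divdiff g i s) \<in> cfun (Rn (Suc i))"
    using divdiff_in_cfun[OF assms(1,3)] divdiff_in_cfun[OF assms(2,3)]
    by (auto simp: cfun_def intro!: continuous_on_diff)
  fix s assume "s \<in> Rn (Suc i)" "inj_on s {..i}"
  then show "(\<lambda>s\<in>Rn (Suc i). divdiff f i s - divdiff g i s) s = divdiff_distinct (f - g) i s"
    using divdiff_distinct_diff_divide[of f g 1 i s]
    by (simp add: divdiff_eq_distinct[OF assms(1,3)] divdiff_eq_distinct[OF assms(2,3)] fun_diff_def)
qed

section \<open>Divided differences of polynomials in noncommuting variables\<close>

text \<open>Generating functions: with \<open>geo x = \<Sum>n. x ^ n z ^ n = (1 - x z)\<^sup>-\<^sup>1\<close>, the coefficient of \<open>z ^ n\<close> in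
  \<open>lex_geo m a b = geo (a 0) (b 0) geo (a 1) (b 1) \<dots> geo (a m)\<close> is the sum of all lexicographic monomials of
  degree \<open>n\<close>, and the resolvent identity for \<open>geo\<close> becomes the perturbation formula.\<close>

definition geo :: "'a::{ring,monoid_mult} \<Rightarrow> 'a fps" where
  "geo x = Abs_fps (\<lambda>n. x ^ n)"

definition upshift :: "'a::ring fps \<Rightarrow> 'a fps" where
  "upshift F = Abs_fps (\<lambda>n. case n of 0 \<Rightarrow> 0 | Suc n \<Rightarrow> fps_nth F n)"

primrec lex_geo :: "nat \<Rightarrow> (nat \<Rightarrow> 'a) \<Rightarrow> (nat \<Rightarrow> 'a) \<Rightarrow> 'a::{ring,monoid_mult} fps" where
  "lex_geo 0 a b = geo (a 0)"
| "lex_geo (Suc m) a b = lex_geo m a b * fps_const (b m) * geo (a (Suc m))"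

lemma geo_nth [simp]: "fps_nth (geo x) n = x ^ n"
  by (simp add: geo_def)

lemma upshift_nth [simp]: "fps_nth (upshift F) 0 = 0" "fps_nth (upshift F) (Suc n) = fps_nth F n"
  by (simp_all add: upshift_def)

lemma upshift_mult_left: "upshift F * G = upshift (F * G)"
proof (rule fps_ext)
  fix n show "fps_nth (upshift F * G) n = fps_nth (upshift (F * G)) n"
  proof (cases n)
    case (Suc l)
    then show ?thesis unfolding Suc fps_mult_nth sum.atLeast0_atMost_Suc_shift
      by (simp add: fps_mult_nth)
  qed (simp add: fps_mult_nth)
qed

lemma upshift_mult_right: "G * upshift F = upshift (G * F)"
proof (rule fps_ext)
  fix n show "fps_nth (G * upshift F) n = fps_nth (upshift (G * F)) n"
    by (cases n) (auto simp: fps_mult_nth sum.atLeast0_atMost_Suc Suc_diff_le intro!: sum.cong)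
qed

lemma upshift_add: "upshift (F + G) = upshift F + upshift G"
proof (rule fps_ext)
  fix n show "fps_nth (upshift (F + G)) n = fps_nth (upshift F + upshift G) n"
    by (cases n) simp_all
qed

lemma fps_mult_const_nth: "fps_nth (F * fps_const c) n = fps_nth F n * (c::'a::ring)"
  by (simp add: fps_mult_nth fps_const_def if_distrib[of "\<lambda>x. _ * x"] cong: if_cong)

lemma geo_diff: "geo x - geo y = upshift (geo x * fps_const (x - y) * geo y)"
proof (rule fps_ext)
  have "(\<Sum>i=0..n. x ^ i * (x - y) * y ^ (n - i)) = x ^ Suc n - y ^ Suc n" for n
  proof (induction n)
    case (Suc n)
    have "(\<Sum>i=0..Suc n. x ^ i * (x - y) * y ^ (Suc n - i))
        = (\<Sum>i=0..n. x ^ i * (x - y) * y ^ (n - i)) * y + x ^ Suc n * (x - y)"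
      by (auto simp: sum.atLeast0_atMost_Suc sum_distrib_right Suc_diff_le mult.assoc power_commutes intro!: sum.cong)
    also have "\<dots> = x ^ Suc (Suc n) - y ^ Suc (Suc n)"
      unfolding Suc by (simp add: algebra_simps power_commutes)
    finally show ?case .
  qed simp
  then show "fps_nth (geo x - geo y) n = fps_nth (upshift (geo x * fps_const (x - y) * geo y)) n" for n
    by (cases n) (simp_all add: fps_mult_nth[of "_ * _"] fps_mult_const_nth)
qed

lemma lex_geo_cong:
  "(\<And>i. i \<le> m \<Longrightarrow> a i = a' i) \<Longrightarrow> (\<And>i. i < m \<Longrightarrow> b i = b' i) \<Longrightarrow> lex_geo m a b = lex_geo m a' b'"
  by (induction m) auto

text \<open>The resolvent identity in the last argument.\<close>

lemma lex_geo_last_diff: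
  "lex_geo m a b - lex_geo m (a(m := y)) b = upshift (lex_geo m a b * fps_const (a m - y) * geo y)"
proof (cases m)
  case 0
  then show ?thesis by (simp add: geo_diff)
next
  case (Suc l)
  have "lex_geo l (a(Suc l := y)) b = lex_geo l a b" by (rule lex_geo_cong) auto
  then have "lex_geo m a b - lex_geo m (a(m := y)) b
      = lex_geo l a b * fps_const (b l) * (geo (a (Suc l)) - geo y)"
    by (simp add: Suc right_diff_distrib)
  then show ?thesis by (simp add: geo_diff upshift_mult_right Suc mult.assoc)
qed

definition insert_at :: "nat \<Rightarrow> 'a \<Rightarrow> (nat \<Rightarrow> 'a) \<Rightarrow> nat \<Rightarrow> 'a" where
  "insert_at j y b = (\<lambda>i. if i < j then b i else if i = j then y else b (i - 1))"

text \<open>Change all \<open>m + 1\<close> arguments from \<open>v\<close> to \<open>u\<close>, one after the other.\<close>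

lemma lex_geo_telescope:
  "lex_geo m (\<lambda>_. u) b - lex_geo m (\<lambda>_. v) b =
    upshift (\<Sum>j\<le>m. lex_geo (Suc m) (\<lambda>i. if i \<le> j then u else v) (insert_at j (u - v) b))"
proof (induction m)
  case 0
  then show ?case by (simp add: geo_diff insert_at_def)
next
  case (Suc m)
  let ?x = "\<lambda>j i. if i \<le> j then u else v"
  let ?b = "\<lambda>j. insert_at j (u - v) b"
  have 1: "lex_geo (Suc m) (?x j) (?b j) * fps_const (b m) * geo v = lex_geo (Suc (Suc m)) (?x j) (?b j)"
    if "j \<le> m" for j using that by (simp add: insert_at_def)
  have 2: "lex_geo (Suc m) (\<lambda>_. u) b * fps_const (u - v) * geo v
      = lex_geo (Suc (Suc m)) (?x (Suc m)) (?b (Suc m))"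
  proof -
    have "lex_geo (Suc m) (?x (Suc m)) (?b (Suc m)) = lex_geo (Suc m) (\<lambda>_. u) b"
      by (rule lex_geo_cong) (auto simp: insert_at_def)
    then show ?thesis unfolding lex_geo.simps(2)[of "Suc m"] by (simp add: insert_at_def)
  qed
  have "lex_geo (Suc m) (\<lambda>_. u) b - lex_geo (Suc m) (\<lambda>_. v) b
      = (lex_geo m (\<lambda>_. u) b - lex_geo m (\<lambda>_. v) b) * fps_const (b m) * geo v
        + lex_geo m (\<lambda>_. u) b * fps_const (b m) * (geo u - geo v)"
    by (simp add: algebra_simps)
  also have "lex_geo m (\<lambda>_. u) b * fps_const (b m) * (geo u - geo v)
      = upshift (lex_geo (Suc m) (\<lambda>_. u) b * fps_const (u - v) * geo v)"
    by (simp add: geo_diff upshift_mult_right mult.assoc)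
  also have "(lex_geo m (\<lambda>_. u) b - lex_geo m (\<lambda>_. v) b) * fps_const (b m) * geo v
      = upshift (\<Sum>j\<le>m. lex_geo (Suc (Suc m)) (?x j) (?b j))"
    unfolding Suc upshift_mult_left sum_distrib_right
    by (intro arg_cong[of _ _ upshift] sum.cong) (use 1 in auto)
  finally show ?case
    unfolding 2 by (simp only: sum.atMost_Suc upshift_add)
qed

subsection \<open>Coefficients\<close>

definition exact_indices :: "nat \<Rightarrow> nat \<Rightarrow> (nat \<Rightarrow> nat) set" where
  "exact_indices m n = {\<delta> \<in> tuples m UNIV. (\<Sum>i<m. \<delta> i) = n}"

lemma finite_multi_indices: "finite (multi_indices m d)"
proof (rule finite_subset)
  show "multi_indices m d \<subseteq> PiE {..<m} (\<lambda>_. {..d})"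
  proof
    fix \<delta> assume \<delta>: "\<delta> \<in> multi_indices m d"
    then have "\<delta> i \<le> d" if "i < m" for i
      using that member_le_sum[of i "{..<m}" \<delta>] by (auto simp: multi_indices_def)
    with \<delta> show "\<delta> \<in> PiE {..<m} (\<lambda>_. {..d})"
      by (auto simp: multi_indices_def tuples_def PiE_iff)
  qed
qed (intro finite_PiE; simp)

lemma finite_exact_indices: "finite (exact_indices m n)"
  by (rule finite_subset[OF _ finite_multi_indices[of m n]]) (auto simp: exact_indices_def multi_indices_def)

lemma lex_geo_nth:
  "fps_nth (lex_geo m a b) n =
    (\<Sum>\<delta>\<in>exact_indices (Suc m) n. prod_list (map (\<lambda>i. a i ^ \<delta> i * b i) [0..<m]) * a m ^ \<delta> m)"
proof (induction m arbitrary: n)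
  case 0
  have "exact_indices (Suc 0) n = {\<lambda>i\<in>{..<Suc 0}. n}"
    by (auto simp: exact_indices_def tuples_def PiE_def extensional_def fun_eq_iff)
  then show ?case by simp
next
  case (Suc m)
  let ?M = "\<lambda>m \<delta>. prod_list (map (\<lambda>i. a i ^ \<delta> i * b i) [0..<m]) * a m ^ \<delta> m"
  have "fps_nth (lex_geo (Suc m) a b) n
      = (\<Sum>k=0..n. \<Sum>\<delta>\<in>exact_indices (Suc m) k. ?M m \<delta> * b m * a (Suc m) ^ (n - k))"
    by (simp add: fps_mult_nth[of "_ * _"] fps_mult_const_nth Suc sum_distrib_right)
  also have "\<dots> = (\<Sum>(k, \<delta>)\<in>(SIGMA k:{0..n}. exact_indices (Suc m) k). ?M m \<delta> * b m * a (Suc m) ^ (n - k))"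
    by (rule sum.Sigma) (auto simp: finite_exact_indices)
  also have "\<dots> = (\<Sum>\<delta>\<in>exact_indices (Suc (Suc m)) n. ?M (Suc m) \<delta>)"
  proof (rule sum.reindex_bij_witness
      [where i = "\<lambda>\<delta>. (n - \<delta> (Suc m), restrict \<delta> {..<Suc m})" and j = "\<lambda>(k, \<delta>). \<delta>(Suc m := n - k)"])
    fix p assume p: "p \<in> (SIGMA k:{0..n}. exact_indices (Suc m) k)"
    obtain k \<delta> where p_eq: "p = (k, \<delta>)" by (cases p)
    have k: "k \<le> n" and \<delta>: "\<delta> \<in> tuples (Suc m) UNIV" "(\<Sum>i<Suc m. \<delta> i) = k"
      using p by (auto simp: p_eq exact_indices_def)
    have ext: "\<delta> \<in> extensional {..<Suc m}" using \<delta>(1) by (simp add: tuples_def PiE_def)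
    have s: "(\<Sum>i<Suc m. (\<delta>(Suc m := n - k)) i) = k"
      unfolding \<delta>(2)[symmetric] by (rule sum.cong) auto
    show "(\<lambda>\<delta>. (n - \<delta> (Suc m), restrict \<delta> {..<Suc m})) ((\<lambda>(k, \<delta>). \<delta>(Suc m := n - k)) p) = p"
      using k ext by (auto simp: p_eq fun_eq_iff extensional_def)
    show "(\<lambda>(k, \<delta>). \<delta>(Suc m := n - k)) p \<in> exact_indices (Suc (Suc m)) n"
      using k ext s unfolding p_eq exact_indices_def
      by (auto simp: tuples_def PiE_def extensional_def lessThan_Suc[of "Suc m"])
    show "?M (Suc m) ((\<lambda>(k, \<delta>). \<delta>(Suc m := n - k)) p)
        = (case p of (k, \<delta>) \<Rightarrow> ?M m \<delta> * b m * a (Suc m) ^ (n - k))"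
    proof -
      have "prod_list (map (\<lambda>i. a i ^ (if i = Suc m then n - k else \<delta> i) * b i) [0..<m])
          = prod_list (map (\<lambda>i. a i ^ \<delta> i * b i) [0..<m])"
        by (intro arg_cong[of _ _ prod_list] map_cong) auto
      then show ?thesis by (simp add: p_eq mult.assoc)
    qed
  next
    fix \<delta> assume \<delta>: "\<delta> \<in> exact_indices (Suc (Suc m)) n"
    have ext: "\<delta> \<in> extensional {..<Suc (Suc m)}" using \<delta> by (simp add: exact_indices_def tuples_def PiE_def)
    have s: "(\<Sum>i<Suc m. \<delta> i) + \<delta> (Suc m) = n" using \<delta> by (simp add: exact_indices_def)
    show "(\<lambda>(k, \<delta>). \<delta>(Suc m := n - k)) ((\<lambda>\<delta>. (n - \<delta> (Suc m), restrict \<delta> {..<Suc m})) \<delta>) = \<delta>"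
      using ext s by (auto simp: fun_eq_iff extensional_def)
    show "(n - \<delta> (Suc m), restrict \<delta> {..<Suc m}) \<in> (SIGMA k:{0..n}. exact_indices (Suc m) k)"
      using s by (auto simp: exact_indices_def tuples_def)
  qed
  finally show ?case .
qed

text \<open>The coefficient of \<open>\<delta>\<close> in the \<open>m\<close>-th divided difference of \<open>p\<close> is that of \<open>p\<close> in degree \<open>|\<delta>| + m\<close>.\<close>

definition divdiff_coeff :: "complex poly \<Rightarrow> nat \<Rightarrow> (nat \<Rightarrow> nat) \<Rightarrow> complex" where
  "divdiff_coeff p m \<delta> = coeff p ((\<Sum>i<Suc m. \<delta> i) + m)"

lemma sum_multi_indices:
  "(\<Sum>\<delta>\<in>multi_indices m d. h \<delta>) = (\<Sum>n\<le>d. \<Sum>\<delta>\<in>exact_indices m n. h \<delta>)"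
proof -
  have "(\<Sum>n\<le>d. \<Sum>\<delta>\<in>exact_indices m n. h \<delta>) = sum h (\<Union>n\<in>{..d}. exact_indices m n)"
    by (rule sum.UNION_disjoint[symmetric]) (simp_all add: finite_exact_indices, auto simp: exact_indices_def)
  also have "(\<Union>n\<in>{..d}. exact_indices m n) = multi_indices m d"
    by (auto simp: exact_indices_def multi_indices_def)
  finally show ?thesis by simp
qed

text \<open>Pairing a generating function with the coefficients of \<open>p\<close> from degree \<open>m\<close> on: multiplication by \<open>z\<close>
  amounts to raising \<open>m\<close>. This is where one divided difference turns into the next one.\<close>

lemma sum_coeff_upshift:
  assumes "\<And>x. sc 0 x = (0::'b::comm_monoid_add)" "\<And>c. sc c 0 = 0"
  shows "(\<Sum>n\<le>degree p. sc (coeff p (n + m)) (fps_nth (upshift F) n))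
    = (\<Sum>n\<le>degree p. sc (coeff p (n + Suc m)) (fps_nth F n))"
proof -
  have "(\<Sum>n\<le>degree p. sc (coeff p (n + m)) (fps_nth (upshift F) n))
      = (\<Sum>n\<le>Suc (degree p). sc (coeff p (n + m)) (fps_nth (upshift F) n))"
    by (simp add: coeff_eq_0 assms)
  also have "\<dots> = (\<Sum>n\<le>degree p. sc (coeff p (n + Suc m)) (fps_nth F n))"
    by (subst sum.atMost_Suc_shift) (simp add: assms)
  finally show ?thesis .
qed

lemma poly_lfc_divdiff_coeff:
  "poly_lfc (Suc m) (degree p) (divdiff_coeff p m) a b
    = (\<Sum>n\<le>degree p. coeff p (n + m) *\<^sub>C fps_nth (lex_geo m a b) n)"
  unfolding poly_lfc_def sum_multi_indices
proof (rule sum.cong)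
  fix n
  have "(\<Sum>\<delta>\<in>exact_indices (Suc m) n. divdiff_coeff p m \<delta> *\<^sub>C M \<delta>)
      = coeff p (n + m) *\<^sub>C (\<Sum>\<delta>\<in>exact_indices (Suc m) n. M \<delta>)" for M :: "(nat \<Rightarrow> nat) \<Rightarrow> 'a"
    unfolding scaleC_sum_right by (rule sum.cong) (auto simp: divdiff_coeff_def exact_indices_def)
  then show "(\<Sum>\<delta>\<in>exact_indices (Suc m) n. divdiff_coeff p m \<delta> *\<^sub>C
       (prod_list (map (\<lambda>i. a i ^ \<delta> i * b i) [0..<Suc m - 1]) * a (Suc m - 1) ^ \<delta> (Suc m - 1)))
    = coeff p (n + m) *\<^sub>C fps_nth (lex_geo m a b) n"
    by (simp add: lex_geo_nth)
qed simp

text \<open>The perturbation formula for polynomials: \<open>lex_geo_telescope\<close> paired with the coefficients of \<open>p\<close>.\<close>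

lemma poly_lfc_telescope:
  "poly_lfc (Suc m) (degree p) (divdiff_coeff p m) (\<lambda>_. u) b
     - poly_lfc (Suc m) (degree p) (divdiff_coeff p m) (\<lambda>_. v) b
   = (\<Sum>j\<le>m. poly_lfc (Suc (Suc m)) (degree p) (divdiff_coeff p (Suc m))
         (\<lambda>i. if i \<le> j then u else v) (insert_at j (u - v) b))"
proof -
  have "poly_lfc (Suc m) (degree p) (divdiff_coeff p m) (\<lambda>_. u) b
     - poly_lfc (Suc m) (degree p) (divdiff_coeff p m) (\<lambda>_. v) b
    = (\<Sum>n\<le>degree p. coeff p (n + m) *\<^sub>C fps_nth (lex_geo m (\<lambda>_. u) b - lex_geo m (\<lambda>_. v) b) n)"
    by (simp add: poly_lfc_divdiff_coeff sum_subtractf scaleC_diff_right)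
  also have "\<dots> = (\<Sum>n\<le>degree p. coeff p (n + Suc m) *\<^sub>C
      fps_nth (\<Sum>j\<le>m. lex_geo (Suc m) (\<lambda>i. if i \<le> j then u else v) (insert_at j (u - v) b)) n)"
    unfolding lex_geo_telescope by (rule sum_coeff_upshift) auto
  also have "\<dots> = (\<Sum>j\<le>m. \<Sum>n\<le>degree p. coeff p (n + Suc m) *\<^sub>C
      fps_nth (lex_geo (Suc m) (\<lambda>i. if i \<le> j then u else v) (insert_at j (u - v) b)) n)"
    unfolding fps_sum_nth scaleC_sum_right by (rule sum.swap)
  finally show ?thesis by (simp add: poly_lfc_divdiff_coeff)
qed

text \<open>The perturbation formula for \<open>m = 0\<close>.\<close>

lemma alg_poly_diff_eq_poly_lfc:
  "alg_poly p u - alg_poly p v =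
    poly_lfc (Suc (Suc 0)) (degree p) (divdiff_coeff p (Suc 0)) (\<lambda>i. if i \<le> 0 then u else v) (\<lambda>_. u - v)"
proof -
  have *: "alg_poly p x = poly_lfc (Suc 0) (degree p) (divdiff_coeff p 0) (\<lambda>_. x) (\<lambda>_. u - v)" for x
    by (simp add: poly_lfc_divdiff_coeff alg_poly_def)
  have "insert_at 0 (u - v) (\<lambda>_. u - v) = (\<lambda>_. u - v)" by (auto simp: insert_at_def)
  then show ?thesis unfolding * poly_lfc_telescope by simp
qed

lemma prod_list_map_upt: "prod_list (map h [0..<m]) = (\<Prod>i<m. h i)" for h :: "nat \<Rightarrow> 'a::comm_monoid_mult"
  by (induction m) (simp_all add: mult.commute)

text \<open>The scalar case of the resolvent identity is the recursion for divided differences.\<close>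

lemma divdiff_distinct_poly:
  "inj_on s {..m} \<Longrightarrow> divdiff_distinct (\<lambda>x. poly p (complex_of_real x)) m s =
    (\<Sum>n\<le>degree p. coeff p (n + m) * fps_nth (lex_geo m (\<lambda>i. complex_of_real (s i)) (\<lambda>_. 1)) n)"
proof (induction m arbitrary: s)
  case 0
  then show ?case by (simp add: poly_altdef)
next
  case (Suc m)
  let ?L = "\<lambda>m F. \<Sum>n\<le>degree p. coeff p (n + m) * fps_nth F n"
  let ?G = "\<lambda>m s. lex_geo m (\<lambda>i. complex_of_real (s i)) (\<lambda>_. 1)"
  define c where "c = complex_of_real (s m - s (Suc m))"
  have c0: "c \<noteq> 0" using inj_on_eq_iff[OF Suc.prems, of m "Suc m"] by (simp add: c_def)
  have "inj_on s {..m}" using Suc.prems by (rule inj_on_subset) auto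
  moreover have "inj_on (s(m := s (Suc m))) {..m}"
    by (rule inj_on_replace_last[OF Suc.prems])
  ultimately have "divdiff_distinct (\<lambda>x. poly p (complex_of_real x)) (Suc m) s
      = (?L m (?G m s) - ?L m (?G m (s(m := s (Suc m))))) / c"
    by (simp add: Suc.IH c_def del: fun_upd_apply)
  also have "?L m (?G m s) - ?L m (?G m (s(m := s (Suc m)))) = ?L m (?G m s - ?G m (s(m := s (Suc m))))"
    by (simp add: sum_subtractf right_diff_distrib)
  also have "(\<lambda>i. complex_of_real ((s(m := s (Suc m))) i)) = (\<lambda>i. complex_of_real (s i))(m := complex_of_real (s (Suc m)))"
    by auto
  also have "?G m s - lex_geo m \<dots> (\<lambda>_. 1)
      = upshift (?G m s * fps_const c * geo (complex_of_real (s (Suc m))))"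
    unfolding lex_geo_last_diff by (simp add: c_def)
  also have "?L m \<dots> = ?L (Suc m) (?G m s * fps_const c * geo (complex_of_real (s (Suc m))))"
    by (rule sum_coeff_upshift) auto
  also have "?G m s * fps_const c * geo (complex_of_real (s (Suc m))) = fps_const c * ?G (Suc m) s"
    by (simp add: mult_ac)
  also have "?L (Suc m) \<dots> = c * ?L (Suc m) (?G (Suc m) s)"
    by (simp only: fps_mult_left_const_nth sum_distrib_left) (simp add: mult_ac)
  finally show ?case using c0 by simp
qed

lemma poly_fun_in_cfun: "poly_fun m d c \<in> cfun (Rn m)"
proof -
  have "continuous_on (Rn m) (\<lambda>x. \<Sum>\<delta>\<in>multi_indices m d. c \<delta> * complex_of_real (\<Prod>i<m. x i ^ \<delta> i))"
    by (intro continuous_intros continuous_on_subset[OF continuous_on_product_coordinates]) auto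
  then show ?thesis by (simp add: cfun_def poly_fun_def)
qed

lemma divdiff_poly:
  "divdiff (\<lambda>x. poly p (complex_of_real x)) m = poly_fun (Suc m) (degree p) (divdiff_coeff p m)"
proof (rule divdiff_eqI[OF poly_fun_in_cfun])
  fix s assume s: "s \<in> Rn (Suc m)" "inj_on s {..m}"
  have "poly_fun (Suc m) (degree p) (divdiff_coeff p m) s
      = (\<Sum>n\<le>degree p. \<Sum>\<delta>\<in>exact_indices (Suc m) n. coeff p (n + m) * complex_of_real (\<Prod>i<Suc m. s i ^ \<delta> i))"
    unfolding poly_fun_def sum_multi_indices restrict_apply'[OF s(1)]
    by (intro sum.cong) (auto simp: divdiff_coeff_def exact_indices_def)
  also have "\<dots> = (\<Sum>n\<le>degree p. coeff p (n + m) *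
      fps_nth (lex_geo m (\<lambda>i. complex_of_real (s i)) (\<lambda>_. 1)) n)"
    by (simp add: lex_geo_nth prod_list_map_upt sum_distrib_left)
  finally show "poly_fun (Suc m) (degree p) (divdiff_coeff p m) s
      = divdiff_distinct (\<lambda>x. poly p (complex_of_real x)) m s"
    using divdiff_distinct_poly[OF s(2)] by simp
qed

section \<open>Topologies generated by seminorms\<close>

text \<open>The sets \<open>V\<close> below consist of extensional functions and are not closed under pointwise subtraction,
  hence the triangle inequality is only asked for differences of elements.\<close>

locale seminorm_space =
  fixes V :: "'v::minus set" and S :: "('v \<Rightarrow> ennreal) set"
  assumes diff_self: "\<And>p v. p \<in> S \<Longrightarrow> v \<in> V \<Longrightarrow> p (v - v) = 0"
    and triangle: "\<And>p u v w. p \<in> S \<Longrightarrow> u \<in> V \<Longrightarrow> v \<in> V \<Longrightarrow> w \<in> V \<Longrightarrow> p (u - w) \<le> p (u - v) + p (v - w)"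
    and nonempty: "S \<noteq> {}"
begin

lemma openin_ball: "p \<in> S \<Longrightarrow> v \<in> V \<Longrightarrow> 0 < e \<Longrightarrow> openin (seminorm_topology V S) {w \<in> V. p (w - v) < ennreal e}"
  unfolding seminorm_topology_def by (rule topology_generated_by_Basis) blast

lemma topspace: "topspace (seminorm_topology V S) = V"
proof -
  obtain p where p: "p \<in> S" using nonempty by blast
  have "v \<in> topspace (seminorm_topology V S)" if "v \<in> V" for v
    using openin_subset[OF openin_ball[OF p that, of 1]] diff_self[OF p that] that by auto
  moreover have "topspace (seminorm_topology V S) \<subseteq> V"
    unfolding seminorm_topology_def topology_generated_by_topspace by auto
  ultimately show ?thesis by blast
qed

lemma ball_shift:
  assumes "p \<in> S" and "u \<in> V" and "v \<in> V" and lt: "p (u - v) < ennreal e"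
  shows "\<exists>d>0. \<forall>w\<in>V. p (w - u) < ennreal d \<longrightarrow> p (w - v) < ennreal e"
proof -
  obtain q where q: "p (u - v) = ennreal q" "0 \<le> q"
    using lt by (cases "p (u - v)") auto
  have qe: "q < e" using lt q by (simp add: ennreal_less_iff)
  have "p (w - v) < ennreal e" if wV: "w \<in> V" and wu: "p (w - u) < ennreal (e - q)" for w
  proof -
    obtain s where s: "p (w - u) = ennreal s" "0 \<le> s"
      using wu by (cases "p (w - u)") auto
    have "s < e - q" using wu s by (simp add: ennreal_less_iff)
    have "p (w - v) \<le> ennreal s + ennreal q"
      using triangle[OF assms(1) wV assms(2,3)] q s by simp
    also have "\<dots> = ennreal (s + q)" using q s by simp
    also have "\<dots> < ennreal e" using \<open>s < e - q\<close> q s by (intro ennreal_lessI) auto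
    finally show ?thesis .
  qed
  then show ?thesis using qe by (intro exI[of _ "e - q"]) auto
qed

text \<open>Balls for finitely many seminorms form a neighbourhood basis; \<open>ball_shift\<close> handles balls of the subbasis with
  another centre.\<close>

lemma openin_imp_ball:
  assumes "openin (seminorm_topology V S) U" "v \<in> U" "v \<in> V"
  shows "\<exists>F e. finite F \<and> F \<subseteq> S \<and> 0 < e \<and> {w \<in> V. \<forall>p\<in>F. p (w - v) < ennreal e} \<subseteq> U"
proof -
  have "generate_topology_on {{w \<in> V. p (w - v) < ennreal e} |p v e. p \<in> S \<and> v \<in> V \<and> 0 < e} U"
    using assms(1) unfolding seminorm_topology_def by (rule openin_topology_generated_by)
  then show ?thesis using assms(2)
  proof (induction rule: generate_topology_on.induct)
    case (Int U1 U2)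
    then obtain F1 e1 F2 e2 where
      1: "finite F1" "F1 \<subseteq> S" "0 < e1" "{w \<in> V. \<forall>p\<in>F1. p (w - v) < ennreal e1} \<subseteq> U1" and
      2: "finite F2" "F2 \<subseteq> S" "0 < e2" "{w \<in> V. \<forall>p\<in>F2. p (w - v) < ennreal e2} \<subseteq> U2"
      by (meson IntE)
    have "x < ennreal e1 \<and> x < ennreal e2" if "x < ennreal (min e1 e2)" for x
      using that by (meson ennreal_leI less_le_trans min.cobounded1 min.cobounded2)
    then have "{w \<in> V. \<forall>p\<in>F1 \<union> F2. p (w - v) < ennreal (min e1 e2)} \<subseteq> U1 \<inter> U2"
      using 1(4) 2(4) by blast
    then show ?case using 1 2 by (intro exI[of _ "F1 \<union> F2"] exI[of _ "min e1 e2"]) auto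
  next
    case (UN K)
    then obtain k where "k \<in> K" "v \<in> k" by blast
    with UN.IH[OF this] show ?case by (meson Union_upper order_trans)
  next
    case (Basis B)
    then obtain p u e where B: "B = {w \<in> V. p (w - u) < ennreal e}" "p \<in> S" "u \<in> V" by blast
    then obtain d where "d > 0" "\<forall>w\<in>V. p (w - v) < ennreal d \<longrightarrow> p (w - u) < ennreal e"
      using ball_shift[of p v u e] Basis.prems by auto
    then show ?case using B by (intro exI[of _ "{p}"] exI[of _ d]) auto
  next
    case Empty
    then show ?case by blast
  qed
qed

lemma closure_of_iff:
  "v \<in> seminorm_topology V S closure_of P \<longleftrightarrow>
    v \<in> V \<and> (\<forall>F e. finite F \<and> F \<subseteq> S \<and> 0 < e \<longrightarrow> (\<exists>w\<in>P. w \<in> V \<and> (\<forall>p\<in>F. p (w - v) < ennreal e)))"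
    (is "?L \<longleftrightarrow> ?R")
proof
  assume L: ?L
  then have v: "v \<in> V" by (simp add: in_closure_of topspace)
  have "\<exists>w\<in>P. w \<in> V \<and> (\<forall>p\<in>F. p (w - v) < ennreal e)" if F: "finite F" "F \<subseteq> S" "0 < e" for F e
  proof -
    define U where "U = (\<Inter>p\<in>F. {w \<in> V. p (w - v) < ennreal e}) \<inter> V"
    have "openin (seminorm_topology V S) U"
    proof (cases "F = {}")
      case True then show ?thesis using openin_topspace[of "seminorm_topology V S"] by (simp add: U_def topspace)
    next
      case False
      have "openin (seminorm_topology V S) (\<Inter>p\<in>F. {w \<in> V. p (w - v) < ennreal e})"
      proof (rule openin_INT2[OF F(1) False])
        show "openin (seminorm_topology V S) {w \<in> V. p (w - v) < ennreal e}" if "p \<in> F" for p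
          using openin_ball[of p v e] F v that by blast
      qed
      then show ?thesis
        unfolding U_def using openin_topspace[of "seminorm_topology V S"] by (simp add: openin_Int topspace)
    qed
    moreover have "p (v - v) < ennreal e" if "p \<in> F" for p
      using diff_self[of p v] that F v by auto
    then have "v \<in> U" using v by (auto simp: U_def)
    ultimately obtain w where "w \<in> P" "w \<in> U" using L unfolding in_closure_of by blast
    then show ?thesis by (auto simp: U_def)
  qed
  with v show ?R by simp
next
  assume R: ?R
  then have v: "v \<in> V" and R': "\<And>F e. finite F \<Longrightarrow> F \<subseteq> S \<Longrightarrow> 0 < e \<Longrightarrow>
      \<exists>w\<in>P. w \<in> V \<and> (\<forall>p\<in>F. p (w - v) < ennreal e)" by simp_all
  have "\<exists>y. y \<in> P \<and> y \<in> U" if vU: "v \<in> U" and U: "openin (seminorm_topology V S) U" for U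
  proof -
    obtain F e where "finite F" "F \<subseteq> S" "0 < e" "{w \<in> V. \<forall>p\<in>F. p (w - v) < ennreal e} \<subseteq> U"
      using openin_imp_ball[OF U vU v] by (elim exE conjE)
    moreover from R'[OF this(1-3)] obtain w where "w \<in> P" "w \<in> V" "\<forall>p\<in>F. p (w - v) < ennreal e"
      by (elim bexE conjE)
    ultimately show ?thesis by blast
  qed
  then show ?L unfolding in_closure_of topspace using v by blast
qed

lemma continuous_map_into:
  assumes "f \<in> topspace X \<rightarrow> V"
    and "\<And>x p e. x \<in> topspace X \<Longrightarrow> p \<in> S \<Longrightarrow> 0 < e \<Longrightarrow>
      \<exists>U. openin X U \<and> x \<in> U \<and> (\<forall>y\<in>U. p (f y - f x) < ennreal e)"
  shows "continuous_map X (seminorm_topology V S) f"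
  unfolding seminorm_topology_def
proof (rule continuous_on_generated_topo)
  show "f ` topspace X \<subseteq> \<Union> {{w \<in> V. p (w - v) < ennreal e} |p v e. p \<in> S \<and> v \<in> V \<and> 0 < e}"
  proof -
    have eq: "\<Union> {{w \<in> V. p (w - v) < ennreal e} |p v e. p \<in> S \<and> v \<in> V \<and> 0 < e} = V"
      using topspace unfolding seminorm_topology_def topology_generated_by_topspace .
    show ?thesis unfolding eq using assms(1) by blast
  qed
  fix B assume "B \<in> {{w \<in> V. p (w - v) < ennreal e} |p v e. p \<in> S \<and> v \<in> V \<and> 0 < e}"
  then obtain p v e where B: "B = {w \<in> V. p (w - v) < ennreal e}" "p \<in> S" "v \<in> V" "0 < e" by blast
  show "openin X (f -` B \<inter> topspace X)"
  proof (subst openin_subopen, safe)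
    fix x assume x: "f x \<in> B" "x \<in> topspace X"
    have fx: "f x \<in> V" using assms(1) x(2) by blast
    have "p (f x - v) < ennreal e" using x(1) unfolding B(1) by simp
    from ball_shift[OF B(2) fx B(3) this]
    obtain d where d: "d > 0" "\<And>w. w \<in> V \<Longrightarrow> p (w - f x) < ennreal d \<Longrightarrow> p (w - v) < ennreal e"
      by blast
    obtain U where U: "openin X U" "x \<in> U" "\<forall>y\<in>U. p (f y - f x) < ennreal d"
      using assms(2)[OF x(2) B(2) d(1)] by blast
    have "U \<subseteq> f -` B \<inter> topspace X"
    proof
      fix y assume y: "y \<in> U"
      then have "y \<in> topspace X" using openin_subset[OF U(1)] by blast
      moreover from this have "f y \<in> V" using assms(1) by blast
      moreover have "p (f y - f x) < ennreal d" using U(3) y by blast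
      ultimately show "y \<in> f -` B \<inter> topspace X" using d(2) unfolding B(1) by simp
    qed
    with U show "\<exists>T. openin X T \<and> x \<in> T \<and> T \<subseteq> f -` B \<inter> topspace X" by blast
  qed
qed

end


section \<open>Symmetrically normed ideals\<close>

lemma tuples_D: "b \<in> tuples n V \<Longrightarrow> i < n \<Longrightarrow> b i \<in> V"
  by (auto simp: tuples_def PiE_iff)

context symmetrically_normed_ideal
begin

lemma scaleR_mem: "x \<in> I \<Longrightarrow> r *\<^sub>R x \<in> I"
  using scaleC_mem[of x "complex_of_real r"] by (simp add: scaleC_of_real)

lemma minus_mem: "x \<in> I \<Longrightarrow> - x \<in> I"
  using scaleC_mem[of x "-1"] by (simp add: scaleC_minus_one)

lemma diff_mem: "x \<in> I \<Longrightarrow> y \<in> I \<Longrightarrow> x - y \<in> I"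
  using add_mem[of x "-y"] minus_mem by simp

lemma sum_mem: "(\<And>i. i \<in> A \<Longrightarrow> f i \<in> I) \<Longrightarrow> (\<Sum>i\<in>A. f i) \<in> I"
  by (induction A rule: infinite_finite_induct) (auto simp: zero_mem add_mem)

lemma nI_zero [simp]: "nI 0 = 0"
  using nI_eq_0_iff[OF zero_mem] by simp

lemma nI_minus: "x \<in> I \<Longrightarrow> nI (- x) = nI x"
  using nI_scaleC[of x "-1"] by (simp add: scaleC_minus_one)

lemma nI_scaleR: "x \<in> I \<Longrightarrow> nI (r *\<^sub>R x) = \<bar>r\<bar> * nI x"
  using nI_scaleC[of x "complex_of_real r"] by (simp add: scaleC_of_real)

lemma nI_diff_commute: "x \<in> I \<Longrightarrow> y \<in> I \<Longrightarrow> nI (x - y) = nI (y - x)"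
  using nI_minus[of "x - y"] diff_mem by simp

lemma nI_triangle4: "x \<in> I \<Longrightarrow> y \<in> I \<Longrightarrow> nI (x - y) \<le> nI x + nI y"
  using nI_triangle[of x "- y"] minus_mem nI_minus by simp

lemma nI_triangle3: "x \<in> I \<Longrightarrow> y \<in> I \<Longrightarrow> z \<in> I \<Longrightarrow> nI (x - z) \<le> nI (x - y) + nI (y - z)"
  using nI_triangle[of "x - y" "y - z"] diff_mem by simp

lemma nI_le_add_diff: "x \<in> I \<Longrightarrow> y \<in> I \<Longrightarrow> nI x \<le> nI y + nI (y - x)"
  using nI_triangle4[of y "y - x"] diff_mem by simp

lemma nI_sum: "(\<And>i. i \<in> A \<Longrightarrow> f i \<in> I) \<Longrightarrow> nI (\<Sum>i\<in>A. f i) \<le> (\<Sum>i\<in>A. nI (f i))"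
proof (induction A rule: infinite_finite_induct)
  case (insert x F)
  have "nI (f x + (\<Sum>i\<in>F. f i)) \<le> nI (f x) + nI (\<Sum>i\<in>F. f i)"
    using insert by (intro nI_triangle sum_mem) auto
  with insert show ?case by fastforce
qed auto

lemma norm_le_nI: "x \<in> I \<Longrightarrow> norm x \<le> incl_norm I nI * nI x"
  and incl_norm_nonneg: "0 \<le> incl_norm I nI"
proof -
  obtain C where C: "\<And>r. r \<in> I \<Longrightarrow> norm r \<le> C * nI r" using inclusion_bounded by blast
  have "norm r / nI r \<le> \<bar>C\<bar>" if "r \<in> I" for r
  proof (cases "nI r = 0")
    case False
    then have "0 < nI r" using nI_nonneg[OF that] by simp
    moreover have "C * nI r \<le> \<bar>C\<bar> * nI r" using nI_nonneg[OF that] by (intro mult_right_mono) auto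
    then have "norm r \<le> \<bar>C\<bar> * nI r" using C[OF that] by linarith
    ultimately show ?thesis by (simp add: divide_le_eq)
  qed simp
  then have bdd: "bdd_above ((\<lambda>r. norm r / nI r) ` I)" by (auto intro!: bdd_aboveI)
  have le: "norm x / nI x \<le> incl_norm I nI" if "x \<in> I" for x
    unfolding incl_norm_def by (rule cSUP_upper[OF that bdd])
  show "0 \<le> incl_norm I nI" using le[OF zero_mem] by simp
  show "norm x \<le> incl_norm I nI * nI x" if x: "x \<in> I"
  proof (cases "nI x = 0")
    case True
    then show ?thesis using nI_eq_0_iff[OF x] by simp
  next
    case False
    then have "0 < nI x" using nI_nonneg[OF x] by simp
    then show ?thesis using le[OF x] by (simp add: divide_le_eq)
  qed
qed

lemma prod_nI_nonneg: "b \<in> tuples n I \<Longrightarrow> 0 \<le> (\<Prod>i<n. nI (b i))"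
  using tuples_D by (intro prod_nonneg nI_nonneg ballI) blast

end


section \<open>Norms of multilinear maps\<close>

lemma tuples_upd: "b \<in> tuples n V \<Longrightarrow> i < n \<Longrightarrow> x \<in> V \<Longrightarrow> b(i := x) \<in> tuples n V"
  by (auto simp: tuples_def PiE_iff extensional_def)

lemma tuples_mono: "V \<subseteq> W \<Longrightarrow> b \<in> tuples n V \<Longrightarrow> b \<in> tuples n W"
  by (auto simp: tuples_def PiE_iff)

lemma tuples_restrict: "(\<And>i. i < n \<Longrightarrow> b i \<in> V) \<Longrightarrow> (\<lambda>i\<in>{..<n}. b i) \<in> tuples n V"
  by (auto simp: tuples_def)

lemma multilinear_norm_le:
  assumes "0 \<le> C" "\<And>b. b \<in> tuples n V \<Longrightarrow> nW (S b) \<le> C * (\<Prod>i<n. nV (b i))"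
  shows "multilinear_norm V nV nW n S \<le> C"
  unfolding multilinear_norm_def
  by (rule cInf_lower) (use assms in \<open>auto intro!: bdd_belowI[of _ 0]\<close>)

text \<open>The infimum is attained, also at tuples for which the product of the norms vanishes.\<close>

lemma
  assumes bd: "\<And>b. b \<in> tuples n V \<Longrightarrow> nW (S b) \<le> C * (\<Prod>i<n. nV (b i))"
    and nV: "\<And>v. v \<in> V \<Longrightarrow> 0 \<le> nV v"
  shows multilinear_norm_nonneg: "0 \<le> multilinear_norm V nV nW n S"
    and le_multilinear_norm: "b \<in> tuples n V \<Longrightarrow> nW (S b) \<le> multilinear_norm V nV nW n S * (\<Prod>i<n. nV (b i))"
proof -
  let ?A = "{C. 0 \<le> C \<and> (\<forall>b\<in>tuples n V. nW (S b) \<le> C * (\<Prod>i<n. nV (b i)))}"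
  have nn: "0 \<le> (\<Prod>i<n. nV (b i))" if "b \<in> tuples n V" for b
    using tuples_D[OF that] nV by (intro prod_nonneg) blast
  have "max 0 C \<in> ?A"
  proof -
    have "C * (\<Prod>i<n. nV (b i)) \<le> max 0 C * (\<Prod>i<n. nV (b i))" if "b \<in> tuples n V" for b
      using nn[OF that] by (intro mult_right_mono) auto
    then show ?thesis using bd by fastforce
  qed
  then have ne: "?A \<noteq> {}" by blast
  show "0 \<le> multilinear_norm V nV nW n S"
    unfolding multilinear_norm_def by (rule cInf_greatest[OF ne]) auto
  show "nW (S b) \<le> multilinear_norm V nV nW n S * (\<Prod>i<n. nV (b i))" if b: "b \<in> tuples n V"
  proof (cases "(\<Prod>i<n. nV (b i)) = 0")
    case True
    have "nW (S b) \<le> 0" using bd[OF b] unfolding True by simp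
    then show ?thesis unfolding True by simp
  next
    case False
    then have p: "0 < (\<Prod>i<n. nV (b i))" using nn[OF b] by linarith
    have "nW (S b) / (\<Prod>i<n. nV (b i)) \<le> multilinear_norm V nV nW n S"
      unfolding multilinear_norm_def by (rule cInf_greatest[OF ne]) (use b p in \<open>auto simp: divide_le_eq\<close>)
    then show ?thesis using p by (simp add: divide_le_eq)
  qed
qed

lemma (in symmetrically_normed_ideal) seminorm_space_multilinear:
  assumes VI: "V \<subseteq> I"
  shows "seminorm_space (bounded_multilinear K V nI I nI n) {\<lambda>S. ennreal (multilinear_norm V nI nI n S)}"
proof
  let ?B = "bounded_multilinear K V nI I nI n" and ?N = "multilinear_norm V nI nI n"
  have nV: "0 \<le> nI v" if "v \<in> V" for v using that VI nI_nonneg by auto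
  have mem: "S b \<in> I" if "S \<in> ?B" "b \<in> tuples n V" for S b
    using that by (auto simp: bounded_multilinear_def)
  have nn: "0 \<le> (\<Prod>i<n. nI (b i))" if "b \<in> tuples n V" for b
    using that by (intro prod_nI_nonneg) (rule tuples_mono[OF VI])
  have diff_bd: "\<exists>C. \<forall>b\<in>tuples n V. nI ((S - S') b) \<le> C * (\<Prod>i<n. nI (b i))" if S: "S \<in> ?B" "S' \<in> ?B" for S S'
  proof -
    obtain C C' where "\<forall>b\<in>tuples n V. nI (S b) \<le> C * (\<Prod>i<n. nI (b i))"
      "\<forall>b\<in>tuples n V. nI (S' b) \<le> C' * (\<Prod>i<n. nI (b i))"
      using S by (auto simp: bounded_multilinear_def)
    then have "nI ((S - S') b) \<le> (C + C') * (\<Prod>i<n. nI (b i))" if "b \<in> tuples n V" for b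
      using that nI_triangle4[OF mem[OF S(1) that] mem[OF S(2) that]] by (fastforce simp: distrib_right)
    then show ?thesis by blast
  qed
  fix p assume "p \<in> {\<lambda>S. ennreal (?N S)}"
  then have p: "p = (\<lambda>S. ennreal (?N S))" by simp
  show "p (S - S) = 0" if "S \<in> ?B" for S
  proof -
    have "?N (S - S) \<le> 0" by (rule multilinear_norm_le) simp_all
    then show ?thesis by (simp add: p ennreal_neg)
  qed
  show "p (u - w) \<le> p (u - v) + p (v - w)" if B: "u \<in> ?B" "v \<in> ?B" "w \<in> ?B" for u v w
  proof -
    obtain C1 C2 where C: "\<And>b. b \<in> tuples n V \<Longrightarrow> nI ((u - v) b) \<le> C1 * (\<Prod>i<n. nI (b i))"
      "\<And>b. b \<in> tuples n V \<Longrightarrow> nI ((v - w) b) \<le> C2 * (\<Prod>i<n. nI (b i))"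
      using diff_bd[OF B(1,2)] diff_bd[OF B(2,3)] by blast
    note n0 = multilinear_norm_nonneg[of n V nI "u - v" C1 nI, OF C(1) nV]
      multilinear_norm_nonneg[of n V nI "v - w" C2 nI, OF C(2) nV]
    have "?N (u - w) \<le> ?N (u - v) + ?N (v - w)"
    proof (rule multilinear_norm_le)
      fix b assume b: "b \<in> tuples n V"
      have "nI ((u - w) b) \<le> nI ((u - v) b) + nI ((v - w) b)"
        using nI_triangle3[OF mem[OF B(1) b] mem[OF B(2) b] mem[OF B(3) b]] by simp
      also have "\<dots> \<le> (?N (u - v) + ?N (v - w)) * (\<Prod>i<n. nI (b i))"
        using le_multilinear_norm[of n V nI "u - v" C1 nI, OF C(1) nV b]
          le_multilinear_norm[of n V nI "v - w" C2 nI, OF C(2) nV b] by (simp add: distrib_right)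
      finally show "nI ((u - w) b) \<le> (?N (u - v) + ?N (v - w)) * (\<Prod>i<n. nI (b i))" .
    qed (use n0 in simp)
    then show ?thesis unfolding p using n0 by (simp add: ennreal_plus[symmetric] ennreal_leI del: ennreal_plus)
  qed
qed simp


section \<open>Polynomial lexicographic functional calculus\<close>

text \<open>The \<open>i\<close>-th factor occurs exactly once, which yields linearity in it.\<close>

lemma prod_list_upd_split:
  assumes "i < n"
  shows "prod_list (map (\<lambda>j. A j * (b(i := x)) j) [0..<n]) =
    (prod_list (map (\<lambda>j. A j * b j) [0..<i]) * A i) * x * prod_list (map (\<lambda>j. A j * b j) [Suc i..<n])"
    (is "_ = ?R")
proof -
  have "[0..<n] = [0..<i] @ i # [Suc i..<n]"
    using assms by (metis less_imp_le_nat upt_add_eq_append upt_conv_Cons zero_le add.left_neutral le_add_diff_inverse)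
  moreover have "prod_list (map (\<lambda>j. A j * (b(i := x)) j) [0..<i]) = prod_list (map (\<lambda>j. A j * b j) [0..<i])"
    "prod_list (map (\<lambda>j. A j * (b(i := x)) j) [Suc i..<n]) = prod_list (map (\<lambda>j. A j * b j) [Suc i..<n])"
    by (intro arg_cong[of _ _ prod_list] map_cong; auto)+
  ultimately show ?thesis by (simp add: mult.assoc del: upt_Suc fun_upd_apply) simp
qed

lemma poly_lfc_add:
  assumes "i < m - 1"
  shows "poly_lfc m d c a (b(i := x + y)) = poly_lfc m d c a (b(i := x)) + poly_lfc m d c a (b(i := y))"
  unfolding poly_lfc_def prod_list_upd_split[OF assms] sum.distrib[symmetric]
  by (intro sum.cong) (simp_all add: distrib_left distrib_right scaleC_add_right)

lemma poly_lfc_scaleC: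
  assumes "i < m - 1"
  shows "poly_lfc m d c a (b(i := z *\<^sub>C x)) = z *\<^sub>C poly_lfc m d c a (b(i := x))"
  unfolding poly_lfc_def prod_list_upd_split[OF assms] scaleC_sum_right
  by (intro sum.cong) (simp_all add: mult_scaleC_left mult_scaleC_right scaleC_scaleC mult.commute[of z])

lemma poly_lfc_cong:
  assumes "m \<ge> 1" "\<And>i. i < m \<Longrightarrow> a i = a' i" "\<And>i. i < m - 1 \<Longrightarrow> b i = b' i"
  shows "poly_lfc m d c a b = poly_lfc m d c a' b'"
proof -
  have "map (\<lambda>i. a i ^ \<delta> i * b i) [0..<m-1] = map (\<lambda>i. a' i ^ \<delta> i * b' i) [0..<m-1]" for \<delta>
    using assms by auto
  moreover have "a (m - 1) = a' (m - 1)" using assms by simp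
  ultimately show ?thesis by (simp only: poly_lfc_def)
qed

lemma multi_indices_mono: "d \<le> e \<Longrightarrow> multi_indices m d \<subseteq> multi_indices m e"
  by (auto simp: multi_indices_def)

lemma poly_fun_pad:
  assumes "d \<le> e"
  shows "poly_fun m e (\<lambda>\<delta>. if \<delta> \<in> multi_indices m d then c \<delta> else 0) = poly_fun m d c"
  unfolding poly_fun_def
  by (intro ext restrict_ext sum.mono_neutral_cong_right[OF finite_multi_indices multi_indices_mono[OF assms]]) auto

lemma poly_lfc_pad:
  assumes "d \<le> e"
  shows "poly_lfc m e (\<lambda>\<delta>. if \<delta> \<in> multi_indices m d then c \<delta> else 0) a b = poly_lfc m d c a b"
  unfolding poly_lfc_def
  by (intro sum.mono_neutral_cong_right[OF finite_multi_indices multi_indices_mono[OF assms]]) auto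

text \<open>Coefficients of \<open>z P + Q\<close>; both polynomials are padded with zeros up to the larger degree bound.\<close>

definition comb_coeff :: "nat \<Rightarrow> complex \<Rightarrow> nat \<Rightarrow> ((nat \<Rightarrow> nat) \<Rightarrow> complex) \<Rightarrow> nat \<Rightarrow> ((nat \<Rightarrow> nat) \<Rightarrow> complex)
    \<Rightarrow> (nat \<Rightarrow> nat) \<Rightarrow> complex" where
  "comb_coeff m z d c d' c' = (\<lambda>\<delta>. z * (if \<delta> \<in> multi_indices m d then c \<delta> else 0)
     + (if \<delta> \<in> multi_indices m d' then c' \<delta> else 0))"

lemma poly_fun_linear:
  "poly_fun m (max d d') (comb_coeff m z d c d' c') = (\<lambda>x\<in>Rn m. z * poly_fun m d c x + poly_fun m d' c' x)"
proof -
  let ?p = "\<lambda>d c \<delta>. if \<delta> \<in> multi_indices m d then c \<delta> else (0::complex)"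
  let ?e = "max d d'"
  have "(\<lambda>x\<in>Rn m. z * poly_fun m ?e (?p d c) x + poly_fun m ?e (?p d' c') x)
    = poly_fun m ?e (\<lambda>\<delta>. z * ?p d c \<delta> + ?p d' c' \<delta>)"
    unfolding poly_fun_def
    by (auto simp: sum_distrib_left sum.distrib distrib_right mult.assoc simp del: if_distribR intro!: restrict_ext)
  then show ?thesis
    unfolding comb_coeff_def
    by (simp only: poly_fun_pad[of d ?e] poly_fun_pad[of d' ?e] max.cobounded1 max.cobounded2)
qed

lemma poly_lfc_linear:
  "poly_lfc m (max d d') (comb_coeff m z d c d' c') a b = z *\<^sub>C poly_lfc m d c a b + poly_lfc m d' c' a b"
proof -
  let ?p = "\<lambda>d c \<delta>. if \<delta> \<in> multi_indices m d then c \<delta> else (0::complex)"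
  let ?e = "max d d'"
  have "z *\<^sub>C poly_lfc m ?e (?p d c) a b + poly_lfc m ?e (?p d' c') a b
    = poly_lfc m ?e (\<lambda>\<delta>. z * ?p d c \<delta> + ?p d' c' \<delta>) a b"
    unfolding poly_lfc_def scaleC_sum_right sum.distrib[symmetric]
    by (simp only: scaleC_add_left scaleC_scaleC)
  then show ?thesis
    unfolding comb_coeff_def
    by (simp only: poly_lfc_pad[of d ?e] poly_lfc_pad[of d' ?e] max.cobounded1 max.cobounded2)
qed

lemma norm_mult2_le: "norm x \<le> A \<Longrightarrow> norm y \<le> B \<Longrightarrow> norm (x * y) \<le> A * B" for x y :: "'a::real_normed_algebra"
  using order_trans[OF norm_ge_zero, of x A] by (intro order_trans[OF norm_mult_ineq mult_mono]) auto

lemma norm_mult3_le: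
  "norm x \<le> A \<Longrightarrow> norm y \<le> B \<Longrightarrow> norm z \<le> C \<Longrightarrow> norm (x * y * z) \<le> A * B * C"
  for x y z :: "'a::real_normed_algebra"
  by (intro norm_mult2_le)

lemma power_lipschitz:
  assumes "0 \<le> R"
  shows "\<exists>L\<ge>0. \<forall>x y::'a::cstar_algebra. norm x \<le> R \<longrightarrow> norm y \<le> R \<longrightarrow> norm (x ^ n - y ^ n) \<le> L * norm (x - y)"
proof (induction n)
  case (Suc n)
  then obtain L where L: "L \<ge> 0" "\<And>x y::'a. norm x \<le> R \<Longrightarrow> norm y \<le> R \<Longrightarrow> norm (x ^ n - y ^ n) \<le> L * norm (x - y)"
    by blast
  have "norm (x ^ Suc n - y ^ Suc n) \<le> (R * L + R ^ n) * norm (x - y)" if xy: "norm x \<le> R" "norm y \<le> R" for x y :: 'a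
  proof -
    have "x ^ Suc n - y ^ Suc n = x * (x ^ n - y ^ n) + (x - y) * y ^ n" by (simp add: algebra_simps)
    also have "norm \<dots> \<le> norm x * norm (x ^ n - y ^ n) + norm (x - y) * norm (y ^ n)"
      by (intro order_trans[OF norm_triangle_ineq] add_mono norm_mult_ineq)
    also have "\<dots> \<le> R * (L * norm (x - y)) + norm (x - y) * R ^ n"
      using xy L assms order_trans[OF norm_power_le power_mono, of y R n]
      by (intro add_mono mult_mono) auto
    finally show ?thesis by (simp add: algebra_simps)
  qed
  then show ?case using L assms by (intro exI[of _ "R * L + R ^ n"]) auto
next
  case 0
  show ?case by (intro exI[of _ 0]) simp
qed

context symmetrically_normed_ideal
begin

lemma prod_list_mem:
  assumes "b 0 \<in> I" "0 < n"
  shows "prod_list (map (\<lambda>i. A i * b i) [0..<n]) \<in> I"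
proof -
  have "[0..<n] = 0 # [Suc 0..<n]" using assms upt_conv_Cons by blast
  then show ?thesis using assms by (simp add: mult_left_mem mult_right_mem del: upt_Suc)
qed

lemma poly_lfc_mem:
  assumes "m \<ge> 2" "b \<in> tuples (m - 1) I"
  shows "poly_lfc m d c a b \<in> I"
proof -
  have "b 0 \<in> I" using assms by (auto intro!: tuples_D[of b])
  then show ?thesis
    unfolding poly_lfc_def using assms
    by (intro sum_mem scaleC_mem mult_right_mem prod_list_mem) auto
qed

text \<open>All factors but the last are estimated in the norm of the algebra, which allows the empty product
  as the start of the induction; the last \<open>b i\<close> carries the norm of the ideal.\<close>

lemma lex_product_lipschitz:
  assumes R: "0 \<le> R"
  shows "\<exists>L\<ge>0. \<forall>a a' b t. b \<in> tuples N I \<longrightarrow> (\<forall>i<n. norm (a i) \<le> R \<and> norm (a' i) \<le> R \<and> norm (a' i - a i) \<le> t) \<longrightarrow> 0 \<le> t \<longrightarrow> n \<le> N \<longrightarrow>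
    norm (prod_list (map (\<lambda>i. a i ^ \<delta> i * b i) [0..<n])) \<le> L * (\<Prod>i<n. nI (b i)) \<and>
    norm (prod_list (map (\<lambda>i. a' i ^ \<delta> i * b i) [0..<n]) - prod_list (map (\<lambda>i. a i ^ \<delta> i * b i) [0..<n]))
      \<le> L * t * (\<Prod>i<n. nI (b i))"
proof (induction n)
  case 0
  show ?case by (intro exI[of _ 1]) (auto simp: norm_one_le)
next
  case (Suc n)
  let ?Q = "\<lambda>n a b. prod_list (map (\<lambda>i. a i ^ \<delta> i * b i) [0..<n])"
  let ?P = "\<lambda>n b. \<Prod>i<n. nI (b i)"
  obtain L where L: "L \<ge> 0"
    "\<And>a a' b t. b \<in> tuples N I \<Longrightarrow> (\<And>i. i < n \<Longrightarrow> norm (a i) \<le> R \<and> norm (a' i) \<le> R \<and> norm (a' i - a i) \<le> t) \<Longrightarrow> 0 \<le> t \<Longrightarrow> n \<le> N \<Longrightarrow>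
      norm (?Q n a b) \<le> L * ?P n b \<and> norm (?Q n a' b - ?Q n a b) \<le> L * t * ?P n b"
    using Suc by blast
  obtain K where K: "K \<ge> 0" "\<And>x y::'a. norm x \<le> R \<Longrightarrow> norm y \<le> R \<Longrightarrow> norm (x ^ \<delta> n - y ^ \<delta> n) \<le> K * norm (x - y)"
    using power_lipschitz[OF R, of "\<delta> n"] by blast
  define C where "C = incl_norm I nI"
  have C: "C \<ge> 0" "\<And>x. x \<in> I \<Longrightarrow> norm x \<le> C * nI x" unfolding C_def using incl_norm_nonneg norm_le_nI by auto
  define M where "M = L * R ^ \<delta> n * C + L * K * C"
  have M: "M \<ge> 0" using L K C R by (simp add: M_def)
  have "norm (?Q (Suc n) a b) \<le> M * ?P (Suc n) b \<and>
      norm (?Q (Suc n) a' b - ?Q (Suc n) a b) \<le> M * t * ?P (Suc n) b"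
    if h: "b \<in> tuples N I" "\<forall>i<Suc n. norm (a i) \<le> R \<and> norm (a' i) \<le> R \<and> norm (a' i - a i) \<le> t" "0 \<le> t" "Suc n \<le> N"
    for a a' b t
  proof -
    have bn: "b n \<in> I" using h by (auto intro!: tuples_D[of b])
    have P0: "0 \<le> ?P n b" using h by (intro prod_nonneg) (auto intro!: nI_nonneg tuples_D[of b])
    have Ln: "norm (?Q n a b) \<le> L * ?P n b" "norm (?Q n a' b - ?Q n a b) \<le> L * t * ?P n b"
      using L(2)[of b a a' t] h by auto
    have ap: "norm (a n ^ \<delta> n) \<le> R ^ \<delta> n" "norm (a' n ^ \<delta> n) \<le> R ^ \<delta> n"
      using h order_trans[OF norm_power_le power_mono] by auto
    have ad: "norm (a' n ^ \<delta> n - a n ^ \<delta> n) \<le> K * t"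
      using K h by (intro order_trans[OF K(2)] mult_left_mono) auto
    have nb: "norm (b n) \<le> C * nI (b n)" by (rule C(2)[OF bn])
    have nn: "0 \<le> nI (b n)" by (rule nI_nonneg[OF bn])
    have "norm (?Q n a b * a n ^ \<delta> n * b n) \<le> (L * ?P n b) * R ^ \<delta> n * (C * nI (b n))"
      by (rule norm_mult3_le[OF Ln(1) ap(1) nb])
    also have "\<dots> \<le> (L * ?P n b) * R ^ \<delta> n * (C * nI (b n)) + L * K * C * (?P n b * nI (b n))"
      using L K C P0 nn by simp
    also have "\<dots> = M * ?P (Suc n) b" by (simp add: M_def algebra_simps)
    finally have 1: "norm (?Q (Suc n) a b) \<le> M * ?P (Suc n) b" by (simp add: mult.assoc)
    have eq: "?Q (Suc n) a' b - ?Q (Suc n) a b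
        = (?Q n a' b - ?Q n a b) * a' n ^ \<delta> n * b n + ?Q n a b * (a' n ^ \<delta> n - a n ^ \<delta> n) * b n"
      by (simp add: algebra_simps)
    have "norm (?Q (Suc n) a' b - ?Q (Suc n) a b)
        \<le> (L * t * ?P n b) * R ^ \<delta> n * (C * nI (b n)) + (L * ?P n b) * (K * t) * (C * nI (b n))"
      unfolding eq by (rule order_trans[OF norm_triangle_ineq
            add_mono[OF norm_mult3_le[OF Ln(2) ap(2) nb] norm_mult3_le[OF Ln(1) ad nb]]])
    also have "\<dots> = M * t * ?P (Suc n) b" by (simp add: M_def algebra_simps)
    finally show ?thesis using 1 by blast
  qed
  with M show ?case by blast
qed

text \<open>Continuity on bounded sets, uniformly in \<open>b\<close>. The last direction \<open>b (m - 2)\<close> is flanked by two factors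
  whose Lipschitz estimates hold in the norm of the algebra, and symmetry of the norm of the ideal combines them.\<close>

lemma poly_lfc_lipschitz:
  assumes R: "0 \<le> R" and m: "m \<ge> 2"
  shows "\<exists>L\<ge>0. \<forall>a a' b t. b \<in> tuples (m - 1) I \<longrightarrow>
    (\<forall>i<m. norm (a i) \<le> R \<and> norm (a' i) \<le> R \<and> norm (a' i - a i) \<le> t) \<longrightarrow> 0 \<le> t \<longrightarrow>
    nI (poly_lfc m d c a' b - poly_lfc m d c a b) \<le> L * t * (\<Prod>i<m-1. nI (b i))"
proof -
  \<comment> \<open>The last direction \<open>b n\<close> is singled out: a monomial is \<open>X * b n *
    Y\<close> with \<open>Y\<close> a power of the last argument.\<close>
  define n where "n = m - 2"
  have mn: "m = Suc (Suc n)" using m by (simp add: n_def)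
  let ?Q = "\<lambda>\<delta> n a b. prod_list (map (\<lambda>i. a i ^ \<delta> i * b i) [0..<n])"
  let ?P = "\<lambda>n b. \<Prod>i<n. nI (b i)"
  define lip where "lip \<delta> L \<longleftrightarrow> L \<ge> 0 \<and> (\<forall>a a' b t. b \<in> tuples (Suc n) I \<longrightarrow>
    (\<forall>i<m. norm (a i) \<le> R \<and> norm (a' i) \<le> R \<and> norm (a' i - a i) \<le> t) \<longrightarrow> 0 \<le> t \<longrightarrow>
    nI (?Q \<delta> (Suc n) a' b * a' (Suc n) ^ \<delta> (Suc n) - ?Q \<delta> (Suc n) a b * a (Suc n) ^ \<delta> (Suc n)) \<le> L * t * ?P (Suc n) b)" for \<delta> L
  have mono: "\<exists>L. lip \<delta> L" for \<delta>
  proof -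
    obtain L where L0: "L \<ge> 0" and L1:
      "\<forall>a a' b t. b \<in> tuples (Suc n) I \<longrightarrow> (\<forall>i<n. norm (a i) \<le> R \<and> norm (a' i) \<le> R \<and> norm (a' i - a i) \<le> t) \<longrightarrow> 0 \<le> t \<longrightarrow> n \<le> Suc n \<longrightarrow>
        norm (?Q \<delta> n a b) \<le> L * ?P n b \<and> norm (?Q \<delta> n a' b - ?Q \<delta> n a b) \<le> L * t * ?P n b"
      using lex_product_lipschitz[OF R, of "Suc n" n \<delta>] by blast
    have L: "norm (?Q \<delta> n a b) \<le> L * ?P n b \<and> norm (?Q \<delta> n a' b - ?Q \<delta> n a b) \<le> L * t * ?P n b"
      if "b \<in> tuples (Suc n) I" "\<forall>i<n. norm (a i) \<le> R \<and> norm (a' i) \<le> R \<and> norm (a' i - a i) \<le> t" "0 \<le> t" for a a' b t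
      by (rule L1[THEN spec, THEN spec, THEN spec, THEN spec, THEN mp, THEN mp, THEN mp, THEN mp, OF that]) simp
    have "\<exists>K\<ge>0. \<forall>x y::'a. norm x \<le> R \<longrightarrow> norm y \<le> R \<longrightarrow> norm (x ^ k - y ^ k) \<le> K * norm (x - y)" for k
      by (rule power_lipschitz[OF R])
    then obtain K where K: "\<And>k. K k \<ge> 0" "\<And>k (x::'a) y. norm x \<le> R \<Longrightarrow> norm y \<le> R \<Longrightarrow> norm (x ^ k - y ^ k) \<le> K k * norm (x - y)"
      by metis
    let ?p = "\<delta> n" and ?q = "\<delta> (Suc n)"
    define M where "M = L * R ^ ?p * R ^ ?q + L * K ?p * R ^ ?q + L * R ^ ?p * K ?q"
    have M0: "M \<ge> 0" using L0 K R by (simp add: M_def)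
    have "nI (?Q \<delta> (Suc n) a' b * a' (Suc n) ^ ?q - ?Q \<delta> (Suc n) a b * a (Suc n) ^ ?q) \<le> M * t * ?P (Suc n) b"
      if h: "b \<in> tuples (Suc n) I" "\<forall>i<m. norm (a i) \<le> R \<and> norm (a' i) \<le> R \<and> norm (a' i - a i) \<le> t" "0 \<le> t"
      for a a' b t
    proof -
      have bn: "b n \<in> I" using h by (auto intro!: tuples_D[of b])
      have nn: "0 \<le> nI (b n)" by (rule nI_nonneg[OF bn])
      have P0: "0 \<le> ?P n b" using h by (intro prod_nonneg) (auto intro!: nI_nonneg tuples_D[of b])
      have Ln: "norm (?Q \<delta> n a b) \<le> L * ?P n b" "norm (?Q \<delta> n a' b - ?Q \<delta> n a b) \<le> L * t * ?P n b"
        using L[of b a a' t] h by (auto simp: mn)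
      have ap: "norm (a i ^ k) \<le> R ^ k" "norm (a' i ^ k) \<le> R ^ k" if "i < m" for i k
        using h that order_trans[OF norm_power_le power_mono] by auto
      have ad: "norm (a' i ^ k - a i ^ k) \<le> K k * t" if "i < m" for i k
        using K h that by (intro order_trans[OF K(2)] mult_left_mono) auto
      define X X' Y Y' where "X = ?Q \<delta> n a b * a n ^ ?p" and "X' = ?Q \<delta> n a' b * a' n ^ ?p"
        and "Y = a (Suc n) ^ ?q" and "Y' = a' (Suc n) ^ ?q"
      have X: "norm X \<le> L * ?P n b * R ^ ?p"
        unfolding X_def by (rule norm_mult2_le[OF Ln(1) ap(1)]) (simp add: mn)
      have eqX: "X' - X = (?Q \<delta> n a' b - ?Q \<delta> n a b) * a' n ^ ?p + ?Q \<delta> n a b * (a' n ^ ?p - a n ^ ?p)"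
        by (simp add: X_def X'_def algebra_simps)
      have X': "norm (X' - X) \<le> L * t * ?P n b * R ^ ?p + L * ?P n b * (K ?p * t)"
        unfolding eqX by (rule order_trans[OF norm_triangle_ineq add_mono
              [OF norm_mult2_le[OF Ln(2) ap(2)] norm_mult2_le[OF Ln(1) ad]]]) (simp_all add: mn)

      have Y: "norm Y' \<le> R ^ ?q" "norm (Y' - Y) \<le> K ?q * t"
        using ap[of "Suc n"] ad[of "Suc n"] by (auto simp: Y_def Y'_def mn)
      have mem: "(X' - X) * b n * Y' \<in> I" "X * b n * (Y' - Y) \<in> I"
        using bn by (auto intro: mult_left_mem mult_right_mem)
      have eq: "?Q \<delta> (Suc n) a' b * a' (Suc n) ^ ?q - ?Q \<delta> (Suc n) a b * a (Suc n) ^ ?q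
          = (X' - X) * b n * Y' + X * b n * (Y' - Y)"
        by (simp add: X_def X'_def Y_def Y'_def algebra_simps)
      have "nI (?Q \<delta> (Suc n) a' b * a' (Suc n) ^ ?q - ?Q \<delta> (Suc n) a b * a (Suc n) ^ ?q)
          \<le> norm (X' - X) * nI (b n) * norm Y' + norm X * nI (b n) * norm (Y' - Y)"
        unfolding eq using nI_triangle[OF mem] nI_symmetric[OF bn, of "X' - X" Y'] nI_symmetric[OF bn, of X "Y' - Y"] by linarith
      also have "\<dots> \<le> (L * t * ?P n b * R ^ ?p + L * ?P n b * (K ?p * t)) * nI (b n) * R ^ ?q
          + (L * ?P n b * R ^ ?p) * nI (b n) * (K ?q * t)"
        using X X' Y nn L0 K R P0 h(3) by (intro add_mono mult_mono) auto
      also have "\<dots> = M * t * ?P (Suc n) b" by (simp add: M_def algebra_simps)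
      finally show ?thesis .
    qed
    with M0 show ?thesis unfolding lip_def by blast
  qed
  then obtain L where lipL: "\<And>\<delta>. lip \<delta> (L \<delta>)" by metis
  have L: "L \<delta> \<ge> 0" for \<delta> using lipL unfolding lip_def by blast
  have L2: "nI (?Q \<delta> (Suc n) a' b * a' (Suc n) ^ \<delta> (Suc n) - ?Q \<delta> (Suc n) a b * a (Suc n) ^ \<delta> (Suc n)) \<le> L \<delta> * t * ?P (Suc n) b"
    if "b \<in> tuples (Suc n) I" "\<forall>i<m. norm (a i) \<le> R \<and> norm (a' i) \<le> R \<and> norm (a' i - a i) \<le> t" "0 \<le> t"
    for \<delta> a a' b t
    by (rule lipL[unfolded lip_def, THEN conjunct2, THEN spec, THEN spec, THEN spec, THEN spec, THEN mp, THEN mp, THEN mp, OF that])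
  define M where "M = (\<Sum>\<delta>\<in>multi_indices m d. cmod (c \<delta>) * L \<delta>)"
  have "nI (poly_lfc m d c a' b - poly_lfc m d c a b) \<le> M * t * (\<Prod>i<m-1. nI (b i))"
    if h: "b \<in> tuples (m - 1) I" "\<forall>i<m. norm (a i) \<le> R \<and> norm (a' i) \<le> R \<and> norm (a' i - a i) \<le> t" "0 \<le> t"
    for a a' b t
  proof -
    have b0: "b 0 \<in> I" using h by (auto intro!: tuples_D[of b] simp: mn)
    let ?D = "\<lambda>\<delta>. ?Q \<delta> (Suc n) a' b * a' (Suc n) ^ \<delta> (Suc n) - ?Q \<delta> (Suc n) a b * a (Suc n) ^ \<delta> (Suc n)"
    have mem: "?D \<delta> \<in> I" for \<delta>
      using b0 by (intro diff_mem mult_right_mem prod_list_mem) auto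
    have "poly_lfc m d c a' b - poly_lfc m d c a b = (\<Sum>\<delta>\<in>multi_indices m d. c \<delta> *\<^sub>C ?D \<delta>)"
      by (simp add: poly_lfc_def mn sum_subtractf scaleC_diff_right del: upt_Suc)
    then have "nI (poly_lfc m d c a' b - poly_lfc m d c a b) \<le> (\<Sum>\<delta>\<in>multi_indices m d. nI (c \<delta> *\<^sub>C ?D \<delta>))"
      by (simp only:) (intro nI_sum scaleC_mem mem)
    also have "\<dots> \<le> (\<Sum>\<delta>\<in>multi_indices m d. cmod (c \<delta>) * (L \<delta> * t * ?P (Suc n) b))"
    proof (rule sum_mono)
      fix \<delta>
      have b: "b \<in> tuples (Suc n) I" using h(1) by (simp add: mn)
      show "nI (c \<delta> *\<^sub>C ?D \<delta>) \<le> cmod (c \<delta>) * (L \<delta> * t * ?P (Suc n) b)"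
        unfolding nI_scaleC[OF mem] by (rule mult_left_mono[OF L2[OF b h(2,3)] norm_ge_zero])
    qed
    also have "\<dots> = M * t * (\<Prod>i<m-1. nI (b i))" by (simp add: M_def mn sum_distrib_right mult.assoc)
    finally show ?thesis .
  qed
  moreover have "M \<ge> 0" using L by (simp add: M_def sum_nonneg)
  ultimately show ?thesis by blast
qed

end

section \<open>Families of norms and their function spaces\<close>

lemma cube_subset_Rn: "cube r m \<subseteq> Rn m"
  unfolding cube_def using tuples_mono[of "{-r..r}" UNIV] by blast

lemma fam_norm_cong: "(\<And>x. x \<in> cube r m \<Longrightarrow> \<phi> x = \<psi> x) \<Longrightarrow> fam_norm \<alpha> r m \<phi> = fam_norm \<alpha> r m \<psi>"
  unfolding fam_norm_def by (metis restrict_ext)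

lemma cfun_continuous_on_cube: "\<phi> \<in> cfun (Rn m) \<Longrightarrow> continuous_on (cube r m) \<phi>"
  unfolding cfun_def using continuous_on_subset cube_subset_Rn by blast

locale norm_fam_setting =
  fixes \<alpha> :: norm_fam
  assumes fam: "norm_family \<alpha>"
begin

context
  fixes r :: real and m :: nat
  assumes r: "0 < r" and m: "1 \<le> m"
begin

lemma possibly_infinite_norm_at: "possibly_infinite_norm (cube r m) (\<alpha> r m)"
  using fam r m unfolding norm_family_def by blast

lemma fam_norm_scale:
  assumes "continuous_on (cube r m) \<phi>"
  shows "fam_norm \<alpha> r m (\<lambda>x. c * \<phi> x) = ennreal (cmod c) * fam_norm \<alpha> r m \<phi>"
proof -
  have "restrict \<phi> (cube r m) \<in> cfun (cube r m)" using assms by (simp add: cfun_def)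
  then have "\<alpha> r m (\<lambda>x\<in>cube r m. c * restrict \<phi> (cube r m) x) = ennreal (cmod c) * \<alpha> r m (restrict \<phi> (cube r m))"
    using possibly_infinite_norm_at unfolding possibly_infinite_norm_def by blast
  moreover have "(\<lambda>x\<in>cube r m. c * restrict \<phi> (cube r m) x) = restrict (\<lambda>x. c * \<phi> x) (cube r m)" by auto
  ultimately show ?thesis by (simp add: fam_norm_def)
qed

lemma fam_norm_add:
  assumes "continuous_on (cube r m) \<phi>" "continuous_on (cube r m) \<psi>"
  shows "fam_norm \<alpha> r m (\<lambda>x. \<phi> x + \<psi> x) \<le> fam_norm \<alpha> r m \<phi> + fam_norm \<alpha> r m \<psi>"
proof -
  have "restrict \<phi> (cube r m) \<in> cfun (cube r m)" "restrict \<psi> (cube r m) \<in> cfun (cube r m)"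
    using assms by (simp_all add: cfun_def)
  then have "\<alpha> r m (\<lambda>x\<in>cube r m. restrict \<phi> (cube r m) x + restrict \<psi> (cube r m) x)
      \<le> \<alpha> r m (restrict \<phi> (cube r m)) + \<alpha> r m (restrict \<psi> (cube r m))"
    using possibly_infinite_norm_at unfolding possibly_infinite_norm_def by blast
  moreover have "(\<lambda>x\<in>cube r m. restrict \<phi> (cube r m) x + restrict \<psi> (cube r m) x)
      = restrict (\<lambda>x. \<phi> x + \<psi> x) (cube r m)" by auto
  ultimately show ?thesis by (simp add: fam_norm_def)
qed

lemma fam_norm_zero: "fam_norm \<alpha> r m (\<lambda>x. 0) = 0"
  using fam_norm_scale[of "\<lambda>x. 0" 0] by simp

lemma fam_norm_diff_self: "fam_norm \<alpha> r m (\<phi> - \<phi>) = 0"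
  using fam_norm_zero by (simp add: fun_diff_def)

lemma fam_norm_diff_commute:
  assumes "continuous_on (cube r m) \<phi>" "continuous_on (cube r m) \<psi>"
  shows "fam_norm \<alpha> r m (\<phi> - \<psi>) = fam_norm \<alpha> r m (\<psi> - \<phi>)"
proof -
  have "continuous_on (cube r m) (\<lambda>x. \<psi> x - \<phi> x)" using assms by (intro continuous_on_diff)
  from fam_norm_scale[OF this, of "-1"] show ?thesis by (simp add: fun_diff_def)
qed

lemma fam_norm_triangle:
  assumes "continuous_on (cube r m) \<phi>" "continuous_on (cube r m) \<psi>" "continuous_on (cube r m) \<theta>"
  shows "fam_norm \<alpha> r m (\<phi> - \<theta>) \<le> fam_norm \<alpha> r m (\<phi> - \<psi>) + fam_norm \<alpha> r m (\<psi> - \<theta>)"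
proof -
  have "continuous_on (cube r m) (\<lambda>x. \<phi> x - \<psi> x)" "continuous_on (cube r m) (\<lambda>x. \<psi> x - \<theta> x)"
    using assms by (auto intro: continuous_on_diff)
  from fam_norm_add[OF this] show ?thesis by (simp add: fun_diff_def)
qed

lemma fam_norm_le_add_diff:
  assumes "continuous_on (cube r m) \<phi>" "continuous_on (cube r m) \<psi>"
  shows "fam_norm \<alpha> r m \<psi> \<le> fam_norm \<alpha> r m \<phi> + fam_norm \<alpha> r m (\<phi> - \<psi>)"
proof -
  have "continuous_on (cube r m) (\<lambda>x. \<psi> x - \<phi> x)" using assms by (intro continuous_on_diff)
  from fam_norm_add[OF assms(1) this] have "fam_norm \<alpha> r m \<psi> \<le> fam_norm \<alpha> r m \<phi> + fam_norm \<alpha> r m (\<psi> - \<phi>)"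
    by (simp add: fun_diff_def)
  then show ?thesis using fam_norm_diff_commute[OF assms] by simp
qed

end

lemma seminorm_space_finite_norm_funs:
  assumes m: "1 \<le> m"
  shows "seminorm_space (finite_norm_funs \<alpha> m) {fam_norm \<alpha> r m |r. 0 < r}"
proof
  show "{fam_norm \<alpha> r m |r. 0 < r} \<noteq> {}" using zero_less_one by blast
  fix p assume "p \<in> {fam_norm \<alpha> r m |r. 0 < r}"
  then obtain r where p: "p = fam_norm \<alpha> r m" "0 < r" by blast
  show "p (v - v) = 0" for v unfolding p(1) by (rule fam_norm_diff_self[OF p(2) m])
  show "p (u - w) \<le> p (u - v) + p (v - w)"
    if "u \<in> finite_norm_funs \<alpha> m" "v \<in> finite_norm_funs \<alpha> m" "w \<in> finite_norm_funs \<alpha> m" for u v w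
    unfolding p(1) using that
    by (intro fam_norm_triangle[OF p(2) m] cfun_continuous_on_cube) (auto simp: finite_norm_funs_def)
qed

text \<open>The norms for different radii are not assumed to be comparable. Hence an approximating polynomial has to be
  chosen for finitely many radii at once.\<close>

lemma C_alpha_iff:
  assumes m: "1 \<le> m" and fin: "finite_on_polynomials \<alpha>"
  shows "\<phi> \<in> C_alpha \<alpha> m \<longleftrightarrow> \<phi> \<in> finite_norm_funs \<alpha> m \<and>
    (\<forall>R e. finite R \<and> R \<subseteq> {0<..} \<and> 0 < e \<longrightarrow>
      (\<exists>d c. \<forall>r\<in>R. fam_norm \<alpha> r m (\<phi> - poly_fun m d c) < ennreal e))"
    (is "?L \<longleftrightarrow> ?V \<and> ?R")
proof -
  let ?S = "{fam_norm \<alpha> r m |r. 0 < r}"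
  have S_eq: "?S = (\<lambda>r. fam_norm \<alpha> r m) ` {0<..}" by auto
  have sym: "fam_norm \<alpha> r m (\<phi> - poly_fun m d c) = fam_norm \<alpha> r m (poly_fun m d c - \<phi>)"
    if "\<phi> \<in> finite_norm_funs \<alpha> m" "0 < r" for r d c
    using that by (intro fam_norm_diff_commute[OF _ m] cfun_continuous_on_cube poly_fun_in_cfun)
      (auto simp: finite_norm_funs_def)
  have poly: "poly_fun m d c \<in> finite_norm_funs \<alpha> m" for d c
    using fin m unfolding finite_on_polynomials_def poly_funs_def by blast
  have "?L \<longleftrightarrow> ?V \<and> (\<forall>F e. finite F \<and> F \<subseteq> ?S \<and> 0 < e \<longrightarrow>
      (\<exists>w\<in>poly_funs m. w \<in> finite_norm_funs \<alpha> m \<and> (\<forall>p\<in>F. p (w - \<phi>) < ennreal e)))"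
    unfolding C_alpha_def finite_norm_topology_def
    by (rule seminorm_space.closure_of_iff[OF seminorm_space_finite_norm_funs[OF m]])
  also have "\<dots> \<longleftrightarrow> ?V \<and> ?R"
  proof (rule conj_cong[OF refl])
    assume V: ?V
    show "(\<forall>F e. finite F \<and> F \<subseteq> ?S \<and> 0 < e \<longrightarrow>
      (\<exists>w\<in>poly_funs m. w \<in> finite_norm_funs \<alpha> m \<and> (\<forall>p\<in>F. p (w - \<phi>) < ennreal e))) \<longleftrightarrow> ?R" (is "?A \<longleftrightarrow> _")
    proof
      assume A: ?A
      show ?R
      proof (intro allI impI)
        fix R :: "real set" and e :: real assume R: "finite R \<and> R \<subseteq> {0<..} \<and> 0 < e"
        then have "finite ((\<lambda>r. fam_norm \<alpha> r m) ` R) \<and> (\<lambda>r. fam_norm \<alpha> r m) ` R \<subseteq> ?S \<and> 0 < e"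
          unfolding S_eq by blast
        with A obtain w where w: "w \<in> poly_funs m" "\<forall>p\<in>(\<lambda>r. fam_norm \<alpha> r m) ` R. p (w - \<phi>) < ennreal e"
          by meson
        from w(1) obtain d c where w_eq: "w = poly_fun m d c" unfolding poly_funs_def by blast
        have "fam_norm \<alpha> r m (\<phi> - poly_fun m d c) < ennreal e" if "r \<in> R" for r
        proof -
          have "0 < r" using R that by auto
          then show ?thesis using w(2) that sym[OF V] unfolding w_eq by simp
        qed
        then show "\<exists>d c. \<forall>r\<in>R. fam_norm \<alpha> r m (\<phi> - poly_fun m d c) < ennreal e" by blast
      qed
    next
      assume R: ?R
      show ?A
      proof (intro allI impI)
        fix F and e :: real assume F: "finite F \<and> F \<subseteq> ?S \<and> 0 < e"
        then obtain R where R1: "R \<subseteq> {0<..}" "finite R" "F = (\<lambda>r. fam_norm \<alpha> r m) ` R"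
          unfolding S_eq using finite_subset_image[of F "\<lambda>r. fam_norm \<alpha> r m" "{0<..}"] by metis
        then obtain d c where dc: "\<forall>r\<in>R. fam_norm \<alpha> r m (\<phi> - poly_fun m d c) < ennreal e"
          using R F by meson
        have "p (poly_fun m d c - \<phi>) < ennreal e" if pF: "p \<in> F" for p
        proof -
          obtain r where r: "r \<in> R" "p = fam_norm \<alpha> r m" using pF R1(3) by blast
          then have "0 < r" using R1(1) by auto
          then show ?thesis unfolding r(2) sym[OF V \<open>0 < r\<close>, symmetric] using dc r(1) by blast
        qed
        moreover have "poly_fun m d c \<in> poly_funs m" unfolding poly_funs_def by blast
        ultimately show "\<exists>w\<in>poly_funs m. w \<in> finite_norm_funs \<alpha> m \<and> (\<forall>p\<in>F. p (w - \<phi>) < ennreal e)"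
          using poly by blast
      qed
    qed
  qed
  finally show ?thesis .
qed

lemma C_alpha_approx:
  assumes "1 \<le> m" "finite_on_polynomials \<alpha>" "\<phi> \<in> C_alpha \<alpha> m" "finite R" "R \<subseteq> {0<..}" "0 < e"
  obtains d c where "\<And>r. r \<in> R \<Longrightarrow> fam_norm \<alpha> r m (\<phi> - poly_fun m d c) < ennreal e"
  using assms(3-6) unfolding C_alpha_iff[OF assms(1,2)] by meson

lemma C_alpha_continuous:
  assumes "1 \<le> m" "finite_on_polynomials \<alpha>" "\<phi> \<in> C_alpha \<alpha> m"
  shows "\<phi> \<in> cfun (Rn m)" "continuous_on (cube r m) \<phi>"
proof -
  show "\<phi> \<in> cfun (Rn m)" using assms(3) unfolding C_alpha_iff[OF assms(1,2)] finite_norm_funs_def by simp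
  then show "continuous_on (cube r m) \<phi>" by (rule cfun_continuous_on_cube)
qed

lemma poly_fun_in_C_alpha:
  assumes "1 \<le> m" "finite_on_polynomials \<alpha>"
  shows "poly_fun m d c \<in> C_alpha \<alpha> m"
  unfolding C_alpha_iff[OF assms]
proof (intro conjI allI impI)
  show "poly_fun m d c \<in> finite_norm_funs \<alpha> m"
    using assms unfolding finite_on_polynomials_def poly_funs_def by blast
  fix R :: "real set" and e :: real assume R: "finite R \<and> R \<subseteq> {0<..} \<and> 0 < e"
  have "fam_norm \<alpha> r m (poly_fun m d c - poly_fun m d c) < ennreal e" if "r \<in> R" for r
    using R that fam_norm_diff_self[of r m "poly_fun m d c"] assms(1) by auto
  then show "\<exists>d' c'. \<forall>r\<in>R. fam_norm \<alpha> r m (poly_fun m d c - poly_fun m d' c') < ennreal e" by blast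
qed

lemma fam_norm_linear_lt:
  assumes m: "1 \<le> m" and r: "0 < r" and e: "0 < e"
    and c: "continuous_on (cube r m) u" "continuous_on (cube r m) v"
    and uv: "fam_norm \<alpha> r m u < ennreal (e / (2 * (cmod z + 1)))" "fam_norm \<alpha> r m v < ennreal (e / (2 * (cmod z + 1)))"
  shows "fam_norm \<alpha> r m (\<lambda>x. z * u x + v x) < ennreal e"
proof -
  let ?e = "e / (2 * (cmod z + 1))"
  have pos: "0 < 2 * (cmod z + 1)" by (simp add: add_nonneg_pos)
  have e0: "0 \<le> ?e" using e pos by simp
  have "fam_norm \<alpha> r m (\<lambda>x. z * u x + v x) \<le> fam_norm \<alpha> r m (\<lambda>x. z * u x) + fam_norm \<alpha> r m v"
    by (rule fam_norm_add[OF r m continuous_on_mult[OF continuous_on_const c(1)] c(2)])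
  also have "fam_norm \<alpha> r m (\<lambda>x. z * u x) = ennreal (cmod z) * fam_norm \<alpha> r m u"
    by (rule fam_norm_scale[OF r m c(1)])
  also have "ennreal (cmod z) * fam_norm \<alpha> r m u + fam_norm \<alpha> r m v \<le> ennreal (cmod z) * ennreal ?e + ennreal ?e"
    using uv by (intro add_mono mult_left_mono) auto
  also have "\<dots> = ennreal (cmod z * ?e + ?e)"
  proof -
    have "ennreal (cmod z) * ennreal t + ennreal t = ennreal (cmod z * t + t)" if "0 \<le> t" for t
      using that by (simp add: ennreal_mult)
    from this[OF e0] show ?thesis .
  qed
  also have "cmod z * ?e + ?e = (cmod z + 1) * e / (2 * (cmod z + 1))" by (simp add: algebra_simps add_divide_distrib)
  also have "\<dots> = e / 2"
  proof -
    have "c * e / (2 * c) = e / 2" if "c \<noteq> 0" for c :: real using that by simp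
    moreover have "cmod z + 1 \<noteq> 0" using norm_ge_zero[of z] by linarith
    ultimately show ?thesis .
  qed
  also have "ennreal (e / 2) < ennreal e" using e by (intro ennreal_lessI) auto
  finally show ?thesis .
qed

lemma C_alpha_linear:
  assumes m: "1 \<le> m" and fin: "finite_on_polynomials \<alpha>"
    and \<phi>: "\<phi> \<in> C_alpha \<alpha> m" and \<psi>: "\<psi> \<in> C_alpha \<alpha> m"
  shows "(\<lambda>x\<in>Rn m. z * \<phi> x + \<psi> x) \<in> C_alpha \<alpha> m"
proof -
  note c\<phi> = C_alpha_continuous[OF m fin \<phi>] and c\<psi> = C_alpha_continuous[OF m fin \<psi>]
  let ?L = "\<lambda>x\<in>Rn m. z * \<phi> x + \<psi> x"
  have cf: "?L \<in> cfun (Rn m)"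
    using c\<phi>(1) c\<psi>(1) unfolding cfun_def by (auto intro!: continuous_intros)
  have L: "fam_norm \<alpha> r m ?L = fam_norm \<alpha> r m (\<lambda>x. z * \<phi> x + \<psi> x)" for r
    by (rule fam_norm_cong) (use cube_subset_Rn in auto)
  have "fam_norm \<alpha> r m ?L < \<infinity>" if r: "0 < r" for r
  proof -
    have f: "fam_norm \<alpha> r m \<phi> < \<infinity>" "fam_norm \<alpha> r m \<psi> < \<infinity>"
      using \<phi> \<psi> r unfolding C_alpha_iff[OF m fin] finite_norm_funs_def by auto
    have "fam_norm \<alpha> r m ?L \<le> fam_norm \<alpha> r m (\<lambda>x. z * \<phi> x) + fam_norm \<alpha> r m \<psi>"
      unfolding L by (rule fam_norm_add[OF r m continuous_on_mult[OF continuous_on_const c\<phi>(2)] c\<psi>(2)])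
    also have "fam_norm \<alpha> r m (\<lambda>x. z * \<phi> x) = ennreal (cmod z) * fam_norm \<alpha> r m \<phi>"
      by (rule fam_norm_scale[OF r m c\<phi>(2)])
    also have "ennreal (cmod z) * fam_norm \<alpha> r m \<phi> + fam_norm \<alpha> r m \<psi> < \<infinity>"
      using f by (simp add: ennreal_mult_less_top)
    finally show ?thesis .
  qed
  then have 1: "?L \<in> finite_norm_funs \<alpha> m" using cf unfolding finite_norm_funs_def by blast
  have "\<exists>d c. \<forall>r\<in>R. fam_norm \<alpha> r m (?L - poly_fun m d c) < ennreal e"
    if R: "finite R" "R \<subseteq> {0<..}" "0 < e" for R e
  proof -
    have e': "0 < e / (2 * (cmod z + 1))" using R(3) by (simp add: add_nonneg_pos)
    obtain d1 c1 where 1: "\<And>r. r \<in> R \<Longrightarrow> fam_norm \<alpha> r m (\<phi> - poly_fun m d1 c1) < ennreal (e / (2 * (cmod z + 1)))"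
      using C_alpha_approx[OF m fin \<phi> R(1,2) e'] by blast
    obtain d2 c2 where 2: "\<And>r. r \<in> R \<Longrightarrow> fam_norm \<alpha> r m (\<psi> - poly_fun m d2 c2) < ennreal (e / (2 * (cmod z + 1)))"
      using C_alpha_approx[OF m fin \<psi> R(1,2) e'] by blast
    define d c where "d = max d1 d2" and "c = comb_coeff m z d1 c1 d2 c2"
    have dc: "poly_fun m d c = (\<lambda>x\<in>Rn m. z * poly_fun m d1 c1 x + poly_fun m d2 c2 x)"
      unfolding d_def c_def by (rule poly_fun_linear)
    have "fam_norm \<alpha> r m (?L - poly_fun m d c) < ennreal e" if "r \<in> R" for r
    proof -
      have r: "0 < r" using R that by auto
      have "fam_norm \<alpha> r m (?L - poly_fun m d c)
          = fam_norm \<alpha> r m (\<lambda>x. z * (\<phi> - poly_fun m d1 c1) x + (\<psi> - poly_fun m d2 c2) x)"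
        using cube_subset_Rn[of r m] by (intro fam_norm_cong) (auto simp: dc algebra_simps)
      also have "\<dots> < ennreal e"
      proof (rule fam_norm_linear_lt[OF m r R(3) _ _ 1[OF that] 2[OF that]])
        show "continuous_on (cube r m) (\<phi> - poly_fun m d1 c1)" "continuous_on (cube r m) (\<psi> - poly_fun m d2 c2)"
          unfolding fun_diff_def
          by (intro continuous_on_diff c\<phi> c\<psi> cfun_continuous_on_cube[OF poly_fun_in_cfun])+
      qed
      finally show ?thesis .
    qed
    then show ?thesis by blast
  qed
  with 1 show ?thesis unfolding C_alpha_iff[OF m fin] by blast
qed

end


section \<open>The lexicographic functional calculus as a limit\<close>

locale lfc_setting = symmetrically_normed_ideal I nI + norm_fam_setting \<alpha>
  for I :: "'a::cstar_algebra set" and nI \<alpha> +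
  assumes ctrl: "controls_polynomial_lfc \<alpha> I nI"
begin

abbreviation C where "C \<equiv> incl_norm I nI"

lemma fin: "finite_on_polynomials \<alpha>"
  using ctrl unfolding controls_polynomial_lfc_def by blast

lemma C_power_nonneg: "0 \<le> C ^ n"
  using incl_norm_nonneg by simp

lemma eq_zero_if_nI_small:
  assumes "x \<in> I" "\<And>e. 0 < e \<Longrightarrow> nI x \<le> e * K" "0 \<le> K"
  shows "x = 0"
proof -
  have "nI x \<le> 0 + e" if "0 < e" for e
  proof -
    have "nI x \<le> e / (K + 1) * K" using assms(2)[of "e / (K + 1)"] that assms(3) by simp
    also have "\<dots> \<le> e" using that assms(3) by (simp add: divide_le_eq)
    finally show ?thesis by simp
  qed
  then have "nI x \<le> 0" by (rule field_le_epsilon)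
  then show ?thesis using nI_nonneg[OF assms(1)] nI_eq_0_iff[OF assms(1)] by simp
qed

lemma tuples_ball_exists:
  assumes "a \<in> tuples m selfadjoint"
  obtains r where "0 < r" "a \<in> tuples m (selfadjoint_ball r)"
proof -
  define r where "r = 1 + (\<Sum>i<m. norm (a i))"
  have "norm (a i) \<le> r" if "i < m" for i
    using that member_le_sum[of i "{..<m}" "\<lambda>i. norm (a i)"] by (simp add: r_def)
  moreover have "0 < r" by (simp add: r_def add_pos_nonneg sum_nonneg)
  ultimately show thesis
    using that[of r] assms by (auto simp: tuples_def selfadjoint_ball_def PiE_iff)
qed

lemma tuples_ball_selfadjoint: "a \<in> tuples m (selfadjoint_ball r) \<Longrightarrow> a \<in> tuples m selfadjoint"
  by (rule tuples_mono[rotated]) (auto simp: selfadjoint_ball_def)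

text \<open>The control inequality, in real numbers.\<close>

lemma poly_lfc_bound:
  assumes m: "2 \<le> m" and r: "0 < r" and a: "a \<in> tuples m (selfadjoint_ball r)" and b: "b \<in> tuples (m - 1) I"
    and A: "fam_norm \<alpha> r m (poly_fun m d c) \<le> ennreal A" "0 \<le> A"
  shows "nI (poly_lfc m d c a b) \<le> C ^ (m - 2) * A * (\<Prod>i<m-1. nI (b i))"
proof -
  have P: "0 \<le> (\<Prod>i<m-1. nI (b i))" by (rule prod_nI_nonneg[OF b])
  have "ennreal (nI (poly_lfc m d c a b))
      \<le> (SUP a\<in>tuples m (selfadjoint_ball r). ennreal (nI (poly_lfc m d c a b)))"
    by (rule SUP_upper[OF a])
  also have "\<dots> \<le> ennreal (C ^ (m-2)) * fam_norm \<alpha> r m (poly_fun m d c) * ennreal (\<Prod>i<m-1. nI (b i))"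
    using ctrl m b r unfolding controls_polynomial_lfc_def by blast
  also have "\<dots> \<le> ennreal (C ^ (m-2)) * ennreal A * ennreal (\<Prod>i<m-1. nI (b i))"
    by (intro mult_right_mono mult_left_mono A) simp_all
  also have "\<dots> = ennreal (C ^ (m - 2) * A * (\<Prod>i<m-1. nI (b i)))"
    using A(2) P C_power_nonneg[of "m - 2"] by (simp add: ennreal_mult)
  finally show ?thesis
    using A(2) P C_power_nonneg[of "m - 2"] by (subst (asm) ennreal_le_iff) auto
qed

lemma poly_lfc_diff_bound:
  assumes m: "2 \<le> m" and r: "0 < r" and a: "a \<in> tuples m (selfadjoint_ball r)" and b: "b \<in> tuples (m - 1) I"
    and A: "fam_norm \<alpha> r m (poly_fun m d c - poly_fun m d' c') \<le> ennreal A" "0 \<le> A"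
  shows "nI (poly_lfc m d c a b - poly_lfc m d' c' a b) \<le> C ^ (m - 2) * A * (\<Prod>i<m-1. nI (b i))"
proof -
  define e c'' where "e = max d' d" and "c'' = comb_coeff m (-1) d' c' d c"
  have p: "poly_fun m e c'' = (\<lambda>x\<in>Rn m. (-1) * poly_fun m d' c' x + poly_fun m d c x)"
    "\<And>a b :: nat \<Rightarrow> 'a. poly_lfc m e c'' a b = (-1) *\<^sub>C poly_lfc m d' c' a b + poly_lfc m d c a b"
    unfolding e_def c''_def by (rule poly_fun_linear poly_lfc_linear)+
  have "fam_norm \<alpha> r m (poly_fun m e c'') = fam_norm \<alpha> r m (poly_fun m d c - poly_fun m d' c')"
    using cube_subset_Rn[of r m] by (intro fam_norm_cong) (auto simp: p(1))
  with A(1) have "fam_norm \<alpha> r m (poly_fun m e c'') \<le> ennreal A" by simp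
  from poly_lfc_bound[OF m r a b this A(2)] show ?thesis
    by (simp add: p(2) scaleC_minus_one)
qed

text \<open>\<open>y\<close> is a limit of the values of polynomials that approximate \<open>\<phi>\<close>. Finitely many radii \<open>R\<close> are allowed at
  once, so that limits obtained with different radii agree.\<close>

definition is_lfc :: "nat \<Rightarrow> ((nat \<Rightarrow> real) \<Rightarrow> complex) \<Rightarrow> (nat \<Rightarrow> 'a) \<Rightarrow> (nat \<Rightarrow> 'a) \<Rightarrow> 'a \<Rightarrow> bool" where
  "is_lfc m \<phi> a b y \<longleftrightarrow> y \<in> I \<and> (\<forall>R e. finite R \<and> R \<subseteq> {0<..} \<and> 0 < e \<longrightarrow>
    (\<exists>d c. (\<forall>r\<in>R. fam_norm \<alpha> r m (\<phi> - poly_fun m d c) < ennreal e) \<and> nI (poly_lfc m d c a b - y) < e))"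

lemma is_lfcD:
  assumes "is_lfc m \<phi> a b y"
  shows "y \<in> I"
    and "finite R \<Longrightarrow> R \<subseteq> {0<..} \<Longrightarrow> 0 < e \<Longrightarrow>
      \<exists>d c. (\<forall>r\<in>R. fam_norm \<alpha> r m (\<phi> - poly_fun m d c) < ennreal e) \<and> nI (poly_lfc m d c a b - y) < e"
  using assms unfolding is_lfc_def by simp_all

text \<open>The control inequality passes from the approximating polynomials to the limit.\<close>

lemma is_lfc_bound:
  assumes m: "2 \<le> m" and r: "0 < r" and a: "a \<in> tuples m (selfadjoint_ball r)" and b: "b \<in> tuples (m - 1) I"
    and y: "is_lfc m \<phi> a b y" and \<phi>: "\<phi> \<in> cfun (Rn m)"
    and A: "fam_norm \<alpha> r m \<phi> \<le> ennreal A" "0 \<le> A"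
  shows "nI y \<le> C ^ (m - 2) * A * (\<Prod>i<m-1. nI (b i))"
proof -
  define K where "K = C ^ (m - 2) * (\<Prod>i<m-1. nI (b i))"
  have K: "0 \<le> K" unfolding K_def using C_power_nonneg prod_nI_nonneg[OF b] by simp
  have m1: "1 \<le> m" using m by simp
  have yI: "y \<in> I" by (rule is_lfcD(1)[OF y])
  have key: "nI y \<le> K * A + (K + 1) * e" if e: "0 < e" for e
  proof -
    obtain d c where dc: "fam_norm \<alpha> r m (\<phi> - poly_fun m d c) < ennreal e" "nI (poly_lfc m d c a b - y) < e"
      using is_lfcD(2)[OF y, of "{r}" e] r e by auto
    have "fam_norm \<alpha> r m (poly_fun m d c) \<le> fam_norm \<alpha> r m \<phi> + fam_norm \<alpha> r m (\<phi> - poly_fun m d c)"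
      by (rule fam_norm_le_add_diff[OF r m1 cfun_continuous_on_cube[OF \<phi>] cfun_continuous_on_cube[OF poly_fun_in_cfun]])
    also have "\<dots> \<le> ennreal A + ennreal e" using A(1) dc(1) by (intro add_mono) auto
    also have "\<dots> = ennreal (A + e)" using A(2) e by simp
    finally have "nI (poly_lfc m d c a b) \<le> C ^ (m - 2) * (A + e) * (\<Prod>i<m-1. nI (b i))"
      using poly_lfc_bound[OF m r a b, of d c "A + e"] A(2) e by simp
    also have "\<dots> = K * A + K * e" by (simp add: K_def algebra_simps)
    finally show ?thesis
      using dc(2) nI_le_add_diff[OF yI poly_lfc_mem[OF m b], of d c a] by (simp add: algebra_simps)
  qed
  have "nI y \<le> K * A + e" if "0 < e" for e
    using key[of "e / (K + 1)"] that K by simp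
  then have "nI y \<le> K * A" by (rule field_le_epsilon)
  then show ?thesis by (simp add: K_def mult_ac)
qed

lemma is_lfc_linear:
  assumes m: "2 \<le> m" and b: "b \<in> tuples (m - 1) I"
    and \<phi>: "\<phi> \<in> cfun (Rn m)" and \<psi>: "\<psi> \<in> cfun (Rn m)"
    and y: "is_lfc m \<phi> a b y" and y': "is_lfc m \<psi> a b y'"
  shows "is_lfc m (\<lambda>x\<in>Rn m. z * \<phi> x + \<psi> x) a b (z *\<^sub>C y + y')"
  unfolding is_lfc_def
proof (intro conjI allI impI)
  note yI = is_lfcD(1)[OF y] is_lfcD(1)[OF y']
  show "z *\<^sub>C y + y' \<in> I" using yI by (intro add_mem scaleC_mem)
  have m1: "1 \<le> m" using m by simp
  fix R :: "real set" and e :: real assume R: "finite R \<and> R \<subseteq> {0<..} \<and> 0 < e"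
  let ?L = "\<lambda>x\<in>Rn m. z * \<phi> x + \<psi> x"
  define e' where "e' = e / (2 * (cmod z + 1))"
  have pos: "0 < 2 * (cmod z + 1)" by (simp add: add_nonneg_pos)
  have e': "0 < e'" using R pos by (simp add: e'_def)
  obtain d1 c1 where 1: "\<forall>r\<in>R. fam_norm \<alpha> r m (\<phi> - poly_fun m d1 c1) < ennreal e'" "nI (poly_lfc m d1 c1 a b - y) < e'"
    using is_lfcD(2)[OF y _ _ e', of R] R by blast
  obtain d2 c2 where 2: "\<forall>r\<in>R. fam_norm \<alpha> r m (\<psi> - poly_fun m d2 c2) < ennreal e'" "nI (poly_lfc m d2 c2 a b - y') < e'"
    using is_lfcD(2)[OF y' _ _ e', of R] R by blast
  define d c where "d = max d1 d2" and "c = comb_coeff m z d1 c1 d2 c2"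
  have dc: "poly_fun m d c = (\<lambda>x\<in>Rn m. z * poly_fun m d1 c1 x + poly_fun m d2 c2 x)"
    "\<And>a b :: nat \<Rightarrow> 'a. poly_lfc m d c a b = z *\<^sub>C poly_lfc m d1 c1 a b + poly_lfc m d2 c2 a b"
    unfolding d_def c_def by (rule poly_fun_linear poly_lfc_linear)+
  have A: "fam_norm \<alpha> r m (?L - poly_fun m d c) < ennreal e" if "r \<in> R" for r
  proof -
    have r: "0 < r" using R that by auto
    have "fam_norm \<alpha> r m (?L - poly_fun m d c)
        = fam_norm \<alpha> r m (\<lambda>x. z * (\<phi> - poly_fun m d1 c1) x + (\<psi> - poly_fun m d2 c2) x)"
      using cube_subset_Rn[of r m] by (intro fam_norm_cong) (auto simp: dc(1) algebra_simps)
    also have "\<dots> < ennreal e"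
    proof (rule fam_norm_linear_lt[OF m1 r])
      show "continuous_on (cube r m) (\<phi> - poly_fun m d1 c1)" "continuous_on (cube r m) (\<psi> - poly_fun m d2 c2)"
        unfolding fun_diff_def
        by (intro continuous_on_diff cfun_continuous_on_cube \<phi> \<psi> poly_fun_in_cfun)+
      show "fam_norm \<alpha> r m (\<phi> - poly_fun m d1 c1) < ennreal (e / (2 * (cmod z + 1)))"
        "fam_norm \<alpha> r m (\<psi> - poly_fun m d2 c2) < ennreal (e / (2 * (cmod z + 1)))"
        using 1(1) 2(1) that unfolding e'_def by blast+
      show "0 < e" using R by blast
    qed
    finally show ?thesis .
  qed
  have B: "nI (poly_lfc m d c a b - (z *\<^sub>C y + y')) < e"
  proof -
    have I1: "poly_lfc m d1 c1 a b - y \<in> I" "poly_lfc m d2 c2 a b - y' \<in> I"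
      by (intro diff_mem yI poly_lfc_mem[OF m b])+
    have eq: "poly_lfc m d c a b - (z *\<^sub>C y + y') = z *\<^sub>C (poly_lfc m d1 c1 a b - y) + (poly_lfc m d2 c2 a b - y')"
      by (simp add: dc(2) scaleC_diff_right)
    have "nI (poly_lfc m d c a b - (z *\<^sub>C y + y')) \<le> cmod z * nI (poly_lfc m d1 c1 a b - y) + nI (poly_lfc m d2 c2 a b - y')"
      unfolding eq using nI_triangle[OF scaleC_mem[OF I1(1), of z] I1(2)] nI_scaleC[OF I1(1), of z] by simp
    also have "\<dots> < cmod z * e' + (e' + e')"
      using 1(2) 2(2) e' by (intro add_le_less_mono mult_left_mono) auto
    also have "\<dots> \<le> 2 * (cmod z + 1) * e'" using e' by (simp add: algebra_simps)
    also have "\<dots> = e" using pos by (simp add: e'_def)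
    finally show ?thesis .
  qed
  from A B show "\<exists>d c. (\<forall>r\<in>R. fam_norm \<alpha> r m (?L - poly_fun m d c) < ennreal e) \<and>
      nI (poly_lfc m d c a b - (z *\<^sub>C y + y')) < e" by blast
qed

lemma is_lfc_poly:
  assumes m: "2 \<le> m" and b: "b \<in> tuples (m - 1) I"
  shows "is_lfc m (poly_fun m d c) a b (poly_lfc m d c a b)"
  unfolding is_lfc_def
proof (intro conjI allI impI)
  show "poly_lfc m d c a b \<in> I" by (rule poly_lfc_mem[OF m b])
  fix R :: "real set" and e :: real assume R: "finite R \<and> R \<subseteq> {0<..} \<and> 0 < e"
  have "fam_norm \<alpha> r m (poly_fun m d c - poly_fun m d c) < ennreal e" if "r \<in> R" for r
    using R that fam_norm_diff_self[of r m "poly_fun m d c"] m by auto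
  moreover have "nI (poly_lfc m d c a b - poly_lfc m d c a b) < e" using R by simp
  ultimately show "\<exists>d' c'. (\<forall>r\<in>R. fam_norm \<alpha> r m (poly_fun m d c - poly_fun m d' c') < ennreal e) \<and>
      nI (poly_lfc m d' c' a b - poly_lfc m d c a b) < e" by blast
qed

lemma is_lfc_unique:
  assumes m: "2 \<le> m" and a: "a \<in> tuples m selfadjoint" and b: "b \<in> tuples (m - 1) I"
    and \<phi>: "\<phi> \<in> cfun (Rn m)" and y: "is_lfc m \<phi> a b y" "is_lfc m \<phi> a b y'"
  shows "y = y'"
proof -
  obtain r where r: "0 < r" "a \<in> tuples m (selfadjoint_ball r)" by (rule tuples_ball_exists[OF a])
  let ?Z = "\<lambda>x\<in>Rn m. (-1) * \<phi> x + \<phi> x"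
  have Z: "is_lfc m ?Z a b ((-1) *\<^sub>C y + y')" by (rule is_lfc_linear[OF m b \<phi> \<phi> y])
  have cf: "?Z \<in> cfun (Rn m)" unfolding cfun_def by simp
  have "fam_norm \<alpha> r m ?Z = fam_norm \<alpha> r m (\<lambda>x. 0)"
    using cube_subset_Rn[of r m] by (intro fam_norm_cong) auto
  then have 0: "fam_norm \<alpha> r m ?Z \<le> ennreal 0" using fam_norm_zero[of r m] r m by simp
  have "nI ((-1) *\<^sub>C y + y') \<le> 0"
    using is_lfc_bound[OF m r b Z cf 0] by simp
  moreover have "(-1) *\<^sub>C y + y' \<in> I" by (rule is_lfcD(1)[OF Z])
  ultimately have "(-1) *\<^sub>C y + y' = 0"
    using nI_nonneg nI_eq_0_iff by (metis antisym)
  then show ?thesis by (simp add: scaleC_minus_one)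
qed

text \<open>On a ball that contains all entries of \<open>a\<close>, the control inequality turns a sequence of approximating
  polynomials into a Cauchy sequence in the ideal. Its limit has the required property for all other radii as well,
  because those can be added to the radius of the ball in the choice of the polynomial.\<close>

lemma is_lfc_exists:
  assumes m: "2 \<le> m" and a: "a \<in> tuples m selfadjoint" and b: "b \<in> tuples (m - 1) I"
    and \<phi>: "\<phi> \<in> C_alpha \<alpha> m"
  shows "\<exists>y. is_lfc m \<phi> a b y"
proof -
  have m1: "1 \<le> m" using m by simp
  obtain r where r: "0 < r" "a \<in> tuples m (selfadjoint_ball r)" by (rule tuples_ball_exists[OF a])
  have cont: "continuous_on (cube r m) \<phi>" by (rule C_alpha_continuous(2)[OF m1 fin \<phi>])
  define K where "K = C ^ (m - 2) * (\<Prod>i<m-1. nI (b i))"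
  have K: "0 \<le> K" unfolding K_def using C_power_nonneg prod_nI_nonneg[OF b] by simp
  have close: "nI (poly_lfc m d c a b - poly_lfc m d' c' a b) \<le> K * (s + t)"
    if s: "fam_norm \<alpha> r m (\<phi> - poly_fun m d c) < ennreal s" "0 < s"
      and t: "fam_norm \<alpha> r m (\<phi> - poly_fun m d' c') < ennreal t" "0 < t" for d c d' c' s t
  proof -
    note cp = cfun_continuous_on_cube[OF poly_fun_in_cfun]
    have "fam_norm \<alpha> r m (poly_fun m d c - poly_fun m d' c')
        \<le> fam_norm \<alpha> r m (poly_fun m d c - \<phi>) + fam_norm \<alpha> r m (\<phi> - poly_fun m d' c')"
      by (rule fam_norm_triangle[OF r(1) m1 cp cont cp])
    also have "fam_norm \<alpha> r m (poly_fun m d c - \<phi>) = fam_norm \<alpha> r m (\<phi> - poly_fun m d c)"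
      by (rule fam_norm_diff_commute[OF r(1) m1 cp cont])
    also have "fam_norm \<alpha> r m (\<phi> - poly_fun m d c) + fam_norm \<alpha> r m (\<phi> - poly_fun m d' c') \<le> ennreal s + ennreal t"
      using s t by (intro add_mono) auto
    also have "\<dots> = ennreal (s + t)" using s t by simp
    finally have "fam_norm \<alpha> r m (poly_fun m d c - poly_fun m d' c') \<le> ennreal (s + t)" .
    moreover have "0 \<le> s + t" using s t by simp
    ultimately have "nI (poly_lfc m d c a b - poly_lfc m d' c' a b) \<le> C ^ (m - 2) * (s + t) * (\<Prod>i<m-1. nI (b i))"
      by (rule poly_lfc_diff_bound[OF m r b])
    then show ?thesis by (simp add: K_def mult_ac)
  qed
  have "\<exists>d c. fam_norm \<alpha> r m (\<phi> - poly_fun m d c) < ennreal (inverse (real (Suc n)))" for n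
  proof -
    have R: "{r} \<subseteq> {0<..}" "0 < inverse (real (Suc n))" using r(1) by auto
    obtain d c where "\<And>s. s \<in> {r} \<Longrightarrow> fam_norm \<alpha> s m (\<phi> - poly_fun m d c) < ennreal (inverse (real (Suc n)))"
      using C_alpha_approx[OF m1 fin \<phi> _ R] by blast
    then show ?thesis by blast
  qed
  then obtain d c where dc: "\<And>n. fam_norm \<alpha> r m (\<phi> - poly_fun m (d n) (c n)) < ennreal (inverse (real (Suc n)))"
    by metis
  define u where "u n = poly_lfc m (d n) (c n) a b" for n
  have uI: "u n \<in> I" for n unfolding u_def by (rule poly_lfc_mem[OF m b])
  have small: "\<exists>N. \<forall>n\<ge>N. inverse (real (Suc n)) < e" if e: "0 < e" for e
  proof -
    obtain N where N: "inverse (real (Suc N)) < e" using reals_Archimedean[OF e] by blast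
    have "inverse (real (Suc n)) < e" if "n \<ge> N" for n
    proof -
      have "inverse (real (Suc n)) \<le> inverse (real (Suc N))" using that by (intro le_imp_inverse_le) auto
      then show ?thesis using N by linarith
    qed
    then show ?thesis by blast
  qed
  have "\<exists>N. \<forall>i\<ge>N. \<forall>j\<ge>N. nI (u i - u j) < e" if e: "0 < e" for e
  proof -
    have "0 < e / (2 * (K + 1))" using e K by simp
    then obtain N where N: "\<And>n. n \<ge> N \<Longrightarrow> inverse (real (Suc n)) < e / (2 * (K + 1))" using small by blast
    have "nI (u i - u j) < e" if ij: "i \<ge> N" "j \<ge> N" for i j
    proof -
      have "nI (u i - u j) \<le> K * (inverse (real (Suc i)) + inverse (real (Suc j)))"
        unfolding u_def by (rule close[OF dc _ dc]) simp_all
      also have "\<dots> \<le> K * (e / (2 * (K + 1)) + e / (2 * (K + 1)))"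
        using N[OF ij(1)] N[OF ij(2)] K by (intro mult_left_mono add_mono) auto
      also have "\<dots> = K * e / (K + 1)"
      proof -
        have "K * (e / (2 * c) + e / (2 * c)) = K * e / c" for c :: real
          by (cases "c = 0") (simp_all add: field_simps)
        then show ?thesis .
      qed
      also have "\<dots> < e" using e K by (simp add: divide_less_eq algebra_simps)
      finally show ?thesis .
    qed
    then show ?thesis by blast
  qed
  then obtain l where l: "l \<in> I" "(\<lambda>n. nI (u n - l)) \<longlonglongrightarrow> 0"
    using nI_complete[of u] uI by blast
  have "is_lfc m \<phi> a b l"
    unfolding is_lfc_def
  proof (intro conjI allI impI l(1))
    fix R :: "real set" and e :: real assume R: "finite R \<and> R \<subseteq> {0<..} \<and> 0 < e"
    \<comment> \<open>The polynomial found for \<open>insert r R\<close> differs from a late member of the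
      sequence by at most \<open>2 K e'\<close>, and that one from \<open>l\<close> by at most
      \<open>e'\<close>.\<close>
    define e' where "e' = e / (2 * K + 2)"
    have e': "0 < e'" "e' \<le> e" using R K by (auto simp: e'_def divide_le_eq algebra_simps)
    obtain d' c' where d': "\<And>s. s \<in> insert r R \<Longrightarrow> fam_norm \<alpha> s m (\<phi> - poly_fun m d' c') < ennreal e'"
      using C_alpha_approx[OF m1 fin \<phi>, of "insert r R" e'] R r(1) e'(1) by auto
    obtain N1 where N1: "\<And>n. n \<ge> N1 \<Longrightarrow> inverse (real (Suc n)) < e'" using small[OF e'(1)] by blast
    obtain N2 where N2: "\<And>n. n \<ge> N2 \<Longrightarrow> \<bar>nI (u n - l)\<bar> < e'"
      using LIMSEQ_D[OF l(2) e'(1)] by auto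
    define n where "n = max N1 N2"
    have n: "inverse (real (Suc n)) < e'" "nI (u n - l) < e'"
      using N1[of n] N2[of n] by (auto simp: n_def)
    have pI: "poly_lfc m d' c' a b \<in> I" by (rule poly_lfc_mem[OF m b])
    have "nI (poly_lfc m d' c' a b - l) \<le> nI (poly_lfc m d' c' a b - u n) + nI (u n - l)"
      by (rule nI_triangle3[OF pI uI l(1)])
    also have "nI (poly_lfc m d' c' a b - u n) \<le> K * (e' + inverse (real (Suc n)))"
      unfolding u_def by (rule close[OF _ e'(1) dc]) (use d' in simp_all)
    also have "K * (e' + inverse (real (Suc n))) \<le> K * (e' + e')"
      using n K by (intro mult_left_mono) auto
    finally have "nI (poly_lfc m d' c' a b - l) < K * (e' + e') + 2 * e'" using n(2) e'(1) by linarith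
    also have "K * (e' + e') + 2 * e' = (2 * K + 2) * e'" by (simp add: algebra_simps)
    also have "\<dots> = e" using K by (simp add: e'_def)
    finally have B: "nI (poly_lfc m d' c' a b - l) < e" .
    have A: "fam_norm \<alpha> s m (\<phi> - poly_fun m d' c') < ennreal e" if "s \<in> R" for s
      using less_le_trans[OF d' ennreal_leI[OF e'(2)]] that by blast
    from A B show "\<exists>d c. (\<forall>r\<in>R. fam_norm \<alpha> r m (\<phi> - poly_fun m d c) < ennreal e) \<and> nI (poly_lfc m d c a b - l) < e"
      by blast
  qed
  then show ?thesis by blast
qed

definition lfc_map :: "nat \<Rightarrow> ((nat \<Rightarrow> real) \<Rightarrow> complex) \<Rightarrow> (nat \<Rightarrow> 'a) \<Rightarrow> (nat \<Rightarrow> 'a) \<Rightarrow> 'a" where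
  "lfc_map m \<phi> = (\<lambda>a\<in>tuples m selfadjoint. \<lambda>b\<in>tuples (m - 1) I. THE y. is_lfc m \<phi> a b y)"

context
  fixes m :: nat
  assumes m: "2 \<le> m"
begin

lemma m1: "1 \<le> m" using m by simp

lemma lfc_map_eqI:
  assumes "\<phi> \<in> cfun (Rn m)" "a \<in> tuples m selfadjoint" "b \<in> tuples (m - 1) I" "is_lfc m \<phi> a b y"
  shows "lfc_map m \<phi> a b = y"
proof -
  have "(THE y. is_lfc m \<phi> a b y) = y"
    by (rule the_equality) (use assms is_lfc_unique[OF m assms(2,3,1)] in blast)+
  then show ?thesis using assms by (simp add: lfc_map_def)
qed

lemma is_lfc_lfc_map:
  assumes "\<phi> \<in> C_alpha \<alpha> m" "a \<in> tuples m selfadjoint" "b \<in> tuples (m - 1) I"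
  shows "is_lfc m \<phi> a b (lfc_map m \<phi> a b)"
proof -
  obtain y where y: "is_lfc m \<phi> a b y" using is_lfc_exists[OF m assms(2,3,1)] by blast
  show ?thesis using lfc_map_eqI[OF C_alpha_continuous(1)[OF m1 fin assms(1)] assms(2,3) y] y by simp
qed

lemma lfc_map_mem:
  "\<phi> \<in> C_alpha \<alpha> m \<Longrightarrow> a \<in> tuples m selfadjoint \<Longrightarrow> b \<in> tuples (m - 1) I \<Longrightarrow> lfc_map m \<phi> a b \<in> I"
  by (rule is_lfcD(1)[OF is_lfc_lfc_map])

lemma lfc_map_bound:
  assumes "\<phi> \<in> C_alpha \<alpha> m" "0 < r" "a \<in> tuples m (selfadjoint_ball r)" "b \<in> tuples (m - 1) I"
    "fam_norm \<alpha> r m \<phi> \<le> ennreal A" "0 \<le> A"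
  shows "nI (lfc_map m \<phi> a b) \<le> C ^ (m - 2) * A * (\<Prod>i<m-1. nI (b i))"
  by (rule is_lfc_bound[OF m assms(2-4) is_lfc_lfc_map[OF assms(1) tuples_ball_selfadjoint[OF assms(3)] assms(4)]
        C_alpha_continuous(1)[OF m1 fin assms(1)] assms(5,6)])

lemma lfc_map_linear:
  assumes "\<phi> \<in> C_alpha \<alpha> m" "\<psi> \<in> C_alpha \<alpha> m" "a \<in> tuples m selfadjoint" "b \<in> tuples (m - 1) I"
  shows "lfc_map m (\<lambda>x\<in>Rn m. z * \<phi> x + \<psi> x) a b = z *\<^sub>C lfc_map m \<phi> a b + lfc_map m \<psi> a b"
  by (rule lfc_map_eqI[OF C_alpha_continuous(1)[OF m1 fin C_alpha_linear[OF m1 fin assms(1,2)]] assms(3,4)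
        is_lfc_linear[OF m assms(4) C_alpha_continuous(1)[OF m1 fin assms(1)] C_alpha_continuous(1)[OF m1 fin assms(2)]
          is_lfc_lfc_map[OF assms(1,3,4)] is_lfc_lfc_map[OF assms(2,3,4)]]])

lemma lfc_map_poly:
  assumes "a \<in> tuples m selfadjoint" "b \<in> tuples (m - 1) I"
  shows "lfc_map m (poly_fun m d c) a b = poly_lfc m d c a b"
  by (rule lfc_map_eqI[OF poly_fun_in_cfun assms is_lfc_poly[OF m assms(2)]])

lemma lfc_map_diff_bound:
  assumes \<phi>: "\<phi> \<in> C_alpha \<alpha> m" and \<psi>: "\<psi> \<in> C_alpha \<alpha> m" and r: "0 < r"
    and a: "a \<in> tuples m (selfadjoint_ball r)" and b: "b \<in> tuples (m - 1) I"
    and A: "fam_norm \<alpha> r m (\<phi> - \<psi>) \<le> ennreal A" "0 \<le> A"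
  shows "nI (lfc_map m \<phi> a b - lfc_map m \<psi> a b) \<le> C ^ (m - 2) * A * (\<Prod>i<m-1. nI (b i))"
proof -
  let ?L = "\<lambda>x\<in>Rn m. (-1) * \<psi> x + \<phi> x"
  have L: "?L \<in> C_alpha \<alpha> m" by (rule C_alpha_linear[OF m1 fin \<psi> \<phi>])
  have "fam_norm \<alpha> r m ?L = fam_norm \<alpha> r m (\<phi> - \<psi>)"
    using cube_subset_Rn[of r m] by (intro fam_norm_cong) auto
  then have "nI (lfc_map m ?L a b) \<le> C ^ (m - 2) * A * (\<Prod>i<m-1. nI (b i))"
    using A by (intro lfc_map_bound[OF L r a b]) simp_all
  then show ?thesis
    unfolding lfc_map_linear[OF \<psi> \<phi> tuples_ball_selfadjoint[OF a] b] by (simp add: scaleC_minus_one)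
qed

text \<open>Through this approximation, uniform in \<open>a\<close> and \<open>b\<close>, multilinearity and continuity carry over from
  polynomials.\<close>

lemma lfc_map_approx:
  assumes \<phi>: "\<phi> \<in> C_alpha \<alpha> m" and r: "0 < r" and e: "0 < e"
  obtains d c where "\<And>a b. a \<in> tuples m (selfadjoint_ball r) \<Longrightarrow> b \<in> tuples (m - 1) I \<Longrightarrow>
    nI (lfc_map m \<phi> a b - poly_lfc m d c a b) \<le> e * (\<Prod>i<m-1. nI (b i))"
proof -
  define e' where "e' = e / (C ^ (m - 2) + 1)"
  have pos: "0 < C ^ (m - 2) + 1" using C_power_nonneg[of "m - 2"] by linarith
  have e': "0 < e'" using e pos by (simp add: e'_def)
  obtain d c where dc: "fam_norm \<alpha> r m (\<phi> - poly_fun m d c) < ennreal e'"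
    using C_alpha_approx[OF m1 fin \<phi>, of "{r}" e'] r e' by auto
  have "nI (lfc_map m \<phi> a b - poly_lfc m d c a b) \<le> e * (\<Prod>i<m-1. nI (b i))"
    if a: "a \<in> tuples m (selfadjoint_ball r)" and b: "b \<in> tuples (m - 1) I" for a b
  proof -
    have "nI (lfc_map m \<phi> a b - poly_lfc m d c a b) \<le> C ^ (m - 2) * e' * (\<Prod>i<m-1. nI (b i))"
      unfolding lfc_map_poly[OF tuples_ball_selfadjoint[OF a] b, symmetric]
      by (rule lfc_map_diff_bound[OF \<phi> poly_fun_in_C_alpha[OF m1 fin] r a b]) (use dc e' in simp_all)
    also have "\<dots> \<le> e * (\<Prod>i<m-1. nI (b i))"
    proof (rule mult_right_mono[OF _ prod_nI_nonneg[OF b]])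
      have "C ^ (m - 2) * e' \<le> (C ^ (m - 2) + 1) * e'" using e' by (intro mult_right_mono) auto
      also have "\<dots> = e" using pos by (simp add: e'_def)
      finally show "C ^ (m - 2) * e' \<le> e" .
    qed
    finally show ?thesis .
  qed
  then show thesis by (rule that)
qed

lemma lfc_map_add:
  assumes \<phi>: "\<phi> \<in> C_alpha \<alpha> m" and a: "a \<in> tuples m selfadjoint" and b: "b \<in> tuples (m - 1) I"
    and i: "i < m - 1" and x: "x \<in> I" and y: "y \<in> I"
  shows "lfc_map m \<phi> a (b(i := x + y)) = lfc_map m \<phi> a (b(i := x)) + lfc_map m \<phi> a (b(i := y))"
proof -
  obtain r where r: "0 < r" "a \<in> tuples m (selfadjoint_ball r)" by (rule tuples_ball_exists[OF a])
  let ?T = "lfc_map m \<phi> a" and ?P = "\<lambda>b. \<Prod>i<m-1. nI (b i)"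
  note bs = tuples_upd[OF b i add_mem[OF x y]] tuples_upd[OF b i x] tuples_upd[OF b i y]
  let ?D = "?T (b(i := x + y)) - (?T (b(i := x)) + ?T (b(i := y)))"
  have "?D = 0"
  proof (rule eq_zero_if_nI_small)
    show "?D \<in> I" by (intro diff_mem add_mem lfc_map_mem[OF \<phi> a] bs)
    show "0 \<le> ?P (b(i := x + y)) + (?P (b(i := x)) + ?P (b(i := y)))"
      by (intro add_nonneg_nonneg prod_nI_nonneg bs)
    fix e :: real assume "0 < e"
    then obtain d c where dc: "\<And>a b. a \<in> tuples m (selfadjoint_ball r) \<Longrightarrow> b \<in> tuples (m - 1) I \<Longrightarrow>
      nI (lfc_map m \<phi> a b - poly_lfc m d c a b) \<le> e * (\<Prod>i<m-1. nI (b i))"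
      using lfc_map_approx[OF \<phi> r(1)] by blast
    let ?E = "\<lambda>b. ?T b - poly_lfc m d c a b"
    have EI: "?E b' \<in> I" if "b' \<in> tuples (m - 1) I" for b'
      by (intro diff_mem lfc_map_mem[OF \<phi> a that] poly_lfc_mem[OF m that])
    have D_eq: "?D = ?E (b(i := x + y)) - (?E (b(i := x)) + ?E (b(i := y)))"
      unfolding poly_lfc_add[OF i] by simp
    have "nI ?D \<le> nI (?E (b(i := x + y))) + (nI (?E (b(i := x))) + nI (?E (b(i := y))))"
      unfolding D_eq
      using nI_triangle4[OF EI[OF bs(1)] add_mem[OF EI[OF bs(2)] EI[OF bs(3)]]] nI_triangle[OF EI[OF bs(2)] EI[OF bs(3)]]
      by linarith
    also have "\<dots> \<le> e * ?P (b(i := x + y)) + (e * ?P (b(i := x)) + e * ?P (b(i := y)))"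
      by (intro add_mono dc[OF r(2)] bs)
    finally show "nI ?D \<le> e * (?P (b(i := x + y)) + (?P (b(i := x)) + ?P (b(i := y))))"
      by (simp add: distrib_left)
  qed
  then show ?thesis by simp
qed

lemma lfc_map_scaleC:
  assumes \<phi>: "\<phi> \<in> C_alpha \<alpha> m" and a: "a \<in> tuples m selfadjoint" and b: "b \<in> tuples (m - 1) I"
    and i: "i < m - 1" and x: "x \<in> I"
  shows "lfc_map m \<phi> a (b(i := z *\<^sub>C x)) = z *\<^sub>C lfc_map m \<phi> a (b(i := x))"
proof -
  obtain r where r: "0 < r" "a \<in> tuples m (selfadjoint_ball r)" by (rule tuples_ball_exists[OF a])
  let ?T = "lfc_map m \<phi> a" and ?P = "\<lambda>b. \<Prod>i<m-1. nI (b i)"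
  note bs = tuples_upd[OF b i scaleC_mem[OF x]] tuples_upd[OF b i x]
  let ?D = "?T (b(i := z *\<^sub>C x)) - z *\<^sub>C ?T (b(i := x))"
  have "?D = 0"
  proof (rule eq_zero_if_nI_small)
    show "?D \<in> I" by (intro diff_mem scaleC_mem lfc_map_mem[OF \<phi> a] bs)
    show "0 \<le> ?P (b(i := z *\<^sub>C x)) + cmod z * ?P (b(i := x))"
      by (intro add_nonneg_nonneg mult_nonneg_nonneg prod_nI_nonneg bs norm_ge_zero)
    fix e :: real assume "0 < e"
    then obtain d c where dc: "\<And>a b. a \<in> tuples m (selfadjoint_ball r) \<Longrightarrow> b \<in> tuples (m - 1) I \<Longrightarrow>
      nI (lfc_map m \<phi> a b - poly_lfc m d c a b) \<le> e * (\<Prod>i<m-1. nI (b i))"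
      using lfc_map_approx[OF \<phi> r(1)] by blast
    let ?E = "\<lambda>b. ?T b - poly_lfc m d c a b"
    have EI: "?E b' \<in> I" if "b' \<in> tuples (m - 1) I" for b'
      by (intro diff_mem lfc_map_mem[OF \<phi> a that] poly_lfc_mem[OF m that])
    have D_eq: "?D = ?E (b(i := z *\<^sub>C x)) - z *\<^sub>C ?E (b(i := x))"
      unfolding poly_lfc_scaleC[OF i] scaleC_diff_right by simp
    have "nI ?D \<le> nI (?E (b(i := z *\<^sub>C x))) + cmod z * nI (?E (b(i := x)))"
      unfolding D_eq
      using nI_triangle4[OF EI[OF bs(1)] scaleC_mem[OF EI[OF bs(2)]], of z z] nI_scaleC[OF EI[OF bs(2)], of z]
      by linarith
    also have "\<dots> \<le> e * ?P (b(i := z *\<^sub>C x)) + cmod z * (e * ?P (b(i := x)))"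
      by (intro add_mono mult_left_mono dc[OF r(2)] bs norm_ge_zero)
    finally show "nI ?D \<le> e * (?P (b(i := z *\<^sub>C x)) + cmod z * ?P (b(i := x)))"
      by (simp add: algebra_simps)
  qed
  then show ?thesis by simp
qed

lemma lfc_map_bounded:
  assumes "\<phi> \<in> C_alpha \<alpha> m" "0 < r"
  shows "\<exists>K\<ge>0. \<forall>a\<in>tuples m (selfadjoint_ball r). \<forall>b\<in>tuples (m - 1) I.
    nI (lfc_map m \<phi> a b) \<le> K * (\<Prod>i<m-1. nI (b i))"
proof -
  have "fam_norm \<alpha> r m \<phi> < \<infinity>"
    using assms unfolding C_alpha_iff[OF m1 fin] finite_norm_funs_def by auto
  then obtain A where A: "fam_norm \<alpha> r m \<phi> = ennreal A" "0 \<le> A" by (cases "fam_norm \<alpha> r m \<phi>") auto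
  show ?thesis
  proof (intro exI[of _ "C ^ (m - 2) * A"] conjI ballI)
    show "0 \<le> C ^ (m - 2) * A" using A C_power_nonneg by simp
    fix a b :: "nat \<Rightarrow> 'a" assume ab: "a \<in> tuples m (selfadjoint_ball r)" "b \<in> tuples (m - 1) I"
    show "nI (lfc_map m \<phi> a b) \<le> C ^ (m - 2) * A * (\<Prod>i<m-1. nI (b i))"
      by (rule lfc_map_bound[OF assms ab]) (use A in simp_all)
  qed
qed

lemma lfc_map_continuous:
  assumes \<phi>: "\<phi> \<in> C_alpha \<alpha> m" and a: "a \<in> tuples m selfadjoint" and e: "0 < e"
  obtains \<delta> where "0 < \<delta>" "\<And>a' b. a' \<in> tuples m selfadjoint \<Longrightarrow> (\<And>i. i < m \<Longrightarrow> norm (a' i - a i) < \<delta>) \<Longrightarrow>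
    b \<in> tuples (m - 1) I \<Longrightarrow> nI (lfc_map m \<phi> a' b - lfc_map m \<phi> a b) \<le> e * (\<Prod>i<m-1. nI (b i))"
proof -
  obtain r where r: "0 < r" "a \<in> tuples m (selfadjoint_ball r)" by (rule tuples_ball_exists[OF a])
  define R where "R = r + 1"
  have R: "0 < R" "0 \<le> R" using r by (auto simp: R_def)
  have na: "norm (a i) \<le> r" if "i < m" for i
    using tuples_D[OF r(2) that] by (simp add: selfadjoint_ball_def)
  have aR: "a \<in> tuples m (selfadjoint_ball R)"
    by (rule tuples_mono[OF _ r(2)]) (auto simp: selfadjoint_ball_def R_def)
  have e3: "0 < e / 3" using e by simp
  obtain d c where dc: "\<And>a b. a \<in> tuples m (selfadjoint_ball R) \<Longrightarrow> b \<in> tuples (m - 1) I \<Longrightarrow>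
    nI (lfc_map m \<phi> a b - poly_lfc m d c a b) \<le> e / 3 * (\<Prod>i<m-1. nI (b i))"
    using lfc_map_approx[OF \<phi> R(1) e3] by blast
  obtain L where L: "L \<ge> 0" "\<forall>a a' b t. b \<in> tuples (m - 1) I \<longrightarrow>
    (\<forall>i<m. norm (a i) \<le> R \<and> norm (a' i) \<le> R \<and> norm (a' i - a i) \<le> t) \<longrightarrow> 0 \<le> t \<longrightarrow>
    nI (poly_lfc m d c a' b - poly_lfc m d c a b) \<le> L * t * (\<Prod>i<m-1. nI (b i))"
    using poly_lfc_lipschitz[OF R(2) m, of d c] by blast
  define \<delta> where "\<delta> = min 1 (e / (3 * (L + 1)))"
  have \<delta>: "0 < \<delta>" "\<delta> \<le> 1" using e L by (auto simp: \<delta>_def)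
  have L\<delta>: "L * \<delta> \<le> e / 3"
  proof -
    have "L * \<delta> \<le> (L + 1) * (e / (3 * (L + 1)))" using L \<delta> by (intro mult_mono) (auto simp: \<delta>_def)
    also have "\<dots> = e / 3"
    proof -
      have "c * (e / (3 * c)) = e / 3" if "c \<noteq> 0" for c :: real using that by simp
      moreover have "L + 1 \<noteq> 0" using L(1) by linarith
      ultimately show ?thesis .
    qed
    finally show ?thesis .
  qed
  show thesis
  proof (rule that[OF \<delta>(1)])
    fix a' b assume a': "a' \<in> tuples m selfadjoint" "\<And>i. i < m \<Longrightarrow> norm (a' i - a i) < \<delta>" and b: "b \<in> tuples (m - 1) I"
    have na': "norm (a' i) \<le> R" if "i < m" for i
      using a'(2)[OF that] na[OF that] \<delta>(2) norm_triangle_sub[of "a' i" "a i"] unfolding R_def by linarith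
    have a'R: "a' \<in> tuples m (selfadjoint_ball R)"
      using a'(1) na' by (auto simp: tuples_def PiE_iff selfadjoint_ball_def)
    let ?P = "\<Prod>i<m-1. nI (b i)"
    let ?Q = "\<lambda>a. poly_lfc m d c a b" and ?T = "\<lambda>a. lfc_map m \<phi> a b"
    have T: "?T a' \<in> I" "?T a \<in> I" by (rule lfc_map_mem[OF \<phi> _ b], rule a' a)+
    have Q: "?Q a' \<in> I" "?Q a \<in> I" by (rule poly_lfc_mem[OF m b])+
    have "norm (a i) \<le> R \<and> norm (a' i) \<le> R \<and> norm (a' i - a i) \<le> \<delta>" if "i < m" for i
      using na[OF that] na'[OF that] a'(2)[OF that] by (simp add: R_def)
    then have "nI (?Q a' - ?Q a) \<le> L * \<delta> * ?P"
      using L(2) b \<delta>(1) by (meson less_imp_le)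
    also have "\<dots> \<le> e / 3 * ?P" by (rule mult_right_mono[OF L\<delta> prod_nI_nonneg[OF b]])
    finally have 1: "nI (?Q a' - ?Q a) \<le> e / 3 * ?P" .
    have 2: "nI (?T a' - ?Q a') \<le> e / 3 * ?P" by (rule dc[OF a'R b])
    have 3: "nI (?Q a - ?T a) \<le> e / 3 * ?P" using dc[OF aR b] nI_diff_commute[OF Q(2) T(2)] by simp
    have "nI (?T a' - ?T a) \<le> nI (?T a' - ?Q a') + (nI (?Q a' - ?Q a) + nI (?Q a - ?T a))"
      using nI_triangle3[OF T(1) Q(1) T(2)] nI_triangle3[OF Q(1) Q(2) T(2)] by linarith
    also have "\<dots> \<le> e / 3 * ?P + (e / 3 * ?P + e / 3 * ?P)" using 1 2 3 by linarith
    also have "\<dots> = e * ?P" by simp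
    finally show "nI (?T a' - ?T a) \<le> e * ?P" .
  qed
qed

end

end

lemma bounded_multilinearD:
  assumes "S \<in> bounded_multilinear K V nV W nW n"
  shows "S \<in> tuples n V \<rightarrow>\<^sub>E W" and "b \<in> tuples n V \<Longrightarrow> S b \<in> W"
    and "\<exists>C. \<forall>b\<in>tuples n V. nW (S b) \<le> C * (\<Prod>i<n. nV (b i))"
proof -
  show E: "S \<in> tuples n V \<rightarrow>\<^sub>E W"
    using assms unfolding bounded_multilinear_def mem_Collect_eq by (rule conjunct1)
  show "\<exists>C. \<forall>b\<in>tuples n V. nW (S b) \<le> C * (\<Prod>i<n. nV (b i))"
    using assms unfolding bounded_multilinear_def mem_Collect_eq by (elim conjE)
  show "S b \<in> W" if "b \<in> tuples n V" by (rule PiE_mem[OF E that])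
qed

context lfc_setting
begin

context
  fixes m :: nat
  assumes m: "2 \<le> m"
begin

lemma multilinear_norm_diff_le:
  assumes "0 \<le> K" "\<And>b. b \<in> tuples n I \<Longrightarrow> nI (S b - S' b) \<le> K * (\<Prod>i<n. nI (b i))"
  shows "multilinear_norm I nI nI n (S - S') \<le> K"
  by (rule multilinear_norm_le[OF assms(1)]) (simp add: assms(2))

lemma nI_diff_le_multilinear_norm:
  assumes S: "S \<in> bounded_multilinear UNIV I nI I nI n" "S' \<in> bounded_multilinear UNIV I nI I nI n"
    and b: "b \<in> tuples n I"
  shows "nI (S b - S' b) \<le> multilinear_norm I nI nI n (S - S') * (\<Prod>i<n. nI (b i))"
proof -
  obtain C1 C2 where C1: "\<forall>b\<in>tuples n I. nI (S b) \<le> C1 * (\<Prod>i<n. nI (b i))"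
    and C2: "\<forall>b\<in>tuples n I. nI (S' b) \<le> C2 * (\<Prod>i<n. nI (b i))"
    using bounded_multilinearD(3)[OF S(1)] bounded_multilinearD(3)[OF S(2)] by (elim exE)
  have "nI ((S - S') b) \<le> (C1 + C2) * (\<Prod>i<n. nI (b i))" if b: "b \<in> tuples n I" for b
  proof -
    have "S b \<in> I" "S' b \<in> I" using bounded_multilinearD(2)[OF S(1) b] bounded_multilinearD(2)[OF S(2) b] .
    from nI_triangle4[OF this] C1 C2 b have "nI (S b - S' b) \<le> C1 * (\<Prod>i<n. nI (b i)) + C2 * (\<Prod>i<n. nI (b i))"
      by fastforce
    then show ?thesis by (simp add: distrib_right)
  qed
  from le_multilinear_norm[of n I nI "S - S'" "C1 + C2" nI, OF this nI_nonneg b]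
  show ?thesis by simp
qed

lemma lfc_map_multilinear:
  assumes \<phi>: "\<phi> \<in> C_alpha \<alpha> m" and a: "a \<in> tuples m selfadjoint"
  shows "lfc_map m \<phi> a \<in> bounded_multilinear UNIV I nI I nI (m - 1)"
  unfolding bounded_multilinear_def
proof (intro CollectI conjI ballI allI impI)
  show "lfc_map m \<phi> a \<in> tuples (m - 1) I \<rightarrow>\<^sub>E I"
  proof (rule PiE_I)
    show "lfc_map m \<phi> a b \<in> I" if "b \<in> tuples (m - 1) I" for b by (rule lfc_map_mem[OF m \<phi> a that])
    show "lfc_map m \<phi> a b = undefined" if "b \<notin> tuples (m - 1) I" for b
      using a that by (simp add: lfc_map_def)
  qed
  show "lfc_map m \<phi> a (b(i := x + y)) = lfc_map m \<phi> a (b(i := x)) + lfc_map m \<phi> a (b(i := y))"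
    if "b \<in> tuples (m - 1) I" "i < m - 1" "x \<in> I" "y \<in> I" for b i x y
    by (rule lfc_map_add[OF m \<phi> a that])
  show "lfc_map m \<phi> a (b(i := z *\<^sub>C x)) = z *\<^sub>C lfc_map m \<phi> a (b(i := x))"
    if "b \<in> tuples (m - 1) I" "i < m - 1" "x \<in> I" for b i x z
    by (rule lfc_map_scaleC[OF m \<phi> a that])
  obtain r where r: "0 < r" "a \<in> tuples m (selfadjoint_ball r)" by (rule tuples_ball_exists[OF a])
  obtain K where "\<forall>a\<in>tuples m (selfadjoint_ball r). \<forall>b\<in>tuples (m - 1) I.
    nI (lfc_map m \<phi> a b) \<le> K * (\<Prod>i<m-1. nI (b i))"
    using lfc_map_bounded[OF m \<phi> r(1)] by (elim exE conjE)
  from bspec[OF this r(2)]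
  show "\<exists>C. \<forall>b\<in>tuples (m - 1) I. nI (lfc_map m \<phi> a b) \<le> C * (\<Prod>i<m - 1. nI (b i))" by (rule exI)
qed

lemma lfc_map_in_lfc_maps:
  assumes \<phi>: "\<phi> \<in> C_alpha \<alpha> m"
  shows "lfc_map m \<phi> \<in> lfc_maps I nI m"
  unfolding lfc_maps_def Let_def
proof (intro CollectI conjI allI impI)
  let ?B = "bounded_multilinear UNIV I nI I nI (m - 1)" and ?N = "multilinear_norm I nI nI (m - 1)"
  let ?X = "top_of_set (tuples m (selfadjoint :: 'a set))"
  show "lfc_map m \<phi> \<in> tuples m selfadjoint \<rightarrow>\<^sub>E ?B"
  proof (rule PiE_I)
    show "lfc_map m \<phi> a \<in> ?B" if "a \<in> tuples m selfadjoint" for a by (rule lfc_map_multilinear[OF \<phi> that])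
    show "lfc_map m \<phi> a = undefined" if "a \<notin> tuples m selfadjoint" for a
      using that by (simp add: lfc_map_def)
  qed
  show "continuous_map ?X (seminorm_topology ?B {\<lambda>S. ennreal (?N S)}) (lfc_map m \<phi>)"
  proof (rule seminorm_space.continuous_map_into[OF seminorm_space_multilinear[OF order_refl]])
    show "lfc_map m \<phi> \<in> topspace ?X \<rightarrow> ?B" using lfc_map_multilinear[OF \<phi>] by simp
    fix a p and e :: real
    assume a: "a \<in> topspace ?X" and p: "p \<in> {\<lambda>S. ennreal (?N S)}" and e: "0 < e"
    have a': "a \<in> tuples m selfadjoint" using a by simp
    have e2: "0 < e / 2" using e by simp
    obtain \<delta> where \<delta>: "0 < \<delta>" "\<And>a' b. a' \<in> tuples m selfadjoint \<Longrightarrow> (\<And>i. i < m \<Longrightarrow> norm (a' i - a i) < \<delta>) \<Longrightarrow>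
      b \<in> tuples (m - 1) I \<Longrightarrow> nI (lfc_map m \<phi> a' b - lfc_map m \<phi> a b) \<le> e / 2 * (\<Prod>i<m-1. nI (b i))"
      using lfc_map_continuous[OF m \<phi> a' e2] by blast
    define W where "W = {x :: nat \<Rightarrow> 'a. \<forall>i\<in>{..<m}. x i \<in> ball (a i) \<delta>}"
    have "open W" unfolding W_def by (rule product_topology_basis') auto
    then have "openin ?X (tuples m selfadjoint \<inter> W)" by (rule openin_open_Int)
    moreover have "a \<in> tuples m selfadjoint \<inter> W" using a' \<delta>(1) by (simp add: W_def)
    moreover have "p (lfc_map m \<phi> x - lfc_map m \<phi> a) < ennreal e" if x: "x \<in> tuples m selfadjoint \<inter> W" for x
    proof -
      have "norm (x i - a i) < \<delta>" if "i < m" for i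
        using x that by (auto simp: W_def dist_norm norm_minus_commute)
      then have "?N (lfc_map m \<phi> x - lfc_map m \<phi> a) \<le> e / 2"
        using x e by (intro multilinear_norm_diff_le \<delta>(2)) auto
      then have "ennreal (?N (lfc_map m \<phi> x - lfc_map m \<phi> a)) \<le> ennreal (e / 2)" by (rule ennreal_leI)
      also have "\<dots> < ennreal e" using e by (intro ennreal_lessI) auto
      finally show ?thesis using p by simp
    qed
    ultimately show "\<exists>U. openin ?X U \<and> a \<in> U \<and> (\<forall>y\<in>U. p (lfc_map m \<phi> y - lfc_map m \<phi> a) < ennreal e)"
      by blast
  qed
  fix r :: real assume r: "0 < r"
  obtain K where K: "0 \<le> K" "\<forall>a\<in>tuples m (selfadjoint_ball r). \<forall>b\<in>tuples (m - 1) I.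
    nI (lfc_map m \<phi> a b) \<le> K * (\<Prod>i<m-1. nI (b i))"
    using lfc_map_bounded[OF m \<phi> r] by (elim exE conjE)
  have "?N (lfc_map m \<phi> a) \<le> K" if "a \<in> tuples m (selfadjoint_ball r)" for a
    by (rule multilinear_norm_le[OF K(1)]) (rule bspec[OF bspec[OF K(2) that]])
  then show "\<exists>C. \<forall>a\<in>tuples m (selfadjoint_ball r). ?N (lfc_map m \<phi> a) \<le> C" by blast
qed

lemma lfc_maps_apply:
  "F \<in> lfc_maps I nI m \<Longrightarrow> a \<in> tuples m selfadjoint \<Longrightarrow> F a \<in> bounded_multilinear UNIV I nI I nI (m - 1)"
  unfolding lfc_maps_def Let_def by blast

definition sup_norm :: "real \<Rightarrow> ((nat \<Rightarrow> 'a) \<Rightarrow> (nat \<Rightarrow> 'a) \<Rightarrow> 'a) \<Rightarrow> ennreal" where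
  "sup_norm r F = (SUP a\<in>tuples m (selfadjoint_ball r). ennreal (multilinear_norm I nI nI (m - 1) (F a)))"

lemma lfc_maps_topology_eq:
  "lfc_maps_topology I nI m = seminorm_topology (lfc_maps I nI m) {sup_norm r |r. 0 < r}"
  unfolding lfc_maps_topology_def sup_norm_def ..

lemma seminorm_space_lfc_maps: "seminorm_space (lfc_maps I nI m) {sup_norm r |r. 0 < r}"
proof
  let ?B = "bounded_multilinear UNIV I nI I nI (m - 1)" and ?N = "multilinear_norm I nI nI (m - 1)"
  interpret B: seminorm_space ?B "{\<lambda>S. ennreal (?N S)}" by (rule seminorm_space_multilinear[OF order_refl])
  show "{sup_norm r |r. 0 < r} \<noteq> {}" using zero_less_one by blast
  fix p assume "p \<in> {sup_norm r |r. 0 < r}"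
  then obtain r where p: "p = sup_norm r" "0 < r" by blast
  show "p (F - F) = 0" if F: "F \<in> lfc_maps I nI m" for F
  proof -
    have "ennreal (?N ((F - F) a)) \<le> 0" if "a \<in> tuples m (selfadjoint_ball r)" for a
      using B.diff_self[OF singletonI lfc_maps_apply[OF F tuples_ball_selfadjoint[OF that]]] by simp
    then have "p (F - F) \<le> 0" unfolding p(1) sup_norm_def by (rule SUP_least)
    then show ?thesis by simp
  qed
  show "p (u - w) \<le> p (u - v) + p (v - w)"
    if F: "u \<in> lfc_maps I nI m" "v \<in> lfc_maps I nI m" "w \<in> lfc_maps I nI m" for u v w
    unfolding p(1) sup_norm_def
  proof (rule SUP_least)
    fix a :: "nat \<Rightarrow> 'a" assume a: "a \<in> tuples m (selfadjoint_ball r)"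
    note a' = tuples_ball_selfadjoint[OF a]
    have "ennreal (?N ((u - w) a)) \<le> ennreal (?N ((u - v) a)) + ennreal (?N ((v - w) a))"
      using B.triangle[OF singletonI lfc_maps_apply[OF F(1) a'] lfc_maps_apply[OF F(2) a'] lfc_maps_apply[OF F(3) a']]
      by simp
    also have "\<dots> \<le> (SUP a\<in>tuples m (selfadjoint_ball r). ennreal (?N ((u - v) a)))
        + (SUP a\<in>tuples m (selfadjoint_ball r). ennreal (?N ((v - w) a)))"
      by (intro add_mono SUP_upper a)
    finally show "ennreal (?N ((u - w) a)) \<le> (SUP a\<in>tuples m (selfadjoint_ball r). ennreal (?N ((u - v) a)))
        + (SUP a\<in>tuples m (selfadjoint_ball r). ennreal (?N ((v - w) a)))" .
  qed
qed

lemma C_alpha_subset: "C_alpha \<alpha> m \<subseteq> finite_norm_funs \<alpha> m"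
  using C_alpha_iff[OF m1[OF m] fin] by blast

lemma topspace_C_alpha: "topspace (subtopology (finite_norm_topology \<alpha> m) (C_alpha \<alpha> m)) = C_alpha \<alpha> m"
  unfolding topspace_subtopology finite_norm_topology_def
    seminorm_space.topspace[OF seminorm_space_finite_norm_funs[OF m1[OF m]]]
  using C_alpha_subset by blast

lemma lfc_extension_lfc_map: "lfc_extension \<alpha> I nI m (lfc_map m)"
  unfolding lfc_extension_def
proof (intro conjI ballI allI)
  let ?X = "subtopology (finite_norm_topology \<alpha> m) (C_alpha \<alpha> m)"
  interpret V: seminorm_space "finite_norm_funs \<alpha> m" "{fam_norm \<alpha> r m |r. 0 < r}"
    by (rule seminorm_space_finite_norm_funs[OF m1[OF m]])
  show "continuous_map ?X (lfc_maps_topology I nI m) (lfc_map m)"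
    unfolding lfc_maps_topology_eq
  proof (rule seminorm_space.continuous_map_into[OF seminorm_space_lfc_maps])
    show "lfc_map m \<in> topspace ?X \<rightarrow> lfc_maps I nI m"
      unfolding topspace_C_alpha using lfc_map_in_lfc_maps by blast
    fix \<phi> p and e :: real
    assume \<phi>: "\<phi> \<in> topspace ?X" and p: "p \<in> {sup_norm r |r. 0 < r}" and e: "0 < e"
    have \<phi>': "\<phi> \<in> C_alpha \<alpha> m" using \<phi> unfolding topspace_C_alpha .
    obtain r where r: "p = sup_norm r" "0 < r" using p by blast
    define d where "d = e / (2 * (C ^ (m - 2) + 1))"
    have c1: "0 < C ^ (m - 2) + 1" using C_power_nonneg[of "m - 2"] by linarith
    have d: "0 < d" using e c1 by (simp add: d_def)
    have Cd: "C ^ (m - 2) * d \<le> e / 2"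
    proof -
      have "C ^ (m - 2) * d \<le> (C ^ (m - 2) + 1) * d" using d by (intro mult_right_mono) auto
      also have "\<dots> = e / 2"
      proof -
        have "c * (e / (2 * c)) = e / 2" if "c \<noteq> 0" for c :: real using that by simp
        moreover have "C ^ (m - 2) + 1 \<noteq> 0" using c1 by linarith
        ultimately show ?thesis unfolding d_def .
      qed
      finally show ?thesis .
    qed
    define U where "U = {\<psi> \<in> finite_norm_funs \<alpha> m. fam_norm \<alpha> r m (\<psi> - \<phi>) < ennreal d} \<inter> C_alpha \<alpha> m"
    have \<phi>V: "\<phi> \<in> finite_norm_funs \<alpha> m" using \<phi>' C_alpha_subset by blast
    have pr: "fam_norm \<alpha> r m \<in> {fam_norm \<alpha> r m |r. 0 < r}" using r(2) by blast
    have "openin ?X U"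
      unfolding U_def finite_norm_topology_def
      by (rule openin_subtopology_Int[OF V.openin_ball[OF pr \<phi>V d]])
    moreover have "\<phi> \<in> U"
      using \<phi>V \<phi>' V.diff_self[OF pr \<phi>V] d unfolding U_def by simp
    moreover have "p (lfc_map m \<psi> - lfc_map m \<phi>) < ennreal e" if \<psi>: "\<psi> \<in> U" for \<psi>
    proof -
      have \<psi>': "\<psi> \<in> C_alpha \<alpha> m" and l: "fam_norm \<alpha> r m (\<psi> - \<phi>) < ennreal d" using \<psi> unfolding U_def by blast+
      have "ennreal (multilinear_norm I nI nI (m - 1) ((lfc_map m \<psi> - lfc_map m \<phi>) a)) \<le> ennreal (e / 2)"
        if a: "a \<in> tuples m (selfadjoint_ball r)" for a
      proof (rule ennreal_leI)
        have "multilinear_norm I nI nI (m - 1) (lfc_map m \<psi> a - lfc_map m \<phi> a) \<le> C ^ (m - 2) * d"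
        proof (rule multilinear_norm_diff_le)
          show "0 \<le> C ^ (m - 2) * d" using C_power_nonneg d by simp
          show "nI (lfc_map m \<psi> a b - lfc_map m \<phi> a b) \<le> C ^ (m - 2) * d * (\<Prod>i<m-1. nI (b i))"
            if b: "b \<in> tuples (m - 1) I" for b
            by (rule lfc_map_diff_bound[OF m \<psi>' \<phi>' r(2) a b]) (use l d in simp_all)
        qed
        also note Cd
        finally show "multilinear_norm I nI nI (m - 1) ((lfc_map m \<psi> - lfc_map m \<phi>) a) \<le> e / 2" by simp
      qed
      then have "p (lfc_map m \<psi> - lfc_map m \<phi>) \<le> ennreal (e / 2)"
        unfolding r(1) sup_norm_def by (rule SUP_least)
      also have "\<dots> < ennreal e" using e by (intro ennreal_lessI) auto
      finally show ?thesis .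
    qed
    ultimately show "\<exists>U. openin ?X U \<and> \<phi> \<in> U \<and> (\<forall>y\<in>U. p (lfc_map m y - lfc_map m \<phi>) < ennreal e)"
      by blast
  qed
next
  fix \<phi> \<psi> z and a b :: "nat \<Rightarrow> 'a"
  assume "\<phi> \<in> C_alpha \<alpha> m" "\<psi> \<in> C_alpha \<alpha> m" "a \<in> tuples m selfadjoint" "b \<in> tuples (m - 1) I"
  then show "lfc_map m (\<lambda>x\<in>Rn m. z * \<phi> x + \<psi> x) a b = z *\<^sub>C lfc_map m \<phi> a b + lfc_map m \<psi> a b"
    by (rule lfc_map_linear[OF m])
next
  fix d c and a b :: "nat \<Rightarrow> 'a" assume "a \<in> tuples m selfadjoint" "b \<in> tuples (m - 1) I"
  then show "lfc_map m (poly_fun m d c) a b = poly_lfc m d c a b" by (rule lfc_map_poly[OF m])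
qed

text \<open>Polynomials are dense and both maps are continuous: a polynomial close to \<open>\<phi>\<close> for the seminorms that control
  \<open>T\<close> near \<open>\<phi>\<close>, and also for one radius exceeding the entries of \<open>a\<close>, has values close to those of both maps.\<close>

lemma lfc_extension_unique:
  assumes T: "lfc_extension \<alpha> I nI m T" and \<phi>: "\<phi> \<in> C_alpha \<alpha> m"
  shows "T \<phi> = lfc_map m \<phi>"
proof -
  let ?X = "subtopology (finite_norm_topology \<alpha> m) (C_alpha \<alpha> m)"
  interpret V: seminorm_space "finite_norm_funs \<alpha> m" "{fam_norm \<alpha> r m |r. 0 < r}"
    by (rule seminorm_space_finite_norm_funs[OF m1[OF m]])
  interpret W: seminorm_space "lfc_maps I nI m" "{sup_norm r |r. 0 < r}" by (rule seminorm_space_lfc_maps)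
  have cont: "continuous_map ?X (seminorm_topology (lfc_maps I nI m) {sup_norm r |r. 0 < r}) T"
    using T unfolding lfc_extension_def lfc_maps_topology_eq by blast
  have Tmaps: "T \<psi> \<in> lfc_maps I nI m" if "\<psi> \<in> C_alpha \<alpha> m" for \<psi>
    using continuous_map_funspace[OF cont] that unfolding topspace_C_alpha W.topspace by blast
  have Tpoly: "T (poly_fun m d c) a b = poly_lfc m d c a b"
    if "a \<in> tuples m selfadjoint" "b \<in> tuples (m - 1) I" for d c a b
    using T that unfolding lfc_extension_def by blast
  have eq: "T \<phi> a b = lfc_map m \<phi> a b" if a: "a \<in> tuples m selfadjoint" and b: "b \<in> tuples (m - 1) I" for a b
  proof -
    note TB = lfc_maps_apply[OF Tmaps[OF \<phi>] a] and LB = lfc_map_multilinear[OF \<phi> a]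
    have TI: "T \<phi> a b \<in> I" "lfc_map m \<phi> a b \<in> I"
      using bounded_multilinearD(2)[OF TB b] bounded_multilinearD(2)[OF LB b] .
    have "T \<phi> a b - lfc_map m \<phi> a b = 0"
    proof (rule eq_zero_if_nI_small)
      let ?P = "\<Prod>i<m-1. nI (b i)"
      have P0: "0 \<le> ?P" by (rule prod_nI_nonneg[OF b])
      show "T \<phi> a b - lfc_map m \<phi> a b \<in> I" by (rule diff_mem[OF TI])
      show "0 \<le> ?P + C ^ (m - 2) * ?P" using P0 C_power_nonneg by simp
      fix e :: real assume e: "0 < e"
      obtain r where r: "0 < r" "a \<in> tuples m (selfadjoint_ball r)" by (rule tuples_ball_exists[OF a])
      have pr: "sup_norm r \<in> {sup_norm r |r. 0 < r}" using r(1) by blast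
      define O' where "O' = {F \<in> lfc_maps I nI m. sup_norm r (F - T \<phi>) < ennreal e}"
      have "openin (seminorm_topology (lfc_maps I nI m) {sup_norm r |r. 0 < r}) O'"
        unfolding O'_def by (rule W.openin_ball[OF pr Tmaps[OF \<phi>] e])
      from openin_continuous_map_preimage[OF cont this]
      have "openin ?X {\<psi> \<in> C_alpha \<alpha> m. T \<psi> \<in> O'}" unfolding topspace_C_alpha .
      then obtain G where G: "openin (finite_norm_topology \<alpha> m) G" "{\<psi> \<in> C_alpha \<alpha> m. T \<psi> \<in> O'} = G \<inter> C_alpha \<alpha> m"
        unfolding openin_subtopology by blast
      have "sup_norm r (T \<phi> - T \<phi>) < ennreal e"
        unfolding W.diff_self[OF pr Tmaps[OF \<phi>]] using e by simp
      then have "T \<phi> \<in> O'" unfolding O'_def using Tmaps[OF \<phi>] by blast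
      then have "\<phi> \<in> G" using G(2) \<phi> by blast
      have \<phi>V: "\<phi> \<in> finite_norm_funs \<alpha> m" using \<phi> C_alpha_subset by blast
      obtain F d where F: "finite F" "F \<subseteq> {fam_norm \<alpha> r m |r. 0 < r}" "0 < d"
        "{w \<in> finite_norm_funs \<alpha> m. \<forall>p\<in>F. p (w - \<phi>) < ennreal d} \<subseteq> G"
        using V.openin_imp_ball[OF G(1)[unfolded finite_norm_topology_def] \<open>\<phi> \<in> G\<close> \<phi>V] by (elim exE conjE)
      have "F \<subseteq> (\<lambda>r. fam_norm \<alpha> r m) ` {0<..}" using F(2) by auto
      then obtain R where R: "R \<subseteq> {0<..}" "finite R" "F = (\<lambda>r. fam_norm \<alpha> r m) ` R"
        using finite_subset_image[OF F(1)] by metis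
      have R': "finite (insert r R)" "insert r R \<subseteq> {0<..}" "0 < min d e" using R r(1) F(3) e by auto
      obtain d' c where dc: "\<And>s. s \<in> insert r R \<Longrightarrow> fam_norm \<alpha> s m (\<phi> - poly_fun m d' c) < ennreal (min d e)"
        using C_alpha_approx[OF m1[OF m] fin \<phi> R'] by blast
      let ?p = "poly_fun m d' c"
      have pC: "?p \<in> C_alpha \<alpha> m" by (rule poly_fun_in_C_alpha[OF m1[OF m] fin])
      have "q (?p - \<phi>) < ennreal d" if q: "q \<in> F" for q
      proof -
        obtain s where s: "s \<in> R" "q = fam_norm \<alpha> s m" using q R(3) by blast
        have s0: "0 < s" using s R(1) by auto
        have "q (?p - \<phi>) = fam_norm \<alpha> s m (\<phi> - ?p)"
          unfolding s(2)
          by (rule fam_norm_diff_commute[OF s0 m1[OF m] cfun_continuous_on_cube[OF poly_fun_in_cfun]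
                C_alpha_continuous(2)[OF m1[OF m] fin \<phi>]])
        also have "\<dots> < ennreal (min d e)" using dc s(1) by blast
        also have "\<dots> \<le> ennreal d" by (rule ennreal_leI) simp
        finally show ?thesis .
      qed
      then have "?p \<in> G" using F(4) pC C_alpha_subset by blast
      then have "T ?p \<in> O'" using G(2) pC by blast
      then have lt: "sup_norm r (T ?p - T \<phi>) < ennreal e" unfolding O'_def by blast
      have "ennreal (multilinear_norm I nI nI (m - 1) ((T ?p - T \<phi>) a)) \<le> sup_norm r (T ?p - T \<phi>)"
        unfolding sup_norm_def by (rule SUP_upper[OF r(2)])
      with lt have "ennreal (multilinear_norm I nI nI (m - 1) ((T ?p - T \<phi>) a)) \<le> ennreal e" by simp
      then have ne: "multilinear_norm I nI nI (m - 1) (T ?p a - T \<phi> a) \<le> e"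
        using e by (simp add: ennreal_le_iff)
      have "nI (T ?p a b - T \<phi> a b) \<le> multilinear_norm I nI nI (m - 1) (T ?p a - T \<phi> a) * ?P"
        by (rule nI_diff_le_multilinear_norm[OF lfc_maps_apply[OF Tmaps[OF pC] a] TB b])
      also have "\<dots> \<le> e * ?P" by (rule mult_right_mono[OF ne P0])
      finally have 1: "nI (poly_lfc m d' c a b - T \<phi> a b) \<le> e * ?P" unfolding Tpoly[OF a b] .
      have "fam_norm \<alpha> r m (\<phi> - ?p) \<le> ennreal e"
      proof -
        have "fam_norm \<alpha> r m (\<phi> - ?p) < ennreal (min d e)" using dc by blast
        also have "\<dots> \<le> ennreal e" by (rule ennreal_leI) simp
        finally show ?thesis by simp
      qed
      from lfc_map_diff_bound[OF m \<phi> pC r(1) r(2) b this] e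
      have 2: "nI (lfc_map m \<phi> a b - poly_lfc m d' c a b) \<le> C ^ (m - 2) * e * ?P"
        unfolding lfc_map_poly[OF m a b] by simp
      have Q: "poly_lfc m d' c a b \<in> I" by (rule poly_lfc_mem[OF m b])
      have "nI (T \<phi> a b - lfc_map m \<phi> a b) \<le> e * ?P + C ^ (m - 2) * e * ?P"
        using nI_triangle3[OF TI(1) Q TI(2)] 1 2 nI_diff_commute[OF TI(1) Q] nI_diff_commute[OF TI(2) Q] by linarith
      then show "nI (T \<phi> a b - lfc_map m \<phi> a b) \<le> e * (?P + C ^ (m - 2) * ?P)"
        by (simp add: algebra_simps)
    qed
    then show ?thesis by simp
  qed
  let ?B = "bounded_multilinear UNIV I nI I nI (m - 1)"
  have E: "F \<in> tuples m selfadjoint \<rightarrow>\<^sub>E ?B" if "F \<in> lfc_maps I nI m" for F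
    using that unfolding lfc_maps_def Let_def by blast
  have E2: "S \<in> tuples (m - 1) I \<rightarrow>\<^sub>E I" if "S \<in> ?B" for S
    by (rule bounded_multilinearD(1)[OF that])
  show ?thesis
  proof (rule PiE_ext[OF E[OF Tmaps[OF \<phi>]] E[OF lfc_map_in_lfc_maps[OF \<phi>]]])
    fix a :: "nat \<Rightarrow> 'a" assume a: "a \<in> tuples m selfadjoint"
    show "T \<phi> a = lfc_map m \<phi> a"
      by (rule PiE_ext[OF E2[OF lfc_maps_apply[OF Tmaps[OF \<phi>] a]] E2[OF lfc_map_multilinear[OF \<phi> a]]])
         (rule eq[OF a])
  qed
qed

lemma lfc_eq_lfc_map:
  assumes \<phi>: "\<phi> \<in> C_alpha \<alpha> m"
  shows "lfc \<alpha> I nI m \<phi> = lfc_map m \<phi>"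
  unfolding lfc_def
proof (rule the_equality)
  show "\<exists>T. lfc_extension \<alpha> I nI m T \<and> lfc_map m \<phi> = T \<phi>"
    by (rule exI[of _ "lfc_map m"]) (simp add: lfc_extension_lfc_map)
  fix F assume "\<exists>T. lfc_extension \<alpha> I nI m T \<and> F = T \<phi>"
  then obtain T where "lfc_extension \<alpha> I nI m T" "F = T \<phi>" by (elim exE conjE)
  then show "F = lfc_map m \<phi>" using lfc_extension_unique[OF _ \<phi>] by simp
qed

end

end

section \<open>Approximation of functions on the line by polynomials\<close>

lemma Ck_on_line_continuous: "f \<in> Ck_on_line k \<Longrightarrow> continuous_on UNIV f"
proof -
  assume "f \<in> Ck_on_line k"
  then obtain g where "g 0 = f" "\<forall>j\<le>k. continuous_on UNIV (g j)"
    unfolding Ck_on_line_def by blast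
  then show ?thesis by (metis le0)
qed

lemma divdiff_0_apply:
  assumes "f \<in> Ck_on_line k" "s \<in> Rn (Suc 0)"
  shows "divdiff f 0 s = f (s 0)"
  using divdiff_eq_distinct[OF assms(1) le0 assms(2)] by simp

context norm_fam_setting
begin

lemma fam_norm_divdiff_diff:
  assumes "u \<in> Ck_on_line k" "w \<in> Ck_on_line k" "i \<le> k"
  shows "fam_norm \<alpha> r (i + 1) (divdiff (u - w) i) = fam_norm \<alpha> r (i + 1) (divdiff u i - divdiff w i)"
  unfolding divdiff_diff[OF assms]
  by (rule fam_norm_cong) (use cube_subset_Rn[of r "i + 1"] in auto)

lemma divdiff_continuous_on_cube: "f \<in> Ck_on_line k \<Longrightarrow> i \<le> k \<Longrightarrow> continuous_on (cube r (i + 1)) (divdiff f i)"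
  using cfun_continuous_on_cube[OF divdiff_in_cfun] by simp

lemma seminorm_space_finite_norm_Ck:
  "seminorm_space (finite_norm_Ck \<alpha> k) {\<lambda>f. fam_norm \<alpha> r (i+1) (divdiff f i) |r i. 0 < r \<and> i \<le> k}"
proof
  show "{\<lambda>f. fam_norm \<alpha> r (i+1) (divdiff f i) |r i. 0 < r \<and> i \<le> k} \<noteq> {}" using zero_less_one by blast
  have Ck: "f \<in> Ck_on_line k" if "f \<in> finite_norm_Ck \<alpha> k" for f using that unfolding finite_norm_Ck_def by blast
  fix p assume "p \<in> {\<lambda>f. fam_norm \<alpha> r (i+1) (divdiff f i) |r i. 0 < r \<and> i \<le> k}"
  then obtain r i where p: "p = (\<lambda>f. fam_norm \<alpha> r (i+1) (divdiff f i))" "0 < r" "i \<le> k" by blast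
  have i1: "1 \<le> i + 1" by simp
  show "p (v - v) = 0" if "v \<in> finite_norm_Ck \<alpha> k" for v
    unfolding p(1) fam_norm_divdiff_diff[OF Ck[OF that] Ck[OF that] p(3)]
    by (rule fam_norm_diff_self[OF p(2) i1])
  show "p (u - w) \<le> p (u - v) + p (v - w)"
    if F: "u \<in> finite_norm_Ck \<alpha> k" "v \<in> finite_norm_Ck \<alpha> k" "w \<in> finite_norm_Ck \<alpha> k" for u v w
    unfolding p(1) fam_norm_divdiff_diff[OF Ck[OF F(1)] Ck[OF F(3)] p(3)]
      fam_norm_divdiff_diff[OF Ck[OF F(1)] Ck[OF F(2)] p(3)] fam_norm_divdiff_diff[OF Ck[OF F(2)] Ck[OF F(3)] p(3)]
    by (rule fam_norm_triangle[OF p(2) i1]) (rule divdiff_continuous_on_cube[OF Ck p(3)], rule F)+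
qed

lemma Ck_alpha_in_finite_norm_Ck: "f \<in> Ck_alpha \<alpha> k \<Longrightarrow> f \<in> finite_norm_Ck \<alpha> k"
  unfolding Ck_alpha_def finite_norm_Ck_topology_def
    seminorm_space.closure_of_iff[OF seminorm_space_finite_norm_Ck] by blast

text \<open>One polynomial approximates \<open>f\<close> together with all its divided differences up to order \<open>k\<close>.\<close>

lemma Ck_alpha_approx:
  assumes f: "f \<in> Ck_alpha \<alpha> k" and R: "finite R" "R \<subseteq> {0<..}" and e: "0 < e"
  shows "\<exists>p. \<forall>r\<in>R. \<forall>i\<le>k.
    fam_norm \<alpha> r (i + 1) (divdiff f i - poly_fun (i + 1) (degree p) (divdiff_coeff p i)) < ennreal e"
proof -
  let ?q = "\<lambda>(r, i) f. fam_norm \<alpha> r (i+1) (divdiff f i)"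
  let ?S = "{\<lambda>f. fam_norm \<alpha> r (i+1) (divdiff f i) |r i. 0 < r \<and> i \<le> k}"
  have F: "finite (?q ` (R \<times> {..k}))" using R by simp
  have S: "?q ` (R \<times> {..k}) \<subseteq> ?S"
  proof
    fix g assume "g \<in> ?q ` (R \<times> {..k})"
    then obtain r i where "r \<in> R" "i \<le> k" "g = (\<lambda>f. fam_norm \<alpha> r (i+1) (divdiff f i))" by auto
    then show "g \<in> ?S" using R(2) by auto
  qed
  have appr: "\<forall>F e. finite F \<and> F \<subseteq> ?S \<and> 0 < e \<longrightarrow> (\<exists>w\<in>range (\<lambda>p x. poly p (complex_of_real x)).
      w \<in> finite_norm_Ck \<alpha> k \<and> (\<forall>p\<in>F. p (w - f) < ennreal e))"
    using f unfolding Ck_alpha_def finite_norm_Ck_topology_def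
      seminorm_space.closure_of_iff[OF seminorm_space_finite_norm_Ck] by (rule conjunct2)
  obtain p where p: "(\<lambda>x. poly p (complex_of_real x)) \<in> finite_norm_Ck \<alpha> k"
    "\<forall>g\<in>?q ` (R \<times> {..k}). g ((\<lambda>x. poly p (complex_of_real x)) - f) < ennreal e"
    using appr[THEN spec, THEN spec, THEN mp, OF conjI[OF F conjI[OF S e]]] by (elim bexE conjE rangeE) simp
  have Ck: "f \<in> Ck_on_line k" "(\<lambda>x. poly p (complex_of_real x)) \<in> Ck_on_line k"
    using Ck_alpha_in_finite_norm_Ck[OF f] p(1) unfolding finite_norm_Ck_def by blast+
  have "fam_norm \<alpha> r (i + 1) (divdiff f i - poly_fun (i + 1) (degree p) (divdiff_coeff p i)) < ennreal e"
    if ri: "r \<in> R" "i \<le> k" for r i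
  proof -
    have r: "0 < r" using ri R by auto
    have i1: "1 \<le> i + 1" by simp
    have "?q (r, i) \<in> ?q ` (R \<times> {..k})" using ri by blast
    then have "?q (r, i) ((\<lambda>x. poly p (complex_of_real x)) - f) < ennreal e" using p(2) by blast
    then have "fam_norm \<alpha> r (i + 1) (divdiff ((\<lambda>x. poly p (complex_of_real x)) - f) i) < ennreal e" by simp
    also have "fam_norm \<alpha> r (i + 1) (divdiff ((\<lambda>x. poly p (complex_of_real x)) - f) i)
        = fam_norm \<alpha> r (i + 1) (divdiff f i - divdiff (\<lambda>x. poly p (complex_of_real x)) i)"
      unfolding fam_norm_divdiff_diff[OF Ck(2,1) ri(2)]
      by (rule fam_norm_diff_commute[OF r i1 divdiff_continuous_on_cube[OF Ck(2) ri(2)] divdiff_continuous_on_cube[OF Ck(1) ri(2)]])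
    finally show ?thesis by (simp add: divdiff_poly)
  qed
  then show ?thesis by blast
qed

lemma divdiff_in_C_alpha:
  assumes f: "f \<in> Ck_alpha \<alpha> k" and i: "i \<le> k" and fin: "finite_on_polynomials \<alpha>"
  shows "divdiff f i \<in> C_alpha \<alpha> (i + 1)"
proof -
  have i1: "1 \<le> i + 1" by simp
  have f': "f \<in> finite_norm_Ck \<alpha> k" by (rule Ck_alpha_in_finite_norm_Ck[OF f])
  then have "f \<in> Ck_on_line k" unfolding finite_norm_Ck_def by blast
  then have "divdiff f i \<in> finite_norm_funs \<alpha> (i + 1)"
    using f' i divdiff_in_cfun[of f k i] unfolding finite_norm_funs_def finite_norm_Ck_def by auto
  moreover have "\<exists>d c. \<forall>r\<in>R. fam_norm \<alpha> r (i + 1) (divdiff f i - poly_fun (i + 1) d c) < ennreal e"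
    if R: "finite R" "R \<subseteq> {0<..}" "0 < e" for R e
    using Ck_alpha_approx[OF f R] i by blast
  ultimately show ?thesis unfolding C_alpha_iff[OF i1 fin] by blast
qed

end

lemma (in lfc_setting) approx_sup_norm:
  assumes f: "f \<in> Ck_on_line k" and r: "0 < r" and x: "x \<in> {-r..r}" and e: "0 < e"
    and lt: "fam_norm \<alpha> r 1 (divdiff f 0 - poly_fun 1 (degree p) (divdiff_coeff p 0)) < ennreal e"
  shows "cmod (f x - poly p (complex_of_real x)) \<le> e"
proof -
  let ?\<phi> = "restrict (divdiff f 0 - poly_fun 1 (degree p) (divdiff_coeff p 0)) (cube r 1)"
  let ?s = "\<lambda>i\<in>{..<1::nat}. x"
  have s: "?s \<in> cube r 1" using x unfolding cube_def by (intro tuples_restrict) auto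
  then have sR: "?s \<in> Rn (Suc 0)" using cube_subset_Rn[of r 1] by auto
  have pf: "poly_fun 1 (degree p) (divdiff_coeff p 0) = divdiff (\<lambda>x. poly p (complex_of_real x)) 0"
    using divdiff_poly[of p 0] by simp
  have c: "continuous_on (cube r 1) (divdiff f 0)" "continuous_on (cube r 1) (poly_fun 1 (degree p) (divdiff_coeff p 0))"
    using divdiff_continuous_on_cube[OF f le0, of r] cfun_continuous_on_cube[OF poly_fun_in_cfun] by simp_all
  have "?\<phi> \<in> cfun (cube r 1)"
    using continuous_on_diff[OF c] by (simp add: cfun_def fun_diff_def)
  then have "\<alpha> r 1 ?\<phi> = (SUP x\<in>cube r 1. ennreal (cmod (?\<phi> x)))"
    using ctrl r unfolding controls_polynomial_lfc_def by blast
  then have "ennreal (cmod (?\<phi> ?s)) \<le> \<alpha> r 1 ?\<phi>" using SUP_upper[OF s, of "\<lambda>x. ennreal (cmod (?\<phi> x))"] by simp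
  also have "\<dots> < ennreal e" using lt by (simp add: fam_norm_def)
  finally have "cmod (?\<phi> ?s) \<le> e" using e by (simp add: ennreal_less_iff less_imp_le)
  moreover have "?\<phi> ?s = f x - poly p (complex_of_real x)"
  proof -
    have "poly_fun 1 (degree p) (divdiff_coeff p 0) ?s = poly p (complex_of_real x)"
    proof -
      have "continuous_on UNIV (\<lambda>x. poly p (complex_of_real x))" by (intro continuous_intros)
      then have "(\<lambda>x. poly p (complex_of_real x)) \<in> Ck_on_line 0"
        unfolding Ck_on_line_def by (intro CollectI exI[of _ "\<lambda>_ x. poly p (complex_of_real x)"]) simp
      from divdiff_0_apply[OF this sR] show ?thesis unfolding pf by simp
    qed
    then show ?thesis using s divdiff_0_apply[OF f sR] by simp
  qed
  ultimately show ?thesis by simp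
qed

section \<open>Inserting a direction\<close>

lemma insert_at_tuples:
  assumes "b \<in> tuples j V" "y \<in> V" "l \<le> j"
  shows "insert_at l y b \<in> tuples (Suc j) V"
  unfolding tuples_def
proof (rule PiE_I)
  fix i assume "i \<in> {..<Suc j}"
  then show "insert_at l y b i \<in> V"
    using assms tuples_D[OF assms(1), of i] tuples_D[OF assms(1), of "i - 1"] by (auto simp: insert_at_def)
next
  fix i assume "i \<notin> {..<Suc j}"
  then have "i > l" "i - 1 \<notin> {..<j}" using assms(3) by auto
  moreover have "b (i - 1) = undefined"
    using assms(1) calculation(2) unfolding tuples_def by (rule PiE_arb)
  ultimately show "insert_at l y b i = undefined" by (simp add: insert_at_def)
qed

lemma prod_insert_at:
  "l \<le> j \<Longrightarrow> (\<Prod>i<Suc j. g (insert_at l y b i)) = g y * (\<Prod>i<j. g (b i))" for g :: "'a \<Rightarrow> real"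
proof (induction j)
  case 0
  then show ?case by (simp add: insert_at_def)
next
  case (Suc j)
  show ?case
  proof (cases "l = Suc j")
    case True
    have "(\<Prod>i<Suc j. g (insert_at l y b i)) = (\<Prod>i<Suc j. g (b i))"
      by (rule prod.cong) (auto simp: True insert_at_def)
    moreover have "insert_at l y b (Suc j) = y" by (simp add: True insert_at_def)
    ultimately show ?thesis
      unfolding prod.lessThan_Suc[of _ "Suc j"] by (simp only: mult.commute)
  next
    case False
    then have "l \<le> j" using Suc.prems by simp
    moreover have "insert_at l y b (Suc j) = b j" using \<open>l \<le> j\<close> by (simp add: insert_at_def)
    ultimately show ?thesis
      unfolding prod.lessThan_Suc[of _ "Suc j"] Suc.IH[OF \<open>l \<le> j\<close>] by simp
  qed
qed

text \<open>The permutation of \<open>{..j}\<close> that arises from a permutation of \<open>{..<j}\<close>, shifted to \<open>{1..j}\<close>, by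
  inserting the value \<open>0\<close> at position \<open>l\<close>. Every permutation of \<open>{..j}\<close> arises exactly once.\<close>

definition insert_perm :: "nat \<Rightarrow> nat \<Rightarrow> (nat \<Rightarrow> nat) \<Rightarrow> nat \<Rightarrow> nat" where
  "insert_perm j l \<pi> = (\<lambda>i. if i \<le> j then insert_at l 0 (\<lambda>i. Suc (\<pi> i)) i else i)"

lemma insert_perm_permutes:
  assumes \<pi>: "\<pi> permutes {..<j}" and l: "l \<le> j"
  shows "insert_perm j l \<pi> permutes {..<Suc j}"
proof (rule bij_imp_permutes)
  have lt: "\<pi> i < j" if "i < j" for i using permutes_in_image[OF \<pi>, of i] that by simp
  have inj: "\<pi> i = \<pi> i' \<longleftrightarrow> i = i'" for i i' using permutes_inj[OF \<pi>] by (simp add: inj_eq)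
  have "inj_on (insert_perm j l \<pi>) {..<Suc j}"
  proof (rule inj_onI)
    fix x y assume xy: "x \<in> {..<Suc j}" "y \<in> {..<Suc j}" "insert_perm j l \<pi> x = insert_perm j l \<pi> y"
    then show "x = y"
      by (cases x l rule: linorder_cases; cases y l rule: linorder_cases)
        (auto simp: insert_perm_def insert_at_def inj)
  qed
  moreover have "insert_perm j l \<pi> ` {..<Suc j} \<subseteq> {..<Suc j}"
  proof
    fix z assume "z \<in> insert_perm j l \<pi> ` {..<Suc j}"
    then obtain x where x: "x < Suc j" "z = insert_perm j l \<pi> x" by auto
    show "z \<in> {..<Suc j}"
      by (cases x l rule: linorder_cases) (use x l lt[of x] lt[of "x - 1"] in \<open>auto simp: insert_perm_def insert_at_def\<close>)
  qed
  ultimately show "bij_betw (insert_perm j l \<pi>) {..<Suc j} {..<Suc j}"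
    by (metis bij_betw_def endo_inj_surj finite_lessThan)
  show "insert_perm j l \<pi> x = x" if "x \<notin> {..<Suc j}" for x
    using that by (simp add: insert_perm_def)
qed

lemma bij_betw_insert_perm:
  "bij_betw (\<lambda>(\<pi>, l). insert_perm j l \<pi>) ({\<pi>. \<pi> permutes {..<j}} \<times> {..j}) {\<sigma>. \<sigma> permutes {..<Suc j}}"
proof -
  let ?A = "{\<pi>. \<pi> permutes {..<j}} \<times> {..j}" and ?f = "\<lambda>(\<pi>, l). insert_perm j l \<pi>"
  have inj: "inj_on ?f ?A"
  proof (rule inj_onI)
    fix p q assume p: "p \<in> ?A" and q: "q \<in> ?A" and eq: "?f p = ?f q"
    obtain \<pi> l where pl: "p = (\<pi>, l)" by (cases p)
    obtain \<pi>' l' where ql: "q = (\<pi>', l')" by (cases q)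
    have h: "\<pi> permutes {..<j}" "l \<le> j" "\<pi>' permutes {..<j}" "l' \<le> j" using p q by (auto simp: pl ql)
    have e: "insert_perm j l \<pi> i = insert_perm j l' \<pi>' i" for i using eq by (simp add: pl ql)
    have "insert_perm j l' \<pi>' l = 0" using e[of l] h(2) by (simp add: insert_perm_def insert_at_def)
    then have ll: "l = l'" using h by (auto simp: insert_perm_def insert_at_def split: if_splits)
    have "\<pi> i = \<pi>' i" for i
    proof (cases "i < j")
      case True
      then show ?thesis
        using e[of i] e[of "Suc i"] by (cases "i < l") (simp_all add: ll insert_perm_def insert_at_def)
    next
      case False
      then show ?thesis using permutes_not_in[OF h(1), of i] permutes_not_in[OF h(3), of i] by simp
    qed
    then show "p = q" by (auto simp: pl ql ll)
  qed
  have sub: "?f ` ?A \<subseteq> {\<sigma>. \<sigma> permutes {..<Suc j}}" using insert_perm_permutes by auto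
  have "card (?f ` ?A) = card ?A" by (rule card_image[OF inj])
  also have "\<dots> = fact j * Suc j"
    by (simp add: card_cartesian_product card_permutations[of "{..<j}" j])
  also have "\<dots> = card {\<sigma>. \<sigma> permutes {..<Suc j}}"
    by (simp add: card_permutations[of "{..<Suc j}" "Suc j"] algebra_simps)
  finally have "?f ` ?A = {\<sigma>. \<sigma> permutes {..<Suc j}}"
    by (intro card_subset_eq[OF _ sub]) (simp_all add: finite_permutations)
  with inj show ?thesis by (simp add: bij_betw_def)
qed

lemma sum_permutations_insert_at:
  "(\<Sum>\<sigma> | \<sigma> permutes {..<Suc j}. \<Phi> (\<lambda>i\<in>{..<Suc j}. case_nat h b (\<sigma> i))) =
   (\<Sum>\<pi> | \<pi> permutes {..<j}. \<Sum>l\<le>j. \<Phi> (insert_at l h (\<lambda>i\<in>{..<j}. b (\<pi> i))))"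
  for \<Phi> :: "(nat \<Rightarrow> 'b) \<Rightarrow> 'c::comm_monoid_add"
proof -
  have key: "(\<lambda>i\<in>{..<Suc j}. case_nat h b (insert_perm j l \<pi> i)) = insert_at l h (\<lambda>i\<in>{..<j}. b (\<pi> i))"
    if "l \<le> j" for l \<pi>
  proof
    fix i
    show "(\<lambda>i\<in>{..<Suc j}. case_nat h b (insert_perm j l \<pi> i)) i = insert_at l h (\<lambda>i\<in>{..<j}. b (\<pi> i)) i"
      using that by (cases i l rule: linorder_cases) (auto simp: insert_perm_def insert_at_def)
  qed
  have "(\<Sum>\<sigma> | \<sigma> permutes {..<Suc j}. \<Phi> (\<lambda>i\<in>{..<Suc j}. case_nat h b (\<sigma> i)))
      = (\<Sum>p\<in>{\<pi>. \<pi> permutes {..<j}} \<times> {..j}. \<Phi> (\<lambda>i\<in>{..<Suc j}. case_nat h b ((\<lambda>(\<pi>, l). insert_perm j l \<pi>) p i)))"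
    by (rule sum.reindex_bij_betw[OF bij_betw_insert_perm, symmetric])
  also have "\<dots> = (\<Sum>(\<pi>, l)\<in>{\<pi>. \<pi> permutes {..<j}} \<times> {..j}. \<Phi> (insert_at l h (\<lambda>i\<in>{..<j}. b (\<pi> i))))"
    by (rule sum.cong) (auto simp: key)
  also have "\<dots> = (\<Sum>\<pi> | \<pi> permutes {..<j}. \<Sum>l\<le>j. \<Phi> (insert_at l h (\<lambda>i\<in>{..<j}. b (\<pi> i))))"
    by (rule sum.cartesian_product[symmetric])
  finally show ?thesis .
qed

lemma tuples_permute:
  assumes "b \<in> tuples j V" "\<pi> permutes {..<j}"
  shows "(\<lambda>i\<in>{..<j}. b (\<pi> i)) \<in> tuples j V"
  by (rule tuples_restrict) (use tuples_D[OF assms(1)] permutes_in_image[OF assms(2)] in auto)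

lemma prod_permute:
  fixes g :: "'a \<Rightarrow> real"
  assumes "\<pi> permutes {..<j}"
  shows "(\<Prod>i<j. g ((\<lambda>i\<in>{..<j}. b (\<pi> i)) i)) = (\<Prod>i<j. g (b i))"
proof -
  have "(\<Prod>i<j. g ((\<lambda>i\<in>{..<j}. b (\<pi> i)) i)) = (\<Prod>i<j. ((\<lambda>i. g (b i)) \<circ> \<pi>) i)"
    by (rule prod.cong) auto
  also have "\<dots> = (\<Prod>i<j. g (b i))" by (rule prod.permute[OF assms, symmetric])
  finally show ?thesis .
qed

lemma permute_upd:
  assumes "\<pi> permutes {..<j}" "i < j"
  shows "(\<lambda>l\<in>{..<j}. (b(i := x)) (\<pi> l)) = (\<lambda>l\<in>{..<j}. b (\<pi> l))(inv \<pi> i := x)" and "inv \<pi> i < j"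
proof -
  show lt: "inv \<pi> i < j" using permutes_in_image[OF permutes_inv[OF assms(1)], of i] assms(2) by simp
  have "\<pi> l = i \<longleftrightarrow> l = inv \<pi> i" for l using permutes_inverses[OF assms(1)] by metis
  then show "(\<lambda>l\<in>{..<j}. (b(i := x)) (\<pi> l)) = (\<lambda>l\<in>{..<j}. b (\<pi> l))(inv \<pi> i := x)"
    using lt by (auto simp: fun_eq_iff restrict_def)
qed


section \<open>The perturbation formula\<close>

locale perturbation = lfc_setting I nI \<alpha>
  for I :: "'a::cstar_algebra set" and nI \<alpha> +
  fixes f :: "real \<Rightarrow> complex" and k :: nat and a :: 'a
  assumes f: "f \<in> Ck_alpha \<alpha> k" and k: "1 \<le> k" and a: "a \<in> selfadjoint"
begin

lemma f_Ck: "f \<in> Ck_on_line k"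
  using Ck_alpha_in_finite_norm_Ck[OF f] unfolding finite_norm_Ck_def by blast

text \<open>\<open>lfc_dd j y b\<close> is the calculus of the \<open>j\<close>-th divided difference of \<open>f\<close>; for \<open>j = 0\<close> the arguments
  \<open>b\<close> are void and the value \<open>f(y 0)\<close>, which need not lie in the ideal, is taken relative to \<open>f(a)\<close>.\<close>

definition lfc_dd :: "nat \<Rightarrow> (nat \<Rightarrow> 'a) \<Rightarrow> (nat \<Rightarrow> 'a) \<Rightarrow> 'a" where
  "lfc_dd j y b = (if j = 0 then cfc f (y 0) - cfc f a
     else lfc_map (Suc j) (divdiff f j) (\<lambda>i\<in>{..<Suc j}. y i) b)"

lemma divdiff_mem: "i \<le> k \<Longrightarrow> divdiff f i \<in> C_alpha \<alpha> (Suc i)"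
  using divdiff_in_C_alpha[OF f _ fin, of i] by simp

lemma restrict_selfadjoint: "(\<And>i. y i \<in> selfadjoint) \<Longrightarrow> (\<lambda>i\<in>{..<m}. y i) \<in> tuples m selfadjoint"
  by (rule tuples_restrict)

lemma lfc_dd_mem:
  assumes j: "1 \<le> j" "j \<le> k" and y: "\<And>i. y i \<in> selfadjoint" and b: "b \<in> tuples j I"
  shows "lfc_dd j y b \<in> I"
proof -
  have "lfc_map (Suc j) (divdiff f j) (\<lambda>i\<in>{..<Suc j}. y i) b \<in> I"
    by (rule lfc_map_mem[OF _ divdiff_mem[OF j(2)] restrict_selfadjoint[OF y]]) (use j b in auto)
  then show ?thesis using j by (simp add: lfc_dd_def)
qed

lemma lfc_dd_close:
  assumes j: "1 \<le> j" "j \<le> k" and r: "0 < r" and e: "0 < e"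
    and p: "fam_norm \<alpha> r (j + 1) (divdiff f j - poly_fun (j + 1) (degree p) (divdiff_coeff p j)) < ennreal e"
    and y: "\<And>i. y i \<in> selfadjoint" "\<And>i. norm (y i) \<le> r" and b: "b \<in> tuples j I"
  shows "nI (lfc_dd j y b - poly_lfc (Suc j) (degree p) (divdiff_coeff p j) y b) \<le> C ^ (j - 1) * e * (\<Prod>i<j. nI (b i))"
proof -
  let ?y = "\<lambda>i\<in>{..<Suc j}. y i"
  have m: "2 \<le> Suc j" "1 \<le> Suc j" using j by auto
  have yr: "?y \<in> tuples (Suc j) (selfadjoint_ball r)"
    by (rule tuples_restrict) (use y in \<open>simp add: selfadjoint_ball_def\<close>)
  have ys: "?y \<in> tuples (Suc j) selfadjoint" by (rule restrict_selfadjoint[OF y(1)])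
  have b': "b \<in> tuples (Suc j - 1) I" using b by simp
  have le: "fam_norm \<alpha> r (Suc j) (divdiff f j - poly_fun (Suc j) (degree p) (divdiff_coeff p j)) \<le> ennreal e"
    using p by simp
  have "nI (lfc_map (Suc j) (divdiff f j) ?y b
      - lfc_map (Suc j) (poly_fun (Suc j) (degree p) (divdiff_coeff p j)) ?y b)
      \<le> C ^ (Suc j - 2) * e * (\<Prod>i<Suc j - 1. nI (b i))"
    by (rule lfc_map_diff_bound[OF m(1) divdiff_mem[OF j(2)] poly_fun_in_C_alpha[OF m(2) fin] r yr b' le])
       (use e in simp)
  also have "lfc_map (Suc j) (poly_fun (Suc j) (degree p) (divdiff_coeff p j)) ?y b
      = poly_lfc (Suc j) (degree p) (divdiff_coeff p j) ?y b"
    by (rule lfc_map_poly[OF m(1) ys b'])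
  also have "\<dots> = poly_lfc (Suc j) (degree p) (divdiff_coeff p j) y b"
    by (rule poly_lfc_cong[OF m(2)]) auto
  finally show ?thesis using j by (simp add: lfc_dd_def numeral_2_eq_2 restrict_def)
qed

lemma cfc_close:
  assumes r: "0 < r" and e: "0 < e"
    and p: "fam_norm \<alpha> r 1 (divdiff f 0 - poly_fun 1 (degree p) (divdiff_coeff p 0)) < ennreal e"
    and y: "y \<in> selfadjoint" "norm y \<le> r"
  shows "norm (cfc f y - alg_poly p y) \<le> e"
  by (rule norm_cfc_minus_poly_le[OF y Ck_on_line_continuous[OF f_Ck]])
     (rule approx_sup_norm[OF f_Ck r _ e p])

lemma norm_eq_zero_if_small:
  fixes x :: 'a
  assumes "\<And>e. 0 < e \<Longrightarrow> norm x \<le> e * K" "0 \<le> K"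
  shows "x = 0"
proof -
  have "norm x \<le> 0 + e" if "0 < e" for e
  proof -
    have "norm x \<le> e / (K + 1) * K" using assms(1)[of "e / (K + 1)"] that assms(2) by simp
    also have "\<dots> \<le> e" using that assms(2) by (simp add: divide_le_eq)
    finally show ?thesis by simp
  qed
  then have "norm x \<le> 0" by (rule field_le_epsilon)
  then show ?thesis by simp
qed

text \<open>For polynomials this is \<open>alg_poly_diff_eq_poly_lfc\<close>. Along approximating polynomials the left side converges
  in the norm of the algebra and the right side in that of the ideal, hence in both cases in the algebra.\<close>

lemma lfc_dd_telescope_0:
  assumes u: "u \<in> selfadjoint" and v: "v \<in> selfadjoint" and uv: "u - v \<in> I"
  shows "cfc f u - cfc f v = lfc_dd 1 (\<lambda>i. if i \<le> 0 then u else v) (\<lambda>i\<in>{..<1}. u - v)"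
proof -
  define r where "r = norm u + norm v + 1"
  have r: "0 < r" "norm u \<le> r" "norm v \<le> r" by (simp_all add: r_def add_nonneg_pos)
  let ?y = "\<lambda>i::nat. if i \<le> 0 then u else v" and ?b = "\<lambda>i\<in>{..<1::nat}. u - v"
  have b: "?b \<in> tuples 1 I" by (rule tuples_restrict) (use uv in simp)
  have ys: "?y i \<in> selfadjoint" "norm (?y i) \<le> r" for i using u v r by auto
  let ?D = "(cfc f u - cfc f v) - lfc_dd 1 ?y ?b"
  have "?D = 0"
  proof (rule norm_eq_zero_if_small)
    show "0 \<le> 2 + C * nI (u - v)" using incl_norm_nonneg nI_nonneg[OF uv] by simp
    fix e :: real assume e: "0 < e"
    have R: "finite {r}" "{r} \<subseteq> {0<..}" using r by auto
    obtain p where p: "\<And>i. i \<le> k \<Longrightarrow>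
      fam_norm \<alpha> r (i + 1) (divdiff f i - poly_fun (i + 1) (degree p) (divdiff_coeff p i)) < ennreal e"
      using Ck_alpha_approx[OF f R e] by blast
    let ?P = "poly_lfc (Suc (Suc 0)) (degree p) (divdiff_coeff p (Suc 0)) ?y"
    have p0: "fam_norm \<alpha> r 1 (divdiff f 0 - poly_fun 1 (degree p) (divdiff_coeff p 0)) < ennreal e"
      using p[of 0] by simp
    have 1: "nI (lfc_dd 1 ?y ?b - ?P ?b) \<le> e * nI (u - v)"
      using lfc_dd_close[OF order_refl k r(1) e p[OF k] ys b] by simp
    have PI: "lfc_dd 1 ?y ?b - ?P ?b \<in> I"
      by (intro diff_mem lfc_dd_mem[OF order_refl k ys(1) b] poly_lfc_mem) (use b in auto)
    have eqP: "alg_poly p u - alg_poly p v = ?P ?b"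
      unfolding alg_poly_diff_eq_poly_lfc by (rule poly_lfc_cong) auto
    have eq: "?D = ((cfc f u - alg_poly p u) - (cfc f v - alg_poly p v)) - (lfc_dd 1 ?y ?b - ?P ?b)"
      unfolding eqP[symmetric] by simp
    have "norm ?D \<le> (norm (cfc f u - alg_poly p u) + norm (cfc f v - alg_poly p v)) + norm (lfc_dd 1 ?y ?b - ?P ?b)"
      unfolding eq by (rule order_trans[OF norm_triangle_ineq4 add_right_mono[OF norm_triangle_ineq4]])
    also have "\<dots> \<le> (e + e) + C * (e * nI (u - v))"
    proof (intro add_mono)
      show "norm (cfc f u - alg_poly p u) \<le> e" by (rule cfc_close[OF r(1) e p0 u r(2)])
      show "norm (cfc f v - alg_poly p v) \<le> e" by (rule cfc_close[OF r(1) e p0 v r(3)])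
      show "norm (lfc_dd 1 ?y ?b - ?P ?b) \<le> C * (e * nI (u - v))"
        by (rule order_trans[OF norm_le_nI[OF PI] mult_left_mono[OF 1 incl_norm_nonneg]])
    qed
    also have "\<dots> = e * (2 + C * nI (u - v))" by (simp add: algebra_simps)
    finally show "norm ?D \<le> e * (2 + C * nI (u - v))" .
  qed
  then show ?thesis by simp
qed

text \<open>Both sides depend continuously on \<open>f\<close>, and for polynomials this is \<open>poly_lfc_telescope\<close>.\<close>

lemma lfc_dd_telescope_Suc:
  assumes j: "1 \<le> j" "j < k" and u: "u \<in> selfadjoint" and v: "v \<in> selfadjoint" and uv: "u - v \<in> I"
    and b: "b \<in> tuples j I"
  shows "lfc_dd j (\<lambda>_. u) b - lfc_dd j (\<lambda>_. v) b =
    (\<Sum>l\<le>j. lfc_dd (Suc j) (\<lambda>i. if i \<le> l then u else v) (insert_at l (u - v) b))"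
proof -
  define r where "r = norm u + norm v + 1"
  have r: "0 < r" "norm u \<le> r" "norm v \<le> r" by (simp_all add: r_def add_nonneg_pos)
  let ?y = "\<lambda>l i. if i \<le> l then u else v" and ?b = "\<lambda>l. insert_at l (u - v) b"
  have jk: "j \<le> k" "1 \<le> Suc j" "Suc j \<le> k" using j by auto
  have bl: "?b l \<in> tuples (Suc j) I" if "l \<in> {..j}" for l using insert_at_tuples[OF b uv, of l] that by simp
  have ys: "?y l i \<in> selfadjoint" "norm (?y l i) \<le> r" for l i using u v r by auto
  let ?D = "(lfc_dd j (\<lambda>_. u) b - lfc_dd j (\<lambda>_. v) b) - (\<Sum>l\<le>j. lfc_dd (Suc j) (?y l) (?b l))"
  let ?\<Pi> = "\<Prod>i<j. nI (b i)"
  have \<Pi>0: "0 \<le> ?\<Pi>" by (rule prod_nI_nonneg[OF b])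
  have mem: "lfc_dd j (\<lambda>_. u) b \<in> I" "lfc_dd j (\<lambda>_. v) b \<in> I"
    by (rule lfc_dd_mem[OF j(1) jk(1) _ b], rule u v)+
  have meml: "lfc_dd (Suc j) (?y l) (?b l) \<in> I" if "l \<in> {..j}" for l
    by (rule lfc_dd_mem[OF jk(2,3) ys(1) bl[OF that]])
  define K where "K = 2 * (C ^ (j - 1) * ?\<Pi>) + (\<Sum>l\<le>j. C ^ j * (\<Prod>i<Suc j. nI (?b l i)))"
  have "?D = 0"
  proof (rule eq_zero_if_nI_small)
    show "?D \<in> I" by (intro diff_mem mem sum_mem meml)
    have "0 \<le> C ^ j * (\<Prod>i<Suc j. nI (?b l i))" if "l \<in> {..j}" for l
      using C_power_nonneg prod_nI_nonneg[OF bl[OF that]] by (rule mult_nonneg_nonneg)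
    then have "0 \<le> (\<Sum>l\<le>j. C ^ j * (\<Prod>i<Suc j. nI (?b l i)))" by (rule sum_nonneg)
    moreover have "0 \<le> C ^ (j - 1) * ?\<Pi>" using C_power_nonneg \<Pi>0 by (rule mult_nonneg_nonneg)
    ultimately show "0 \<le> K" unfolding K_def by linarith
    fix e :: real assume e: "0 < e"
    have R: "finite {r}" "{r} \<subseteq> {0<..}" using r by auto
    obtain p where p: "\<And>i. i \<le> k \<Longrightarrow>
      fam_norm \<alpha> r (i + 1) (divdiff f i - poly_fun (i + 1) (degree p) (divdiff_coeff p i)) < ennreal e"
      using Ck_alpha_approx[OF f R e] by blast
    let ?P = "poly_lfc (Suc j) (degree p) (divdiff_coeff p j)"
    let ?Q = "poly_lfc (Suc (Suc j)) (degree p) (divdiff_coeff p (Suc j))"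
    have tel: "?P (\<lambda>_. u) b - ?P (\<lambda>_. v) b = (\<Sum>l\<le>j. ?Q (?y l) (?b l))" by (rule poly_lfc_telescope)
    have PI: "?P y b \<in> I" for y by (rule poly_lfc_mem) (use j b in auto)
    have QI: "?Q (?y l) (?b l) \<in> I" if "l \<in> {..j}" for l by (rule poly_lfc_mem) (use bl[OF that] in auto)
    have eq: "?D = ((lfc_dd j (\<lambda>_. u) b - ?P (\<lambda>_. u) b) - (lfc_dd j (\<lambda>_. v) b - ?P (\<lambda>_. v) b))
        - (\<Sum>l\<le>j. lfc_dd (Suc j) (?y l) (?b l) - ?Q (?y l) (?b l))"
      unfolding sum_subtractf tel[symmetric] by simp
    have c1: "nI (lfc_dd j (\<lambda>_. u) b - ?P (\<lambda>_. u) b) \<le> C ^ (j - 1) * e * ?\<Pi>"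
      by (rule lfc_dd_close[OF j(1) jk(1) r(1) e p[OF jk(1)] _ _ b]) (rule u r(2))+
    have c2: "nI (lfc_dd j (\<lambda>_. v) b - ?P (\<lambda>_. v) b) \<le> C ^ (j - 1) * e * ?\<Pi>"
      by (rule lfc_dd_close[OF j(1) jk(1) r(1) e p[OF jk(1)] _ _ b]) (rule v r(3))+
    have c3: "nI (lfc_dd (Suc j) (?y l) (?b l) - ?Q (?y l) (?b l)) \<le> C ^ (Suc j - 1) * e * (\<Prod>i<Suc j. nI (?b l i))"
      if "l \<in> {..j}" for l
      by (rule lfc_dd_close[OF jk(2,3) r(1) e p[OF jk(3)] ys bl[OF that]])
    have I1: "(lfc_dd j (\<lambda>_. u) b - ?P (\<lambda>_. u) b) \<in> I" "(lfc_dd j (\<lambda>_. v) b - ?P (\<lambda>_. v) b) \<in> I"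
      by (intro diff_mem mem PI)+
    have I2: "lfc_dd (Suc j) (?y l) (?b l) - ?Q (?y l) (?b l) \<in> I" if "l \<in> {..j}" for l
      by (rule diff_mem[OF meml[OF that] QI[OF that]])
    have "nI ?D \<le> nI ((lfc_dd j (\<lambda>_. u) b - ?P (\<lambda>_. u) b) - (lfc_dd j (\<lambda>_. v) b - ?P (\<lambda>_. v) b))
        + nI (\<Sum>l\<le>j. lfc_dd (Suc j) (?y l) (?b l) - ?Q (?y l) (?b l))"
      unfolding eq by (rule nI_triangle4[OF diff_mem[OF I1] sum_mem[OF I2]])
    also have "\<dots> \<le> (C ^ (j - 1) * e * ?\<Pi> + C ^ (j - 1) * e * ?\<Pi>)
        + (\<Sum>l\<le>j. C ^ (Suc j - 1) * e * (\<Prod>i<Suc j. nI (?b l i)))"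
    proof (rule add_mono)
      show "nI ((lfc_dd j (\<lambda>_. u) b - ?P (\<lambda>_. u) b) - (lfc_dd j (\<lambda>_. v) b - ?P (\<lambda>_. v) b))
          \<le> C ^ (j - 1) * e * ?\<Pi> + C ^ (j - 1) * e * ?\<Pi>"
        by (rule order_trans[OF nI_triangle4[OF I1] add_mono[OF c1 c2]])
      show "nI (\<Sum>l\<le>j. lfc_dd (Suc j) (?y l) (?b l) - ?Q (?y l) (?b l))
          \<le> (\<Sum>l\<le>j. C ^ (Suc j - 1) * e * (\<Prod>i<Suc j. nI (?b l i)))"
        by (rule order_trans[OF nI_sum[OF I2] sum_mono[OF c3]])
    qed
    also have "\<dots> = e * K"
      by (simp add: K_def distrib_left sum_distrib_left mult_ac del: prod.lessThan_Suc)
    finally show "nI ?D \<le> e * K" .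
  qed
  then show ?thesis by simp
qed

lemma lfc_dd_telescope:
  assumes j: "j < k" and u: "u \<in> selfadjoint" and v: "v \<in> selfadjoint" and uv: "u - v \<in> I"
    and b: "b \<in> tuples j I"
  shows "lfc_dd j (\<lambda>_. u) b - lfc_dd j (\<lambda>_. v) b =
    (\<Sum>l\<le>j. lfc_dd (Suc j) (\<lambda>i. if i \<le> l then u else v) (insert_at l (u - v) b))"
proof (cases "j = 0")
  case True
  have "insert_at 0 (u - v) b = (\<lambda>i\<in>{..<1}. u - v)"
    using b by (auto simp: True insert_at_def tuples_def fun_eq_iff)
  then show ?thesis using lfc_dd_telescope_0[OF u v uv] by (simp add: True lfc_dd_def[of 0])
next
  case False
  then show ?thesis using lfc_dd_telescope_Suc[OF _ j u v uv b] by simp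
qed

end

section \<open>Derivatives with respect to the norm of the ideal\<close>

context perturbation
begin

abbreviation V where "V \<equiv> I \<inter> selfadjoint"

lemma V_D: "x \<in> V \<Longrightarrow> x \<in> I" "x \<in> V \<Longrightarrow> x \<in> selfadjoint" "x \<in> V \<Longrightarrow> a + x \<in> selfadjoint"
  using a by (auto intro: selfadjoint_simps)

lemma V_add: "x \<in> V \<Longrightarrow> y \<in> V \<Longrightarrow> x + y \<in> V"
  by (auto intro: selfadjoint_simps add_mem)

lemma V_scaleR: "x \<in> V \<Longrightarrow> t *\<^sub>R x \<in> V"
  using selfadjoint_simps(4)[of x t] by (auto intro: scaleR_mem simp: scaleC_of_real)

lemma tuples_V_I: "b \<in> tuples j V \<Longrightarrow> b \<in> tuples j I"
  by (rule tuples_mono[of V I]) auto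

text \<open>For \<open>j = 0\<close> this is the assertion that \<open>f(a + x) - f(a)\<close> lies in the ideal, by the perturbation formula.\<close>

lemma lfc_dd_perturbed_mem:
  assumes j: "j \<le> k" and x: "x \<in> V" and b: "b \<in> tuples j I"
  shows "lfc_dd j (\<lambda>_. a + x) b \<in> I"
proof (cases "j = 0")
  case True
  have xI: "(a + x) - a \<in> I" using V_D(1)[OF x] by simp
  have ys: "(if i \<le> 0 then a + x else a) \<in> selfadjoint" for i :: nat using a V_D(3)[OF x] by simp
  have "lfc_dd j (\<lambda>_. a + x) b = cfc f (a + x) - cfc f a" by (simp add: True lfc_dd_def)
  also have "\<dots> = lfc_dd 1 (\<lambda>i. if i \<le> 0 then a + x else a) (\<lambda>i\<in>{..<1}. (a + x) - a)"
    by (rule lfc_dd_telescope_0[OF V_D(3)[OF x] a xI])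
  also have "\<dots> \<in> I"
    by (rule lfc_dd_mem[OF order_refl k ys]) (rule tuples_restrict, rule xI)
  finally show ?thesis .
next
  case False
  then show ?thesis using lfc_dd_mem[OF _ j V_D(3)[OF x] b] by simp
qed

lemma lfc_dd_add:
  assumes j: "j \<le> k" and x: "x \<in> V" and b: "b \<in> tuples j I" and i: "i < j" and u: "u \<in> I" and w: "w \<in> I"
  shows "lfc_dd j (\<lambda>_. a + x) (b(i := u + w)) = lfc_dd j (\<lambda>_. a + x) (b(i := u)) + lfc_dd j (\<lambda>_. a + x) (b(i := w))"
proof -
  have "2 \<le> Suc j" "j \<noteq> 0" "i < Suc j - 1" "b \<in> tuples (Suc j - 1) I" using i b by auto
  with lfc_map_add[OF this(1) divdiff_mem[OF j] restrict_selfadjoint[of "\<lambda>_. a + x"] this(4,3) u w] V_D(3)[OF x]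
  show ?thesis by (simp add: lfc_dd_def)
qed

lemma lfc_dd_scaleC:
  assumes j: "j \<le> k" and x: "x \<in> V" and b: "b \<in> tuples j I" and i: "i < j" and u: "u \<in> I"
  shows "lfc_dd j (\<lambda>_. a + x) (b(i := z *\<^sub>C u)) = z *\<^sub>C lfc_dd j (\<lambda>_. a + x) (b(i := u))"
proof -
  have "2 \<le> Suc j" "j \<noteq> 0" "i < Suc j - 1" "b \<in> tuples (Suc j - 1) I" using i b by auto
  with lfc_map_scaleC[OF this(1) divdiff_mem[OF j] restrict_selfadjoint[of "\<lambda>_. a + x"] this(4,3) u] V_D(3)[OF x]
  show ?thesis by (simp add: lfc_dd_def)
qed

lemma lfc_dd_bounded:
  assumes j: "1 \<le> j" "j \<le> k" and r: "0 < r"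
  shows "\<exists>K\<ge>0. \<forall>y. (\<forall>i. y i \<in> selfadjoint_ball r) \<longrightarrow> (\<forall>b\<in>tuples j I.
      nI (lfc_dd j y b) \<le> K * (\<Prod>i<j. nI (b i)))"
proof -
  have m: "2 \<le> Suc j" using j by simp
  obtain K where K: "0 \<le> K" "\<forall>y\<in>tuples (Suc j) (selfadjoint_ball r). \<forall>b\<in>tuples (Suc j - 1) I.
    nI (lfc_map (Suc j) (divdiff f j) y b) \<le> K * (\<Prod>i<Suc j - 1. nI (b i))"
    using lfc_map_bounded[OF m divdiff_mem[OF j(2)] r] by (elim exE conjE)
  show ?thesis
  proof (intro exI[of _ K] conjI allI impI ballI K(1))
    fix y b :: "nat \<Rightarrow> 'a" assume y: "\<forall>i. y i \<in> selfadjoint_ball r" and b: "b \<in> tuples j I"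
    have y': "(\<lambda>i\<in>{..<Suc j}. y i) \<in> tuples (Suc j) (selfadjoint_ball r)"
      by (rule tuples_restrict) (use y in simp)
    have b': "b \<in> tuples (Suc j - 1) I" using b by simp
    show "nI (lfc_dd j y b) \<le> K * (\<Prod>i<j. nI (b i))"
      using bspec[OF bspec[OF K(2) y'] b'] j by (simp add: lfc_dd_def restrict_def)
  qed
qed

lemma lfc_dd_continuous:
  assumes j: "1 \<le> j" "j \<le> k" and y: "\<And>i. y i \<in> selfadjoint" and e: "0 < e"
  obtains \<delta> where "0 < \<delta>"
    "\<And>y' b. (\<And>i. y' i \<in> selfadjoint) \<Longrightarrow> (\<And>i. norm (y' i - y i) < \<delta>) \<Longrightarrow> b \<in> tuples j I \<Longrightarrow>
      nI (lfc_dd j y' b - lfc_dd j y b) \<le> e * (\<Prod>i<j. nI (b i))"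
proof (rule lfc_map_continuous[OF _ divdiff_mem[OF j(2)] restrict_selfadjoint[OF y] e])
  show "2 \<le> Suc j" using j by simp
  fix \<delta> :: real
  assume \<delta>: "0 < \<delta>"
    and c: "\<And>y' b. y' \<in> tuples (Suc j) selfadjoint \<Longrightarrow> (\<And>i. i < Suc j \<Longrightarrow> norm (y' i - (\<lambda>i\<in>{..<Suc j}. y i) i) < \<delta>) \<Longrightarrow>
      b \<in> tuples (Suc j - 1) I \<Longrightarrow> nI (lfc_map (Suc j) (divdiff f j) y' b - lfc_map (Suc j) (divdiff f j) (\<lambda>i\<in>{..<Suc j}. y i) b)
        \<le> e * (\<Prod>i<Suc j - 1. nI (b i))"
  show thesis
  proof (rule that[OF \<delta>])
    fix y' b :: "nat \<Rightarrow> 'a" assume y': "\<And>i. y' i \<in> selfadjoint" "\<And>i. norm (y' i - y i) < \<delta>" and b: "b \<in> tuples j I"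
    have b': "b \<in> tuples (Suc j - 1) I" using b by simp
    have d: "norm ((\<lambda>i\<in>{..<Suc j}. y' i) i - (\<lambda>i\<in>{..<Suc j}. y i) i) < \<delta>" if "i < Suc j" for i
      using y'(2) that by simp
    show "nI (lfc_dd j y' b - lfc_dd j y b) \<le> e * (\<Prod>i<j. nI (b i))"
      using c[OF restrict_selfadjoint[OF y'(1)] d b'] j by (simp add: lfc_dd_def restrict_def)
  qed
qed

text \<open>The perturbation formula gives even a local Lipschitz estimate, since the calculus of the first divided
  difference is bounded on bounded sets.\<close>

lemma lfc_dd_0_continuous:
  assumes x: "x \<in> V" and e: "0 < e"
  obtains \<delta> where "0 < \<delta>" "\<And>x' b. x' \<in> V \<Longrightarrow> nI (x' - x) < \<delta> \<Longrightarrow> b \<in> tuples 0 I \<Longrightarrow>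
    nI (lfc_dd 0 (\<lambda>_. a + x') b - lfc_dd 0 (\<lambda>_. a + x) b) \<le> e"
proof -
  define r where "r = norm (a + x) + C + 1"
  have r: "0 < r" "norm (a + x) \<le> r" using incl_norm_nonneg norm_ge_zero[of "a + x"] unfolding r_def by linarith+
  obtain K where K: "0 \<le> K" "\<forall>y. (\<forall>i. y i \<in> selfadjoint_ball r) \<longrightarrow> (\<forall>b\<in>tuples 1 I.
      nI (lfc_dd 1 y b) \<le> K * (\<Prod>i<1. nI (b i)))"
    using lfc_dd_bounded[OF order_refl k r(1)] by (elim exE conjE)
  define \<delta> where "\<delta> = min 1 (e / (K + 1))"
  have \<delta>: "0 < \<delta>" using e K(1) by (simp add: \<delta>_def)
  show thesis
  proof (rule that[OF \<delta>])
    fix x' and b :: "nat \<Rightarrow> 'a" assume x': "x' \<in> V" and d: "nI (x' - x) < \<delta>" and b: "b \<in> tuples 0 I"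
    have dI: "x' - x \<in> I" by (rule diff_mem[OF V_D(1)[OF x'] V_D(1)[OF x]])
    have d0: "0 \<le> nI (x' - x)" by (rule nI_nonneg[OF dI])
    have uv: "(a + x') - (a + x) = x' - x" by simp
    let ?y = "\<lambda>i::nat. if i \<le> 0 then a + x' else a + x"
    have "norm (x' - x) \<le> C * nI (x' - x)" by (rule norm_le_nI[OF dI])
    also have "\<dots> \<le> C * 1" using d by (intro mult_left_mono incl_norm_nonneg) (simp add: \<delta>_def)
    finally have "norm (a + x') \<le> r"
      using norm_triangle_ineq[of "a + x" "x' - x"] unfolding r_def by simp
    then have ys: "\<forall>i. ?y i \<in> selfadjoint_ball r"
      using r(2) V_D(3)[OF x] V_D(3)[OF x'] by (simp add: selfadjoint_ball_def)
    have bt: "(\<lambda>i\<in>{..<1::nat}. x' - x) \<in> tuples 1 I" by (rule tuples_restrict) (rule dI)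
    have "lfc_dd 0 (\<lambda>_. a + x') b - lfc_dd 0 (\<lambda>_. a + x) b = cfc f (a + x') - cfc f (a + x)"
      by (simp add: lfc_dd_def)
    also have "\<dots> = lfc_dd 1 ?y (\<lambda>i\<in>{..<1}. x' - x)"
      using lfc_dd_telescope_0[OF V_D(3)[OF x'] V_D(3)[OF x], unfolded uv, OF dI] .
    finally have eq: "lfc_dd 0 (\<lambda>_. a + x') b - lfc_dd 0 (\<lambda>_. a + x) b = lfc_dd 1 ?y (\<lambda>i\<in>{..<1}. x' - x)" .
    have "nI (lfc_dd 1 ?y (\<lambda>i\<in>{..<1}. x' - x)) \<le> K * nI (x' - x)"
      using bspec[OF K(2)[THEN spec, THEN mp, OF ys] bt] by simp
    also have "\<dots> \<le> (K + 1) * (e / (K + 1))"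
      using d d0 K(1) by (intro mult_mono) (auto simp: \<delta>_def)
    also have "\<dots> = e" using K(1) by simp
    finally show "nI (lfc_dd 0 (\<lambda>_. a + x') b - lfc_dd 0 (\<lambda>_. a + x) b) \<le> e" unfolding eq .
  qed
qed

lemma norm_lt_if_nI_lt:
  assumes "x \<in> I" "nI x < \<delta> / (C + 1)" "0 < \<delta>"
  shows "norm x < \<delta>"
proof -
  have c: "0 < C + 1" using incl_norm_nonneg by linarith
  have "norm x \<le> C * nI x" by (rule norm_le_nI[OF assms(1)])
  also have "\<dots> \<le> (C + 1) * nI x" using nI_nonneg[OF assms(1)] by (intro mult_right_mono) auto
  also have "\<dots> < \<delta>" using assms(2) c by (simp add: less_divide_eq mult.commute)
  finally show ?thesis .
qed

lemma lfc_dd_continuous_V: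
  assumes j: "j \<le> k" and x: "x \<in> V" and e: "0 < e"
  obtains \<delta> where "0 < \<delta>" "\<And>x' b. x' \<in> V \<Longrightarrow> nI (x' - x) < \<delta> \<Longrightarrow> b \<in> tuples j I \<Longrightarrow>
    nI (lfc_dd j (\<lambda>_. a + x') b - lfc_dd j (\<lambda>_. a + x) b) \<le> e * (\<Prod>i<j. nI (b i))"
proof (cases "j = 0")
  case True
  show thesis
  proof (rule lfc_dd_0_continuous[OF x e])
    fix \<delta> :: real assume "0 < \<delta>" "\<And>x' b. x' \<in> V \<Longrightarrow> nI (x' - x) < \<delta> \<Longrightarrow> b \<in> tuples 0 I \<Longrightarrow>
      nI (lfc_dd 0 (\<lambda>_. a + x') b - lfc_dd 0 (\<lambda>_. a + x) b) \<le> e"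
    then show thesis using that[of \<delta>] by (simp add: True)
  qed
next
  case False
  then have j1: "1 \<le> j" by simp
  show thesis
  proof (rule lfc_dd_continuous[OF j1 j V_D(3)[OF x] e])
    fix \<delta> :: real assume \<delta>: "0 < \<delta>" and c:
      "\<And>y' b. (\<And>i. y' i \<in> selfadjoint) \<Longrightarrow> (\<And>i. norm (y' i - (a + x)) < \<delta>) \<Longrightarrow> b \<in> tuples j I \<Longrightarrow>
        nI (lfc_dd j y' b - lfc_dd j (\<lambda>_. a + x) b) \<le> e * (\<Prod>i<j. nI (b i))"
    have "0 < \<delta> / (C + 1)" using \<delta> incl_norm_nonneg by (simp add: add_nonneg_pos)
    then show thesis
    proof (rule that)
      fix x' b assume x': "x' \<in> V" and d: "nI (x' - x) < \<delta> / (C + 1)" and b: "b \<in> tuples j I"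
      have "norm (x' - x) < \<delta>" by (rule norm_lt_if_nI_lt[OF diff_mem[OF V_D(1)[OF x'] V_D(1)[OF x]] d \<delta>])
      then have n: "norm ((a + x') - (a + x)) < \<delta>" by simp
      show "nI (lfc_dd j (\<lambda>_. a + x') b - lfc_dd j (\<lambda>_. a + x) b) \<le> e * (\<Prod>i<j. nI (b i))"
        by (rule c[OF V_D(3)[OF x'] n b])
    qed
  qed
qed

text \<open>The candidate for the \<open>j\<close>-th derivative at \<open>x\<close>.\<close>

definition deriv_map :: "nat \<Rightarrow> 'a \<Rightarrow> (nat \<Rightarrow> 'a) \<Rightarrow> 'a" where
  "deriv_map j x = (\<lambda>b\<in>tuples j V. \<Sum>\<pi> | \<pi> permutes {..<j}. lfc_dd j (\<lambda>_. a + x) (\<lambda>i\<in>{..<j}. b (\<pi> i)))"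

lemma deriv_map_apply: "b \<in> tuples j V \<Longrightarrow>
  deriv_map j x b = (\<Sum>\<pi> | \<pi> permutes {..<j}. lfc_dd j (\<lambda>_. a + x) (\<lambda>i\<in>{..<j}. b (\<pi> i)))"
  by (simp add: deriv_map_def)

lemma nI_sum_permutations_le:
  assumes "\<And>\<pi>. \<pi> permutes {..<j} \<Longrightarrow> h \<pi> \<in> I" "\<And>\<pi>. \<pi> permutes {..<j} \<Longrightarrow> nI (h \<pi>) \<le> M"
  shows "nI (\<Sum>\<pi> | \<pi> permutes {..<j}. h \<pi>) \<le> fact j * M"
proof -
  have "nI (\<Sum>\<pi> | \<pi> permutes {..<j}. h \<pi>) \<le> (\<Sum>\<pi> | \<pi> permutes {..<j}. nI (h \<pi>))"
    by (rule nI_sum) (use assms(1) in simp)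
  also have "\<dots> \<le> of_nat (card {\<pi>. \<pi> permutes {..<j}}) * M"
    by (rule sum_bounded_above) (use assms(2) in simp)
  also have "card {\<pi>. \<pi> permutes {..<j}} = fact j" by (rule card_permutations) simp_all
  finally show ?thesis by simp
qed

lemma deriv_map_mem:
  assumes j: "j \<le> k" and x: "x \<in> V" and b: "b \<in> tuples j V"
  shows "deriv_map j x b \<in> I"
  unfolding deriv_map_apply[OF b]
  by (rule sum_mem, rule lfc_dd_perturbed_mem[OF j x]) (use tuples_permute[OF tuples_V_I[OF b]] in simp)

lemma deriv_map_add:
  assumes j: "j \<le> k" and x: "x \<in> V" and b: "b \<in> tuples j V" and i: "i < j" and u: "u \<in> V" and w: "w \<in> V"
  shows "deriv_map j x (b(i := u + w)) = deriv_map j x (b(i := u)) + deriv_map j x (b(i := w))"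
  unfolding deriv_map_apply[OF tuples_upd[OF b i V_add[OF u w]]] deriv_map_apply[OF tuples_upd[OF b i u]] deriv_map_apply[OF tuples_upd[OF b i w]]
    sum.distrib[symmetric]
proof (rule sum.cong[OF refl])
  fix \<pi> assume "\<pi> \<in> {\<pi>. \<pi> permutes {..<j}}"
  then have \<pi>: "\<pi> permutes {..<j}" by simp
  show "lfc_dd j (\<lambda>_. a + x) (\<lambda>l\<in>{..<j}. (b(i := u + w)) (\<pi> l))
      = lfc_dd j (\<lambda>_. a + x) (\<lambda>l\<in>{..<j}. (b(i := u)) (\<pi> l)) + lfc_dd j (\<lambda>_. a + x) (\<lambda>l\<in>{..<j}. (b(i := w)) (\<pi> l))"
    unfolding permute_upd(1)[OF \<pi> i]
    by (rule lfc_dd_add[OF j x tuples_permute[OF tuples_V_I[OF b] \<pi>] permute_upd(2)[OF \<pi> i] V_D(1)[OF u] V_D(1)[OF w]])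
qed

lemma deriv_map_scaleR:
  assumes j: "j \<le> k" and x: "x \<in> V" and b: "b \<in> tuples j V" and i: "i < j" and u: "u \<in> V"
  shows "deriv_map j x (b(i := t *\<^sub>R u)) = t *\<^sub>R deriv_map j x (b(i := u))"
  unfolding deriv_map_apply[OF tuples_upd[OF b i V_scaleR[OF u]]] deriv_map_apply[OF tuples_upd[OF b i u]] scaleR_sum_right
proof (rule sum.cong[OF refl])
  fix \<pi> assume "\<pi> \<in> {\<pi>. \<pi> permutes {..<j}}"
  then have \<pi>: "\<pi> permutes {..<j}" by simp
  show "lfc_dd j (\<lambda>_. a + x) (\<lambda>l\<in>{..<j}. (b(i := t *\<^sub>R u)) (\<pi> l))
      = t *\<^sub>R lfc_dd j (\<lambda>_. a + x) (\<lambda>l\<in>{..<j}. (b(i := u)) (\<pi> l))"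
    unfolding permute_upd(1)[OF \<pi> i] scaleC_of_real[symmetric]
    by (rule lfc_dd_scaleC[OF j x tuples_permute[OF tuples_V_I[OF b] \<pi>] permute_upd(2)[OF \<pi> i] V_D(1)[OF u]])
qed

lemma lfc_dd_bounded_at:
  assumes j: "j \<le> k" and x: "x \<in> V"
  shows "\<exists>K. \<forall>b\<in>tuples j I. nI (lfc_dd j (\<lambda>_. a + x) b) \<le> K * (\<Prod>i<j. nI (b i))"
proof (cases "j = 0")
  case True
  show ?thesis
    by (rule exI[of _ "nI (cfc f (a + x) - cfc f a)"]) (simp add: True lfc_dd_def)
next
  case False
  then have j1: "1 \<le> j" by simp
  have r: "0 < norm (a + x) + 1" by (simp add: add_nonneg_pos)
  obtain K where K: "\<forall>y. (\<forall>i. y i \<in> selfadjoint_ball (norm (a + x) + 1)) \<longrightarrow> (\<forall>b\<in>tuples j I.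
      nI (lfc_dd j y b) \<le> K * (\<Prod>i<j. nI (b i)))"
    using lfc_dd_bounded[OF j1 j r] by (elim exE conjE)
  have "\<forall>i::nat. a + x \<in> selfadjoint_ball (norm (a + x) + 1)"
    using V_D(3)[OF x] by (simp add: selfadjoint_ball_def)
  from K[THEN spec, THEN mp, OF this] show ?thesis by (rule exI)
qed

lemma deriv_map_bounded_multilinear:
  assumes j: "j \<le> k" and x: "x \<in> V"
  shows "deriv_map j x \<in> bounded_multilinear \<real> V nI I nI j"
  unfolding bounded_multilinear_def
proof (intro CollectI conjI ballI allI impI)
  show "deriv_map j x \<in> tuples j V \<rightarrow>\<^sub>E I"
  proof (rule PiE_I)
    show "deriv_map j x b \<in> I" if "b \<in> tuples j V" for b by (rule deriv_map_mem[OF j x that])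
    show "deriv_map j x b = undefined" if "b \<notin> tuples j V" for b using that by (simp add: deriv_map_def)
  qed
  show "deriv_map j x (b(i := u + w)) = deriv_map j x (b(i := u)) + deriv_map j x (b(i := w))"
    if "b \<in> tuples j V" "i < j" "u \<in> V" "w \<in> V" for b i u w by (rule deriv_map_add[OF j x that])
  show "deriv_map j x (b(i := c *\<^sub>C u)) = c *\<^sub>C deriv_map j x (b(i := u))"
    if b: "b \<in> tuples j V" "i < j" "u \<in> V" and c: "c \<in> \<real>" for b i u c
  proof -
    obtain t where "c = complex_of_real t" using c by (rule Reals_cases)
    then show ?thesis using deriv_map_scaleR[OF j x b, of t] by (simp add: scaleC_of_real)
  qed
  obtain K where K: "\<forall>b\<in>tuples j I. nI (lfc_dd j (\<lambda>_. a + x) b) \<le> K * (\<Prod>i<j. nI (b i))"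
    using lfc_dd_bounded_at[OF j x] by (elim exE)
  have "nI (deriv_map j x b) \<le> (fact j * K) * (\<Prod>i<j. nI (b i))" if b: "b \<in> tuples j V" for b
  proof -
    have "nI (deriv_map j x b) \<le> fact j * (K * (\<Prod>i<j. nI (b i)))"
      unfolding deriv_map_apply[OF b]
    proof (rule nI_sum_permutations_le)
      fix \<pi> assume \<pi>: "\<pi> permutes {..<j}"
      note bp = tuples_permute[OF tuples_V_I[OF b] \<pi>]
      show "lfc_dd j (\<lambda>_. a + x) (\<lambda>i\<in>{..<j}. b (\<pi> i)) \<in> I" by (rule lfc_dd_perturbed_mem[OF j x bp])
      show "nI (lfc_dd j (\<lambda>_. a + x) (\<lambda>i\<in>{..<j}. b (\<pi> i))) \<le> K * (\<Prod>i<j. nI (b i))"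
        using bspec[OF K bp] unfolding prod_permute[OF \<pi>] .
    qed
    then show ?thesis by (simp add: mult.assoc)
  qed
  then show "\<exists>C. \<forall>b\<in>tuples j V. nI (deriv_map j x b) \<le> C * (\<Prod>i<j. nI (b i))" by blast
qed

lemma deriv_map_continuous:
  assumes j: "j \<le> k" and x: "x \<in> V" and e: "0 < e"
  obtains \<delta> where "0 < \<delta>" "\<And>x'. x' \<in> V \<Longrightarrow> nI (x' - x) < \<delta> \<Longrightarrow> multilinear_norm V nI nI j (deriv_map j x' - deriv_map j x) \<le> e"
proof -
  define e' where "e' = e / fact j"
  have e': "0 < e'" using e by (simp add: e'_def)
  show thesis
  proof (rule lfc_dd_continuous_V[OF j x e'])
    fix \<delta> :: real assume \<delta>: "0 < \<delta>" and c: "\<And>x' b. x' \<in> V \<Longrightarrow> nI (x' - x) < \<delta> \<Longrightarrow> b \<in> tuples j I \<Longrightarrow>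
      nI (lfc_dd j (\<lambda>_. a + x') b - lfc_dd j (\<lambda>_. a + x) b) \<le> e' * (\<Prod>i<j. nI (b i))"
    show thesis
    proof (rule that[OF \<delta>])
      fix x' assume x': "x' \<in> V" "nI (x' - x) < \<delta>"
      show "multilinear_norm V nI nI j (deriv_map j x' - deriv_map j x) \<le> e"
      proof (rule multilinear_norm_le)
        show "0 \<le> e" using e by simp
        fix b assume b: "b \<in> tuples j V"
        have "(deriv_map j x' - deriv_map j x) b = (\<Sum>\<pi> | \<pi> permutes {..<j}. lfc_dd j (\<lambda>_. a + x') (\<lambda>i\<in>{..<j}. b (\<pi> i))
            - lfc_dd j (\<lambda>_. a + x) (\<lambda>i\<in>{..<j}. b (\<pi> i)))"
          by (simp add: deriv_map_apply[OF b] sum_subtractf)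
        moreover have "nI (\<Sum>\<pi> | \<pi> permutes {..<j}. lfc_dd j (\<lambda>_. a + x') (\<lambda>i\<in>{..<j}. b (\<pi> i))
            - lfc_dd j (\<lambda>_. a + x) (\<lambda>i\<in>{..<j}. b (\<pi> i))) \<le> fact j * (e' * (\<Prod>i<j. nI (b i)))"
        proof (rule nI_sum_permutations_le)
          fix \<pi> assume \<pi>: "\<pi> permutes {..<j}"
          note bp = tuples_permute[OF tuples_V_I[OF b] \<pi>]
          show "lfc_dd j (\<lambda>_. a + x') (\<lambda>i\<in>{..<j}. b (\<pi> i)) - lfc_dd j (\<lambda>_. a + x) (\<lambda>i\<in>{..<j}. b (\<pi> i)) \<in> I"
            by (rule diff_mem[OF lfc_dd_perturbed_mem[OF j x'(1) bp] lfc_dd_perturbed_mem[OF j x bp]])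
          show "nI (lfc_dd j (\<lambda>_. a + x') (\<lambda>i\<in>{..<j}. b (\<pi> i)) - lfc_dd j (\<lambda>_. a + x) (\<lambda>i\<in>{..<j}. b (\<pi> i)))
              \<le> e' * (\<Prod>i<j. nI (b i))"
            using c[OF x' bp] unfolding prod_permute[OF \<pi>] .
        qed
        moreover have "fact j * (e' * (\<Prod>i<j. nI (b i))) = e * (\<Prod>i<j. nI (b i))" by (simp add: e'_def)
        ultimately show "nI ((deriv_map j x' - deriv_map j x) b) \<le> e * (\<Prod>i<j. nI (b i))" by simp
      qed
    qed
  qed
qed

lemma case_nat_tuples: "h \<in> V' \<Longrightarrow> b \<in> tuples j V' \<Longrightarrow> case_nat h b \<in> tuples (Suc j) V'"
  by (auto simp: tuples_def PiE_iff extensional_def split: nat.splits)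

text \<open>With \<open>u = a + x + h\<close> and \<open>v = a + x\<close>, the perturbation formula writes the increment of the \<open>j\<close>-th candidate as a
  sum over all permutations of the \<open>j\<close> directions and all positions at which \<open>h\<close> is inserted, with arguments from
  \<open>{u, v}\<close>. The same sum with all arguments equal to \<open>v\<close> is the next candidate, by \<open>sum_permutations_insert_at\<close>. By
  continuity of the calculus the replacement costs at most a small multiple of the product of all norms.\<close>

lemma deriv_map_frechet:
  assumes j: "j < k" and x: "x \<in> V" and e: "0 < e"
  obtains \<delta> where "0 < \<delta>" "\<And>h b. h \<in> V \<Longrightarrow> nI h < \<delta> \<Longrightarrow> b \<in> tuples j V \<Longrightarrow>
    nI (deriv_map j (x + h) b - deriv_map j x b - deriv_map (Suc j) x (case_nat h b)) \<le> e * nI h * (\<Prod>i<j. nI (b i))"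
proof -
  have j': "1 \<le> Suc j" "Suc j \<le> k" using j by auto
  \<comment> \<open>There are \<open>fact j\<close> permutations and \<open>Suc j\<close> positions for the
    insertion of \<open>h\<close>.\<close>
  define e' where "e' = e / (fact j * real (Suc j))"
  have e': "0 < e'" using e by (simp add: e'_def)
  let ?v = "a + x"
  have v: "?v \<in> selfadjoint" by (rule V_D(3)[OF x])
  show thesis
  proof (rule lfc_dd_continuous[OF j' v e'])
    fix \<delta> :: real assume \<delta>: "0 < \<delta>" and c:
      "\<And>y' b. (\<And>i. y' i \<in> selfadjoint) \<Longrightarrow> (\<And>i. norm (y' i - (a + x)) < \<delta>) \<Longrightarrow> b \<in> tuples (Suc j) I \<Longrightarrow>
        nI (lfc_dd (Suc j) y' b - lfc_dd (Suc j) (\<lambda>_. a + x) b) \<le> e' * (\<Prod>i<Suc j. nI (b i))"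
    \<comment> \<open>Since \<open>norm h \<le> C * nI h\<close>, this radius ensures \<open>norm h <
      \<delta>\<close>.\<close>
    have "0 < \<delta> / (C + 1)" using \<delta> incl_norm_nonneg by (simp add: add_nonneg_pos)
    then show thesis
    proof (rule that)
      fix h b assume h: "h \<in> V" "nI h < \<delta> / (C + 1)" and b: "b \<in> tuples j V"
      note xh = V_add[OF x h(1)]
      let ?u = "a + (x + h)"
      have u: "?u \<in> selfadjoint" by (rule V_D(3)[OF xh])
      have uv: "?u - ?v = h" by simp
      have hI: "h \<in> I" by (rule V_D(1)[OF h(1)])
      have nh: "norm h < \<delta>" by (rule norm_lt_if_nI_lt[OF hI h(2) \<delta>])
      let ?y = "\<lambda>l i. if i \<le> l then ?u else ?v"
      let ?b = "\<lambda>\<pi>. \<lambda>i\<in>{..<j}. b (\<pi> i)"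
      let ?M = "e' * (nI h * (\<Prod>i<j. nI (b i)))"
      have tel: "lfc_dd j (\<lambda>_. ?u) (?b \<pi>) - lfc_dd j (\<lambda>_. ?v) (?b \<pi>)
          = (\<Sum>l\<le>j. lfc_dd (Suc j) (?y l) (insert_at l h (?b \<pi>)))" if \<pi>: "\<pi> permutes {..<j}" for \<pi>
        using lfc_dd_telescope[OF j u v, unfolded uv, OF hI tuples_permute[OF tuples_V_I[OF b] \<pi>]] .
      have d1: "deriv_map j (x + h) b - deriv_map j x b = (\<Sum>\<pi> | \<pi> permutes {..<j}. \<Sum>l\<le>j. lfc_dd (Suc j) (?y l) (insert_at l h (?b \<pi>)))"
        unfolding deriv_map_apply[OF b] sum_subtractf[symmetric] by (rule sum.cong[OF refl]) (use tel in simp)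
      have d2: "deriv_map (Suc j) x (case_nat h b) = (\<Sum>\<pi> | \<pi> permutes {..<j}. \<Sum>l\<le>j. lfc_dd (Suc j) (\<lambda>_. ?v) (insert_at l h (?b \<pi>)))"
        unfolding deriv_map_apply[OF case_nat_tuples[OF h(1) b]] by (rule sum_permutations_insert_at)
      have d: "deriv_map j (x + h) b - deriv_map j x b - deriv_map (Suc j) x (case_nat h b)
          = (\<Sum>\<pi> | \<pi> permutes {..<j}. \<Sum>l\<le>j. lfc_dd (Suc j) (?y l) (insert_at l h (?b \<pi>)) - lfc_dd (Suc j) (\<lambda>_. ?v) (insert_at l h (?b \<pi>)))"
        unfolding d1 d2 sum_subtractf ..
      have ys: "?y l i \<in> selfadjoint" "norm (?y l i - (a + x)) < \<delta>" for l i using u v nh \<delta> by auto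
      have inner: "(\<Sum>l\<le>j. lfc_dd (Suc j) (?y l) (insert_at l h (?b \<pi>)) - lfc_dd (Suc j) (\<lambda>_. ?v) (insert_at l h (?b \<pi>))) \<in> I
        \<and> nI (\<Sum>l\<le>j. lfc_dd (Suc j) (?y l) (insert_at l h (?b \<pi>)) - lfc_dd (Suc j) (\<lambda>_. ?v) (insert_at l h (?b \<pi>))) \<le> real (Suc j) * ?M"
        if \<pi>: "\<pi> permutes {..<j}" for \<pi>
      proof -
        let ?d = "\<lambda>l. lfc_dd (Suc j) (?y l) (insert_at l h (?b \<pi>)) - lfc_dd (Suc j) (\<lambda>_. ?v) (insert_at l h (?b \<pi>))"
        have ins: "insert_at l h (?b \<pi>) \<in> tuples (Suc j) I" if "l \<in> {..j}" for l
          using insert_at_tuples[OF tuples_permute[OF tuples_V_I[OF b] \<pi>] hI, of l] that by simp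
        have mem: "?d l \<in> I" if "l \<in> {..j}" for l
          by (rule diff_mem[OF lfc_dd_mem[OF j' ys(1) ins[OF that]] lfc_dd_mem[OF j' v ins[OF that]]])
        have bd: "nI (?d l) \<le> ?M" if l: "l \<in> {..j}" for l
        proof -
          have "nI (?d l) \<le> e' * (\<Prod>i<Suc j. nI (insert_at l h (?b \<pi>) i))" by (rule c[OF ys ins[OF l]])
          also have "(\<Prod>i<Suc j. nI (insert_at l h (?b \<pi>) i)) = nI h * (\<Prod>i<j. nI (?b \<pi> i))"
            by (rule prod_insert_at) (use l in simp)
          finally show ?thesis unfolding prod_permute[OF \<pi>] .
        qed
        have "nI (\<Sum>l\<le>j. ?d l) \<le> (\<Sum>l\<le>j. nI (?d l))" by (rule nI_sum[OF mem])
        also have "\<dots> \<le> of_nat (card {..j}) * ?M" by (rule sum_bounded_above[OF bd])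
        finally have "nI (\<Sum>l\<le>j. ?d l) \<le> real (card {..j}) * ?M" .
        then have "nI (\<Sum>l\<le>j. ?d l) \<le> real (Suc j) * ?M" unfolding card_atMost .
        with sum_mem[OF mem] show ?thesis by (rule conjI)
      qed
      have "nI (deriv_map j (x + h) b - deriv_map j x b - deriv_map (Suc j) x (case_nat h b)) \<le> fact j * (real (Suc j) * ?M)"
        unfolding d by (rule nI_sum_permutations_le[OF conjunct1[OF inner] conjunct2[OF inner]])
      also have "\<dots> = e * nI h * (\<Prod>i<j. nI (b i))"
      proof -
        have "fact j * (real (Suc j) * e') = e" unfolding e'_def by (simp del: of_nat_Suc)
        then show ?thesis by (metis mult.assoc)
      qed
      finally show "nI (deriv_map j (x + h) b - deriv_map j x b - deriv_map (Suc j) x (case_nat h b)) \<le> e * nI h * (\<Prod>i<j. nI (b i))" .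
    qed
  qed
qed

lemma seminorm_space_V: "seminorm_space V {\<lambda>v. ennreal (nI v)}"
proof
  fix p u v w assume p: "p \<in> {\<lambda>v. ennreal (nI v)}"
  show "p (v - v) = 0" using p by simp
  assume uvw: "u \<in> V" "v \<in> V" "w \<in> V"
  have "nI (u - w) \<le> nI (u - v) + nI (v - w)" using uvw by (intro nI_triangle3) auto
  moreover have "0 \<le> nI (u - v)" "0 \<le> nI (v - w)" using uvw by (auto intro!: nI_nonneg diff_mem)
  ultimately show "p (u - w) \<le> p (u - v) + p (v - w)"
    using p by (simp add: ennreal_plus[symmetric] ennreal_leI del: ennreal_plus)
qed simp

lemma deriv_map_continuous_map:
  assumes j: "j \<le> k"
  shows "continuous_map (seminorm_topology V {\<lambda>v. ennreal (nI v)})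
    (seminorm_topology (bounded_multilinear \<real> V nI I nI j) {\<lambda>S. ennreal (multilinear_norm V nI nI j S)}) (deriv_map j)"
proof (rule seminorm_space.continuous_map_into[OF seminorm_space_multilinear])
  let ?X = "seminorm_topology V {\<lambda>v. ennreal (nI v)}"
  have top: "topspace ?X = V" by (rule seminorm_space.topspace[OF seminorm_space_V])
  show "V \<subseteq> I" by simp
  show "deriv_map j \<in> topspace ?X \<rightarrow> bounded_multilinear \<real> V nI I nI j"
    unfolding top using deriv_map_bounded_multilinear[OF j] by blast
  fix x p and e :: real
  assume x: "x \<in> topspace ?X" and p: "p \<in> {\<lambda>S. ennreal (multilinear_norm V nI nI j S)}" and e: "0 < e"
  have xV: "x \<in> V" using x unfolding top .
  have e2: "0 < e / 2" using e by simp
  show "\<exists>U. openin ?X U \<and> x \<in> U \<and> (\<forall>y\<in>U. p (deriv_map j y - deriv_map j x) < ennreal e)"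
  proof (rule deriv_map_continuous[OF j xV e2])
    fix \<delta> :: real assume \<delta>: "0 < \<delta>"
      and c: "\<And>x'. x' \<in> V \<Longrightarrow> nI (x' - x) < \<delta> \<Longrightarrow> multilinear_norm V nI nI j (deriv_map j x' - deriv_map j x) \<le> e / 2"
    let ?U = "{w \<in> V. ennreal (nI (w - x)) < ennreal \<delta>}"
    have "openin ?X ?U" by (rule seminorm_space.openin_ball[OF seminorm_space_V singletonI xV \<delta>])
    moreover have "x \<in> ?U" using xV \<delta> by simp
    moreover have "p (deriv_map j y - deriv_map j x) < ennreal e" if y: "y \<in> ?U" for y
    proof -
      have yV: "y \<in> V" and "ennreal (nI (y - x)) < ennreal \<delta>" using y by blast+
      then have "nI (y - x) < \<delta>" using nI_nonneg[OF diff_mem[OF V_D(1)[OF yV] V_D(1)[OF xV]]]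
        by (simp add: ennreal_less_iff)
      then have "ennreal (multilinear_norm V nI nI j (deriv_map j y - deriv_map j x)) \<le> ennreal (e / 2)"
        using c[OF yV] by (intro ennreal_leI)
      also have "\<dots> < ennreal e" using e by (intro ennreal_lessI) auto
      finally show ?thesis using p by simp
    qed
    ultimately show ?thesis by blast
  qed
qed

lemma deriv_map_0:
  assumes "b \<in> tuples 0 V"
  shows "deriv_map 0 x b = cfc f (a + x) - cfc f a"
proof -
  have "{\<pi>::nat \<Rightarrow> nat. \<pi> permutes {..<0}} = {id}" by auto
  then show ?thesis unfolding deriv_map_apply[OF assms] by (simp add: lfc_dd_def)
qed

lemma frechet_Ck_cfc: "frechet_Ck k V nI I nI (\<lambda>b. cfc f (a + b) - cfc f a)"
  unfolding frechet_Ck_def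
proof (intro exI[of _ deriv_map] conjI ballI allI impI)
  show "deriv_map 0 x b = cfc f (a + x) - cfc f a" if "b \<in> tuples 0 V" for x b by (rule deriv_map_0[OF that])
  show "continuous_map (seminorm_topology V {\<lambda>v. ennreal (nI v)})
    (seminorm_topology (bounded_multilinear \<real> V nI I nI j) {\<lambda>S. ennreal (multilinear_norm V nI nI j S)}) (deriv_map j)"
    if "j \<le> k" for j by (rule deriv_map_continuous_map[OF that])
  fix j x and e :: real assume j: "j < k" and x: "x \<in> V" and e: "0 < e"
  show "\<exists>\<delta>>0. \<forall>h\<in>V. nI h < \<delta> \<longrightarrow>
    multilinear_norm V nI nI j (\<lambda>b. deriv_map j (x + h) b - deriv_map j x b - deriv_map (Suc j) x (case_nat h b)) \<le> e * nI h"
  proof (rule deriv_map_frechet[OF j x e])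
    fix \<delta> :: real assume \<delta>: "0 < \<delta>" and c: "\<And>h b. h \<in> V \<Longrightarrow> nI h < \<delta> \<Longrightarrow> b \<in> tuples j V \<Longrightarrow>
      nI (deriv_map j (x + h) b - deriv_map j x b - deriv_map (Suc j) x (case_nat h b)) \<le> e * nI h * (\<Prod>i<j. nI (b i))"
    have "multilinear_norm V nI nI j (\<lambda>b. deriv_map j (x + h) b - deriv_map j x b - deriv_map (Suc j) x (case_nat h b)) \<le> e * nI h"
      if h: "h \<in> V" "nI h < \<delta>" for h
    proof (rule multilinear_norm_le)
      show "0 \<le> e * nI h" using e nI_nonneg[OF V_D(1)[OF h(1)]] by simp
    qed (rule c[OF h])
    with \<delta> show ?thesis by blast
  qed
qed

text \<open>Limits with respect to the norm of the ideal are unique.\<close>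

lemma dir_deriv_eqI:
  assumes g: "\<And>t. g (x + t *\<^sub>R v) \<in> I" and y: "y \<in> I"
    and lim: "((\<lambda>t::real. nI ((1 / t) *\<^sub>R (g (x + t *\<^sub>R v) - g x) - y)) \<longlongrightarrow> 0) (at 0)"
  shows "dir_deriv I nI v g x = y"
  unfolding dir_deriv_def
proof (rule the_equality)
  show "y \<in> I \<and> ((\<lambda>t::real. nI ((1 / t) *\<^sub>R (g (x + t *\<^sub>R v) - g x) - y)) \<longlongrightarrow> 0) (at 0)"
    using y lim by blast
  fix y' assume y': "y' \<in> I \<and> ((\<lambda>t::real. nI ((1 / t) *\<^sub>R (g (x + t *\<^sub>R v) - g x) - y')) \<longlongrightarrow> 0) (at 0)"
  let ?q = "\<lambda>t. (1 / t) *\<^sub>R (g (x + t *\<^sub>R v) - g x)"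
  have qI: "?q t \<in> I" for t using g[of t] g[of 0] by (intro scaleR_mem diff_mem) simp_all
  have "((\<lambda>t. nI (?q t - y') + nI (?q t - y)) \<longlongrightarrow> 0 + 0) (at 0)"
    by (rule tendsto_add[OF conjunct2[OF y'] lim])
  then have "0 + 0 \<ge> nI (y' - y)"
  proof (rule tendsto_lowerbound)
    have "nI (y' - y) \<le> nI (?q t - y') + nI (?q t - y)" for t
      using nI_triangle3[OF conjunct1[OF y'] qI y, of t] nI_diff_commute[OF conjunct1[OF y'] qI, of t] by simp
    then show "\<forall>\<^sub>F t in at 0. nI (y' - y) \<le> nI (?q t - y') + nI (?q t - y)" by (intro always_eventually allI)
  qed simp
  then have "nI (y' - y) = 0" using nI_nonneg[OF diff_mem[OF conjunct1[OF y'] y]] by simp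
  then show "y' = y" using nI_eq_0_iff[OF diff_mem[OF conjunct1[OF y'] y]] by simp
qed

text \<open>Each directional derivative puts its direction in front, so the directions appear in reverse order.\<close>

lemma iter_dir_deriv_eq_deriv_map:
  assumes v: "v \<in> tuples k V"
  shows "j \<le> k \<Longrightarrow> x \<in> V \<Longrightarrow>
    iter_dir_deriv I nI j v (\<lambda>b. cfc f (a + b) - cfc f a) x = deriv_map j x (\<lambda>i\<in>{..<j}. v (j - 1 - i))"
proof (induction j arbitrary: x)
  case 0
  have "(\<lambda>i\<in>{..<0}. v (0 - 1 - i)) \<in> tuples 0 V" by (rule tuples_restrict) simp
  from deriv_map_0[OF this, of x] show ?case by (simp only: iter_dir_deriv.simps)
next
  case (Suc j)
  let ?g = "iter_dir_deriv I nI j v (\<lambda>b. cfc f (a + b) - cfc f a)"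
  let ?b = "\<lambda>i\<in>{..<j}. v (j - 1 - i)"
  let ?w = "v j"
  have j: "j < k" "j \<le> k" using Suc.prems by auto
  have w: "?w \<in> V" by (rule tuples_D[OF v j(1)])
  have b: "?b \<in> tuples j V" by (rule tuples_restrict) (use tuples_D[OF v] j in simp)
  have cb: "(\<lambda>i\<in>{..<Suc j}. v (Suc j - 1 - i)) = case_nat ?w ?b"
    by (auto simp: fun_eq_iff split: nat.splits)
  have xt: "x + t *\<^sub>R ?w \<in> V" for t by (rule V_add[OF Suc.prems(2) V_scaleR[OF w]])
  have g: "?g (x + t *\<^sub>R ?w) = deriv_map j (x + t *\<^sub>R ?w) ?b" for t by (rule Suc.IH[OF j(2) xt])
  have g0: "?g x = deriv_map j x ?b" by (rule Suc.IH[OF j(2) Suc.prems(2)])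
  let ?y = "deriv_map (Suc j) x (case_nat ?w ?b)"
  have y: "?y \<in> I" by (rule deriv_map_mem[OF Suc.prems case_nat_tuples[OF w b]])
  define N where "N = nI ?w * (\<Prod>i<j. nI (?b i))"
  have N: "0 \<le> N" unfolding N_def
    by (rule mult_nonneg_nonneg[OF nI_nonneg[OF V_D(1)[OF w]] prod_nI_nonneg[OF tuples_V_I[OF b]]])
  have "((\<lambda>t::real. nI ((1 / t) *\<^sub>R (?g (x + t *\<^sub>R ?w) - ?g x) - ?y)) \<longlongrightarrow> 0) (at 0)"
  proof (rule tendstoI)
    fix e :: real assume e: "0 < e"
    define e' where "e' = e / (N + 1)"
    have e': "0 < e'" using e N by (simp add: e'_def)
    show "\<forall>\<^sub>F t in at 0. dist (nI ((1 / t) *\<^sub>R (?g (x + t *\<^sub>R ?w) - ?g x) - ?y)) 0 < e"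
    proof (rule deriv_map_frechet[OF j(1) Suc.prems(2) e'])
      fix \<delta> :: real assume \<delta>: "0 < \<delta>" and c: "\<And>h b. h \<in> V \<Longrightarrow> nI h < \<delta> \<Longrightarrow> b \<in> tuples j V \<Longrightarrow>
        nI (deriv_map j (x + h) b - deriv_map j x b - deriv_map (Suc j) x (case_nat h b)) \<le> e' * nI h * (\<Prod>i<j. nI (b i))"
      define d where "d = \<delta> / (nI ?w + 1)"
      have nw: "0 \<le> nI ?w" by (rule nI_nonneg[OF V_D(1)[OF w]])
      have d: "0 < d" using \<delta> nw by (simp add: d_def)
      have "dist (nI ((1 / t) *\<^sub>R (?g (x + t *\<^sub>R ?w) - ?g x) - ?y)) 0 < e" if t: "t \<noteq> 0" "dist t 0 < d" for t
      proof -
        let ?h = "t *\<^sub>R ?w"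
        have hV: "?h \<in> V" by (rule V_scaleR[OF w])
        have nh: "nI ?h = \<bar>t\<bar> * nI ?w" by (rule nI_scaleR[OF V_D(1)[OF w]])
        have "\<bar>t\<bar> * nI ?w \<le> \<bar>t\<bar> * (nI ?w + 1)" by (intro mult_left_mono) auto
        also have "\<dots> < \<delta>" using t(2) nw by (simp add: d_def less_divide_eq)
        finally have hd: "nI ?h < \<delta>" unfolding nh .
        let ?R = "deriv_map j (x + ?h) ?b - deriv_map j x ?b - deriv_map (Suc j) x (case_nat ?h ?b)"
        have RI: "?R \<in> I"
          by (intro diff_mem deriv_map_mem[OF j(2) xt b] deriv_map_mem[OF j(2) Suc.prems(2) b] deriv_map_mem[OF Suc.prems case_nat_tuples[OF hV b]])
        have lin: "deriv_map (Suc j) x (case_nat ?h ?b) = t *\<^sub>R ?y"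
        proof -
          have upd: "case_nat z ?b = (case_nat ?w ?b)(0 := z)" for z by (auto simp: fun_eq_iff split: nat.splits)
          have "deriv_map (Suc j) x ((case_nat ?w ?b)(0 := t *\<^sub>R ?w)) = t *\<^sub>R deriv_map (Suc j) x ((case_nat ?w ?b)(0 := ?w))"
            by (rule deriv_map_scaleR[OF Suc.prems case_nat_tuples[OF w b] zero_less_Suc w])
          then show ?thesis unfolding upd[symmetric] .
        qed
        have eq: "(1 / t) *\<^sub>R (?g (x + t *\<^sub>R ?w) - ?g x) - ?y = (1 / t) *\<^sub>R ?R"
          unfolding g g0 lin using t(1) by (simp add: scaleR_diff_right)
        have "nI ((1 / t) *\<^sub>R ?R) = \<bar>1 / t\<bar> * nI ?R" by (rule nI_scaleR[OF RI])
        also have "\<dots> \<le> \<bar>1 / t\<bar> * (e' * nI ?h * (\<Prod>i<j. nI (?b i)))"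
          by (rule mult_left_mono[OF c[OF hV hd b] abs_ge_zero])
        also have "\<dots> = e' * N" using t(1) by (simp add: nh N_def abs_divide del: restrict_apply)
        also have "\<dots> < e" using e N by (simp add: e'_def divide_less_eq)
        finally have "nI ((1 / t) *\<^sub>R ?R) < e" .
        then show ?thesis
          unfolding eq using nI_nonneg[OF scaleR_mem[OF RI, of "1 / t"]] by (simp only: dist_real_def) simp
      qed
      then show ?thesis unfolding eventually_at using d by blast
    qed
  qed
  moreover have "?g (x + t *\<^sub>R ?w) \<in> I" for t
    unfolding g by (rule deriv_map_mem[OF j(2) xt b])
  ultimately have "dir_deriv I nI ?w ?g x = ?y"
    by (intro dir_deriv_eqI[OF _ y])
  then show ?case unfolding cb by (simp only: iter_dir_deriv.simps)
qed

text \<open>\<^const>\<open>deriv_map\<close> is symmetric, as a sum over all permutations.\<close>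

lemma deriv_map_reverse:
  assumes v: "v \<in> tuples k V"
  shows "deriv_map k x (\<lambda>i\<in>{..<k}. v (k - 1 - i)) = deriv_map k x v"
proof -
  define \<rho> where "\<rho> i = (if i < k then k - 1 - i else i)" for i
  have \<rho>: "\<rho> permutes {..<k}"
  proof (rule bij_imp_permutes)
    show "bij_betw \<rho> {..<k} {..<k}"
      by (rule bij_betw_byWitness[where f' = \<rho>]) (auto simp: \<rho>_def)
  qed (simp add: \<rho>_def)
  have r: "(\<lambda>i\<in>{..<k}. v (k - 1 - i)) \<in> tuples k V"
    by (rule tuples_restrict) (use tuples_D[OF v] k in simp)
  have "deriv_map k x v = (\<Sum>\<pi> | \<pi> permutes {..<k}. lfc_dd k (\<lambda>_. a + x) (\<lambda>i\<in>{..<k}. v ((\<rho> \<circ> \<pi>) i)))"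
    unfolding deriv_map_apply[OF v] by (rule setum_permutations_compose_left[OF \<rho>])
  also have "\<dots> = deriv_map k x (\<lambda>i\<in>{..<k}. v (k - 1 - i))"
    unfolding deriv_map_apply[OF r]
  proof (rule sum.cong[OF refl])
    fix \<pi> assume "\<pi> \<in> {\<pi>. \<pi> permutes {..<k}}"
    then have "\<pi> permutes {..<k}" by simp
    then have lt: "\<pi> i < k" if "i < k" for i using permutes_in_image[of \<pi> "{..<k}" i] that by simp
    have "(\<lambda>i\<in>{..<k}. v ((\<rho> \<circ> \<pi>) i)) = (\<lambda>i\<in>{..<k}. (\<lambda>i\<in>{..<k}. v (k - 1 - i)) (\<pi> i))"
      by (rule restrict_ext) (use lt in \<open>simp add: \<rho>_def\<close>)
    then show "lfc_dd k (\<lambda>_. a + x) (\<lambda>i\<in>{..<k}. v ((\<rho> \<circ> \<pi>) i))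
        = lfc_dd k (\<lambda>_. a + x) (\<lambda>i\<in>{..<k}. (\<lambda>i\<in>{..<k}. v (k - 1 - i)) (\<pi> i))" by simp
  qed
  finally show ?thesis ..
qed

end

theorem theorem4p13:
  fixes a :: "'a::cstar_algebra" and I :: "'a set" and nI :: "'a \<Rightarrow> real"
    and k :: nat and \<alpha> :: norm_fam and f :: "real \<Rightarrow> complex"
  assumes "symmetrically_normed_ideal I nI"
    and "k \<ge> 1"
    and "norm_family \<alpha>"
    and "a \<in> selfadjoint"
    and "controls_polynomial_lfc \<alpha> I nI"
    and "f \<in> Ck_alpha \<alpha> k"
  shows "(\<forall>b\<in>I \<inter> selfadjoint. cfc f (a + b) - cfc f a \<in> I) \<and>
    frechet_Ck k (I \<inter> selfadjoint) nI I nI (\<lambda>b. cfc f (a + b) - cfc f a) \<and>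
    (\<forall>b\<in>I \<inter> selfadjoint. \<forall>v\<in>tuples k (I \<inter> selfadjoint).
       iter_dir_deriv I nI k v (\<lambda>b. cfc f (a + b) - cfc f a) b =
       (\<Sum>\<pi> | \<pi> permutes {..<k}.
          lfc \<alpha> I nI (k + 1) (divdiff f k) (\<lambda>i\<in>{..<k + 1}. a + b) (\<lambda>i\<in>{..<k}. v (\<pi> i))))"
proof -
  interpret symmetrically_normed_ideal I nI by (rule assms(1))
  interpret perturbation I nI \<alpha> f k a
    by unfold_locales (use assms in auto)
  have k2: "2 \<le> Suc k" "k \<noteq> 0" using assms(2) by auto
  have mem: "cfc f (a + b) - cfc f a \<in> I" if b: "b \<in> I \<inter> selfadjoint" for b
  proof -
    have "(\<lambda>i\<in>{..<0}. b) \<in> tuples 0 I" by (rule tuples_restrict) simp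
    from lfc_dd_perturbed_mem[OF le0 b this] show ?thesis by (simp add: lfc_dd_def)
  qed
  have deriv: "iter_dir_deriv I nI k v (\<lambda>b. cfc f (a + b) - cfc f a) b =
       (\<Sum>\<pi> | \<pi> permutes {..<k}.
          lfc \<alpha> I nI (k + 1) (divdiff f k) (\<lambda>i\<in>{..<k + 1}. a + b) (\<lambda>i\<in>{..<k}. v (\<pi> i)))"
    if b: "b \<in> I \<inter> selfadjoint" and v: "v \<in> tuples k (I \<inter> selfadjoint)" for b v
  proof -
    have "iter_dir_deriv I nI k v (\<lambda>b. cfc f (a + b) - cfc f a) b = deriv_map k b v"
      unfolding iter_dir_deriv_eq_deriv_map[OF v order_refl b] by (rule deriv_map_reverse[OF v])
    also have "\<dots> = (\<Sum>\<pi> | \<pi> permutes {..<k}. lfc_dd k (\<lambda>_. a + b) (\<lambda>i\<in>{..<k}. v (\<pi> i)))"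
      by (rule deriv_map_apply[OF v])
    finally show ?thesis
      using k2 lfc_eq_lfc_map[OF k2(1) divdiff_mem[OF order_refl]] by (simp add: lfc_dd_def)
  qed
  show ?thesis using mem frechet_Ck_cfc deriv by blast
qed

end
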